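(* Let $k\le n$ be natural numbers. Let $\tilde I\subset S_k$ be an initial ideal of $\tilde I_k^h$ such that $\tilde I_k^m$ is an initial ideal of $\tilde I$. Then the zero set of $\tilde I$ in $\mathbb P(\wedge^k\mathbb C^n)$ is a flat degeneration of the Grassmannian $\mathrm{Gr}(k,n)$ such that all of its irreducible components are Hibi varieties of the form $H(P_k,<'')$ with $<''$ a partial order on $P_k$ stronger than $<$.
   Context: $\mathrm{Gr}(k,n)$ is the Grassmannian of $k$-dimensional subspaces of $\mathbb C^n$. $S_k=\mathbb C[\{X_{a_1,\dots,a_k}\}_{1\le a_1<\dots<a_k\le n}]$ is the homogeneous coordinate ring of $\mathbb P(\wedge^k\mathbb C^n)$ (Plücker coordinates). $\tilde I_k^h\subset S_k$ is the ideal generated by the binomials $X_{a_1,\dots,a_k}X_{b_1,\dots,b_k}-X_{\min(a_1,b_1),\dots,\min(a_k,b_k)}X_{\max(a_1,b_1),\dots,\max(a_k,b_k)}$; it is known to be an initial ideal of the Plücker ideal of $\mathrm{Gr}(k,n)$. $(P_k,<)$ is the poset of elements $p_{i,j}$, $1\le i\le k$, $k+1\le j\le n$, with $p_{i_1,j_1}\le p_{i_2,j_2}$ iff $i_1\le i_2$ and $j_1\le j_2$. $\mathcal J(P,<)$ is the set of order ideals (lower sets) of a finite poset and $\mathbb C[\mathcal J(P,<)]$ is the polynomial ring in variables $X_J$, $J\in\mathcal J(P,<)$. $I^m_{P,<}\subset\mathbb C[\mathcal J(P,<)]$ is generated by the products $X_{J_1}X_{J_2}$ with $J_1,J_2$ incomparable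 under inclusion. $\psi_{\mathcal O}:S_k\to\mathbb C[\mathcal J(P_k,<)]$ is the ring isomorphism with $\psi_{\mathcal O}(X_{a_1,\dots,a_k})=X_J$, $J=\{p_{i,j}: j\le a_{k+1-i}+i-1\}$, and $\tilde I_k^m=\psi_{\mathcal O}^{-1}(I^m_{P_k,<})$. For a finite poset $(P,<'')$ the Hibi variety $H(P,<'')\subset\mathbb P(\mathbb C^{\mathcal J(P,<'')})$ is the zero set of the ideal generated by all $X_{J_1}X_{J_2}-X_{J_1\cup J_2}X_{J_1\cap J_2}$, $J_1,J_2\in\mathcal J(P,<'')$. An order $<''$ is stronger than $<$ if $p<q$ implies $p<''q$ (equality allowed); then $\mathcal J(P,<'')\subset\mathcal J(P,<)$. For $w\in\mathbb R^N$, $\mathrm{in}_wp$ is the sum of the terms of $p$ of minimal $w$-weight, and $\mathrm{in}_wI$ is the span of $\{\mathrm{in}_wp:p\in I\}$; ideals of this form are called initial ideals of $I$. A subvariety $Y\subset\mathbb P^{N-1}$ is a flat degeneration of $X\subset\mathbb P^{N-1}$ if there is a flat family $\mathcal X\subset\mathbb P^{N-1}\times\mathbb A^1$ over $\mathbb A^1$ with fibres over all $a\ne0$ isomorphic to $X$ and fibre over $0$ isomorphic to $Y$. *)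

theory Defs
  imports
    Complex_Main
    "HOL-Library.Poly_Mapping"
    "HOL-Library.Function_Algebras"
    "HOL-Computational_Algebra.Polynomial"
    "HOL-Algebra.Module"
    "HOL-Algebra.QuotRing"
    "HOL-Algebra.Free_Abelian_Groups"
    "HOL-Analysis.Abstract_Topology"
    "Jordan_Normal_Form.Determinant"
begin

section \<open>Polynomials, initial ideals\<close>

text \<open>A polynomial in variables of type \<open>'v\<close> is a finitely supported map from monomials to
  coefficients. Since the set of variables depends on \<open>k\<close> and \<open>n\<close>, it is given by a set \<open>V\<close>, and
  the polynomial ring on \<open>V\<close> is a ring record in the sense of HOL-Algebra.\<close>

type_synonym ('v, 'b) mpoly = "('v \<Rightarrow>\<^sub>0 nat) \<Rightarrow>\<^sub>0 'b"

definition poly_ring :: "'v set \<Rightarrow> ('v, 'b::comm_ring_1) mpoly ring" where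
  "poly_ring V = \<lparr>carrier = {p. \<forall>m\<in>Poly_Mapping.keys p. Poly_Mapping.keys m \<subseteq> V},
     monoid.mult = (*), monoid.one = 1, ring.zero = 0, ring.add = (+)\<rparr>"

definition Const :: "'b \<Rightarrow> ('v, 'b::comm_ring_1) mpoly" where
  "Const c = Poly_Mapping.single 0 c"

definition Var :: "'v \<Rightarrow> ('v, 'b::comm_ring_1) mpoly" where
  "Var v = Poly_Mapping.single (Poly_Mapping.single v 1) 1"

text \<open>Coefficients are mapped by \<open>h\<close> and the variable \<open>v\<close> is sent to \<open>\<sigma> v\<close>; for a ring homomorphism
  \<open>h\<close> this is the induced ring homomorphism.\<close>

definition poly_subst :: "('b \<Rightarrow> 'c) \<Rightarrow> ('v \<Rightarrow> 'c) \<Rightarrow> ('v, 'b::comm_ring_1) mpoly \<Rightarrow> 'c::comm_ring_1" where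
  "poly_subst h \<sigma> p = (\<Sum>m\<in>Poly_Mapping.keys p. h (Poly_Mapping.lookup p m) * (\<Prod>v\<in>Poly_Mapping.keys m. \<sigma> v ^ Poly_Mapping.lookup m v))"

abbreviation poly_eval :: "('v \<Rightarrow> complex) \<Rightarrow> ('v, complex) mpoly \<Rightarrow> complex" where
  "poly_eval x \<equiv> poly_subst (\<lambda>c. c) x"

definition monom_degree :: "('v \<Rightarrow>\<^sub>0 nat) \<Rightarrow> nat" where
  "monom_degree m = (\<Sum>v\<in>Poly_Mapping.keys m. Poly_Mapping.lookup m v)"

definition forms :: "'v set \<Rightarrow> nat \<Rightarrow> ('v, 'b::comm_ring_1) mpoly set" where
  "forms V d = {p \<in> carrier (poly_ring V). \<forall>m\<in>Poly_Mapping.keys p. monom_degree m = d}"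

definition homogeneous_ideal :: "'v set \<Rightarrow> ('v, 'b::comm_ring_1) mpoly set \<Rightarrow> bool" where
  "homogeneous_ideal V I \<longleftrightarrow>
     (\<exists>F. F \<subseteq> (\<Union>d. forms V d) \<and> I = Idl\<^bsub>poly_ring V\<^esub> F)"

definition monom_weight :: "('v \<Rightarrow> real) \<Rightarrow> ('v \<Rightarrow>\<^sub>0 nat) \<Rightarrow> real" where
  "monom_weight w m = (\<Sum>v\<in>Poly_Mapping.keys m. real (Poly_Mapping.lookup m v) * w v)"

definition initial_form :: "('v \<Rightarrow> real) \<Rightarrow> ('v, complex) mpoly \<Rightarrow> ('v, complex) mpoly" where
  "initial_form w p =
     (\<Sum>m\<in>{m \<in> Poly_Mapping.keys p. \<forall>m'\<in>Poly_Mapping.keys p. monom_weight w m \<le> monom_weight w m'}.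
        Poly_Mapping.single m (Poly_Mapping.lookup p m))"

definition initial_ideal :: "('v \<Rightarrow> real) \<Rightarrow> ('v, complex) mpoly set \<Rightarrow> ('v, complex) mpoly set" where
  "initial_ideal w I = module.span (\<lambda>c p. Const c * p) (initial_form w ` I)"

definition is_initial_ideal_of :: "('v, complex) mpoly set \<Rightarrow> ('v, complex) mpoly set \<Rightarrow> bool" where
  "is_initial_ideal_of J I \<longleftrightarrow> (\<exists>w. J = initial_ideal w I)"


section \<open>Projective space, Zariski topology, regular maps\<close>

text \<open>\<open>coord_space V\<close> is \<open>\<complex>\<^sup>V\<close>, its elements being extended by \<open>0\<close>; thus \<open>\<complex>\<^sup>W\<close> is literally a
  coordinate subspace of \<open>\<complex>\<^sup>V\<close> for \<open>W \<subseteq> V\<close>. Points of the projective space \<open>\<P>(\<complex>\<^sup>V)\<close> are the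
  one-dimensional subspaces.\<close>

definition cscale :: "complex \<Rightarrow> ('v \<Rightarrow> complex) \<Rightarrow> 'v \<Rightarrow> complex" where
  "cscale c x = (\<lambda>v. c * x v)"

definition coord_space :: "'v set \<Rightarrow> ('v \<Rightarrow> complex) set" where
  "coord_space V = {x. \<forall>v. v \<notin> V \<longrightarrow> x v = 0}"

definition subspaces_of_dim :: "nat \<Rightarrow> 'v set \<Rightarrow> ('v \<Rightarrow> complex) set set" where
  "subspaces_of_dim d V =
     {U. module.subspace cscale U \<and> U \<subseteq> coord_space V \<and> vector_space.dim cscale U = d}"

definition proj_space :: "'v set \<Rightarrow> ('v \<Rightarrow> complex) set set" where
  "proj_space V = subspaces_of_dim 1 V"

definition zero_set :: "'v set \<Rightarrow> ('v, complex) mpoly set \<Rightarrow> ('v \<Rightarrow> complex) set set" where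
  "zero_set V F = {L \<in> proj_space V. \<forall>f\<in>F. \<forall>x\<in>L. poly_eval x f = 0}"

definition zariski :: "'v set \<Rightarrow> ('v \<Rightarrow> complex) set topology" where
  "zariski V = topology (\<lambda>U. \<exists>F. F \<subseteq> (\<Union>d. forms V d) \<and> U = proj_space V - zero_set V F)"

definition irreducible_in :: "'a topology \<Rightarrow> 'a set \<Rightarrow> bool" where
  "irreducible_in T C \<longleftrightarrow> C \<subseteq> topspace T \<and> C \<noteq> {} \<and>
     (\<forall>A B. closedin T A \<and> closedin T B \<and> C \<subseteq> A \<union> B \<longrightarrow> C \<subseteq> A \<or> C \<subseteq> B)"

definition irreducible_component :: "'a topology \<Rightarrow> 'a set \<Rightarrow> 'a set \<Rightarrow> bool" where
  "irreducible_component T Y C \<longleftrightarrow> irreducible_in T C \<and> C \<subseteq> Y \<and>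
     (\<forall>D. irreducible_in T D \<and> D \<subseteq> Y \<and> C \<subseteq> D \<longrightarrow> D = C)"

definition regular_map ::
  "'v set \<Rightarrow> ('v \<Rightarrow> complex) set set \<Rightarrow> 'w set \<Rightarrow> ('w \<Rightarrow> complex) set set \<Rightarrow>
   (('v \<Rightarrow> complex) set \<Rightarrow> ('w \<Rightarrow> complex) set) \<Rightarrow> bool" where
  "regular_map V X W Y \<phi> \<longleftrightarrow> \<phi> ` X \<subseteq> Y \<and>
     (\<forall>p\<in>X. \<exists>U f d. openin (zariski V) U \<and> p \<in> U \<and> (\<forall>w\<in>W. f w \<in> forms V d) \<and>
        (\<forall>q\<in>U \<inter> X. \<forall>x\<in>q - {0}. (\<exists>w\<in>W. poly_eval x (f w) \<noteq> 0) \<and>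
           \<phi> q = module.span cscale {\<lambda>w. if w \<in> W then poly_eval x (f w) else 0}))"

definition isomorphic_varieties ::
  "'v set \<Rightarrow> ('v \<Rightarrow> complex) set set \<Rightarrow> 'w set \<Rightarrow> ('w \<Rightarrow> complex) set set \<Rightarrow> bool" where
  "isomorphic_varieties V X W Y \<longleftrightarrow>
     (\<exists>\<phi> \<psi>. regular_map V X W Y \<phi> \<and> regular_map W Y V X \<psi> \<and>
        (\<forall>p\<in>X. \<psi> (\<phi> p) = p) \<and> (\<forall>q\<in>Y. \<phi> (\<psi> q) = q))"


section \<open>Flat modules\<close>

text \<open>\<open>N \<otimes>\<^sub>R M\<close> is the free abelian group on \<open>N \<times> M\<close> modulo the bilinearity relations.\<close>

definition tensor_relations ::
  "('r, 'c) ring_scheme \<Rightarrow> ('r, 'x, 'd) module_scheme \<Rightarrow> ('r, 'm, 'e) module_scheme \<Rightarrow>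
   ('x \<times> 'm \<Rightarrow>\<^sub>0 int) set" where
  "tensor_relations R N M =
     generate (free_Abelian_group (carrier N \<times> carrier M))
       ({frag_of (x \<oplus>\<^bsub>N\<^esub> y, m) - frag_of (x, m) - frag_of (y, m) | x y m.
           x \<in> carrier N \<and> y \<in> carrier N \<and> m \<in> carrier M} \<union>
        {frag_of (x, l \<oplus>\<^bsub>M\<^esub> m) - frag_of (x, l) - frag_of (x, m) | x l m.
           x \<in> carrier N \<and> l \<in> carrier M \<and> m \<in> carrier M} \<union>
        {frag_of (r \<odot>\<^bsub>N\<^esub> x, m) - frag_of (x, r \<odot>\<^bsub>M\<^esub> m) | r x m.
           r \<in> carrier R \<and> x \<in> carrier N \<and> m \<in> carrier M})"

definition tensor_product ::
  "('r, 'c) ring_scheme \<Rightarrow> ('r, 'x, 'd) module_scheme \<Rightarrow> ('r, 'm, 'e) module_scheme \<Rightarrow>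
   ('x \<times> 'm \<Rightarrow>\<^sub>0 int) set monoid" where
  "tensor_product R N M =
     free_Abelian_group (carrier N \<times> carrier M) Mod tensor_relations R N M"

text \<open>For a submodule \<open>N'\<close> of \<open>N\<close> the canonical map \<open>N' \<otimes> M \<rightarrow> N \<otimes> M\<close> sends the class of \<open>z\<close> modulo
  the relations of \<open>N' \<otimes> M\<close> to its class modulo the relations of \<open>N \<otimes> M\<close>.\<close>

definition tensor_inclusion ::
  "('r, 'c) ring_scheme \<Rightarrow> ('r, 'x, 'd) module_scheme \<Rightarrow> ('r, 'm, 'e) module_scheme \<Rightarrow>
   ('x \<times> 'm \<Rightarrow>\<^sub>0 int) set \<Rightarrow> ('x \<times> 'm \<Rightarrow>\<^sub>0 int) set" where
  "tensor_inclusion R N M c =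
     tensor_relations R N M <#>\<^bsub>free_Abelian_group (carrier N \<times> carrier M)\<^esub> c"

text \<open>The test modules \<open>N\<close> have their elements in the type of \<open>R\<close>. They include \<open>R\<close> itself with all
  of its ideals as submodules, and already these detect flatness, so
  nothing is lost in comparison with arbitrary modules.\<close>

definition flat_module :: "'r ring \<Rightarrow> ('r, 'm) module \<Rightarrow> bool" where
  "flat_module R M \<longleftrightarrow> module R M \<and>
     (\<forall>(N :: ('r, 'r) module) N'. module R N \<and> submodule N' R N \<longrightarrow>
        inj_on (tensor_inclusion R N M) (carrier (tensor_product R (N\<lparr>carrier := N'\<rparr>) M)))"


section \<open>Flat degenerations\<close>

definition univ_ring :: "'b::comm_ring_1 ring" where
  "univ_ring = \<lparr>carrier = UNIV, monoid.mult = (*), monoid.one = 1, ring.zero = 0, ring.add = (+)\<rparr>"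

text \<open>Let \<open>Z\<close> be the closed subscheme of the projective space over a ring \<open>B\<close> defined by the
  homogeneous ideal \<open>I \<subseteq> B[V]\<close>. The chart of \<open>Z\<close> on which the coordinate \<open>v\<close> is invertible has the
  coordinate ring \<open>(B[V]/I)\<^bsub>(v)\<^esub> = B[V]/(I + (v - 1))\<close>.\<close>

definition chart_ideal :: "'v set \<Rightarrow> ('v, 'b::comm_ring_1) mpoly set \<Rightarrow> 'v \<Rightarrow> ('v, 'b) mpoly set" where
  "chart_ideal V I v = Idl\<^bsub>poly_ring V\<^esub> (I \<union> {Var v - 1})"

definition chart_ring :: "'v set \<Rightarrow> ('v, 'b::comm_ring_1) mpoly set \<Rightarrow> 'v \<Rightarrow> ('v, 'b) mpoly set ring" where
  "chart_ring V I v = poly_ring V Quot chart_ideal V I v"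

definition chart_module ::
  "'v set \<Rightarrow> ('v, 'b::comm_ring_1) mpoly set \<Rightarrow> 'v \<Rightarrow> ('b, ('v, 'b) mpoly set) module" where
  "chart_module V I v =
     \<lparr>carrier = carrier (chart_ring V I v), monoid.mult = monoid.mult (chart_ring V I v),
      monoid.one = monoid.one (chart_ring V I v), ring.zero = ring.zero (chart_ring V I v),
      ring.add = ring.add (chart_ring V I v),
      module.smult = (\<lambda>c x. (chart_ideal V I v +>\<^bsub>poly_ring V\<^esub> Const c) \<otimes>\<^bsub>chart_ring V I v\<^esub> x)\<rparr>"

text \<open>With \<open>\<complex>[t]\<close> modelled by \<open>complex poly\<close>, closed subschemes of \<open>\<P>(\<complex>\<^sup>V) \<times> \<A>\<^sup>1\<close> are
  given by homogeneous ideals in \<open>\<complex>[t][V]\<close>.\<close>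

definition flat_family :: "'v set \<Rightarrow> ('v, complex poly) mpoly set \<Rightarrow> bool" where
  "flat_family V I \<longleftrightarrow> homogeneous_ideal V I \<and>
     (\<forall>v\<in>V. flat_module (univ_ring :: complex poly ring) (chart_module V I v))"

definition fibre_ideal :: "complex \<Rightarrow> ('v, complex poly) mpoly set \<Rightarrow> ('v, complex) mpoly set" where
  "fibre_ideal a I = Poly_Mapping.map (\<lambda>c. poly c a) ` I"

text \<open>The subscheme of \<open>\<P>(\<complex>\<^sup>V)\<close> defined by \<open>I\<close> is isomorphic to the variety \<open>X\<close> if it is reduced
  and its underlying variety is isomorphic to \<open>X\<close>.\<close>

definition reduced_subscheme :: "'v set \<Rightarrow> ('v, complex) mpoly set \<Rightarrow> bool" where
  "reduced_subscheme V I \<longleftrightarrow>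
     (\<forall>v\<in>V. \<forall>f\<in>carrier (poly_ring V). \<forall>e::nat. f ^ e \<in> chart_ideal V I v \<longrightarrow> f \<in> chart_ideal V I v)"

definition subscheme_isomorphic ::
  "'v set \<Rightarrow> ('v, complex) mpoly set \<Rightarrow> ('v \<Rightarrow> complex) set set \<Rightarrow> bool" where
  "subscheme_isomorphic V I X \<longleftrightarrow>
     reduced_subscheme V I \<and> isomorphic_varieties V (zero_set V I) V X"

definition flat_degeneration ::
  "'v set \<Rightarrow> ('v \<Rightarrow> complex) set set \<Rightarrow> ('v \<Rightarrow> complex) set set \<Rightarrow> bool" where
  "flat_degeneration V Y X \<longleftrightarrow> closedin (zariski V) Y \<and> closedin (zariski V) X \<and>
     (\<exists>I. flat_family V I \<and>
        (\<forall>a. a \<noteq> 0 \<longrightarrow> subscheme_isomorphic V (fibre_ideal a I) X) \<and>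
        subscheme_isomorphic V (fibre_ideal 0 I) Y)"


section \<open>The Grassmannian\<close>

text \<open>A tuple \<open>a\<^sub>1 < \<dots> < a\<^sub>k\<close> is a list, so that \<open>a\<^sub>i\<close> is \<open>a ! (i - 1)\<close>.\<close>

definition plucker_index :: "nat \<Rightarrow> nat \<Rightarrow> nat list set" where
  "plucker_index k n = {a. length a = k \<and> sorted_wrt (<) a \<and> set a \<subseteq> {1..n}}"

definition plucker_vector :: "nat \<Rightarrow> nat \<Rightarrow> (nat \<Rightarrow> nat \<Rightarrow> complex) \<Rightarrow> nat list \<Rightarrow> complex" where
  "plucker_vector k n u =
     (\<lambda>a. if a \<in> plucker_index k n then det (mat k k (\<lambda>(i, j). u i (a ! j))) else 0)"

text \<open>All \<open>k\<close>-tuples of vectors from a \<open>k\<close>-dimensional subspace \<open>U\<close> have proportional vectors of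
  minors, nonzero for the bases of \<open>U\<close>; hence the span below is a line, the Pluecker point of \<open>U\<close>.\<close>

definition plucker_embedding :: "nat \<Rightarrow> nat \<Rightarrow> (nat \<Rightarrow> complex) set \<Rightarrow> (nat list \<Rightarrow> complex) set" where
  "plucker_embedding k n U =
     module.span cscale {plucker_vector k n u | u. \<forall>i<k. u i \<in> U}"

definition grassmannian :: "nat \<Rightarrow> nat \<Rightarrow> (nat list \<Rightarrow> complex) set set" where
  "grassmannian k n = plucker_embedding k n ` subspaces_of_dim k {1..n}"


section \<open>Posets, Hibi varieties, toric and monomial ideals\<close>

definition order_ideals :: "'a set \<Rightarrow> ('a \<times> 'a) set \<Rightarrow> 'a set set" where
  "order_ideals P r = {J. J \<subseteq> P \<and> (\<forall>q\<in>J. \<forall>p. (p, q) \<in> r \<longrightarrow> p \<in> J)}"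

definition hibi_ideal :: "'a set \<Rightarrow> ('a \<times> 'a) set \<Rightarrow> ('a set, complex) mpoly set" where
  "hibi_ideal P r = Idl\<^bsub>poly_ring (order_ideals P r)\<^esub>
     {Var J1 * Var J2 - Var (J1 \<union> J2) * Var (J1 \<inter> J2) | J1 J2.
        J1 \<in> order_ideals P r \<and> J2 \<in> order_ideals P r}"

definition hibi_variety :: "'a set \<Rightarrow> ('a \<times> 'a) set \<Rightarrow> ('a set \<Rightarrow> complex) set set" where
  "hibi_variety P r = zero_set (order_ideals P r) (hibi_ideal P r)"

definition incomparable_ideal :: "'a set \<Rightarrow> ('a \<times> 'a) set \<Rightarrow> ('a set, complex) mpoly set" where
  "incomparable_ideal P r = Idl\<^bsub>poly_ring (order_ideals P r)\<^esub>
     {Var J1 * Var J2 | J1 J2. J1 \<in> order_ideals P r \<and> J2 \<in> order_ideals P r \<and>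
        \<not> J1 \<subseteq> J2 \<and> \<not> J2 \<subseteq> J1}"

definition grass_poset :: "nat \<Rightarrow> nat \<Rightarrow> (nat \<times> nat) set" where
  "grass_poset k n = {1..k} \<times> {k+1..n}"

definition grass_order :: "nat \<Rightarrow> nat \<Rightarrow> ((nat \<times> nat) \<times> (nat \<times> nat)) set" where
  "grass_order k n = {((i1, j1), (i2, j2)). (i1, j1) \<in> grass_poset k n \<and>
     (i2, j2) \<in> grass_poset k n \<and> i1 \<le> i2 \<and> j1 \<le> j2}"

definition tuple_ideal :: "nat \<Rightarrow> nat \<Rightarrow> nat list \<Rightarrow> (nat \<times> nat) set" where
  "tuple_ideal k n a = {(i, j) \<in> grass_poset k n. j \<le> a ! (k - i) + i - 1}"

definition psi_O :: "nat \<Rightarrow> nat \<Rightarrow> (nat list, complex) mpoly \<Rightarrow> ((nat \<times> nat) set, complex) mpoly" where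
  "psi_O k n = poly_subst Const (\<lambda>a. Var (tuple_ideal k n a))"

definition I_h :: "nat \<Rightarrow> nat \<Rightarrow> (nat list, complex) mpoly set" where
  "I_h k n = Idl\<^bsub>poly_ring (plucker_index k n)\<^esub>
     {Var a * Var b - Var (map2 min a b) * Var (map2 max a b) | a b.
        a \<in> plucker_index k n \<and> b \<in> plucker_index k n}"

definition I_m :: "nat \<Rightarrow> nat \<Rightarrow> (nat list, complex) mpoly set" where
  "I_m k n = {p \<in> carrier (poly_ring (plucker_index k n)).
     psi_O k n p \<in> incomparable_ideal (grass_poset k n) (grass_order k n)}"

text \<open>The identification of \<open>\<P>(\<complex>\<^sup>J)\<close>, for \<open>J\<close> the set of order ideals of \<open>grass_poset k n\<close>, with
  \<open>\<P>(\<wedge>\<^sup>k \<complex>\<^sup>n)\<close> which is dual to \<open>psi_O\<close>: the coordinate \<open>X\<^sub>a\<close> of the image of a point is the value of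
  \<open>psi_O X\<^sub>a\<close> at that point. A Hibi variety for a stronger order lies in a coordinate subspace of
  \<open>\<P>(\<complex>\<^sup>J)\<close>.\<close>

definition psi_O_point ::
  "nat \<Rightarrow> nat \<Rightarrow> ((nat \<times> nat) set \<Rightarrow> complex) set \<Rightarrow> (nat list \<Rightarrow> complex) set" where
  "psi_O_point k n L =
     (\<lambda>x a. if a \<in> plucker_index k n then x (tuple_ideal k n a) else 0) ` L"


section \<open>Well-definedness of the Zariski topology and of the chart modules\<close>

lemma vector_space_cscale: "vector_space cscale"
  by unfold_locales (auto simp: cscale_def fun_eq_iff algebra_simps)

lemma poly_ring_mult_closed:
  fixes p q :: "('v, 'b::comm_ring_1) mpoly"
  assumes "p \<in> carrier (poly_ring V)" "q \<in> carrier (poly_ring V)"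
  shows "p * q \<in> carrier (poly_ring V)"
proof -
  have "Poly_Mapping.keys m \<subseteq> V" if m: "m \<in> Poly_Mapping.keys (p * q)" for m
  proof -
    obtain a b where "a \<in> Poly_Mapping.keys p" "b \<in> Poly_Mapping.keys q" "m = a + b"
      using keys_mult[of p q] m by blast
    then show ?thesis
      using assms Poly_Mapping.keys_add[of a b] by (fastforce simp: poly_ring_def)
  qed
  then show ?thesis by (simp add: poly_ring_def)
qed

lemma cring_poly_ring: "cring (poly_ring V :: ('v, 'b::comm_ring_1) mpoly ring)"
proof (rule cringI)
  show "abelian_group (poly_ring V :: ('v, 'b) mpoly ring)"
  proof (rule abelian_groupI, goal_cases)
    case (6 x)
    then show ?case by (intro bexI[of _ "- x"]) (auto simp: poly_ring_def)
  qed (auto simp: poly_ring_def algebra_simps dest!: subsetD[OF Poly_Mapping.keys_add])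
  show "Group.comm_monoid (poly_ring V :: ('v, 'b) mpoly ring)"
    using poly_ring_mult_closed[of _ V]
    by (intro comm_monoidI) (auto simp: poly_ring_def algebra_simps)
qed (auto simp: poly_ring_def algebra_simps)

lemma poly_subst_superset:
  assumes "finite A" "Poly_Mapping.keys p \<subseteq> A" "h 0 = 0"
  shows "poly_subst h \<sigma> p =
    (\<Sum>m\<in>A. h (Poly_Mapping.lookup p m) * (\<Prod>v\<in>Poly_Mapping.keys m. \<sigma> v ^ Poly_Mapping.lookup m v))"
  unfolding poly_subst_def using assms
  by (intro sum.mono_neutral_left) (auto simp: in_keys_iff)

lemma poly_eval_add: "poly_eval x (p + q) = poly_eval x p + poly_eval x q"
  using Poly_Mapping.keys_add[of p q]
  by (subst (1 2 3) poly_subst_superset[of "Poly_Mapping.keys p \<union> Poly_Mapping.keys q"])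
    (auto simp: lookup_add algebra_simps sum.distrib)

lemma poly_eval_zero: "poly_eval x 0 = 0"
  by (simp add: poly_subst_def)

lemma poly_eval_single: "poly_eval x (Poly_Mapping.single m c) =
   c * (\<Prod>v\<in>Poly_Mapping.keys m. x v ^ Poly_Mapping.lookup m v)"
  by (simp add: poly_subst_def)

lemma monom_eval_add:
  fixes x :: "'v \<Rightarrow> complex"
  shows "(\<Prod>v\<in>Poly_Mapping.keys (a + b). x v ^ Poly_Mapping.lookup (a + b) v) =
    (\<Prod>v\<in>Poly_Mapping.keys a. x v ^ Poly_Mapping.lookup a v) *
    (\<Prod>v\<in>Poly_Mapping.keys b. x v ^ Poly_Mapping.lookup b v)"
proof -
  let ?A = "Poly_Mapping.keys a \<union> Poly_Mapping.keys b"
  have *: "(\<Prod>v\<in>Poly_Mapping.keys c. x v ^ Poly_Mapping.lookup c v) =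
     (\<Prod>v\<in>?A. x v ^ Poly_Mapping.lookup c v)" if "Poly_Mapping.keys c \<subseteq> ?A" for c
    using that by (intro prod.mono_neutral_left) (auto simp: in_keys_iff)
  show ?thesis
    unfolding *[OF Poly_Mapping.keys_add] *[OF Un_upper1] *[OF Un_upper2]
    by (simp add: lookup_add power_add prod.distrib)
qed

lemma sum_of_singles:
  "p = (\<Sum>m\<in>Poly_Mapping.keys p. Poly_Mapping.single m (Poly_Mapping.lookup p m))"
proof (rule poly_mapping_eqI)
  fix k
  have "Poly_Mapping.lookup (\<Sum>m\<in>Poly_Mapping.keys p. Poly_Mapping.single m (Poly_Mapping.lookup p m)) k =
    (\<Sum>m\<in>Poly_Mapping.keys p. if m = k then Poly_Mapping.lookup p m else 0)"
    by (simp add: lookup_sum lookup_single when_def)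
  then show "Poly_Mapping.lookup p k =
      Poly_Mapping.lookup (\<Sum>m\<in>Poly_Mapping.keys p. Poly_Mapping.single m (Poly_Mapping.lookup p m)) k"
    by (simp add: in_keys_iff)
qed

lemma poly_eval_sum: "poly_eval x (\<Sum>i\<in>A. f i) = (\<Sum>i\<in>A. poly_eval x (f i))"
  by (induction A rule: infinite_finite_induct) (auto simp: poly_eval_add poly_eval_zero)

lemma poly_eval_mult: "poly_eval x (p * q) = poly_eval x p * poly_eval x q"
proof -
  have "poly_eval x (p * q) = poly_eval x
    ((\<Sum>m\<in>Poly_Mapping.keys p. Poly_Mapping.single m (Poly_Mapping.lookup p m)) *
     (\<Sum>m\<in>Poly_Mapping.keys q. Poly_Mapping.single m (Poly_Mapping.lookup q m)))"
    by (rule arg_cong[OF arg_cong2[where f = "(*)", OF sum_of_singles sum_of_singles]])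
  also have "\<dots> = poly_eval x p * poly_eval x q"
    unfolding poly_subst_def[of _ _ p] poly_subst_def[of _ _ q] sum_product poly_eval_sum
    by (intro sum.cong refl)
      (simp only: mult_single poly_eval_single monom_eval_add mult.assoc mult.left_commute)
  finally show ?thesis .
qed

lemma forms_mult:
  assumes "p \<in> forms V d" "q \<in> forms V e"
  shows "p * q \<in> forms V (d + e)"
proof -
  have "monom_degree m = d + e" if m: "m \<in> Poly_Mapping.keys (p * q)" for m
  proof -
    obtain a b where ab: "a \<in> Poly_Mapping.keys p" "b \<in> Poly_Mapping.keys q" "m = a + b"
      using keys_mult[of p q] m by blast
    let ?A = "Poly_Mapping.keys a \<union> Poly_Mapping.keys b"
    have *: "monom_degree c = (\<Sum>v\<in>?A. Poly_Mapping.lookup c v)" if "Poly_Mapping.keys c \<subseteq> ?A" for c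
      unfolding monom_degree_def
      using that by (intro sum.mono_neutral_left) (auto simp: in_keys_iff)
    have "monom_degree (a + b) = monom_degree a + monom_degree b"
      using Poly_Mapping.keys_add[of a b] by (simp add: * lookup_add sum.distrib)
    then show ?thesis using ab assms by (auto simp: forms_def)
  qed
  then show ?thesis using assms by (auto simp: forms_def poly_ring_mult_closed)
qed

lemma poly_eval_form:
  assumes "f \<in> forms V d"
  shows "poly_eval (cscale c x) f = c ^ d * poly_eval x f"
proof -
  have "(\<Prod>v\<in>Poly_Mapping.keys m. cscale c x v ^ Poly_Mapping.lookup m v) =
    c ^ d * (\<Prod>v\<in>Poly_Mapping.keys m. x v ^ Poly_Mapping.lookup m v)"
    if "m \<in> Poly_Mapping.keys f" for m
    using that assms
    by (auto simp: cscale_def forms_def monom_degree_def power_mult_distrib prod.distrib power_sum)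
  then show ?thesis
    by (simp add: poly_subst_def sum_distrib_left algebra_simps)
qed

lemma proj_space_line:
  assumes "L \<in> proj_space V"
  obtains z where "L = range (\<lambda>c. cscale c z)"
proof -
  interpret vector_space cscale by (rule vector_space_cscale)
  have L: "subspace L" "dim L = 1"
    using assms by (auto simp: proj_space_def subspaces_of_dim_def)
  obtain B where B: "B \<subseteq> L" "independent B" "L \<subseteq> span B" "card B = dim L"
    using basis_exists[of L] by blast
  then obtain z where "B = {z}" using L card_1_singletonE by metis
  then have "L = span {z}" using B L span_minimal by blast
  then show ?thesis using that[of z] by (simp add: span_singleton)
qed

lemma istopology_zariski:
  "istopology (\<lambda>U. \<exists>F. F \<subseteq> (\<Union>d. forms V d) \<and> U = proj_space V - zero_set V F)"
  unfolding istopology_def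
proof (intro conjI allI impI)
  fix S T
  assume "\<exists>F. F \<subseteq> (\<Union>d. forms V d) \<and> S = proj_space V - zero_set V F"
    and "\<exists>F. F \<subseteq> (\<Union>d. forms V d) \<and> T = proj_space V - zero_set V F"
  then obtain F G where F: "F \<subseteq> (\<Union>d. forms V d)" "S = proj_space V - zero_set V F"
    and G: "G \<subseteq> (\<Union>d. forms V d)" "T = proj_space V - zero_set V G" by blast
  define H where "H = {f * g | f g. f \<in> F \<and> g \<in> G}"
  have H: "H \<subseteq> (\<Union>d. forms V d)"
  proof
    fix h assume "h \<in> H"
    then obtain f g d e where "h = f * g" "f \<in> forms V d" "g \<in> forms V e"
      using F G by (fastforce simp: H_def)
    then show "h \<in> (\<Union>d. forms V d)" using forms_mult by blast
  qed
  have "zero_set V H = zero_set V F \<union> zero_set V G"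
  proof
    show "zero_set V F \<union> zero_set V G \<subseteq> zero_set V H"
      by (auto simp: zero_set_def H_def poly_eval_mult)
    show "zero_set V H \<subseteq> zero_set V F \<union> zero_set V G"
    proof (rule ccontr)
      assume "\<not> ?thesis"
      then obtain L f g x y where L: "L \<in> proj_space V" "L \<in> zero_set V H" and
        f: "f \<in> F" "x \<in> L" "poly_eval x f \<noteq> 0" and g: "g \<in> G" "y \<in> L" "poly_eval y g \<noteq> 0"
        unfolding zero_set_def by blast
      obtain z where z: "L = range (\<lambda>c. cscale c z)" using proj_space_line L by blast
      have nz: "poly_eval z p \<noteq> 0" if p: "p \<in> (\<Union>d. forms V d)" and "u \<in> L" "poly_eval u p \<noteq> 0" for p u
        using that poly_eval_form z by fastforce
      have "z \<in> L" unfolding z by (rule range_eqI[of _ _ 1]) (simp add: cscale_def)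
      moreover have "f * g \<in> H" using f g by (auto simp: H_def)
      ultimately have "poly_eval z f * poly_eval z g = 0"
        using L by (auto simp: zero_set_def simp flip: poly_eval_mult)
      moreover have "poly_eval z f \<noteq> 0" using nz[of f x] f F(1) by blast
      moreover have "poly_eval z g \<noteq> 0" using nz[of g y] g G(1) by blast
      ultimately show False by simp
    qed
  qed
  then show "\<exists>F. F \<subseteq> (\<Union>d. forms V d) \<and> S \<inter> T = proj_space V - zero_set V F"
    using F G H by (intro exI[of _ H]) auto
next
  fix K
  assume K: "\<forall>S\<in>K. \<exists>F. F \<subseteq> (\<Union>d. forms V d) \<and> S = proj_space V - zero_set V F"
  define F where "F = \<Union>{F. F \<subseteq> (\<Union>d. forms V d) \<and> proj_space V - zero_set V F \<in> K}"
  have "\<Union>K = proj_space V - zero_set V F"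
  proof (intro equalityI subsetI)
    fix L assume "L \<in> \<Union>K"
    then obtain S where S: "S \<in> K" "L \<in> S" by (elim UnionE)
    from bspec[OF K S(1)] obtain G where
      G: "G \<subseteq> (\<Union>d. forms V d)" "S = proj_space V - zero_set V G" by (elim exE conjE)
    have "G \<subseteq> F" unfolding F_def using S(1) G by (intro Union_upper) simp
    then have "zero_set V F \<subseteq> zero_set V G" by (auto simp: zero_set_def)
    then show "L \<in> proj_space V - zero_set V F" using S(2) G(2) by auto
  next
    fix L assume "L \<in> proj_space V - zero_set V F"
    then obtain f x where L: "L \<in> proj_space V" "f \<in> F" "x \<in> L" "poly_eval x f \<noteq> 0"
      by (auto simp: zero_set_def)
    obtain G where G: "proj_space V - zero_set V G \<in> K" "f \<in> G"
      using L(2) by (auto simp: F_def)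
    then have "L \<in> proj_space V - zero_set V G" using L by (auto simp: zero_set_def)
    then show "L \<in> \<Union>K" using G(1) by (rule UnionI[rotated])
  qed
  then show "\<exists>F. F \<subseteq> (\<Union>d. forms V d) \<and> \<Union>K = proj_space V - zero_set V F"
    by (intro exI[of _ F] conjI Union_least) (simp_all add: F_def Sup_le_iff)
qed

lemma ideal_chart:
  fixes I :: "('v, 'b::comm_ring_1) mpoly set"
  assumes "v \<in> V" "I \<subseteq> carrier (poly_ring V)"
  shows "ideal (chart_ideal V I v) (poly_ring V)"
proof -
  interpret cring "poly_ring V :: ('v, 'b) mpoly ring" by (rule cring_poly_ring)
  have "Var v - (1::('v, 'b) mpoly) \<in> carrier (poly_ring V)"
    using Poly_Mapping.keys_diff[of "Var v" "1 :: ('v,'b) mpoly"] assms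
    by (fastforce simp: poly_ring_def Var_def)
  then show ?thesis unfolding chart_ideal_def using assms by (intro genideal_ideal) auto
qed

lemma module_chart:
  fixes I :: "('v, 'b::comm_ring_1) mpoly set"
  assumes "v \<in> V" "I \<subseteq> carrier (poly_ring V)"
  shows "module (univ_ring :: 'b ring) (chart_module V I v)"
proof -
  let ?R = "poly_ring V :: ('v, 'b) mpoly ring"
  interpret P: cring ?R by (rule cring_poly_ring)
  interpret id: ideal "chart_ideal V I v" ?R by (rule ideal_chart[OF assms])
  interpret Q: cring "chart_ring V I v"
    unfolding chart_ring_def by (rule id.quotient_is_cring[OF cring_poly_ring])
  let ?h = "\<lambda>c. chart_ideal V I v +>\<^bsub>?R\<^esub> Const c"
  have C: "Const c \<in> carrier ?R" for c by (auto simp: Const_def poly_ring_def)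
  note hom = id.rcos_ring_hom
  have h: "?h c \<in> carrier (chart_ring V I v)" for c
    using ring_hom_closed[OF hom C] by (simp add: chart_ring_def)
  have h1: "?h 1 = \<one>\<^bsub>chart_ring V I v\<^esub>"
    using ring_hom_one[OF hom] by (simp add: chart_ring_def Const_def poly_ring_def)
  have hadd: "?h (a + b) = ?h a \<oplus>\<^bsub>chart_ring V I v\<^esub> ?h b" for a b
    using ring_hom_add[OF hom C C, of a b] by (simp add: chart_ring_def Const_def poly_ring_def single_add)
  have hmul: "?h (a * b) = ?h a \<otimes>\<^bsub>chart_ring V I v\<^esub> ?h b" for a b
    using ring_hom_mult[OF hom C C, of a b] by (simp add: chart_ring_def Const_def poly_ring_def mult_single)
  show ?thesis
  proof (rule moduleI)
    show "cring (univ_ring :: 'b ring)"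
    proof (rule cringI)
      show "abelian_group (univ_ring :: 'b ring)"
      proof (rule abelian_groupI, goal_cases)
        case (6 x)
        then show ?case by (intro bexI[of _ "- x"]) (auto simp: univ_ring_def)
      qed (auto simp: univ_ring_def algebra_simps)
      show "Group.comm_monoid (univ_ring :: 'b ring)"
        by (rule comm_monoidI) (auto simp: univ_ring_def algebra_simps)
    qed (auto simp: univ_ring_def algebra_simps)
    show "abelian_group (chart_module V I v)"
    proof (rule abelian_groupI, goal_cases)
      case (6 x)
      then show ?case
        by (intro bexI[of _ "\<ominus>\<^bsub>chart_ring V I v\<^esub> x"]) (auto simp: chart_module_def Q.l_neg)
    qed (simp_all add: chart_module_def Q.a_ac)
  qed (simp_all add: chart_module_def univ_ring_def h h1 hadd hmul Q.l_distr Q.r_distr Q.m_assoc)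
qed

end

theory Submission
  imports Defs "HOL-Analysis.Kronecker_Approximation_Theorem"
begin

text \<open>Pluecker coordinates form a distributive lattice under entrywise minimum and maximum, and \<open>I_h\<close> is
  its Hibi ideal. An initial ideal \<open>I\<close> of \<open>I_h\<close> that degenerates further to \<open>I_m\<close> comes from a weight
  \<open>w\<close> that is supermodular on the lattice, so that \<open>w a + w b \<le> w (min a b) + w (max a b)\<close>, and \<open>I\<close> consists of
  the polynomials vanishing where \<open>x\<^sub>a x\<^sub>b\<close> equals \<open>x\<^bsub>min a b\<^esub> x\<^bsub>max a b\<^esub>\<close> if equality holds and \<open>0\<close>
  otherwise, for all incomparable \<open>a\<close> and \<open>b\<close>. The order polytope is triangulated by maximal chains of the lattice, which
  correspond to the linear extensions of the poset. The domains of linearity of the piecewise affine interpolation of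
  \<open>w\<close> on this triangulation subdivide the order polytope; a domain consists of the order ideals of a stronger
  order, and its Hibi variety is an irreducible component.

  For the degeneration, products of incomparable Pluecker coordinates straighten on the Grassmannian with
  leading term \<open>x\<^bsub>min a b\<^esub> x\<^bsub>max a b\<^esub>\<close>. Adding \<open>w\<close>, made integral, as a small perturbation to a large multiple of a
  modular weight that singles out this leading term gives a family, parametrized by \<open>t\<close>, of diagonal coordinate changes. The
  standard monomials span each graded piece of the family and are linearly independent on every
  fibre. Hence the coordinate rings of the charts are directed unions of free \<open>\<complex>[t]\<close>-modules, which makes the
  family flat, and each fibre is cut out by the full vanishing ideal of its points, which makes it reduced.\<close>

section \<open>Polynomials and ideals\<close>

text \<open>Ideals are identified by a sandwich. From below, explicit quadrics reduce every
  polynomial to a combination of standard monomials, those supported on a chain; from above, the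
  ideal vanishes on points where standard monomials are linearly independent. Anything between the
  two bounds equals both. The hypothesis on \<open>I_m\<close> enters here: its elements involve
  nonstandard monomials only, so no nonzero combination of standard ones lies in \<open>I\<close>,
  since its initial form would again be standard. Applied to the binomials of \<open>I_h\<close>
  this also forces supermodularity. Independence is tested on curves
  \<open>t \<mapsto> (t ^ g a)\<close>, or on curves with such leading terms, along which distinct
  standard monomials get distinct exponents.

  The given weight belongs to the Hibi ideal and not to the Pluecker ideal, so two successive
  degenerations have to be merged into one family over the line. The merged weight only has to
  respect finitely many comparisons between sums of two weights, which is why a real weight may be
  replaced by an integral one.\<close>

abbreviation (input) "keys \<equiv> Poly_Mapping.keys"
abbreviation (input) "lookup \<equiv> Poly_Mapping.lookup"
abbreviation (input) "single \<equiv> Poly_Mapping.single"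

lemma carrier_poly_ring: "p \<in> carrier (poly_ring V) \<longleftrightarrow> (\<forall>m\<in>keys p. keys m \<subseteq> V)"
  by (simp add: poly_ring_def)

lemma poly_ring_simps [simp]:
  "monoid.mult (poly_ring V) = (*)" "monoid.one (poly_ring V) = 1"
  "ring.zero (poly_ring V) = 0" "ring.add (poly_ring V) = (+)"
  by (simp_all add: poly_ring_def)

lemma single_in_carrier: "keys m \<subseteq> V \<Longrightarrow> single m c \<in> carrier (poly_ring V)"
  by (auto simp: carrier_poly_ring split: if_splits)

lemma Var_in_carrier: "v \<in> V \<Longrightarrow> Var v \<in> carrier (poly_ring V)"
  by (auto simp: Var_def carrier_poly_ring)

lemma plus_in_carrier:
  "p \<in> carrier (poly_ring V) \<Longrightarrow> q \<in> carrier (poly_ring V) \<Longrightarrow> p + q \<in> carrier (poly_ring V)"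
  using Poly_Mapping.keys_add[of p q] by (auto simp: carrier_poly_ring)

lemma diff_in_carrier:
  fixes p q :: "('v, 'b::comm_ring_1) mpoly"
  shows "p \<in> carrier (poly_ring V) \<Longrightarrow> q \<in> carrier (poly_ring V) \<Longrightarrow> p - q \<in> carrier (poly_ring V)"
  using Poly_Mapping.keys_diff[of p q] by (fastforce simp: carrier_poly_ring)

lemma keys_sum_subset: "keys (\<Sum>i\<in>A. f i) \<subseteq> (\<Union>i\<in>A. keys (f i))"
proof (induction A rule: infinite_finite_induct)
  case (insert a A)
  then show ?case using Poly_Mapping.keys_add[of "f a" "sum f A"] by auto
qed auto

lemma sum_in_carrier:
  "(\<And>i. i \<in> A \<Longrightarrow> f i \<in> carrier (poly_ring V)) \<Longrightarrow> (\<Sum>i\<in>A. f i) \<in> carrier (poly_ring V)"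
  using keys_sum_subset[of f A] by (fastforce simp: carrier_poly_ring)

lemma Var_mult_Var: "Var a * Var b = single (single a 1 + single b 1) 1"
  by (simp add: Var_def mult_single)

lemma poly_idealI:
  fixes Q :: "('v, 'b::comm_ring_1) mpoly set"
  assumes "Q \<subseteq> carrier (poly_ring V)" "0 \<in> Q" "\<And>p q. p \<in> Q \<Longrightarrow> q \<in> Q \<Longrightarrow> p + q \<in> Q"
    and "\<And>p q. p \<in> Q \<Longrightarrow> q \<in> carrier (poly_ring V) \<Longrightarrow> q * p \<in> Q"
  shows "ideal Q (poly_ring V)"
proof -
  interpret cring "poly_ring V :: ('v, 'b) mpoly ring" by (rule cring_poly_ring)
  have m1: "- 1 \<in> carrier (poly_ring V :: ('v, 'b) mpoly ring)" by (auto simp: carrier_poly_ring)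
  have minus: "- p \<in> Q" if "p \<in> Q" for p using assms(4)[OF that m1] by simp
  have a_inv: "\<ominus>\<^bsub>poly_ring V\<^esub> p = - p" if "p \<in> carrier (poly_ring V)" for p :: "('v, 'b) mpoly"
    using that by (intro minus_equality) (auto simp: carrier_poly_ring)
  show ?thesis
  proof (rule idealI)
    show "ring (poly_ring V :: ('v, 'b) mpoly ring)" by unfold_locales
    show "subgroup Q (add_monoid (poly_ring V))"
    proof
      show "inv\<^bsub>add_monoid (poly_ring V)\<^esub> x \<in> Q" if "x \<in> Q" for x
        using minus[OF that] a_inv[of x] assms(1) that by (auto simp: a_inv_def)
    qed (use assms in auto)
  qed (use assms in \<open>auto simp: mult.commute\<close>)
qed

lemma poly_idealD:
  fixes Q :: "('v, 'b::comm_ring_1) mpoly set"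
  assumes "ideal Q (poly_ring V)"
  shows "Q \<subseteq> carrier (poly_ring V)" "0 \<in> Q" "\<And>p q. p \<in> Q \<Longrightarrow> q \<in> Q \<Longrightarrow> p + q \<in> Q"
    and "\<And>p q. p \<in> Q \<Longrightarrow> q \<in> Q \<Longrightarrow> p - q \<in> Q"
    and "\<And>p q. p \<in> Q \<Longrightarrow> q \<in> carrier (poly_ring V) \<Longrightarrow> q * p \<in> Q"
    and "\<And>A f. (\<And>i. i \<in> A \<Longrightarrow> f i \<in> Q) \<Longrightarrow> (\<Sum>i\<in>A. f i) \<in> Q"
proof -
  interpret ideal Q "poly_ring V" by fact
  show *: "Q \<subseteq> carrier (poly_ring V)" by auto
  show zero: "0 \<in> Q" using additive_subgroup.zero_closed[OF is_additive_subgroup] by simp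
  show plus: "p + q \<in> Q" if "p \<in> Q" "q \<in> Q" for p q
    using additive_subgroup.a_closed[OF is_additive_subgroup that] by simp
  show mult: "q * p \<in> Q" if "p \<in> Q" "q \<in> carrier (poly_ring V)" for p q
    using I_l_closed[OF that] by simp
  have "- 1 \<in> carrier (poly_ring V :: ('v, 'b) mpoly ring)" by (auto simp: carrier_poly_ring)
  then show "p - q \<in> Q" if "p \<in> Q" "q \<in> Q" for p q
    using plus[OF that(1) mult[OF that(2)]] by force
  show "(\<Sum>i\<in>A. f i) \<in> Q" if "\<And>i. i \<in> A \<Longrightarrow> f i \<in> Q" for A :: "'z set" and f
    using that by (induction A rule: infinite_finite_induct) (auto intro: plus zero)
qed

lemma poly_Idl:
  fixes F :: "('v, 'b::comm_ring_1) mpoly set"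
  assumes "F \<subseteq> carrier (poly_ring V)"
  shows "ideal (Idl\<^bsub>poly_ring V\<^esub> F) (poly_ring V)" "F \<subseteq> Idl\<^bsub>poly_ring V\<^esub> F"
    and "\<And>Q. ideal Q (poly_ring V) \<Longrightarrow> F \<subseteq> Q \<Longrightarrow> Idl\<^bsub>poly_ring V\<^esub> F \<subseteq> Q"
proof -
  interpret cring "poly_ring V :: ('v, 'b) mpoly ring" by (rule cring_poly_ring)
  show "ideal (Idl\<^bsub>poly_ring V\<^esub> F) (poly_ring V)" by (rule genideal_ideal) fact
  show "F \<subseteq> Idl\<^bsub>poly_ring V\<^esub> F" by (rule genideal_self) fact
  show "\<And>Q. ideal Q (poly_ring V) \<Longrightarrow> F \<subseteq> Q \<Longrightarrow> Idl\<^bsub>poly_ring V\<^esub> F \<subseteq> Q" by (rule genideal_minimal)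
qed

subsection \<open>Weights and evaluation of monomials\<close>

text \<open>Values lie in an arbitrary semiring: real weights define initial ideals and
  interpolants, natural ones serve as exponents of \<open>t\<close> and as termination
  measures.\<close>

definition weight :: "('v \<Rightarrow> 'a::comm_semiring_1) \<Rightarrow> ('v \<Rightarrow>\<^sub>0 nat) \<Rightarrow> 'a" where
  "weight f m = (\<Sum>v\<in>keys m. of_nat (lookup m v) * f v)"

lemma weight_superset: "finite A \<Longrightarrow> keys m \<subseteq> A \<Longrightarrow> weight f m = (\<Sum>v\<in>A. of_nat (lookup m v) * f v)"
  unfolding weight_def by (intro sum.mono_neutral_left) (auto simp: in_keys_iff)

lemma weight_zero [simp]: "weight f 0 = 0"
  by (simp add: weight_def)

lemma weight_single [simp]: "weight f (single v c) = of_nat c * f v"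
  by (simp add: weight_def)

lemma weight_add [simp]: "weight f (a + b) = weight f a + weight f b"
  using Poly_Mapping.keys_add[of a b]
  by (subst (1 2 3) weight_superset[of "keys a \<union> keys b"])
    (auto simp: lookup_add algebra_simps sum.distrib)

lemma weight_cong: "(\<And>v. v \<in> keys m \<Longrightarrow> f v = g v) \<Longrightarrow> weight f m = weight g m"
  by (simp add: weight_def)

lemma monom_weight_eq: "monom_weight w = weight w"
  by (simp add: monom_weight_def weight_def fun_eq_iff)

lemma monom_degree_eq: "monom_degree = weight (\<lambda>_. 1)"
  by (simp add: monom_degree_def weight_def fun_eq_iff)

text \<open>The target ring varies: complex numbers for points, \<open>complex poly\<close> for
  evaluation along a curve.\<close>

definition meval :: "('v \<Rightarrow> 'c::comm_ring_1) \<Rightarrow> ('v \<Rightarrow>\<^sub>0 nat) \<Rightarrow> 'c" where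
  "meval x m = (\<Prod>v\<in>keys m. x v ^ lookup m v)"

lemma meval_superset: "finite A \<Longrightarrow> keys m \<subseteq> A \<Longrightarrow> meval x m = (\<Prod>v\<in>A. x v ^ lookup m v)"
  unfolding meval_def by (intro prod.mono_neutral_left) (auto simp: in_keys_iff)

lemma meval_zero [simp]: "meval x 0 = 1"
  by (simp add: meval_def)

lemma meval_single [simp]: "meval x (single v c) = x v ^ c"
  by (cases "c = 0") (simp_all add: meval_def)

lemma meval_add [simp]: "meval x (a + b) = meval x a * meval x b"
  using Poly_Mapping.keys_add[of a b]
  by (subst (1 2 3) meval_superset[of "keys a \<union> keys b"])
    (auto simp: lookup_add power_add prod.distrib)

lemma meval_cong: "(\<And>v. v \<in> keys m \<Longrightarrow> x v = y v) \<Longrightarrow> meval x m = meval y m"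
  by (simp add: meval_def)

lemma meval_mult: "meval (\<lambda>v. x v * y v) m = meval x m * meval y m"
  by (simp add: meval_def power_mult_distrib prod.distrib)

lemma meval_power: "meval (\<lambda>v. t ^ f v) m = t ^ weight f m"
  by (simp add: meval_def weight_def power_sum mult.commute flip: power_mult)

lemma meval_eq_0_iff:
  fixes x :: "'v \<Rightarrow> 'c::idom"
  shows "meval x m = 0 \<longleftrightarrow> (\<exists>v\<in>keys m. x v = 0)"
  by (auto simp: meval_def in_keys_iff)

lemma poly_subst_meval: "poly_subst h \<sigma> p = (\<Sum>m\<in>keys p. h (lookup p m) * meval \<sigma> m)"
  by (simp add: poly_subst_def meval_def)

lemma monom_induct [case_names zero plus]:
  fixes m :: "'v \<Rightarrow>\<^sub>0 nat"
  assumes "P 0" "\<And>m v. P m \<Longrightarrow> P (m + single v 1)"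
  shows "P m"
proof (induction "monom_degree m" arbitrary: m)
  case 0
  then have "m = 0" by (auto simp: monom_degree_def in_keys_iff simp flip: Poly_Mapping.keys_eq_empty)
  then show ?case using assms by simp
next
  case (Suc d)
  then have "keys m \<noteq> {}" by (auto simp: monom_degree_def)
  then obtain v where v: "v \<in> keys m" by blast
  define m' where "m' = m - single v 1"
  have m: "m = m' + single v 1"
    unfolding m'_def using v
    by (intro poly_mapping_eqI) (auto simp: lookup_add lookup_minus lookup_single when_def in_keys_iff)
  have "monom_degree m' = d" using Suc(2) by (simp add: m monom_degree_eq)
  then show ?case using Suc(1)[of m'] assms(2) by (simp add: m)
qed

lemma single_minus_add:
  fixes m :: "'v \<Rightarrow>\<^sub>0 nat"
  assumes "v \<in> keys m" shows "m = single v 1 + (m - single v 1)"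
  using assms
  by (intro poly_mapping_eqI) (auto simp: lookup_add lookup_minus lookup_single when_def in_keys_iff)

lemma pair_split:
  fixes m :: "'v \<Rightarrow>\<^sub>0 nat"
  assumes "a \<in> keys m" "b \<in> keys m" "a \<noteq> b"
  obtains m' where "m = single a 1 + single b 1 + m'"
proof -
  have "b \<in> keys (m - single a 1)" using assms
    by (auto simp: in_keys_iff lookup_minus lookup_single)
  then show ?thesis
    using single_minus_add[OF assms(1)] single_minus_add[of b "m - single a 1"] that
    by (metis add.assoc)
qed

lemma keys_plus_monom: "keys (a + b :: 'v \<Rightarrow>\<^sub>0 nat) = keys a \<union> keys b"
  by (auto simp: in_keys_iff lookup_add)

context
  fixes h :: "'b::comm_ring_1 \<Rightarrow> 'c::comm_ring_1"
  assumes h: "comm_ring_hom h"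
begin

interpretation comm_ring_hom h by (rule h)

lemma poly_subst_add: "poly_subst h x (p + q) = poly_subst h x p + poly_subst h x q"
  using Poly_Mapping.keys_add[of p q]
  by (subst (1 2 3) poly_subst_superset[of "keys p \<union> keys q"])
    (auto simp: lookup_add algebra_simps sum.distrib hom_add)

lemma poly_subst_zero: "poly_subst h x 0 = 0"
  by (simp add: poly_subst_def)

lemma poly_subst_single: "poly_subst h x (single m c) = h c * meval x m"
  by (simp add: poly_subst_meval)

lemma poly_subst_Var: "poly_subst h x (Var v) = x v"
  by (simp add: Var_def poly_subst_single)

lemma poly_subst_one: "poly_subst h x 1 = 1"
  using poly_subst_single[of x 0 1] by simp

lemma poly_subst_Const: "poly_subst h x (Const c) = h c"
  by (simp add: Const_def poly_subst_single)

lemma poly_subst_sum: "poly_subst h x (\<Sum>i\<in>A. f i) = (\<Sum>i\<in>A. poly_subst h x (f i))"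
  by (induction A rule: infinite_finite_induct) (auto simp: poly_subst_add poly_subst_zero)

lemma poly_subst_mult: "poly_subst h x (p * q) = poly_subst h x p * poly_subst h x q"
proof -
  have "poly_subst h x (p * q) = poly_subst h x
    ((\<Sum>m\<in>keys p. single m (lookup p m)) * (\<Sum>m\<in>keys q. single m (lookup q m)))"
    by (rule arg_cong[OF arg_cong2[where f = "(*)", OF sum_of_singles sum_of_singles]])
  also have "\<dots> = poly_subst h x p * poly_subst h x q"
    unfolding poly_subst_meval[of _ _ p] poly_subst_meval[of _ _ q] sum_product poly_subst_sum
    by (intro sum.cong refl)
      (simp only: mult_single poly_subst_single meval_add hom_mult mult.assoc mult.left_commute)
  finally show ?thesis .
qed

lemma poly_subst_power: "poly_subst h x (p ^ e) = poly_subst h x p ^ e"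
  by (induction e) (simp_all add: poly_subst_one poly_subst_mult)

lemma poly_subst_diff: "poly_subst h x (p - q) = poly_subst h x p - poly_subst h x q"
proof -
  have "poly_subst h x (p - q + q) = poly_subst h x (p - q) + poly_subst h x q"
    by (rule poly_subst_add)
  then show ?thesis by simp
qed

text \<open>The coefficient map \<open>h\<close> lets one statement cover vanishing at complex
  points and, with \<open>h\<close> the evaluation at a parameter, vanishing of a family on points
  of one fibre.\<close>

lemma ideal_poly_subst_zeros:
  "ideal {p \<in> carrier (poly_ring V). \<forall>x\<in>X. poly_subst h x p = 0} (poly_ring V)"
  by (rule poly_idealI)
    (auto simp: poly_subst_add poly_subst_zero poly_subst_mult plus_in_carrier poly_ring_mult_closed
      carrier_poly_ring[of 0])

end

lemma comm_ring_hom_id: "comm_ring_hom (\<lambda>c. c)"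
  by unfold_locales auto

lemma comm_ring_hom_poly: "comm_ring_hom (\<lambda>c. poly c a)"
  by unfold_locales auto

lemmas poly_eval_diff = poly_subst_diff[OF comm_ring_hom_id]
lemmas poly_eval_Var = poly_subst_Var[OF comm_ring_hom_id]
lemmas poly_eval_meval = poly_subst_meval[of "\<lambda>c. c"]
lemmas poly_eval_monom = poly_subst_single[OF comm_ring_hom_id]

lemma poly_eval_scale_weight:
  "poly_eval (\<lambda>v. s v * x v) p = (\<Sum>m\<in>keys p. lookup p m * meval s m * meval x m)"
  by (simp add: poly_eval_meval meval_mult mult.assoc)

section \<open>Standard monomials\<close>

text \<open>A finite distributive lattice, represented by sets through \<open>T\<close>. The
  elements stay abstract so that the same results apply to the Pluecker indices and, later, to
  sublattices of them.\<close>

locale set_lattice =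
  fixes V :: "'v set" and T :: "'v \<Rightarrow> 'p set" and meet join :: "'v \<Rightarrow> 'v \<Rightarrow> 'v"
  assumes fin: "finite V" and inj: "inj_on T V"
    and meet: "\<And>a b. a \<in> V \<Longrightarrow> b \<in> V \<Longrightarrow> meet a b \<in> V \<and> T (meet a b) = T a \<inter> T b"
    and join: "\<And>a b. a \<in> V \<Longrightarrow> b \<in> V \<Longrightarrow> join a b \<in> V \<and> T (join a b) = T a \<union> T b"
    and finT: "\<And>a. a \<in> V \<Longrightarrow> finite (T a)"
begin

definition comparable :: "'v \<Rightarrow> 'v \<Rightarrow> bool" where
  "comparable a b \<longleftrightarrow> T a \<subseteq> T b \<or> T b \<subseteq> T a"

definition std :: "('v \<Rightarrow>\<^sub>0 nat) \<Rightarrow> bool" where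
  "std m \<longleftrightarrow> keys m \<subseteq> V \<and> (\<forall>a\<in>keys m. \<forall>b\<in>keys m. comparable a b)"

text \<open>\<open>D\<close> selects degrees: \<open>UNIV\<close> for no restriction,
  \<open>{d}\<close> for a graded piece, \<open>{2}\<close> for the right-hand sides of quadratic
  straightening.\<close>

definition std_polys :: "nat set \<Rightarrow> ('v, 'b::comm_ring_1) mpoly set" where
  "std_polys D = {r. \<forall>s\<in>keys r. std s \<and> monom_degree s \<in> D}"

text \<open>The exponent of \<open>y_p\<close> under the Hibi parametrization, which sends the
  variable of \<open>a\<close> to \<open>z\<close> times the product of all \<open>y_p\<close> with
  \<open>p\<close> in \<open>T a\<close>. The exponent of \<open>z\<close> is the degree.\<close>

definition multiplicity :: "('v \<Rightarrow>\<^sub>0 nat) \<Rightarrow> 'p \<Rightarrow> nat" where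
  "multiplicity m p = weight (\<lambda>a. of_bool (p \<in> T a)) m"

lemma not_comparable_neq: "\<not> comparable a b \<Longrightarrow> a \<noteq> b"
  by (auto simp: comparable_def)

lemma std_polys_carrier: "r \<in> std_polys D \<Longrightarrow> r \<in> carrier (poly_ring V)"
  by (auto simp: std_polys_def carrier_poly_ring std_def)

lemma std_polys_sum: "(\<And>i. i \<in> A \<Longrightarrow> f i \<in> std_polys D) \<Longrightarrow> (\<Sum>i\<in>A. f i) \<in> std_polys D"
  using keys_sum_subset[of f A] by (fastforce simp: std_polys_def)

lemma straighten_sum:
  assumes Q: "ideal Q (poly_ring V)" and "\<And>i. i \<in> A \<Longrightarrow> \<exists>r\<in>std_polys D. f i - r \<in> Q"
  shows "\<exists>r\<in>std_polys D. (\<Sum>i\<in>A. f i) - r \<in> Q"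
proof -
  obtain r where r: "\<And>i. i \<in> A \<Longrightarrow> r i \<in> std_polys D \<and> f i - r i \<in> Q"
    using assms(2) by metis
  have "(\<Sum>i\<in>A. f i) - (\<Sum>i\<in>A. r i) \<in> Q"
    unfolding sum_subtractf[symmetric] using r by (intro poly_idealD(6)[OF Q]) auto
  then show ?thesis using std_polys_sum[of A r D] r by auto
qed

text \<open>The weight \<open>\<mu>\<close> makes the rewriting of incomparable pairs terminate.\<close>

lemma straighten:
  fixes Q :: "('v, 'b::comm_ring_1) mpoly set" and \<mu> :: "'v \<Rightarrow> nat"
  assumes Q: "ideal Q (poly_ring V)"
    and step: "\<And>a b. a \<in> V \<Longrightarrow> b \<in> V \<Longrightarrow> \<not> comparable a b \<Longrightarrow> \<exists>r. Var a * Var b - r \<in> Q \<and>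
      (\<forall>s\<in>keys r. keys s \<subseteq> V \<and> weight \<mu> s < \<mu> a + \<mu> b \<and> monom_degree s = 2)"
    and p: "p \<in> carrier (poly_ring V)" "\<And>m. m \<in> keys p \<Longrightarrow> monom_degree m \<in> D"
  shows "\<exists>r\<in>std_polys D. p - r \<in> Q"
proof -
  have monom: "\<exists>r\<in>std_polys D. single m c - r \<in> Q"
    if "keys m \<subseteq> V" "monom_degree m \<in> D" for m and c :: 'b
    using that
  proof (induction "weight \<mu> m" arbitrary: m c rule: less_induct)
    case less
    show ?case
    proof (cases "std m")
      case True
      then show ?thesis using less.prems poly_idealD(2)[OF Q]
        by (intro bexI[of _ "single m c"]) (auto simp: std_polys_def)
    next
      case False
      then obtain a b where ab: "a \<in> keys m" "b \<in> keys m" "\<not> comparable a b"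
        using less.prems by (auto simp: std_def)
      then obtain m' where m: "m = single a 1 + single b 1 + m'"
        using pair_split not_comparable_neq by metis
      obtain r where r: "Var a * Var b - r \<in> Q"
        "\<And>s. s \<in> keys r \<Longrightarrow> keys s \<subseteq> V \<and> weight \<mu> s < \<mu> a + \<mu> b \<and> monom_degree s = 2"
        using step[of a b] ab less.prems by blast
      have m': "keys m' \<subseteq> V" using less.prems by (auto simp: m keys_plus_monom)
      have "single m' c * r = (\<Sum>s\<in>keys r. single (m' + s) (c * lookup r s))"
        by (subst sum_of_singles[of r]) (simp add: sum_distrib_left mult_single)
      moreover have "\<exists>q\<in>std_polys D. (\<Sum>s\<in>keys r. single (m' + s) (c * lookup r s)) - q \<in> Q"
      proof (rule straighten_sum[OF Q])
        fix s assume "s \<in> keys r"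
        then show "\<exists>q\<in>std_polys D. single (m' + s) (c * lookup r s) - q \<in> Q"
          using r(2)[of s] m' less.prems
          by (intro less.hyps) (auto simp: m keys_plus_monom monom_degree_eq eval_nat_numeral)
      qed
      ultimately obtain q where q: "q \<in> std_polys D" "single m' c * r - q \<in> Q" by auto
      have "single m c - q = single m' c * (Var a * Var b - r) + (single m' c * r - q)"
        by (simp add: m Var_mult_Var mult_single algebra_simps)
      then show ?thesis
        using q poly_idealD(3)[OF Q poly_idealD(5)[OF Q r(1)] q(2)] m' single_in_carrier by metis
    qed
  qed
  have "\<exists>r\<in>std_polys D. (\<Sum>m\<in>keys p. single m (lookup p m)) - r \<in> Q"
    using p by (intro straighten_sum[OF Q] monom) (auto simp: carrier_poly_ring)
  then show ?thesis by (simp flip: sum_of_singles)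
qed

end

section \<open>Separating weights\<close>

text \<open>Comparison of base \<open>B\<close> expansions with digit positions
  \<open>\<nu>\<close>: the highest position at which they differ decides, because the lower digits
  of \<open>z\<close> sum to less than \<open>B ^ \<nu> x\<close>.\<close>

lemma digits_less:
  fixes z z' \<nu> :: "'i \<Rightarrow> nat"
  assumes A: "finite A" "inj_on \<nu> A" and z: "\<And>y. y \<in> A \<Longrightarrow> z y < B"
    and x: "x \<in> A" "z x < z' x" "\<And>y. y \<in> A \<Longrightarrow> \<nu> x < \<nu> y \<Longrightarrow> z y = z' y"
  shows "(\<Sum>y\<in>A. z y * B ^ \<nu> y) < (\<Sum>y\<in>A. z' y * B ^ \<nu> y)"
proof -
  define L where "L = {y\<in>A. \<nu> y < \<nu> x}"
  define H where "H = {y\<in>A. \<nu> x < \<nu> y}"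
  have "y = x \<or> \<nu> y < \<nu> x \<or> \<nu> x < \<nu> y" if "y \<in> A" for y
    using inj_onD[OF A(2), of y x] that x(1) by (cases "\<nu> y = \<nu> x") auto
  then have A_eq: "A = insert x (L \<union> H)"
    using x(1) unfolding L_def H_def by blast
  have fin1: "finite L" using A(1) unfolding L_def by (rule finite_subset[rotated]) blast
  have fin2: "finite H" using A(1) unfolding H_def by (rule finite_subset[rotated]) blast
  have fin3: "x \<notin> L \<union> H" unfolding L_def H_def by blast
  have fin4: "L \<inter> H = {}" unfolding L_def H_def using less_asym by blast
  note fin = fin1 fin2 fin3 fin4
  have split: "(\<Sum>y\<in>A. f y * B ^ \<nu> y) = f x * B ^ \<nu> x + ((\<Sum>y\<in>L. f y * B ^ \<nu> y) + (\<Sum>y\<in>H. f y * B ^ \<nu> y))"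
    for f :: "'i \<Rightarrow> nat"
    unfolding A_eq using fin by (simp add: sum.union_disjoint)
  \<comment> \<open>\<open>B\<close> is positive since it exceeds a digit, so \<open>B - 1\<close>
    is not truncated; the geometric sum is stated additively for the same reason.\<close>
  obtain b where "B = Suc b" using z[OF x(1)] by (cases B) auto
  then have geometric: "(\<Sum>j<n. (B - 1) * B ^ j) + 1 = B ^ n" for n
    by (induction n) (simp_all add: algebra_simps)
  have "(\<Sum>y\<in>L. z y * B ^ \<nu> y) \<le> (\<Sum>y\<in>L. (B - 1) * B ^ \<nu> y)"
    using z by (intro sum_mono mult_right_mono) (fastforce simp: L_def)+
  also have "\<dots> = (\<Sum>j\<in>\<nu> ` L. (B - 1) * B ^ j)"
    using A(2) by (subst sum.reindex) (auto simp: L_def intro: inj_on_subset)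
  also have "\<dots> \<le> (\<Sum>j<\<nu> x. (B - 1) * B ^ j)"
    by (intro sum_mono2) (auto simp: L_def)
  also have "\<dots> < B ^ \<nu> x" using geometric[of "\<nu> x"] by simp
  finally have "(\<Sum>y\<in>L. z y * B ^ \<nu> y) < B ^ \<nu> x" .
  moreover have "Suc (z x) * B ^ \<nu> x \<le> z' x * B ^ \<nu> x" using x(2) by (intro mult_right_mono) auto
  moreover have "(\<Sum>y\<in>H. z y * B ^ \<nu> y) = (\<Sum>y\<in>H. z' y * B ^ \<nu> y)"
    using x(3) by (intro sum.cong) (auto simp: H_def)
  ultimately show ?thesis unfolding split by simp
qed

text \<open>At the highest position of disagreement \<open>digits_less\<close> applies in one of the
  two directions.\<close>

lemma digits_inj:
  fixes z z' \<nu> :: "'i \<Rightarrow> nat"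
  assumes A: "finite A" "inj_on \<nu> A" and z: "\<And>y. y \<in> A \<Longrightarrow> z y < B" "\<And>y. y \<in> A \<Longrightarrow> z' y < B"
    and eq: "(\<Sum>y\<in>A. z y * B ^ \<nu> y) = (\<Sum>y\<in>A. z' y * B ^ \<nu> y)" and y: "y \<in> A"
  shows "z y = z' y"
proof (rule ccontr)
  assume "z y \<noteq> z' y"
  define D where "D = {y\<in>A. z y \<noteq> z' y}"
  have D: "finite (\<nu> ` D)" "\<nu> ` D \<noteq> {}" using A y \<open>z y \<noteq> z' y\<close> by (auto simp: D_def)
  obtain x where x: "x \<in> D" "\<nu> x = Max (\<nu> ` D)" using Max_in[OF D] by auto
  have high: "z u = z' u" if "u \<in> A" "\<nu> x < \<nu> u" for u
    using Max_ge[OF D(1), of "\<nu> u"] x that by (fastforce simp: D_def)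
  have "x \<in> A" "z x \<noteq> z' x" using x by (auto simp: D_def)
  then consider "z x < z' x" | "z' x < z x" by linarith
  then show False
    using digits_less[of A \<nu> z B x z', OF A z(1) \<open>x \<in> A\<close> _ high]
      digits_less[of A \<nu> z' B x z, OF A z(2) \<open>x \<in> A\<close> _ high[symmetric]] eq
    by cases auto
qed

text \<open>Distinct exponents make the sum a polynomial in \<open>t\<close> with coefficients
  \<open>c s\<close>. Independence of monomials on a cone is reduced to this along one-parameter
  curves.\<close>

lemma exponents_independent:
  fixes c :: "'s \<Rightarrow> complex" and e :: "'s \<Rightarrow> nat"
  assumes "finite S" "inj_on e S" "\<And>t. (\<Sum>s\<in>S. c s * t ^ e s) = 0" "s \<in> S"
  shows "c s = 0"
proof -
  define p where "p = (\<Sum>s\<in>S. monom (c s) (e s))"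
  have "poly p t = 0" for t using assms(3) by (simp add: p_def poly_sum poly_monom)
  then have "p = 0" by (simp flip: poly_all_0_iff_0)
  moreover have "Polynomial.coeff p (e s) = (\<Sum>s'\<in>S. if s' = s then c s else 0)"
    unfolding p_def coeff_sum using assms(2,4)
    by (intro sum.cong) (auto dest: inj_onD)
  ultimately show ?thesis using assms(1,4) by simp
qed

text \<open>Simultaneous Dirichlet approximation with a large denominator bound preserves the signs of
  finitely many linear forms with integral coefficients.\<close>

lemma integral_weights:
  fixes w :: "'v \<Rightarrow> real"
  assumes "finite V"
  shows "\<exists>u :: 'v \<Rightarrow> int. \<forall>a\<in>V. \<forall>b\<in>V. \<forall>c\<in>V. \<forall>d\<in>V.
    (w a + w b < w c + w d \<longrightarrow> u a + u b < u c + u d) \<and>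
    (w a + w b = w c + w d \<longrightarrow> u a + u b = u c + u d)"
proof -
  \<comment> \<open>Four coordinates with errors below \<open>1 / N\<close> give an error below
    \<open>4 / N\<close>. A bound \<open>N\<close> on the numbers \<open>4 / gap\<close> keeps every
    positive gap above this error; zero and negative gaps contribute harmless nonpositive numbers.
    \<open>N \<ge> 4\<close> makes the error smaller than 1, which turns equalities into equalities
    of integers.\<close>
  define D where "D = (\<lambda>(a, b, c, d). 4 / (w c + w d - w a - w b)) ` (V \<times> V \<times> V \<times> V)"
  have "finite D" using assms by (simp add: D_def)
  then obtain M where M: "\<And>x. x \<in> D \<Longrightarrow> x \<le> M" using bdd_above_finite[OF \<open>finite D\<close>] unfolding bdd_above_def by blast
  obtain N0 :: nat where N0: "M \<le> real N0" using real_arch_simple by blast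
  define N where "N = max N0 4"
  have N: "N > 0" "4 / real N \<le> 1" "\<And>x. x \<in> D \<Longrightarrow> x \<le> real N" using M N0
    by (fastforce simp: N_def)+
  obtain f where f: "bij_betw f {0..<card V} V" using ex_bij_betw_nat_finite[OF assms] by blast
  obtain q p where q: "0 < q" and p: "\<And>i. i < card V \<Longrightarrow> \<bar>of_int q * w (f i) - of_int (p i)\<bar> < 1 / N"
    using Dirichlet_approx_simult[OF N(1), of "card V" "\<lambda>i. w (f i)"] by metis
  define u where "u v = p (inv_into {0..<card V} f v)" for v
  have u: "\<bar>of_int q * w v - of_int (u v)\<bar> < 1 / N" if "v \<in> V" for v
    using p[of "inv_into {0..<card V} f v"] that f bij_betw_inv_into_right[OF f that]
      bij_betw_apply[OF bij_betw_inv_into[OF f] that]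
    by (auto simp: u_def)
  show ?thesis
  proof (intro exI[of _ u] ballI conjI impI)
    fix a b c d assume V: "a \<in> V" "b \<in> V" "c \<in> V" "d \<in> V"
    define \<delta> where "\<delta> = w c + w d - w a - w b"
    have close: "\<bar>q * \<delta> - (u c + u d - u a - u b)\<bar> < 4 / N"
      using u[OF V(1)] u[OF V(2)] u[OF V(3)] u[OF V(4)] unfolding \<delta>_def
      by (simp add: algebra_simps)
    {
      assume "w a + w b < w c + w d"
      then have "\<delta> > 0" by (simp add: \<delta>_def)
      have "4 / \<delta> \<in> D" using V by (force simp: D_def \<delta>_def)
      then have "4 / \<delta> \<le> N" by (rule N(3))
      then have "4 / N \<le> \<delta>" using N(1) \<open>\<delta> > 0\<close> by (simp add: field_simps)
      also have "\<dots> \<le> q * \<delta>" using q \<open>\<delta> > 0\<close> by simp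
      finally show "u a + u b < u c + u d" using close by linarith
    next
      assume "w a + w b = w c + w d"
      then have "\<delta> = 0" by (simp add: \<delta>_def)
      then have "\<bar>real_of_int (u c + u d - u a - u b)\<bar> < 1" using close N(2) by simp
      then show "u a + u b = u c + u d" by linarith
    }
  qed
qed

section \<open>Termination of the rewriting and separation of standard monomials by weights\<close>

context set_lattice
begin

text \<open>The constant bounds every squared cardinality, so the subtraction is not truncated on
  \<open>V\<close>.\<close>

definition corank :: "'v \<Rightarrow> nat" where
  "corank a = (\<Sum>b\<in>V. card (T b))\<^sup>2 - (card (T a))\<^sup>2"

text \<open>The squared cardinality is strictly supermodular, so its complement \<open>corank\<close> decreases when an
  incomparable pair is replaced by its meet and join.\<close>

lemma corank_less:
  assumes "a \<in> V" "b \<in> V" "\<not> comparable a b"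
  shows "corank (meet a b) + corank (join a b) < corank a + corank b"
proof -
  define i where "i = card (T a \<inter> T b)"
  define x where "x = card (T a - T b)"
  define y where "y = card (T b - T a)"
  have f: "finite (T a)" "finite (T b)" using finT assms by auto
  have pos: "x > 0" "y > 0" using assms(3) f by (auto simp: x_def y_def comparable_def card_gt_0_iff)
  have ca: "card (T a) = i + x" unfolding i_def x_def using f
    by (subst card_Un_disjoint[symmetric]) (auto intro: arg_cong[of _ _ card])
  have cb: "card (T b) = i + y" unfolding i_def y_def using f
    by (subst card_Un_disjoint[symmetric]) (auto intro: arg_cong[of _ _ card])
  have cj: "card (T (join a b)) = i + x + y"
    using card_Un_Int[OF f] join[OF assms(1,2)] ca cb by (simp add: i_def)
  have cm: "card (T (meet a b)) = i" using meet[OF assms(1,2)] by (simp add: i_def)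
  have bound: "(card (T c))\<^sup>2 \<le> (\<Sum>b\<in>V. card (T b))\<^sup>2" if "c \<in> V" for c
    using that fin by (intro power_mono member_le_sum) auto
  \<comment> \<open>The two sides differ by \<open>2 * x * y\<close>.\<close>
  have less: "(i + x)\<^sup>2 + (i + y)\<^sup>2 < i\<^sup>2 + (i + x + y)\<^sup>2"
    using pos by (simp add: power2_eq_square algebra_simps)
  have arith: "(s - t) + (s - r) < (s - p) + (s - q)"
    if "p + q < t + r" "p \<le> s" "q \<le> s" "r \<le> s" "t \<le> s" for p q r s t :: nat
    using that by arith
  have "(i + x)\<^sup>2 \<le> (\<Sum>b\<in>V. card (T b))\<^sup>2" "(i + y)\<^sup>2 \<le> (\<Sum>b\<in>V. card (T b))\<^sup>2"
    "(i + x + y)\<^sup>2 \<le> (\<Sum>b\<in>V. card (T b))\<^sup>2" "i\<^sup>2 \<le> (\<Sum>b\<in>V. card (T b))\<^sup>2"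
    using bound[of a] bound[of b] bound[of "join a b"] bound[of "meet a b"]
      meet[OF assms(1,2)] join[OF assms(1,2)] assms(1,2)
    unfolding ca cb cj cm by auto
  then show ?thesis
    unfolding corank_def ca cb cj cm by (intro arith less)
qed

text \<open>Replacing an incomparable pair by its meet and join lowers the total
  \<open>corank\<close>, so every monomial reaches a standard one.\<close>

lemma chain_induct [consumes 1, case_names std swap]:
  assumes "keys m \<subseteq> V" and std: "\<And>s. std s \<Longrightarrow> R s"
    and swap: "\<And>a b m. a \<in> V \<Longrightarrow> b \<in> V \<Longrightarrow> \<not> comparable a b \<Longrightarrow> keys m \<subseteq> V \<Longrightarrow>
      R (single (meet a b) 1 + single (join a b) 1 + m) \<Longrightarrow> R (single a 1 + single b 1 + m)"
  shows "R m"
  using assms(1)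
proof (induction "weight corank m" arbitrary: m rule: less_induct)
  case less
  show ?case
  proof (cases "std m")
    case False
    then obtain a b where ab: "a \<in> keys m" "b \<in> keys m" "\<not> comparable a b"
      using less.prems by (auto simp: std_def)
    then obtain m' where m: "m = single a 1 + single b 1 + m'"
      using pair_split not_comparable_neq by metis
    have V: "a \<in> V" "b \<in> V" "keys m' \<subseteq> V" using less.prems by (auto simp: m keys_plus_monom)
    show ?thesis unfolding m
    proof (rule swap[OF V(1,2) ab(3) V(3)])
      show "R (single (meet a b) 1 + single (join a b) 1 + m')"
        using V meet[OF V(1,2)] join[OF V(1,2)] corank_less[OF V(1,2) ab(3)]
        by (intro less.hyps) (auto simp: m keys_plus_monom)
    qed
  qed (rule std)
qed

lemma multiplicity_add [simp]: "multiplicity (m + m') p = multiplicity m p + multiplicity m' p"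
  by (simp add: multiplicity_def)

lemma multiplicity_single [simp]: "multiplicity (single a c) p = (if p \<in> T a then c else 0)"
  by (simp add: multiplicity_def)

lemma multiplicity_le: "multiplicity m p \<le> monom_degree m"
  unfolding multiplicity_def weight_def monom_degree_def by (rule sum_mono) simp

lemma multiplicity_pos_iff: "0 < multiplicity m p \<longleftrightarrow> (\<exists>a\<in>keys m. p \<in> T a)"
proof -
  have "multiplicity m p = 0 \<longleftrightarrow> (\<forall>a\<in>keys m. p \<notin> T a)"
    by (auto simp: multiplicity_def weight_def in_keys_iff)
  then show ?thesis by (simp add: neq0_conv[symmetric] del: neq0_conv)
qed

text \<open>On a chain the union of the sets \<open>T b\<close> is attained by the largest factor,
  and this union is the support of the multiplicities.\<close>

lemma std_top:
  assumes "std m" "m \<noteq> 0"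
  obtains a where "a \<in> keys m" "T a = {p. 0 < multiplicity m p}"
proof -
  have ne: "finite ((card \<circ> T) ` keys m)" "(card \<circ> T) ` keys m \<noteq> {}" using assms by auto
  obtain a where a: "a \<in> keys m" "card (T a) = Max ((card \<circ> T) ` keys m)" using Max_in[OF ne] by auto
  have "T b \<subseteq> T a" if b: "b \<in> keys m" for b
  proof -
    have "card (T b) \<le> card (T a)" using Max_ge[OF ne(1)] a(2) b by auto
    moreover have "finite (T b)" "comparable a b"
      using assms(1) a(1) b finT by (auto simp: std_def)
    ultimately show ?thesis
      unfolding comparable_def using card_seteq[of "T b" "T a"] by blast
  qed
  then have "T a = {p. 0 < multiplicity m p}" using a(1) by (auto simp: multiplicity_pos_iff)
  then show ?thesis using that a(1) by blast
qed

text \<open>The largest factor is determined by the multiplicities and can be peeled off. The degree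
  has to be known as well, because a factor \<open>a\<close> with \<open>T a\<close> empty leaves no
  trace in the multiplicities.\<close>

lemma std_unique:
  assumes "std m" "std m'" "monom_degree m = monom_degree m'" "\<And>p. multiplicity m p = multiplicity m' p"
  shows "m = m'"
  using assms
proof (induction "monom_degree m" arbitrary: m m')
  case 0
  have "m = 0" "m' = 0" using 0(1) 0(4)
    by (auto simp: monom_degree_def in_keys_iff simp flip: Poly_Mapping.keys_eq_empty)
  then show ?case by simp
next
  case (Suc d)
  have "m \<noteq> 0" "m' \<noteq> 0" using Suc(2,5) by (auto simp: monom_degree_def)
  obtain a where "a \<in> keys m" "T a = {p. 0 < multiplicity m p}"
    using std_top[OF Suc(3) \<open>m \<noteq> 0\<close>] .
  moreover obtain a' where "a' \<in> keys m'" "T a' = {p. 0 < multiplicity m' p}"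
    using std_top[OF Suc(4) \<open>m' \<noteq> 0\<close>] .
  ultimately have a: "a \<in> keys m" "a' \<in> keys m'" "T a = T a'" using Suc(6) by auto
  moreover have "a \<in> V" "a' \<in> V" using a Suc(3,4) by (auto simp: std_def)
  ultimately have "a' = a" using inj by (auto dest: inj_onD)
  then obtain l l' where l: "m = single a 1 + l" "m' = single a 1 + l'"
    using single_minus_add[of a m] single_minus_add[of a m'] a by blast
  have "l = l'"
    using Suc(2-6) by (intro Suc(1)) (auto simp: l monom_degree_eq std_def keys_plus_monom)
  then show ?case by (simp add: l)
qed

text \<open>Exactly what makes the points with coordinates \<open>t ^ g a\<close> satisfy the Hibi
  equations.\<close>

definition modular :: "('v \<Rightarrow> nat) \<Rightarrow> bool" where
  "modular g \<longleftrightarrow> (\<forall>a\<in>V. \<forall>b\<in>V. g (meet a b) + g (join a b) = g a + g b)"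

text \<open>Degree and multiplicities are written as the digits of one number, in a base above all
  degrees that occur; position \<open>None\<close> holds the degree. By \<open>std_unique\<close>
  the digits determine a standard monomial, and each digit is modular because union and intersection
  preserve the number of memberships.\<close>

lemma separating_modular_weight:
  assumes S: "finite S" "\<And>s. s \<in> S \<Longrightarrow> std s"
  shows "\<exists>g. modular g \<and> inj_on (weight g) S"
proof -
  define P where "P = (\<Union>a\<in>V. T a)"
  have "finite P" using fin finT by (auto simp: P_def)
  define A where "A = insert None (Some ` P)"
  have A: "finite A" using \<open>finite P\<close> by (simp add: A_def)
  obtain \<nu> :: "'p option \<Rightarrow> nat" where \<nu>: "inj_on \<nu> A"
    using finite_imp_inj_to_nat_seg[OF A] by blast
  define B where "B = Suc (\<Sum>s\<in>S. monom_degree s)"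
  define digit where "digit m i = (case i of None \<Rightarrow> monom_degree m | Some p \<Rightarrow> multiplicity m p)" for m i
  define g where "g a = (\<Sum>i\<in>A. digit (single a 1) i * B ^ \<nu> i)" for a
  have digit_add: "digit (m + m') i = digit m i + digit m' i" for m m' i
    by (auto simp: digit_def monom_degree_eq split: option.split)
  have weight: "weight g m = (\<Sum>i\<in>A. digit m i * B ^ \<nu> i)" for m
  proof (induction m rule: monom_induct)
    case zero
    show ?case by (auto simp: digit_def monom_degree_eq multiplicity_def split: option.split intro!: sum.neutral)
  next
    case (plus m v)
    then show ?case by (simp add: digit_add g_def sum.distrib distrib_right)
  qed
  have bound: "digit s i < B" if "s \<in> S" for s i
  proof -
    have "digit s i \<le> monom_degree s" using multiplicity_le by (auto simp: digit_def split: option.split)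
    also have "\<dots> \<le> (\<Sum>s\<in>S. monom_degree s)" using S that by (intro member_le_sum) auto
    finally show ?thesis by (simp add: B_def)
  qed
  have "inj_on (weight g) S"
  proof (rule inj_onI)
    fix s s' assume s: "s \<in> S" "s' \<in> S" "weight g s = weight g s'"
    have eq: "digit s i = digit s' i" if "i \<in> A" for i
      using digits_inj[OF A \<nu>, of "digit s" B "digit s'"] bound s that by (simp add: weight)
    have zero: "multiplicity r p = 0" if "r \<in> S" "p \<notin> P" for r p
      using that S(2)[of r] multiplicity_pos_iff[of r p] by (force simp: P_def std_def)
    show "s = s'"
    proof (rule std_unique)
      show "monom_degree s = monom_degree s'" using eq[of None] by (simp add: A_def digit_def)
      show "multiplicity s p = multiplicity s' p" for p
        using eq[of "Some p"] zero[of _ p] s by (cases "p \<in> P") (simp_all add: A_def digit_def)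
    qed (use S s in auto)
  qed
  moreover have "modular g"
    unfolding modular_def
  proof (intro ballI)
    fix a b assume "a \<in> V" "b \<in> V"
    then have "digit (single (meet a b) 1) i + digit (single (join a b) 1) i =
        digit (single a 1) i + digit (single b 1) i" for i
      using meet[of a b] join[of a b] by (auto simp: digit_def monom_degree_eq split: option.split)
    then show "g (meet a b) + g (join a b) = g a + g b"
      by (simp add: g_def flip: sum.distrib distrib_right)
  qed
  ultimately show ?thesis by blast
qed

end

section \<open>Flatness of directed unions of finite free modules\<close>

definition bilinear_relators ::
  "('r, 'c) ring_scheme \<Rightarrow> ('r, 'x, 'd) module_scheme \<Rightarrow> ('r, 'm, 'e) module_scheme \<Rightarrow>
   ('x \<times> 'm \<Rightarrow>\<^sub>0 int) set" where
  "bilinear_relators R N M =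
       {frag_of (x \<oplus>\<^bsub>N\<^esub> y, m) - frag_of (x, m) - frag_of (y, m) | x y m.
           x \<in> carrier N \<and> y \<in> carrier N \<and> m \<in> carrier M} \<union>
        {frag_of (x, l \<oplus>\<^bsub>M\<^esub> m) - frag_of (x, l) - frag_of (x, m) | x l m.
           x \<in> carrier N \<and> l \<in> carrier M \<and> m \<in> carrier M} \<union>
        {frag_of (r \<odot>\<^bsub>N\<^esub> x, m) - frag_of (x, r \<odot>\<^bsub>M\<^esub> m) | r x m.
           r \<in> carrier R \<and> x \<in> carrier N \<and> m \<in> carrier M}"

lemma tensor_relations_eq:
  "tensor_relations R N M = generate (free_Abelian_group (carrier N \<times> carrier M)) (bilinear_relators R N M)"
  by (simp add: tensor_relations_def bilinear_relators_def)

lemma keys_diff_subset: "keys a \<subseteq> S \<Longrightarrow> keys b \<subseteq> S \<Longrightarrow> keys (a - b :: 'a \<Rightarrow>\<^sub>0 int) \<subseteq> S"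
  using Poly_Mapping.keys_diff[of a b] by blast

lemma bilinear_relators_carrier:
  assumes "module R N" "module R M"
  shows "bilinear_relators R N M \<subseteq> carrier (free_Abelian_group (carrier N \<times> carrier M))"
proof -
  interpret N: module R N by fact
  interpret M: module R M by fact
  have pair: "keys (frag_of (x, m)) \<subseteq> carrier N \<times> carrier M"
    if "x \<in> carrier N" "m \<in> carrier M" for x m
    using that by simp
  show ?thesis unfolding bilinear_relators_def
    by (intro subsetI, elim UnE CollectE exE conjE)
      (simp_all only: carrier_free_Abelian_group_iff, (intro keys_diff_subset pair; simp)+)
qed

lemma tensor_relations_closed:
  assumes "module R N" "module R M"
  shows "bilinear_relators R N M \<subseteq> tensor_relations R N M" "0 \<in> tensor_relations R N M"
    and "\<And>y z. y \<in> tensor_relations R N M \<Longrightarrow> z \<in> tensor_relations R N M \<Longrightarrow> y + z \<in> tensor_relations R N M"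
    and "\<And>z. z \<in> tensor_relations R N M \<Longrightarrow> - z \<in> tensor_relations R N M"
    and "\<And>y z. y \<in> tensor_relations R N M \<Longrightarrow> z \<in> tensor_relations R N M \<Longrightarrow> y - z \<in> tensor_relations R N M"
    and "\<And>z. z \<in> tensor_relations R N M \<Longrightarrow> keys z \<subseteq> carrier N \<times> carrier M"
    and "\<And>A f. (\<And>i. i \<in> A \<Longrightarrow> f i \<in> tensor_relations R N M) \<Longrightarrow> (\<Sum>i\<in>A. f i) \<in> tensor_relations R N M"
proof -
  let ?F = "free_Abelian_group (carrier N \<times> carrier M)"
  interpret F: group ?F by simp
  interpret subgroup "tensor_relations R N M" ?F
    unfolding tensor_relations_eq
    by (rule F.generate_is_subgroup[OF bilinear_relators_carrier[OF assms]])
  show "bilinear_relators R N M \<subseteq> tensor_relations R N M"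
    unfolding tensor_relations_eq by (auto intro: generate.incl)
  show zero: "0 \<in> tensor_relations R N M" using one_closed by simp
  show add: "y + z \<in> tensor_relations R N M" if "y \<in> tensor_relations R N M" "z \<in> tensor_relations R N M" for y z
    using m_closed[OF that] by simp
  show keys: "keys z \<subseteq> carrier N \<times> carrier M" if "z \<in> tensor_relations R N M" for z
    using mem_carrier[OF that] by simp
  show minus: "- z \<in> tensor_relations R N M" if "z \<in> tensor_relations R N M" for z
    using m_inv_closed[OF that] keys[OF that] by simp
  show "y - z \<in> tensor_relations R N M" if "y \<in> tensor_relations R N M" "z \<in> tensor_relations R N M" for y z
    using add[OF that(1) minus[OF that(2)]] by simp
  show "(\<Sum>i\<in>A. f i) \<in> tensor_relations R N M" if "\<And>i. i \<in> A \<Longrightarrow> f i \<in> tensor_relations R N M" for A :: "'z set" and f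
    using that by (induction A rule: infinite_finite_induct) (auto intro: add zero)
qed

lemma tensor_relations_induct [consumes 3, case_names zero relator minus add]:
  assumes "module R N" "module R M" "z \<in> tensor_relations R N M"
    and "P 0" "\<And>x. x \<in> bilinear_relators R N M \<Longrightarrow> P x" "\<And>x. P x \<Longrightarrow> P (- x)"
    and "\<And>x y. P x \<Longrightarrow> P y \<Longrightarrow> P (x + y)"
  shows "P z"
  using assms(3) unfolding tensor_relations_eq
proof (induction rule: generate.induct)
  case (inv h)
  have "h \<in> carrier (free_Abelian_group (carrier N \<times> carrier M))"
    using bilinear_relators_carrier[OF assms(1,2)] inv by blast
  then have "keys h \<subseteq> carrier N \<times> carrier M" by simp
  then show ?case using inv assms by auto
qed (use assms in auto)

lemma bilinear_relators_mono:
  assumes "carrier N' \<subseteq> carrier N" "carrier M' \<subseteq> carrier M"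
    and "ring.add N' = ring.add N" "ring.add M' = ring.add M" "module.smult N' = module.smult N" "module.smult M' = module.smult M"
  shows "bilinear_relators R N' M' \<subseteq> bilinear_relators R N M"
  using assms(1,2) unfolding bilinear_relators_def assms(3-) by blast

lemma tensor_relations_mono:
  assumes "module R N" "module R M" "module R N'" "module R M'"
    and "carrier N' \<subseteq> carrier N" "carrier M' \<subseteq> carrier M"
    and "ring.add N' = ring.add N" "ring.add M' = ring.add M" "module.smult N' = module.smult N" "module.smult M' = module.smult M"
    and "z \<in> tensor_relations R N' M'"
  shows "z \<in> tensor_relations R N M"
  using assms(3,4,11)
proof (induction rule: tensor_relations_induct)
  case (relator x)
  then show ?case
    using bilinear_relators_mono[OF assms(5-10)] tensor_relations_closed(1)[OF assms(1,2)] by blast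
qed (auto intro: tensor_relations_closed[OF assms(1,2)])

text \<open>A relation involves only finitely many elements of \<open>M\<close>.\<close>

lemma tensor_relations_finite_support:
  assumes "module R N" "module R M" "z \<in> tensor_relations R N M"
  shows "\<exists>A. finite A \<and> A \<subseteq> carrier M \<and>
    (\<forall>B. A \<subseteq> B \<and> submodule B R M \<longrightarrow> z \<in> tensor_relations R N (M\<lparr>carrier := B\<rparr>))"
  using assms
proof (induction rule: tensor_relations_induct)
  case zero
  show ?case using tensor_relations_closed(2)[OF assms(1) submodule.submodule_is_module] assms(2)
    by (intro exI[of _ "{}"]) auto
next
  case (relator z)
  interpret M: module R M by fact
  have gen: ?case if A: "finite A" "A \<subseteq> carrier M"
    and "\<And>B. A \<subseteq> B \<Longrightarrow> submodule B R M \<Longrightarrow> z \<in> bilinear_relators R N (M\<lparr>carrier := B\<rparr>)" for A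
    using that tensor_relations_closed(1)[OF assms(1) submodule.submodule_is_module[OF _ assms(2)]]
    by (intro exI[of _ A]) blast
  from relator consider
    (a) x y m where "z = frag_of (x \<oplus>\<^bsub>N\<^esub> y, m) - frag_of (x, m) - frag_of (y, m)"
      "x \<in> carrier N" "y \<in> carrier N" "m \<in> carrier M"
    | (b) x l m where "z = frag_of (x, l \<oplus>\<^bsub>M\<^esub> m) - frag_of (x, l) - frag_of (x, m)"
      "x \<in> carrier N" "l \<in> carrier M" "m \<in> carrier M"
    | (c) r x m where "z = frag_of (r \<odot>\<^bsub>N\<^esub> x, m) - frag_of (x, r \<odot>\<^bsub>M\<^esub> m)"
      "r \<in> carrier R" "x \<in> carrier N" "m \<in> carrier M"
    unfolding bilinear_relators_def by blast
  then show ?case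
  proof cases
    case a
    show ?thesis by (rule gen[of "{m}"]) (use a in \<open>auto simp: bilinear_relators_def\<close>)
  next
    case b
    show ?thesis by (rule gen[of "{l, m}"]) (use b in \<open>auto simp: bilinear_relators_def\<close>)
  next
    case c
    show ?thesis by (rule gen[of "{m}"]) (use c in \<open>auto simp: bilinear_relators_def\<close>)
  qed
next
  case (minus z)
  then show ?case
    using tensor_relations_closed(4)[OF assms(1) submodule.submodule_is_module[OF _ assms(2)]] by meson
next
  case (add y z)
  then obtain A A' where
    "finite A" "A \<subseteq> carrier M" "\<And>B. A \<subseteq> B \<Longrightarrow> submodule B R M \<Longrightarrow> y \<in> tensor_relations R N (M\<lparr>carrier := B\<rparr>)"
    "finite A'" "A' \<subseteq> carrier M" "\<And>B. A' \<subseteq> B \<Longrightarrow> submodule B R M \<Longrightarrow> z \<in> tensor_relations R N (M\<lparr>carrier := B\<rparr>)"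
    by meson
  then show ?case
    using tensor_relations_closed(3)[OF assms(1) submodule.submodule_is_module[OF _ assms(2)]]
    by (intro exI[of _ "A \<union> A'"]) auto
qed

text \<open>The conditions of the dual basis lemma: linear coordinate functions that reconstruct
  every element of \<open>B\<close>. They provide the maps from \<open>N \<otimes> B\<close> to
  \<open>N\<close> on which the injectivity proof rests.\<close>

definition free_coordinates ::
  "'r ring \<Rightarrow> ('r, 'm) module \<Rightarrow> 'm set \<Rightarrow> 's set \<Rightarrow> ('s \<Rightarrow> 'm) \<Rightarrow> ('s \<Rightarrow> 'm \<Rightarrow> 'r) \<Rightarrow> bool" where
  "free_coordinates R M B S e coord \<longleftrightarrow> submodule B R M \<and> finite S \<and> (\<forall>s\<in>S. e s \<in> B) \<and>
    (\<forall>s\<in>S. \<forall>m\<in>B. coord s m \<in> carrier R) \<and>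
    (\<forall>s\<in>S. \<forall>l\<in>B. \<forall>m\<in>B. coord s (l \<oplus>\<^bsub>M\<^esub> m) = coord s l \<oplus>\<^bsub>R\<^esub> coord s m) \<and>
    (\<forall>s\<in>S. \<forall>r\<in>carrier R. \<forall>m\<in>B. coord s (r \<odot>\<^bsub>M\<^esub> m) = r \<otimes>\<^bsub>R\<^esub> coord s m) \<and>
    (\<forall>m\<in>B. m = (\<Oplus>\<^bsub>M\<^esub>s\<in>S. coord s m \<odot>\<^bsub>M\<^esub> e s))"

text \<open>Each coordinate induces a map \<open>h s\<close> from \<open>N \<otimes> B\<close> to
  \<open>N\<close>. Modulo relations over \<open>N'\<close>, an element \<open>z\<close> of
  \<open>N' \<otimes> B\<close> is the sum of the \<open>h s z \<otimes> e s\<close>. A relation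
  over \<open>N\<close> is killed by every \<open>h s\<close>, so this sum is then trivial already
  over \<open>N'\<close>.\<close>

lemma tensor_relations_restrict:
  fixes R :: "'r ring" and N :: "('r, 'x) module" and M :: "('r, 'm) module" and S :: "'s set"
  assumes N: "module R N" and M: "module R M" and N': "submodule N' R N" and free: "free_coordinates R M B S e coord"
    and z: "z \<in> tensor_relations R N (M\<lparr>carrier := B\<rparr>)" "keys z \<subseteq> N' \<times> B"
  shows "z \<in> tensor_relations R (N\<lparr>carrier := N'\<rparr>) (M\<lparr>carrier := B\<rparr>)"
proof -
  have B: "submodule B R M" and S: "finite S" "\<And>s. s \<in> S \<Longrightarrow> e s \<in> B"
    and coord: "\<And>s m. s \<in> S \<Longrightarrow> m \<in> B \<Longrightarrow> coord s m \<in> carrier R"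
      "\<And>s l m. s \<in> S \<Longrightarrow> l \<in> B \<Longrightarrow> m \<in> B \<Longrightarrow> coord s (l \<oplus>\<^bsub>M\<^esub> m) = coord s l \<oplus>\<^bsub>R\<^esub> coord s m"
      "\<And>s r m. s \<in> S \<Longrightarrow> r \<in> carrier R \<Longrightarrow> m \<in> B \<Longrightarrow> coord s (r \<odot>\<^bsub>M\<^esub> m) = r \<otimes>\<^bsub>R\<^esub> coord s m"
      "\<And>m. m \<in> B \<Longrightarrow> m = (\<Oplus>\<^bsub>M\<^esub>s\<in>S. coord s m \<odot>\<^bsub>M\<^esub> e s)"
    using free unfolding free_coordinates_def by blast+
  interpret N: module R N by fact
  interpret M: module R M by fact
  interpret N': submodule N' R N by fact
  interpret B: submodule B R M by fact
  have N'm: "module R (N\<lparr>carrier := N'\<rparr>)" by (rule N'.submodule_is_module[OF N])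
  have Bm: "module R (M\<lparr>carrier := B\<rparr>)" by (rule B.submodule_is_module[OF M])
  have Bsub: "B \<subseteq> carrier M" using M.submoduleE(1)[OF B] .
  have N'sub: "N' \<subseteq> carrier N" using N.submoduleE(1)[OF N'] .
  note N'D = N.submoduleE[OF N'] and BD = M.submoduleE[OF B]
  let ?H = "tensor_relations R (N\<lparr>carrier := N'\<rparr>) (M\<lparr>carrier := B\<rparr>)"
  note H = tensor_relations_closed[OF N'm Bm]
  have H_add: "frag_of (x \<oplus>\<^bsub>N\<^esub> y, m) - frag_of (x, m) - frag_of (y, m) \<in> ?H"
    if "x \<in> N'" "y \<in> N'" "m \<in> B" for x y m
    using that by (intro subsetD[OF H(1)]) (auto simp: bilinear_relators_def)
  have H_add2: "frag_of (x, l \<oplus>\<^bsub>M\<^esub> m) - frag_of (x, l) - frag_of (x, m) \<in> ?H"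
    if "x \<in> N'" "l \<in> B" "m \<in> B" for x l m
    using that by (intro subsetD[OF H(1)]) (auto simp: bilinear_relators_def)
  have H_smult: "frag_of (r \<odot>\<^bsub>N\<^esub> x, m) - frag_of (x, r \<odot>\<^bsub>M\<^esub> m) \<in> ?H"
    if "r \<in> carrier R" "x \<in> N'" "m \<in> B" for r x m
    using that by (intro subsetD[OF H(1)]) (auto simp: bilinear_relators_def)
  have zeroN': "\<zero>\<^bsub>N\<^esub> \<in> N'" using N'.one_closed by simp
  have zeroB: "\<zero>\<^bsub>M\<^esub> \<in> B" using B.one_closed by simp
  have H_zero: "frag_of (\<zero>\<^bsub>N\<^esub>, m) \<in> ?H" if "m \<in> B" for m
    using H(4)[OF H_add[OF zeroN' zeroN' that]] by simp
  have H_zero2: "frag_of (x, \<zero>\<^bsub>M\<^esub>) \<in> ?H" if "x \<in> N'" for x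
    using H(4)[OF H_add2[OF that zeroB zeroB]] by simp
  \<comment> \<open>The universal property of the free abelian group extends
    \<open>(x, m) \<mapsto> coord s m \<odot> x\<close>.\<close>
  have "\<exists>h. h \<in> hom (free_Abelian_group (carrier N \<times> B)) (add_monoid N) \<and>
      (\<forall>x\<in>carrier N. \<forall>m\<in>B. h (frag_of (x, m)) = coord s m \<odot>\<^bsub>N\<^esub> x)" if s: "s \<in> S" for s
  proof -
    have "(\<lambda>(x, m). coord s m \<odot>\<^bsub>N\<^esub> x) ` (carrier N \<times> B) \<subseteq> carrier (add_monoid N)"
      using coord(1) s by auto
    then obtain h where "h \<in> hom (free_Abelian_group (carrier N \<times> B)) (add_monoid N)"
      "\<And>y. y \<in> carrier N \<times> B \<Longrightarrow> h (frag_of y) = (\<lambda>(x, m). coord s m \<odot>\<^bsub>N\<^esub> x) y"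
      using comm_group.free_Abelian_group_universal[OF N.a_comm_group] by blast
    then show ?thesis by (intro exI[of _ h]) auto
  qed
  then obtain h where h: "\<And>s. s \<in> S \<Longrightarrow> h s \<in> hom (free_Abelian_group (carrier N \<times> B)) (add_monoid N)"
    "\<And>s x m. s \<in> S \<Longrightarrow> x \<in> carrier N \<Longrightarrow> m \<in> B \<Longrightarrow> h s (frag_of (x, m)) = coord s m \<odot>\<^bsub>N\<^esub> x"
    by metis
  have h_hom: "group_hom (free_Abelian_group (carrier N \<times> B)) (add_monoid N) (h s)" if "s \<in> S" for s
    using h(1)[OF that] N.a_comm_group
    by (intro group_hom.intro) (auto simp: group_hom_axioms_def comm_group_def)
  have h_carrier: "h s y \<in> carrier N" if "s \<in> S" "keys y \<subseteq> carrier N \<times> B" for s y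
    using hom_in_carrier[OF h(1)] that by fastforce
  have h_add: "h s (x + y) = h s x \<oplus>\<^bsub>N\<^esub> h s y"
    if "s \<in> S" "keys x \<subseteq> carrier N \<times> B" "keys y \<subseteq> carrier N \<times> B" for s x y
    using hom_mult[OF h(1)[OF that(1)], of x y] that by simp
  have h_minus: "h s (- x) = \<ominus>\<^bsub>N\<^esub> h s x" if "s \<in> S" "keys x \<subseteq> carrier N \<times> B" for s x
    using group_hom.hom_inv[OF h_hom[OF that(1)], of x] that by (simp add: a_inv_def)
  have h_zero: "h s 0 = \<zero>\<^bsub>N\<^esub>" if "s \<in> S" for s
    using group_hom.hom_one[OF h_hom[OF that(1)]] by simp
  have h_diff: "h s (x - y) = h s x \<oplus>\<^bsub>N\<^esub> \<ominus>\<^bsub>N\<^esub> h s y"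
    if "s \<in> S" "keys x \<subseteq> carrier N \<times> B" "keys y \<subseteq> carrier N \<times> B" for s x y
    using h_add[of s x "- y"] h_minus[of s y] that by simp
  have fr: "keys (frag_of (x, m)) \<subseteq> carrier N \<times> B" if "x \<in> carrier N" "m \<in> B" for x and m :: 'm
    using that by simp
  have cancel: "p \<oplus>\<^bsub>N\<^esub> q \<oplus>\<^bsub>N\<^esub> \<ominus>\<^bsub>N\<^esub> p \<oplus>\<^bsub>N\<^esub> \<ominus>\<^bsub>N\<^esub> q = \<zero>\<^bsub>N\<^esub>"
    if "p \<in> carrier N" "q \<in> carrier N" for p q
  proof -
    have "p \<oplus>\<^bsub>N\<^esub> q \<oplus>\<^bsub>N\<^esub> \<ominus>\<^bsub>N\<^esub> p \<oplus>\<^bsub>N\<^esub> \<ominus>\<^bsub>N\<^esub> q = (p \<oplus>\<^bsub>N\<^esub> \<ominus>\<^bsub>N\<^esub> p) \<oplus>\<^bsub>N\<^esub> (q \<oplus>\<^bsub>N\<^esub> \<ominus>\<^bsub>N\<^esub> q)"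
      using that by (simp only: N.a_ac N.a_inv_closed N.a_closed)
    then show ?thesis using that by (simp add: N.r_neg)
  qed
  have kernel: "keys z \<subseteq> carrier N \<times> B \<and> (\<forall>s\<in>S. h s z = \<zero>\<^bsub>N\<^esub>)"
    using N Bm z(1)
  proof (induction rule: tensor_relations_induct)
    case (relator z)
    then have "keys z \<subseteq> carrier N \<times> B"
      using subsetD[OF bilinear_relators_carrier[OF N Bm]] by simp
    moreover have "h s z = \<zero>\<^bsub>N\<^esub>" if s: "s \<in> S" for s
    proof -
      from relator consider
        (a) x y m where "z = frag_of (x \<oplus>\<^bsub>N\<^esub> y, m) - frag_of (x, m) - frag_of (y, m)"
          "x \<in> carrier N" "y \<in> carrier N" "m \<in> B"
        | (b) x l m where "z = frag_of (x, l \<oplus>\<^bsub>M\<^esub> m) - frag_of (x, l) - frag_of (x, m)"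
          "x \<in> carrier N" "l \<in> B" "m \<in> B"
        | (c) r x m where "z = frag_of (r \<odot>\<^bsub>N\<^esub> x, m) - frag_of (x, r \<odot>\<^bsub>M\<^esub> m)"
          "r \<in> carrier R" "x \<in> carrier N" "m \<in> B"
        unfolding bilinear_relators_def by auto
      then show ?thesis
      proof cases
        case a
        have "h s z = (coord s m \<odot>\<^bsub>N\<^esub> (x \<oplus>\<^bsub>N\<^esub> y)) \<oplus>\<^bsub>N\<^esub> \<ominus>\<^bsub>N\<^esub> (coord s m \<odot>\<^bsub>N\<^esub> x) \<oplus>\<^bsub>N\<^esub> \<ominus>\<^bsub>N\<^esub> (coord s m \<odot>\<^bsub>N\<^esub> y)"
          unfolding a(1) using s a by (simp only: h_diff fr keys_diff_subset h(2) N.a_closed)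
        then show ?thesis
          using a coord(1)[OF s a(4)] by (simp only: N.smult_r_distr cancel N.smult_closed)
      next
        case b
        have "h s z = (coord s (l \<oplus>\<^bsub>M\<^esub> m) \<odot>\<^bsub>N\<^esub> x) \<oplus>\<^bsub>N\<^esub> \<ominus>\<^bsub>N\<^esub> (coord s l \<odot>\<^bsub>N\<^esub> x) \<oplus>\<^bsub>N\<^esub> \<ominus>\<^bsub>N\<^esub> (coord s m \<odot>\<^bsub>N\<^esub> x)"
          unfolding b(1) using s b BD(5)[OF b(3,4)] by (simp only: h_diff fr keys_diff_subset h(2))
        then show ?thesis
          using b coord(1)[OF s] coord(2)[OF s b(3,4)] by (simp only: N.smult_l_distr cancel N.smult_closed)
      next
        case c
        have "h s z = (coord s m \<odot>\<^bsub>N\<^esub> (r \<odot>\<^bsub>N\<^esub> x)) \<oplus>\<^bsub>N\<^esub> \<ominus>\<^bsub>N\<^esub> (coord s (r \<odot>\<^bsub>M\<^esub> m) \<odot>\<^bsub>N\<^esub> x)"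
          unfolding c(1) using s c BD(4)[OF c(2,4)] by (simp only: h_diff fr keys_diff_subset h(2) N.smult_closed)
        also have "coord s m \<odot>\<^bsub>N\<^esub> (r \<odot>\<^bsub>N\<^esub> x) = coord s (r \<odot>\<^bsub>M\<^esub> m) \<odot>\<^bsub>N\<^esub> x"
          using coord(1)[OF s c(4)] coord(3)[OF s c(2,4)] c
          by (simp only: N.smult_assoc1[symmetric] N.R.m_comm)
        finally show ?thesis
          using coord(1)[OF s BD(4)[OF c(2,4)]] c by (simp only: N.r_neg N.smult_closed)
      qed
    qed
    ultimately show ?case by blast
  qed (use h_zero h_add h_minus in \<open>auto simp: N.r_zero dest!: subsetD[OF Poly_Mapping.keys_add]\<close>)
  have frag_fin: "frag_of (x, \<Oplus>\<^bsub>M\<^esub>s\<in>K. c s \<odot>\<^bsub>M\<^esub> e s) - (\<Sum>s\<in>K. frag_of (c s \<odot>\<^bsub>N\<^esub> x, e s)) \<in> ?H \<and>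
      (\<Oplus>\<^bsub>M\<^esub>s\<in>K. c s \<odot>\<^bsub>M\<^esub> e s) \<in> B"
    if x: "x \<in> N'" and "K \<subseteq> S" and c: "\<And>s. s \<in> S \<Longrightarrow> c s \<in> carrier R" for x K c
    using finite_subset[OF \<open>K \<subseteq> S\<close> S(1)] \<open>K \<subseteq> S\<close>
  proof (induction K rule: finite_induct)
    case empty
    then show ?case using H_zero2[OF x] zeroB by simp
  next
    case (insert s K)
    let ?t = "\<Oplus>\<^bsub>M\<^esub>s\<in>K. c s \<odot>\<^bsub>M\<^esub> e s"
    have s: "c s \<in> carrier R" "e s \<in> B" "c s \<odot>\<^bsub>M\<^esub> e s \<in> B" using insert.prems c S(2) BD(4) by auto
    have eq: "(\<Oplus>\<^bsub>M\<^esub>s\<in>insert s K. c s \<odot>\<^bsub>M\<^esub> e s) = c s \<odot>\<^bsub>M\<^esub> e s \<oplus>\<^bsub>M\<^esub> ?t"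
      using insert c S(2) Bsub by (intro M.finsum_insert) (auto intro!: M.smult_closed)
    have IH: "frag_of (x, ?t) - (\<Sum>s\<in>K. frag_of (c s \<odot>\<^bsub>N\<^esub> x, e s)) \<in> ?H" "?t \<in> B"
      using insert by auto
    have "frag_of (x, c s \<odot>\<^bsub>M\<^esub> e s \<oplus>\<^bsub>M\<^esub> ?t) - (\<Sum>s\<in>insert s K. frag_of (c s \<odot>\<^bsub>N\<^esub> x, e s)) =
      (frag_of (x, c s \<odot>\<^bsub>M\<^esub> e s \<oplus>\<^bsub>M\<^esub> ?t) - frag_of (x, c s \<odot>\<^bsub>M\<^esub> e s) - frag_of (x, ?t)) +
      (frag_of (x, ?t) - (\<Sum>s\<in>K. frag_of (c s \<odot>\<^bsub>N\<^esub> x, e s))) -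
      (frag_of (c s \<odot>\<^bsub>N\<^esub> x, e s) - frag_of (x, c s \<odot>\<^bsub>M\<^esub> e s))"
      using insert by simp
    also have "\<dots> \<in> ?H"
      by (intro H(5) H(3) H_add2 IH H_smult s x)
    finally show ?case using BD(5)[OF s(3) IH(2)] unfolding eq by simp
  qed
  have reduce: "(\<forall>s\<in>S. h s y \<in> N') \<and> y - (\<Sum>s\<in>S. frag_of (h s y, e s)) \<in> ?H" if "keys y \<subseteq> N' \<times> B" for y
    using that
  proof (induction rule: free_Abelian_group_induct[consumes 1, case_names zero diff frag])
    case zero
    have "- (\<Sum>s\<in>S. frag_of (h s 0, e s)) \<in> ?H"
      using H_zero S(2) by (intro H(4,7)) (auto simp: h_zero)
    then show ?case using zeroN' by (simp add: h_zero)
  next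
    case (diff x y)
    have k: "keys x \<subseteq> carrier N \<times> B" "keys y \<subseteq> carrier N \<times> B" using diff N'sub by auto
    have hs: "h s (x - y) = h s x \<oplus>\<^bsub>N\<^esub> \<ominus>\<^bsub>N\<^esub> h s y" if "s \<in> S" for s
      by (rule h_diff[OF that k])
    have N'_diff: "h s (x - y) \<in> N'" "h s x = h s (x - y) \<oplus>\<^bsub>N\<^esub> h s y" if "s \<in> S" for s
      using diff that hs h_carrier k N'D(3,5) by (auto simp: N.a_assoc N.l_neg)
    \<comment> \<open>The last sum consists of additivity relators for \<open>h s x\<close> as the
      sum of \<open>h s (x - y)\<close> and \<open>h s y\<close>; writing the difference this way
      avoids relators for negatives.\<close>
    have "x - y - (\<Sum>s\<in>S. frag_of (h s (x - y), e s)) =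
      (x - (\<Sum>s\<in>S. frag_of (h s x, e s))) - (y - (\<Sum>s\<in>S. frag_of (h s y, e s))) +
      (\<Sum>s\<in>S. frag_of (h s (x - y) \<oplus>\<^bsub>N\<^esub> h s y, e s) - frag_of (h s (x - y), e s) - frag_of (h s y, e s))"
      by (simp add: sum_subtractf N'_diff(2)[symmetric])
    also have "\<dots> \<in> ?H"
      using diff N'_diff(1) S(2) by (intro H(3)[OF H(5) H(7)[OF H_add]]) auto
    finally show ?case using N'_diff(1) by blast
  next
    case (frag a)
    obtain x m where a: "a = (x, m)" "x \<in> N'" "m \<in> B" using frag by auto
    have hs: "h s (frag_of a) = coord s m \<odot>\<^bsub>N\<^esub> x" if "s \<in> S" for s
      using h(2)[OF that] a N'sub by auto
    have "frag_of (x, m) - (\<Sum>s\<in>S. frag_of (coord s m \<odot>\<^bsub>N\<^esub> x, e s)) \<in> ?H"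
      using frag_fin[OF a(2) order_refl, of "\<lambda>s. coord s m"] coord(1,4) a(3) by simp
    moreover have "(\<Sum>s\<in>S. frag_of (h s (frag_of a), e s)) = (\<Sum>s\<in>S. frag_of (coord s m \<odot>\<^bsub>N\<^esub> x, e s))"
      by (rule sum.cong) (simp_all add: hs)
    ultimately show ?case using hs N'D(4) coord(1) a by auto
  qed
  have "(\<Sum>s\<in>S. frag_of (h s z, e s)) \<in> ?H"
    using H_zero S(2) kernel by (intro H(7)) auto
  from H(3)[OF conjunct2[OF reduce[OF z(2)]] this] show ?thesis by simp
qed

text \<open>A relation over \<open>N\<close> uses finitely many elements of \<open>M\<close>, which
  lie in one submodule \<open>B\<close> with coordinates. There it restricts to a relation over
  \<open>N'\<close>, which remains one when \<open>B\<close> is enlarged to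
  \<open>M\<close>.\<close>

lemma flat_moduleI:
  fixes R :: "'r ring" and M :: "('r, 'm) module"
  assumes M: "module R M"
    and free: "\<And>A. finite A \<Longrightarrow> A \<subseteq> carrier M \<Longrightarrow>
      \<exists>B (S :: 's set) e coord. A \<subseteq> B \<and> free_coordinates R M B S e coord"
  shows "flat_module R M"
  unfolding flat_module_def
proof (intro conjI allI impI M)
  fix N :: "('r, 'r) module" and N'
  assume NN': "module R N \<and> submodule N' R N"
  then have N: "module R N" and N': "submodule N' R N" by auto
  interpret N: module R N by fact
  interpret N': submodule N' R N by fact
  have N'm: "module R (N\<lparr>carrier := N'\<rparr>)" by (rule N'.submodule_is_module[OF N])
  have N'sub: "N' \<subseteq> carrier N" using N.submoduleE(1)[OF N'] .
  let ?H = "tensor_relations R N M" and ?H' = "tensor_relations R (N\<lparr>carrier := N'\<rparr>) M"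
  note H = tensor_relations_closed[OF N M] and H' = tensor_relations_closed[OF N'm M]
  have sub: "z \<in> ?H" if "z \<in> ?H'" for z
    by (rule tensor_relations_mono[OF N M N'm M _ _ _ _ _ _ that]) (use N'sub in auto)
  have restrict: "z \<in> ?H'" if z: "z \<in> ?H" "keys z \<subseteq> N' \<times> carrier M" for z
  proof -
    obtain A where A: "finite A" "A \<subseteq> carrier M"
      "\<And>B. A \<subseteq> B \<Longrightarrow> submodule B R M \<Longrightarrow> z \<in> tensor_relations R N (M\<lparr>carrier := B\<rparr>)"
      using tensor_relations_finite_support[OF N M z(1)] by blast
    obtain B e coord and S :: "'s set" where AB: "A \<subseteq> B" and fc: "free_coordinates R M B S e coord"
      using free[OF A(1,2)] by blast
    have B: "submodule B R M" using fc by (simp add: free_coordinates_def)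
    have zB: "z \<in> tensor_relations R N (M\<lparr>carrier := B\<rparr>)" by (rule A(3)[OF AB B])
    have Bm: "module R (M\<lparr>carrier := B\<rparr>)" by (rule submodule.submodule_is_module[OF B M])
    have "keys z \<subseteq> carrier N \<times> B" using tensor_relations_closed(6)[OF N Bm zB] by simp
    then have "keys z \<subseteq> N' \<times> B" using z(2) by blast
    from tensor_relations_restrict[OF N M N' fc zB this]
    have "z \<in> tensor_relations R (N\<lparr>carrier := N'\<rparr>) (M\<lparr>carrier := B\<rparr>)" .
    then show ?thesis
      by (rule tensor_relations_mono[OF N'm M N'm Bm, rotated -1])
        (use module.submoduleE(1)[OF M B] in auto)
  qed
  show "inj_on (tensor_inclusion R N M) (carrier (tensor_product R (N\<lparr>carrier := N'\<rparr>) M))"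
  proof (rule inj_onI)
    fix c1 c2
    assume c: "c1 \<in> carrier (tensor_product R (N\<lparr>carrier := N'\<rparr>) M)"
      "c2 \<in> carrier (tensor_product R (N\<lparr>carrier := N'\<rparr>) M)"
      and eq: "tensor_inclusion R N M c1 = tensor_inclusion R N M c2"
    have coset: "\<exists>z. keys z \<subseteq> N' \<times> carrier M \<and> c = {y + z | y. y \<in> ?H'}"
      if c: "c \<in> carrier (tensor_product R (N\<lparr>carrier := N'\<rparr>) M)" for c
    proof -
      obtain z where "keys z \<subseteq> N' \<times> carrier M" "c = (\<Union>y\<in>?H'. {y + z})"
        using c by (auto simp: tensor_product_def FactGroup_def RCOSETS_def r_coset_def)
      then show ?thesis by (intro exI[of _ z]) blast
    qed
    obtain z1 where z1: "keys z1 \<subseteq> N' \<times> carrier M" "c1 = {y + z1 | y. y \<in> ?H'}"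
      using coset[OF c(1)] by blast
    obtain z2 where z2: "keys z2 \<subseteq> N' \<times> carrier M" "c2 = {y + z2 | y. y \<in> ?H'}"
      using coset[OF c(2)] by blast
    note z = z1 z2
    have "z1 \<in> tensor_inclusion R N M c1"
      using H(2) H'(2) unfolding tensor_inclusion_def set_mult_def z(2) by force
    then obtain y y' where y: "y \<in> ?H" "y' \<in> ?H'" "z1 = y + (y' + z2)"
      unfolding eq unfolding tensor_inclusion_def set_mult_def z(4) by force
    have "z1 - z2 \<in> ?H" using H(3)[OF y(1) sub[OF y(2)]] y(3) by (simp add: algebra_simps)
    then have d: "z1 - z2 \<in> ?H'" using z by (intro restrict keys_diff_subset) auto
    have "y + z1 \<in> c2" if "y \<in> ?H'" for y
      unfolding z(4) using H'(3)[OF that d] by (intro CollectI exI[of _ "y + (z1 - z2)"]) simp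
    moreover have "y + z2 \<in> c1" if "y \<in> ?H'" for y
      unfolding z(2) using H'(5)[OF that d] by (intro CollectI exI[of _ "y - (z1 - z2)"]) simp
    ultimately show "c1 = c2" using z by blast
  qed
qed

section \<open>Projective zero sets\<close>

text \<open>\<open>X\<close> consists of vectors and not of lines: projective sets are handled
  through their affine cones.\<close>

definition vanishing :: "'v set \<Rightarrow> ('v \<Rightarrow> complex) set \<Rightarrow> ('v, complex) mpoly set" where
  "vanishing V X = {p \<in> carrier (poly_ring V). \<forall>x\<in>X. poly_eval x p = 0}"

lemma ideal_vanishing: "ideal (vanishing V X) (poly_ring V)"
  unfolding vanishing_def by (rule ideal_poly_subst_zeros[OF comm_ring_hom_id])

lemma Idl_subset_vanishing:
  assumes "\<And>f. f \<in> F \<Longrightarrow> f \<in> carrier (poly_ring V)" "\<And>f x. f \<in> F \<Longrightarrow> x \<in> X \<Longrightarrow> poly_eval x f = 0"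
  shows "Idl\<^bsub>poly_ring V\<^esub> F \<subseteq> vanishing V X"
proof (rule poly_Idl(3))
  show "F \<subseteq> carrier (poly_ring V)" using assms(1) by blast
  show "F \<subseteq> vanishing V X" using assms by (auto simp: vanishing_def)
qed (rule ideal_vanishing)

definition line :: "('v \<Rightarrow> complex) \<Rightarrow> ('v \<Rightarrow> complex) set" where
  "line z = range (\<lambda>c. cscale c z)"

lemma cscale_simps [simp]: "cscale 1 x = x" "cscale c (cscale d x) = cscale (c * d) x" "cscale c 0 = 0" "cscale 0 x = 0"
  by (auto simp: cscale_def fun_eq_iff)

lemma cscale_eq_0_iff: "cscale c x = 0 \<longleftrightarrow> c = 0 \<or> x = 0"
  by (auto simp: cscale_def fun_eq_iff)

lemma line_eq_span: "line z = module.span cscale {z}"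
proof -
  interpret vector_space cscale by (rule vector_space_cscale)
  show ?thesis by (simp add: line_def span_singleton)
qed

lemma self_in_line: "z \<in> line z"
  unfolding line_def by (rule range_eqI[of _ _ 1]) simp

lemma line_cscale: "c \<noteq> 0 \<Longrightarrow> line (cscale c z) = line z"
proof (intro equalityI subsetI)
  fix x assume "c \<noteq> 0" "x \<in> line z"
  then obtain d where "x = cscale d z" by (auto simp: line_def)
  then have "x = cscale (d / c) (cscale c z)" using \<open>c \<noteq> 0\<close> by simp
  then show "x \<in> line (cscale c z)" unfolding line_def by (rule range_eqI)
qed (auto simp: line_def)

lemma line_in_proj_space:
  assumes "z \<in> coord_space V" "z \<noteq> 0"
  shows "line z \<in> proj_space V"
proof -
  interpret vector_space cscale by (rule vector_space_cscale)
  have "independent {z}" using assms(2) by simp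
  then have "dim (line z) = 1" unfolding line_eq_span using dim_span_eq_card_independent by fastforce
  moreover have "subspace (line z)" by (simp add: line_eq_span)
  ultimately show ?thesis using assms(1)
    by (auto simp: proj_space_def subspaces_of_dim_def line_def coord_space_def cscale_def)
qed

lemma proj_space_cases:
  fixes L :: "('v \<Rightarrow> complex) set"
  assumes "L \<in> proj_space V"
  obtains z where "z \<in> coord_space V" "z \<noteq> 0" "L = line z"
proof -
  interpret vector_space cscale by (rule vector_space_cscale)
  obtain z where z: "L = line z" using proj_space_line[OF assms] by (metis line_def)
  have "L \<subseteq> coord_space V" "dim L = 1"
    using assms by (auto simp: proj_space_def subspaces_of_dim_def)
  moreover have "dim (line (0 :: 'v \<Rightarrow> complex)) = 0"
    using dim_span_eq_card_independent[OF independent_empty] by (simp add: line_eq_span)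
  ultimately have "z \<noteq> 0" using z by auto
  then show ?thesis using that[of z] z self_in_line[of z] \<open>L \<subseteq> coord_space V\<close> by auto
qed

lemma line_of_nonzero:
  assumes "L \<in> proj_space V" "x \<in> L" "x \<noteq> 0"
  shows "L = line x"
proof -
  obtain z where z: "L = line z" using proj_space_cases[OF assms(1)] by blast
  then obtain c where "x = cscale c z" using assms(2) by (auto simp: line_def)
  then show ?thesis using z assms(3) line_cscale[of c z] by (auto simp: cscale_eq_0_iff)
qed

lemma in_zero_set_iff: "L \<in> zero_set V F \<longleftrightarrow> L \<in> proj_space V \<and> (\<forall>x\<in>L. \<forall>f\<in>F. poly_eval x f = 0)"
  by (auto simp: zero_set_def)

lemma line_in_zero_set_iff:
  assumes "F \<subseteq> (\<Union>d. forms V d)" "z \<in> coord_space V" "z \<noteq> 0"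
  shows "line z \<in> zero_set V F \<longleftrightarrow> (\<forall>f\<in>F. poly_eval z f = 0)"
proof -
  have "poly_eval (cscale c z) f = 0" if f: "f \<in> F" "poly_eval z f = 0" for c f
  proof -
    obtain d where "f \<in> forms V d" using assms(1) f(1) by blast
    from poly_eval_form[OF this, of c z] show ?thesis using f(2) by simp
  qed
  then have "line z \<in> zero_set V F" if "\<forall>f\<in>F. poly_eval z f = 0"
    using that line_in_proj_space[OF assms(2,3)] by (auto simp: in_zero_set_iff line_def)
  then show ?thesis using self_in_line[of z] by (auto simp: in_zero_set_iff)
qed

lemma openin_zariski:
  "openin (zariski V) U \<longleftrightarrow> (\<exists>F. F \<subseteq> (\<Union>d. forms V d) \<and> U = proj_space V - zero_set V F)"
  unfolding zariski_def by (simp add: topology_inverse'[OF istopology_zariski])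

lemma one_in_forms: "1 \<in> forms V 0"
  by (auto simp: forms_def carrier_poly_ring monom_degree_def)

lemma zero_set_one: "zero_set V {1} = {}"
proof -
  have "L \<notin> zero_set V {1}" for L
  proof
    assume "L \<in> zero_set V {1}"
    then have L: "L \<in> proj_space V" "\<And>x. x \<in> L \<Longrightarrow> poly_eval x 1 = 0"
      by (auto simp: in_zero_set_iff)
    obtain z where "L = line z" using proj_space_cases[OF L(1)] by blast
    then show False using L(2)[of z] self_in_line[of z]
      by (simp add: poly_subst_one[OF comm_ring_hom_id])
  qed
  then show ?thesis by blast
qed

lemma openin_proj_space: "openin (zariski V) (proj_space V)"
  unfolding openin_zariski using one_in_forms[of V] zero_set_one[of V]
  by (intro exI[of _ "{1}"]) auto

lemma topspace_zariski: "topspace (zariski V) = proj_space V"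
proof
  show "topspace (zariski V) \<subseteq> proj_space V"
    using openin_topspace[of "zariski V"] unfolding openin_zariski by blast
  show "proj_space V \<subseteq> topspace (zariski V)"
    by (rule openin_subset[OF openin_proj_space])
qed

lemma closedin_zariski:
  "closedin (zariski V) A \<longleftrightarrow> (\<exists>F. F \<subseteq> (\<Union>d. forms V d) \<and> A = zero_set V F)"
proof -
  have "zero_set V F \<subseteq> proj_space V" for F by (auto simp: zero_set_def)
  then show ?thesis
    unfolding closedin_def topspace_zariski openin_zariski by (metis Diff_Diff_Int Int_absorb1 Diff_subset inf.absorb_iff2)
qed

lemma forms_carrier: "f \<in> forms V d \<Longrightarrow> f \<in> carrier (poly_ring V)"
  by (simp add: forms_def)

lemma single_in_forms: "keys m \<subseteq> V \<Longrightarrow> monom_degree m = d \<Longrightarrow> single m c \<in> forms V d"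
  by (auto simp: forms_def single_in_carrier)

lemma sum_in_forms: "(\<And>i. i \<in> A \<Longrightarrow> f i \<in> forms V d) \<Longrightarrow> (\<Sum>i\<in>A. f i) \<in> forms V d"
  using keys_sum_subset[of f A] by (fastforce simp: forms_def intro: sum_in_carrier)

lemma diff_in_forms:
  fixes p q :: "('v, 'b::comm_ring_1) mpoly"
  shows "p \<in> forms V d \<Longrightarrow> q \<in> forms V d \<Longrightarrow> p - q \<in> forms V d"
  using Poly_Mapping.keys_diff[of p q] by (auto simp: forms_def diff_in_carrier)

section \<open>Charts\<close>

lemma chart_idealD:
  fixes I :: "('v, 'b::comm_ring_1) mpoly set"
  assumes "v \<in> V" "I \<subseteq> carrier (poly_ring V)"
  shows "I \<subseteq> chart_ideal V I v" "Var v - 1 \<in> chart_ideal V I v"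
    and "\<And>Q. ideal Q (poly_ring V) \<Longrightarrow> I \<subseteq> Q \<Longrightarrow> Var v - 1 \<in> Q \<Longrightarrow> chart_ideal V I v \<subseteq> Q"
proof -
  have "(1 :: ('v, 'b) mpoly) \<in> carrier (poly_ring V)" by (auto simp: carrier_poly_ring)
  then have F: "I \<union> {Var v - 1} \<subseteq> carrier (poly_ring V)"
    using assms Var_in_carrier[of v V] diff_in_carrier[of "Var v" V 1] by auto
  show "I \<subseteq> chart_ideal V I v" "Var v - 1 \<in> chart_ideal V I v"
    using poly_Idl(2)[OF F] by (auto simp: chart_ideal_def)
  show "chart_ideal V I v \<subseteq> Q" if "ideal Q (poly_ring V)" "I \<subseteq> Q" "Var v - 1 \<in> Q" for Q
    unfolding chart_ideal_def using that by (intro poly_Idl(3)[OF F]) auto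
qed

text \<open>Powers of \<open>Var v\<close> are 1 modulo the chart ideal, so each monomial can be
  padded with \<open>v\<close> up to degree \<open>d\<close>.\<close>

lemma chart_homogenize:
  fixes I :: "('v, 'b::comm_ring_1) mpoly set"
  assumes v: "v \<in> V" and I: "I \<subseteq> carrier (poly_ring V)" and f: "f \<in> carrier (poly_ring V)"
    and d: "\<And>m. m \<in> keys f \<Longrightarrow> monom_degree m \<le> d"
  shows "\<exists>g\<in>forms V d. f - g \<in> chart_ideal V I v"
proof -
  note Q = poly_idealD[OF ideal_chart[OF v I]]
  have pow: "single (single v j) 1 - 1 \<in> chart_ideal V I v" for j
  proof (induction j)
    case 0
    then show ?case using Q(2) by simp
  next
    case (Suc j)
    have eq: "single (single v (Suc j)) 1 - 1 =
        single (single v j) 1 * (Var v - 1 :: ('v, 'b) mpoly) + (single (single v j) 1 - 1)"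
      by (simp add: Var_def mult_single right_diff_distrib flip: single_add)
    have "single (single v j) 1 * (Var v - 1 :: ('v, 'b) mpoly) \<in> chart_ideal V I v"
      using v by (intro Q(5) chart_idealD(2)[OF v I] single_in_carrier) auto
    then show ?case unfolding eq by (rule Q(3)) (rule Suc)
  qed
  define g where "g = (\<Sum>m\<in>keys f. single (m + single v (d - monom_degree m)) (lookup f m))"
  have "g \<in> forms V d"
    unfolding g_def using f d v
    by (intro sum_in_forms single_in_forms) (auto simp: carrier_poly_ring keys_plus_monom monom_degree_eq split: if_splits)
  moreover have "f - g = (\<Sum>m\<in>keys f. - single m (lookup f m) * (single (single v (d - monom_degree m)) 1 - 1))"
    unfolding g_def by (subst sum_of_singles[of f])
      (simp add: right_diff_distrib mult_single flip: sum_subtractf)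
  moreover have "\<dots> \<in> chart_ideal V I v"
  proof (rule Q(6), rule Q(5)[OF pow])
    fix m assume "m \<in> keys f"
    then show "- single m (lookup f m) \<in> carrier (poly_ring V)"
      using single_in_carrier[of m V "- lookup f m"] f by (auto simp: carrier_poly_ring)
  qed
  ultimately show ?thesis by metis
qed

text \<open>If a power of \<open>f\<close> lies in the chart ideal, then \<open>f\<close> vanishes
  at the points of \<open>X\<close> with coordinate \<open>v\<close> equal to 1. Its homogenization
  \<open>g\<close> is congruent to \<open>f\<close> and to \<open>Var v * g\<close>, and the latter
  vanishes on all of \<open>X\<close>.\<close>

lemma reduced_vanishing:
  fixes X :: "('v \<Rightarrow> complex) set"
  assumes scale: "\<And>c x. x \<in> X \<Longrightarrow> cscale c x \<in> X"
  shows "reduced_subscheme V (vanishing V X)"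
  unfolding reduced_subscheme_def
proof (intro ballI allI impI)
  fix v f and e :: nat
  let ?I = "vanishing V X"
  assume v: "v \<in> V" and f: "f \<in> carrier (poly_ring V)" and e: "f ^ e \<in> chart_ideal V ?I v"
  have I: "?I \<subseteq> carrier (poly_ring V)" by (auto simp: vanishing_def)
  note Q = poly_idealD[OF ideal_chart[OF v I]]
  have "chart_ideal V ?I v \<subseteq> vanishing V {x\<in>X. x v = 1}"
  proof (rule chart_idealD(3)[OF v I ideal_vanishing])
    show "vanishing V X \<subseteq> vanishing V {x\<in>X. x v = 1}" by (auto simp: vanishing_def)
    have "Var v - 1 \<in> carrier (poly_ring V :: ('v, complex) mpoly ring)"
      using Q(1) chart_idealD(2)[OF v I] by blast
    then show "Var v - 1 \<in> vanishing V {x\<in>X. x v = 1}"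
      by (auto simp: vanishing_def poly_eval_diff poly_eval_Var poly_subst_one[OF comm_ring_hom_id])
  qed
  then have zero: "poly_eval x h = 0" if "h \<in> chart_ideal V ?I v" "x \<in> X" "x v = 1" for h x
    using that by (auto simp: vanishing_def)
  define d where "d = (\<Sum>m\<in>keys f. monom_degree m)"
  have "monom_degree m \<le> d" if "m \<in> keys f" for m
    unfolding d_def using that by (intro member_le_sum) auto
  then obtain g where g: "g \<in> forms V d" "f - g \<in> chart_ideal V ?I v"
    using chart_homogenize[OF v I f] by blast
  \<comment> \<open>The factor \<open>Var v\<close> takes care of the points outside the chart, the
    cone property of those inside.\<close>
  have "poly_eval x (Var v * g) = 0" if x: "x \<in> X" for x
  proof (cases "x v = 0")
    case False
    define y where "y = cscale (1 / x v) x"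
    have y: "y \<in> X" "y v = 1" using scale[OF x] False unfolding y_def by (simp, simp add: cscale_def)
    have "poly_eval y f ^ e = 0"
      using zero[OF e y] by (simp add: poly_subst_power[OF comm_ring_hom_id])
    \<comment> \<open>For \<open>e = 0\<close> the previous equation reads \<open>1 = 0\<close>: the
      chart then has no points.\<close>
    then have "poly_eval y f = 0" by (cases "e = 0") auto
    then have "poly_eval y g = 0" using zero[OF g(2) y] by (simp add: poly_eval_diff)
    moreover have "x = cscale (x v) y" using False by (simp add: y_def)
    ultimately have "poly_eval x g = 0" using poly_eval_form[OF g(1)] by (metis mult_zero_right)
    then show ?thesis by (simp add: poly_eval_mult)
  qed (simp add: poly_eval_mult poly_eval_Var)
  then have "Var v * g \<in> ?I"
    using v g(1) by (simp add: vanishing_def poly_ring_mult_closed Var_in_carrier forms_carrier)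
  then have 1: "Var v * g \<in> chart_ideal V ?I v" using chart_idealD(1)[OF v I] by blast
  have 2: "g * (Var v - 1) \<in> chart_ideal V ?I v"
    by (rule Q(5)[OF chart_idealD(2)[OF v I] forms_carrier[OF g(1)]])
  have "f = (f - g) + (Var v * g - g * (Var v - 1))" by (simp add: algebra_simps)
  then show "f \<in> chart_ideal V ?I v" using Q(3)[OF g(2) Q(4)[OF 1 2]] by simp
qed

section \<open>Diagonal isomorphisms\<close>

definition diag :: "('v \<Rightarrow> complex) \<Rightarrow> ('v \<Rightarrow> complex) \<Rightarrow> 'v \<Rightarrow> complex" where
  "diag \<sigma> x = (\<lambda>v. \<sigma> v * x v)"

lemma diag_line: "diag \<sigma> ` line z = line (diag \<sigma> z)"
  by (auto simp: line_def diag_def cscale_def image_iff fun_eq_iff algebra_simps)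

lemma regular_map_diag:
  fixes \<sigma> :: "'v \<Rightarrow> complex"
  assumes \<sigma>: "\<And>v. \<sigma> v \<noteq> 0" and Y: "Y1 \<subseteq> proj_space V" and map: "\<And>L. L \<in> Y1 \<Longrightarrow> diag \<sigma> ` L \<in> Y2"
  shows "regular_map V Y1 V Y2 ((`) (diag \<sigma>))"
  unfolding regular_map_def
proof (intro conjI ballI)
  show "(`) (diag \<sigma>) ` Y1 \<subseteq> Y2" using map by blast
  fix p assume p: "p \<in> Y1"
  define f where "f w = (single (single w 1) (\<sigma> w) :: ('v, complex) mpoly)" for w
  have eval: "poly_eval x (f w) = \<sigma> w * x w" for x w by (simp add: f_def poly_eval_monom)
  have main: "(\<exists>w\<in>V. poly_eval x (f w) \<noteq> 0) \<and>
      diag \<sigma> ` q = module.span cscale {\<lambda>w. if w \<in> V then poly_eval x (f w) else 0}"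
    if q: "q \<in> proj_space V \<inter> Y1" "x \<in> q - {0}" for q x
  proof -
    have x: "q = line x" "x \<noteq> 0" "x \<in> coord_space V"
      using q line_of_nonzero[of q V x] by (auto simp: proj_space_def subspaces_of_dim_def)
    then obtain w where "x w \<noteq> 0" by (auto simp: fun_eq_iff)
    then have "w \<in> V" "poly_eval x (f w) \<noteq> 0" using x(3) \<sigma> by (auto simp: coord_space_def eval)
    moreover have "(\<lambda>w. if w \<in> V then poly_eval x (f w) else 0) = diag \<sigma> x"
      using x(3) by (auto simp: eval diag_def coord_space_def fun_eq_iff)
    ultimately show ?thesis unfolding x(1) diag_line by (auto simp flip: line_eq_span)
  qed
  have f_forms: "\<forall>w\<in>V. f w \<in> forms V 1"
    by (auto simp: f_def monom_degree_eq intro!: single_in_forms split: if_splits)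
  show "\<exists>U f d. openin (zariski V) U \<and> p \<in> U \<and> (\<forall>w\<in>V. f w \<in> forms V d) \<and>
        (\<forall>q\<in>U \<inter> Y1. \<forall>x\<in>q - {0}. (\<exists>w\<in>V. poly_eval x (f w) \<noteq> 0) \<and>
           diag \<sigma> ` q = module.span cscale {\<lambda>w. if w \<in> V then poly_eval x (f w) else 0})"
  proof (intro exI conjI)
    show "openin (zariski V) (proj_space V)" by (rule openin_proj_space)
    show "p \<in> proj_space V" using p Y by blast
    show "\<forall>w\<in>V. f w \<in> forms V 1" by (rule f_forms)
  qed (use main in blast)
qed

lemma isomorphic_diag:
  assumes \<sigma>: "\<And>v. \<sigma> v \<noteq> 0" and Y: "Y1 \<subseteq> proj_space V" "Y2 \<subseteq> proj_space V"
    and "\<And>L. L \<in> Y1 \<Longrightarrow> diag \<sigma> ` L \<in> Y2" "\<And>L. L \<in> Y2 \<Longrightarrow> diag (\<lambda>v. 1 / \<sigma> v) ` L \<in> Y1"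
  shows "isomorphic_varieties V Y1 V Y2"
  unfolding isomorphic_varieties_def
proof (intro exI conjI ballI)
  show "regular_map V Y1 V Y2 ((`) (diag \<sigma>))" "regular_map V Y2 V Y1 ((`) (diag (\<lambda>v. 1 / \<sigma> v)))"
    using assms by (auto intro!: regular_map_diag)
qed (use \<sigma> in \<open>auto simp: image_image diag_def\<close>)

hide_const (open) Finite_Cartesian_Product.mat Finite_Cartesian_Product.row Finite_Cartesian_Product.transpose
  Finite_Cartesian_Product.vec

section \<open>The lattice of Pluecker coordinates\<close>

context
  fixes k n :: nat
begin

lemma plucker_index_nth:
  assumes "a \<in> plucker_index k n"
  shows "length a = k" "\<And>i j. i < j \<Longrightarrow> j < k \<Longrightarrow> a ! i < a ! j" "\<And>i. i < k \<Longrightarrow> 1 \<le> a ! i \<and> a ! i \<le> n"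
    "set a \<subseteq> {1..n}" "distinct a" "sorted a"
proof -
  show l: "length a = k" and s: "set a \<subseteq> {1..n}" using assms by (auto simp: plucker_index_def)
  have sw: "sorted_wrt (<) a" using assms by (simp add: plucker_index_def)
  show "\<And>i j. i < j \<Longrightarrow> j < k \<Longrightarrow> a ! i < a ! j" using sw l by (auto simp: sorted_wrt_iff_nth_less)
  show "\<And>i. i < k \<Longrightarrow> 1 \<le> a ! i \<and> a ! i \<le> n" using s l nth_mem by fastforce
  show "distinct a" "sorted a" using sw by (auto simp: strict_sorted_iff)
qed

lemma plucker_indexI:
  "length a = k \<Longrightarrow> (\<And>i j. i < j \<Longrightarrow> j < k \<Longrightarrow> a ! i < a ! j) \<Longrightarrow> (\<And>i. i < k \<Longrightarrow> 1 \<le> a ! i \<and> a ! i \<le> n)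
    \<Longrightarrow> a \<in> plucker_index k n"
  unfolding plucker_index_def by (force simp: sorted_wrt_iff_nth_less in_set_conv_nth)

lemma finite_plucker_index: "finite (plucker_index k n)"
proof (rule finite_subset)
  show "plucker_index k n \<subseteq> {a. set a \<subseteq> {1..n} \<and> length a = k}" by (auto simp: plucker_index_def)
qed (simp add: finite_lists_length_eq)

lemma plucker_index_lower:
  assumes "a \<in> plucker_index k n"
  shows "i < k \<Longrightarrow> i + 1 \<le> a ! i"
proof (induction i)
  case 0
  then show ?case using plucker_index_nth(3)[OF assms, of 0] by simp
next
  case (Suc i)
  then show ?case using plucker_index_nth(2)[OF assms, of i "Suc i"] by simp
qed

lemma plucker_index_upper:
  assumes "a \<in> plucker_index k n" "i < k"
  shows "a ! i + k \<le> n + i + 1"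
proof -
  have "a ! (k - Suc l) + Suc l \<le> n + 1" if "l < k" for l
    using that
  proof (induction l)
    case 0
    then show ?case using plucker_index_nth(3)[OF assms(1), of "k - 1"] by simp
  next
    case (Suc l)
    then have "a ! (k - Suc (Suc l)) < a ! (k - Suc l)" by (intro plucker_index_nth(2)[OF assms(1)]) linarith+
    then show ?case using Suc by simp
  qed
  from this[of "k - Suc i"] assms(2) show ?thesis by simp
qed

lemma tuple_ideal_subset_iff:
  assumes a: "a \<in> plucker_index k n" and b: "b \<in> plucker_index k n"
  shows "tuple_ideal k n a \<subseteq> tuple_ideal k n b \<longleftrightarrow> (\<forall>i<k. a ! i \<le> b ! i)"
proof
  assume sub: "tuple_ideal k n a \<subseteq> tuple_ideal k n b"
  show "\<forall>i<k. a ! i \<le> b ! i"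
  proof (intro allI impI, rule ccontr)
    fix i assume i: "i < k" and "\<not> a ! i \<le> b ! i"
    then have "b ! i < a ! i" by simp
    moreover have "i + 1 \<le> b ! i" using plucker_index_lower[OF b i] .
    moreover have "a ! i + k \<le> n + i + 1" using plucker_index_upper[OF a i] .
    \<comment> \<open>The last element of row \<open>k - i\<close> in the order ideal of
      \<open>a\<close>. The bounds on the entries place its second component between
      \<open>k + 1\<close> and \<open>n\<close>.\<close>
    ultimately have "(k - i, a ! i + (k - i) - 1) \<in> tuple_ideal k n a"
      "(k - i, a ! i + (k - i) - 1) \<notin> tuple_ideal k n b"
      using i by (auto simp: tuple_ideal_def grass_poset_def)
    then show False using sub by blast
  qed
next
  assume le: "\<forall>i<k. a ! i \<le> b ! i"
  show "tuple_ideal k n a \<subseteq> tuple_ideal k n b"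
  proof
    fix p assume "p \<in> tuple_ideal k n a"
    then obtain i j where p: "p = (i, j)" "(i, j) \<in> grass_poset k n" "j \<le> a ! (k - i) + i - 1"
      by (auto simp: tuple_ideal_def)
    then have "a ! (k - i) \<le> b ! (k - i)" using le by (auto simp: grass_poset_def)
    then show "p \<in> tuple_ideal k n b" using p by (auto simp: tuple_ideal_def)
  qed
qed

lemma inj_tuple_ideal: "inj_on (tuple_ideal k n) (plucker_index k n)"
proof (rule inj_onI)
  fix a b assume *: "a \<in> plucker_index k n" "b \<in> plucker_index k n" "tuple_ideal k n a = tuple_ideal k n b"
  then have "\<forall>i<k. a ! i \<le> b ! i" "\<forall>i<k. b ! i \<le> a ! i"
    using tuple_ideal_subset_iff[of a b] tuple_ideal_subset_iff[of b a] by auto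
  then show "a = b" using *(1,2) by (intro nth_equalityI) (auto simp: plucker_index_nth(1) intro: le_antisym)
qed

lemma map2_min_max_plucker:
  assumes a: "a \<in> plucker_index k n" and b: "b \<in> plucker_index k n"
  shows "map2 min a b \<in> plucker_index k n" "tuple_ideal k n (map2 min a b) = tuple_ideal k n a \<inter> tuple_ideal k n b"
    "map2 max a b \<in> plucker_index k n" "tuple_ideal k n (map2 max a b) = tuple_ideal k n a \<union> tuple_ideal k n b"
proof -
  note la = plucker_index_nth[OF a] and lb = plucker_index_nth[OF b]
  have nth: "map2 min a b ! i = min (a ! i) (b ! i)" "map2 max a b ! i = max (a ! i) (b ! i)" if "i < k" for i
    using that la(1) lb(1) by auto
  show "map2 min a b \<in> plucker_index k n"
  proof (rule plucker_indexI)
    fix i j :: nat assume "i < j" "j < k"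
    then show "map2 min a b ! i < map2 min a b ! j" using la(2)[of i j] lb(2)[of i j] nth by auto
  next
    fix i assume "i < k"
    then show "1 \<le> map2 min a b ! i \<and> map2 min a b ! i \<le> n" using la(3)[of i] lb(3)[of i] nth by auto
  qed (use la(1) lb(1) in auto)
  show "map2 max a b \<in> plucker_index k n"
  proof (rule plucker_indexI)
    fix i j :: nat assume "i < j" "j < k"
    then show "map2 max a b ! i < map2 max a b ! j" using la(2)[of i j] lb(2)[of i j] nth by auto
  next
    fix i assume "i < k"
    then show "1 \<le> map2 max a b ! i \<and> map2 max a b ! i \<le> n" using la(3)[of i] lb(3)[of i] nth by auto
  qed (use la(1) lb(1) in auto)
  have "((i, j) \<in> tuple_ideal k n (map2 min a b) \<longleftrightarrow> (i, j) \<in> tuple_ideal k n a \<inter> tuple_ideal k n b) \<and>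
    ((i, j) \<in> tuple_ideal k n (map2 max a b) \<longleftrightarrow> (i, j) \<in> tuple_ideal k n a \<union> tuple_ideal k n b)" for i j
  proof (cases "(i, j) \<in> grass_poset k n")
    case True
    then have "k - i < k" by (auto simp: grass_poset_def)
    then show ?thesis
      unfolding tuple_ideal_def nth[OF \<open>k - i < k\<close>] mem_Collect_eq prod.case Int_iff Un_iff by (auto simp: nth simp del: nth_map nth_zip)
  qed (simp add: tuple_ideal_def)
  then show "tuple_ideal k n (map2 min a b) = tuple_ideal k n a \<inter> tuple_ideal k n b"
    "tuple_ideal k n (map2 max a b) = tuple_ideal k n a \<union> tuple_ideal k n b"
    by auto
qed

lemma finite_grass_poset: "finite (grass_poset k n)"
  by (simp add: grass_poset_def)

lemma tuple_ideal_subset: "tuple_ideal k n a \<subseteq> grass_poset k n"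
  by (auto simp: tuple_ideal_def)

lemma set_lattice_plucker: "set_lattice (plucker_index k n) (tuple_ideal k n) (map2 min) (map2 max)"
  by unfold_locales
    (use finite_plucker_index inj_tuple_ideal map2_min_max_plucker finite_subset[OF tuple_ideal_subset finite_grass_poset] in auto)

text \<open>An order ideal is a Young diagram with weakly decreasing row lengths \<open>l i\<close>.
  Adding the staircase \<open>i + 1\<close> to the lengths, read from the last row upwards, makes
  them strictly increasing and gives the tuple.\<close>

lemma tuple_ideal_surj:
  assumes kn: "k \<le> n" and J: "J \<in> order_ideals (grass_poset k n) (grass_order k n)"
  shows "J \<in> tuple_ideal k n ` plucker_index k n"
proof -
  define l where "l i = card {j. (i, j) \<in> J}" for i
  have J: "J \<subseteq> grass_poset k n" "\<And>p q. q \<in> J \<Longrightarrow> (p, q) \<in> grass_order k n \<Longrightarrow> p \<in> J"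
    using J by (auto simp: order_ideals_def)
  have fin: "finite {j. (i, j) \<in> J}" for i
    by (rule finite_subset[of _ "{k+1..n}"]) (use J(1) in \<open>auto simp: grass_poset_def\<close>)
  have column: "{j. (i, j) \<in> J} = {k+1..k + l i}" for i
  proof (cases "{j. (i, j) \<in> J} = {}")
    case False
    define M where "M = Max {j. (i, j) \<in> J}"
    have M: "(i, M) \<in> J" using Max_in[OF fin False] by (simp add: M_def)
    have "{j. (i, j) \<in> J} = {k+1..M}"
    proof (intro equalityI subsetI)
      fix j assume "j \<in> {j. (i, j) \<in> J}"
      then show "j \<in> {k+1..M}" using Max_ge[OF fin, of j i] J(1) by (auto simp: M_def grass_poset_def)
    next
      fix j assume "j \<in> {k+1..M}"
      then have "((i, j), (i, M)) \<in> grass_order k n" using M J(1) by (auto simp: grass_order_def grass_poset_def)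
      then show "j \<in> {j. (i, j) \<in> J}" using J(2)[OF M] by simp
    qed
    then have "l i = M - k" "M \<ge> k + 1" using M by (auto simp: l_def)
    then show ?thesis using \<open>_ = {k+1..M}\<close> by simp
  qed (simp add: l_def)
  have mem: "(i, j) \<in> J \<longleftrightarrow> k + 1 \<le> j \<and> j \<le> k + l i" for i j
    using column[of i] by (auto simp: set_eq_iff)
  have bound: "l i \<le> n - k" for i
  proof -
    have "card {j. (i, j) \<in> J} \<le> card {k+1..n}"
      using J(1) by (intro card_mono) (auto simp: grass_poset_def)
    then show ?thesis by (simp add: l_def)
  qed
  have anti: "l i' \<le> l i" if "1 \<le> i" "i \<le> i'" "i' \<le> k" for i i'
  proof -
    have "{j. (i', j) \<in> J} \<subseteq> {j. (i, j) \<in> J}"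
    proof
      fix j assume j: "j \<in> {j. (i', j) \<in> J}"
      then have "((i, j), (i', j)) \<in> grass_order k n" using that J(1) by (auto simp: grass_order_def grass_poset_def)
      then show "j \<in> {j. (i, j) \<in> J}" using J(2) j by blast
    qed
    then show ?thesis unfolding l_def by (intro card_mono fin)
  qed
  define a where "a = map (\<lambda>i. i + 1 + l (k - i)) [0..<k]"
  have a: "a ! i = i + 1 + l (k - i)" if "i < k" for i using that by (simp add: a_def)
  have "a \<in> plucker_index k n"
  proof (rule plucker_indexI)
    fix i j :: nat assume "i < j" "j < k"
    then have "l (k - i) \<le> l (k - j)" by (intro anti) linarith+
    then show "a ! i < a ! j" using \<open>i < j\<close> \<open>j < k\<close> by (simp add: a)
  next
    fix i assume "i < k"
    then show "1 \<le> a ! i \<and> a ! i \<le> n" using bound[of "k - i"] kn by (simp add: a)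
  qed (simp add: a_def)
  moreover have "tuple_ideal k n a = J"
  proof -
    have "(i, j) \<in> tuple_ideal k n a \<longleftrightarrow> (i, j) \<in> J" for i j
    proof (cases "(i, j) \<in> grass_poset k n")
      case True
      then have "k - i < k" "k - (k - i) = i" "k - i + i = k" by (auto simp: grass_poset_def)
      then show ?thesis using True a[of "k - i"] by (auto simp: tuple_ideal_def mem grass_poset_def)
    next
      case False
      then show ?thesis using J(1) by (auto simp: tuple_ideal_def)
    qed
    then show ?thesis by auto
  qed
  ultimately show ?thesis by blast
qed

end

section \<open>Minors\<close>

definition minor :: "nat \<Rightarrow> (nat \<Rightarrow> nat \<Rightarrow> complex) \<Rightarrow> nat list \<Rightarrow> complex" where
  "minor k u c = det (mat k k (\<lambda>(i, j). u i (c ! j)))"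

lemma plucker_vector_eq: "plucker_vector k n u a = (if a \<in> plucker_index k n then minor k u a else 0)"
  by (simp add: plucker_vector_def minor_def)

lemma det_sum: "A \<in> carrier_mat k k \<Longrightarrow> (\<And>i j. i < k \<Longrightarrow> j < k \<Longrightarrow> A $$ (i, j) = f i j) \<Longrightarrow>
  det A = (\<Sum>p | p permutes {0..<k}. signof p * (\<Prod>i = 0..<k. f i (p i)))"
proof -
  assume A: "A \<in> carrier_mat k k" "\<And>i j. i < k \<Longrightarrow> j < k \<Longrightarrow> A $$ (i, j) = f i j"
  have "(\<Prod>i = 0..<k. A $$ (i, p i)) = (\<Prod>i = 0..<k. f i (p i))" if "p permutes {0..<k}" for p
    using permutes_in_image[OF that] by (intro prod.cong refl A(2)) auto
  then show ?thesis unfolding det_def'[OF A(1)] by (intro sum.cong refl) simp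
qed

lemma minor_rows: "minor k u c = (\<Sum>p | p permutes {0..<k}. signof p * (\<Prod>i = 0..<k. u i (c ! p i)))"
  unfolding minor_def by (rule det_sum) auto

lemma minor_columns: "minor k u c = (\<Sum>p | p permutes {0..<k}. signof p * (\<Prod>j = 0..<k. u (p j) (c ! j)))"
proof -
  have "minor k u c = det ((mat k k (\<lambda>(i, j). u i (c ! j)))\<^sup>T)"
    unfolding minor_def by (rule det_transpose[symmetric, of _ k]) simp
  also have "\<dots> = (\<Sum>p | p permutes {0..<k}. signof p * (\<Prod>j = 0..<k. u (p j) (c ! j)))"
    by (rule det_sum) auto
  finally show ?thesis .
qed

lemma minor_not_distinct:
  assumes "length c = k" "\<not> distinct c"
  shows "minor k u c = 0"
proof -
  obtain i j where ij: "i < k" "j < k" "i \<noteq> j" "c ! i = c ! j"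
    using assms by (auto simp: distinct_conv_nth)
  then have "col (mat k k (\<lambda>(i, j). u i (c ! j))) i = col (mat k k (\<lambda>(i, j). u i (c ! j))) j"
    by (intro eq_vecI) auto
  then show ?thesis unfolding minor_def using ij by (intro det_identical_columns[of _ k i j]) auto
qed

lemma minor_swap:
  assumes "length c = k" "length c' = k" "i < k" "j < k" "i \<noteq> j"
    and "\<And>l. l < k \<Longrightarrow> c' ! l = c ! (Transposition.transpose i j l)"
  shows "minor k u c' = - minor k u c"
proof -
  have "mat k k (\<lambda>(r, l). u r (c' ! l)) = swapcols i j (mat k k (\<lambda>(r, l). u r (c ! l)))"
    using assms by (intro eq_matI) (auto simp: mat_swapcols_def transpose_def)
  then show ?thesis unfolding minor_def using assms by (simp add: det_swapcols[of i k j])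
qed

text \<open>For distinct \<open>c\<close> the sign of the sorting permutation, as the determinant of
  the permutation matrix relating \<open>c\<close> to \<open>sort c\<close>. In this form
  \<open>minor_sort\<close> is multiplicativity of the determinant.\<close>

definition sort_sign :: "nat \<Rightarrow> nat list \<Rightarrow> complex" where
  "sort_sign k c = det (mat k k (\<lambda>(i, j). if sort c ! i = c ! j then 1 else 0))"

lemma minor_sort:
  assumes "length c = k" "distinct c"
  shows "minor k u c = sort_sign k c * minor k u (sort c)"
proof -
  let ?A = "mat k k (\<lambda>(i, j). u i (sort c ! j))"
  let ?B = "mat k k (\<lambda>(i, j). if sort c ! i = c ! j then 1 else (0 :: complex))"
  have "mat k k (\<lambda>(i, j). u i (c ! j)) = ?A * ?B"
  proof (rule eq_matI)
    fix i j assume "i < dim_row (?A * ?B)" "j < dim_col (?A * ?B)"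
    then have ij: "i < k" "j < k" by auto
    have "c ! j \<in> set (sort c)" using ij assms by simp
    then obtain l where l: "l < k" "sort c ! l = c ! j" using assms(1) 
      by (metis in_set_conv_nth length_sort)
    have uniq: "sort c ! l' = c ! j \<longleftrightarrow> l' = l" if "l' < k" for l'
      using that l assms nth_eq_iff_index_eq[of "sort c" l' l] by auto
    have "(?A * ?B) $$ (i, j) = (\<Sum>l' = 0..<k. u i (sort c ! l') * (if sort c ! l' = c ! j then 1 else 0))"
      using ij by (simp add: scalar_prod_def)
    also have "\<dots> = (\<Sum>l' = 0..<k. if l' = l then u i (c ! j) else 0)"
      using uniq l(2) by (intro sum.cong) auto
    also have "\<dots> = u i (c ! j)" using l by simp
    finally show "mat k k (\<lambda>(i, j). u i (c ! j)) $$ (i, j) = (?A * ?B) $$ (i, j)" using ij by simp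
  qed auto
  then show ?thesis unfolding minor_def sort_sign_def by (simp add: det_mult[of _ k])
qed

lemma minor_unit:
  assumes "length c = k" "distinct c"
  shows "minor k (\<lambda>i j. if c ! i = j then 1 else 0) c = 1"
proof -
  have "mat k k (\<lambda>(i, j). if c ! i = c ! j then 1 else (0 :: complex)) = 1\<^sub>m k"
    using assms by (intro eq_matI) (auto simp: nth_eq_iff_index_eq)
  then show ?thesis by (simp add: minor_def)
qed

text \<open>Some matrix has minor 1 on the columns \<open>c\<close>, and \<open>sort_sign\<close> is
  a factor of that minor.\<close>

lemma sort_sign_nonzero:
  assumes "length c = k" "distinct c"
  shows "sort_sign k c \<noteq> 0"
  using minor_sort[OF assms, of "\<lambda>i j. if c ! i = j then 1 else 0"] minor_unit[OF assms] by auto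

lemma sort_in_plucker_index:
  assumes "length c = k" "distinct c" "set c \<subseteq> {1..n}"
  shows "sort c \<in> plucker_index k n"
  using assms by (simp add: plucker_index_def strict_sorted_iff)

text \<open>Pluecker coordinates of arbitrary column tuples, alternating in the columns.\<close>

definition hat_var :: "nat \<Rightarrow> nat list \<Rightarrow> (nat list, complex) mpoly" where
  "hat_var k c = (if distinct c then Const (sort_sign k c) * Var (sort c) else 0)"

definition hat :: "nat \<Rightarrow> (nat list \<Rightarrow> complex) \<Rightarrow> nat list \<Rightarrow> complex" where
  "hat k x c = (if distinct c then sort_sign k c * x (sort c) else 0)"

lemma poly_eval_hat_var: "poly_eval x (hat_var k c) = hat k x c"
  by (simp add: hat_var_def hat_def poly_eval_mult poly_eval_Var poly_eval_zero
      poly_subst_Const[OF comm_ring_hom_id])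

lemma hat_plucker_vector:
  assumes "length c = k" "set c \<subseteq> {1..n}"
  shows "hat k (plucker_vector k n u) c = minor k u c"
  using assms minor_sort[OF assms(1)] minor_not_distinct[OF assms(1)]
  by (simp add: hat_def plucker_vector_eq sort_in_plucker_index)

lemma hat_var_forms:
  assumes "length c = k" "set c \<subseteq> {1..n}"
  shows "hat_var k c \<in> forms (plucker_index k n) 1"
proof (cases "distinct c")
  case True
  have "hat_var k c = single (single (sort c) 1) (sort_sign k c)"
    using True by (simp add: hat_var_def Const_def Var_def mult_single)
  then show ?thesis using sort_in_plucker_index[OF assms(1) True assms(2)]
    by (auto simp: monom_degree_eq intro!: single_in_forms split: if_splits)
next
  case False
  then show ?thesis by (auto simp: hat_var_def forms_def carrier_poly_ring)
qed

text \<open>The affine cone over the Grassmannian. The scalar makes it a cone also for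
  \<open>k = 0\<close>, where the only Pluecker vector has the value 1 at \<open>[]\<close>.\<close>

definition grass_cone :: "nat \<Rightarrow> nat \<Rightarrow> (nat list \<Rightarrow> complex) set" where
  "grass_cone k n = {cscale c (plucker_vector k n u) | c u. True}"

lemma form_vanishing_grass_cone:
  assumes "f \<in> forms (plucker_index k n) d" "\<And>u. poly_eval (plucker_vector k n u) f = 0"
  shows "f \<in> vanishing (plucker_index k n) (grass_cone k n)"
  using assms poly_eval_form[OF assms(1)] by (auto simp: vanishing_def grass_cone_def forms_carrier)

subsection \<open>Alternation over \<open>k + 1\<close> columns\<close>

text \<open>With \<open>Suc k\<close> positions and only \<open>k\<close> rows some row repeats, and
  the sum is a determinant with two equal rows. All quadratic relations come from this.\<close>

lemma alternating_rows:
  fixes u :: "nat \<Rightarrow> nat \<Rightarrow> complex"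
  assumes r: "\<And>l. l < Suc k \<Longrightarrow> r l < k"
  shows "(\<Sum>p | p permutes {0..<Suc k}. signof p * (\<Prod>l = 0..<Suc k. u (r l) (x (p l)))) = 0"
proof -
  let ?A = "mat (Suc k) (Suc k) (\<lambda>(l, m). u (r l) (x m))"
  have "\<not> inj_on r {0..<Suc k}"
  proof
    assume "inj_on r {0..<Suc k}"
    then have "card {0..<Suc k} \<le> card {0..<k}" using r by (intro card_inj_on_le[of r]) auto
    then show False by simp
  qed
  then obtain l l' where l: "l < Suc k" "l' < Suc k" "l \<noteq> l'" "r l = r l'" by (auto simp: inj_on_def)
  have "row ?A l = row ?A l'" using l by (intro eq_vecI) auto
  then have "det ?A = 0" using l by (intro det_identical_rows[of ?A "Suc k" l l']) auto
  moreover have "det ?A = (\<Sum>p | p permutes {0..<Suc k}. signof p * (\<Prod>l = 0..<Suc k. u (r l) (x (p l))))"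
    by (rule det_sum) auto
  ultimately show ?thesis by simp
qed

text \<open>The last \<open>k - s\<close> columns of \<open>a\<close> and the first
  \<open>Suc s\<close> of \<open>b\<close>, \<open>Suc k\<close> in all, are permuted by
  \<open>p\<close>. The first \<open>k - s\<close> of the result go back to \<open>a\<close>, the
  others to \<open>b\<close>. These are the exchanges of the Garnir (van der Waerden)
  relations.\<close>

definition shuffle_left :: "nat \<Rightarrow> nat \<Rightarrow> nat list \<Rightarrow> nat list \<Rightarrow> (nat \<Rightarrow> nat) \<Rightarrow> nat list" where
  "shuffle_left k s a b p = take s a @ map (\<lambda>l. (drop s a @ take (Suc s) b) ! p l) [0..<k - s]"

definition shuffle_right :: "nat \<Rightarrow> nat \<Rightarrow> nat list \<Rightarrow> nat list \<Rightarrow> (nat \<Rightarrow> nat) \<Rightarrow> nat list" where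
  "shuffle_right k s a b p = map (\<lambda>l. (drop s a @ take (Suc s) b) ! p l) [k - s..<Suc k] @ drop (Suc s) b"

context
  fixes k s :: nat and a b :: "nat list"
  assumes s: "s < k" and len: "length a = k" "length b = k"
begin

lemma length_shuffle: "length (shuffle_left k s a b p) = k" "length (shuffle_right k s a b p) = k"
  using s len by (simp_all add: shuffle_left_def shuffle_right_def)

lemma set_shuffle:
  assumes "set a \<subseteq> X" "set b \<subseteq> X" "p permutes {0..<Suc k}"
  shows "set (shuffle_left k s a b p) \<subseteq> X" "set (shuffle_right k s a b p) \<subseteq> X"
proof -
  let ?xs = "drop s a @ take (Suc s) b"
  have "length ?xs = Suc k" using s len by simp
  then have "?xs ! p l \<in> set ?xs" if "l < Suc k" for l
    using that permutes_in_image[OF assms(3), of l] nth_mem[of "p l" ?xs] by simp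
  moreover have "set ?xs \<subseteq> X" using assms(1,2) set_drop_subset[of s a] set_take_subset[of "Suc s" b] by auto
  ultimately have "?xs ! p l \<in> X" if "l < Suc k" for l using that by blast
  then show "set (shuffle_left k s a b p) \<subseteq> X" "set (shuffle_right k s a b p) \<subseteq> X"
    using assms(1,2) set_take_subset[of s a] set_drop_subset[of "Suc s" b]
    unfolding shuffle_left_def shuffle_right_def by (auto simp del: upt_Suc nth_append)
qed

lemma shuffle_id: "shuffle_left k s a b id = a" "shuffle_right k s a b id = b"
proof -
  show "shuffle_left k s a b id = a"
    using s len by (intro nth_equalityI) (auto simp: shuffle_left_def nth_append)
  show "shuffle_right k s a b id = b"
    using s len by (intro nth_equalityI) (auto simp: shuffle_right_def nth_append simp del: upt_Suc)
qed

text \<open>Both minors are expanded by columns, with row permutations \<open>q\<close> and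
  \<open>q'\<close>. For fixed \<open>q\<close> and \<open>q'\<close> the unmoved columns factor
  out, and \<open>alternating_rows\<close> kills the alternating sum over the moved ones.\<close>

lemma shuffle_relation:
  "(\<Sum>p | p permutes {0..<Suc k}. signof p *
     (minor k u (shuffle_left k s a b p) * minor k u (shuffle_right k s a b p))) = 0"
proof -
  let ?xs = "drop s a @ take (Suc s) b"
  let ?P = "{p. p permutes {0..<k}}"
  \<comment> \<open>The row that meets the moved column at position \<open>l\<close>: one of the
    left minor for \<open>l < k - s\<close>, one of the right minor otherwise.\<close>
  define r where "r q q' l = (if l < k - s then q (s + l) else q' (l - (k - s)))" for q q' :: "nat \<Rightarrow> nat" and l
  have left: "(\<Prod>j = 0..<k. u (q j) (shuffle_left k s a b p ! j)) =
    (\<Prod>j = 0..<s. u (q j) (a ! j)) * (\<Prod>l = 0..<k - s. u (q (s + l)) (?xs ! p l))" for p q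
  proof -
    have "(\<Prod>j = 0..<k. u (q j) (shuffle_left k s a b p ! j)) =
      (\<Prod>j = 0..<s. u (q j) (shuffle_left k s a b p ! j)) * (\<Prod>j = s..<k. u (q j) (shuffle_left k s a b p ! j))"
      using s by (simp add: prod.atLeastLessThan_concat)
    also have "(\<Prod>j = s..<k. u (q j) (shuffle_left k s a b p ! j)) =
      (\<Prod>l = 0..<k - s. u (q (s + l)) (shuffle_left k s a b p ! (s + l)))"
      using s prod.shift_bounds_nat_ivl[of "\<lambda>j. u (q j) (shuffle_left k s a b p ! j)" 0 s "k - s"]
      by (simp add: add.commute)
    also have "(\<Prod>l = 0..<k - s. u (q (s + l)) (shuffle_left k s a b p ! (s + l))) =
        (\<Prod>l = 0..<k - s. u (q (s + l)) (?xs ! p l))"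
      using s len by (intro prod.cong) (auto simp: shuffle_left_def nth_append)
    also have "(\<Prod>j = 0..<s. u (q j) (shuffle_left k s a b p ! j)) = (\<Prod>j = 0..<s. u (q j) (a ! j))"
      using s len by (intro prod.cong) (auto simp: shuffle_left_def nth_append)
    finally show ?thesis .
  qed
  have right: "(\<Prod>j = 0..<k. u (q j) (shuffle_right k s a b p ! j)) =
    (\<Prod>j = Suc s..<k. u (q j) (b ! j)) * (\<Prod>l = k - s..<Suc k. u (q (l - (k - s))) (?xs ! p l))" for p q
  proof -
    have "(\<Prod>j = 0..<k. u (q j) (shuffle_right k s a b p ! j)) =
      (\<Prod>j = 0..<Suc s. u (q j) (shuffle_right k s a b p ! j)) * (\<Prod>j = Suc s..<k. u (q j) (shuffle_right k s a b p ! j))"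
      using s prod.atLeastLessThan_concat[of 0 "Suc s" k "\<lambda>j. u (q j) (shuffle_right k s a b p ! j)"] by simp
    also have "(\<Prod>j = Suc s..<k. u (q j) (shuffle_right k s a b p ! j)) = (\<Prod>j = Suc s..<k. u (q j) (b ! j))"
      using s len by (intro prod.cong) (auto simp: shuffle_right_def nth_append simp del: upt_Suc)
    also have "(\<Prod>j = 0..<Suc s. u (q j) (shuffle_right k s a b p ! j)) =
       (\<Prod>j = 0..<Suc s. u (q j) (?xs ! p (j + (k - s))))"
      using s len by (intro prod.cong) (auto simp: shuffle_right_def nth_append add.commute simp del: upt_Suc)
    also have "\<dots> = (\<Prod>l = k - s..<Suc k. u (q (l - (k - s))) (?xs ! p l))"
      using s prod.shift_bounds_nat_ivl[of "\<lambda>l. u (q (l - (k - s))) (?xs ! p l)" 0 "k - s" "Suc s"] by simp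
    finally show ?thesis by (simp add: mult.commute)
  qed
  have prod_r: "(\<Prod>l = 0..<Suc k. u (r q q' l) (?xs ! p l)) =
    (\<Prod>l = 0..<k - s. u (q (s + l)) (?xs ! p l)) * (\<Prod>l = k - s..<Suc k. u (q' (l - (k - s))) (?xs ! p l))" for p q q'
  proof -
    have "(\<Prod>l = 0..<Suc k. u (r q q' l) (?xs ! p l)) =
      (\<Prod>l = 0..<k - s. u (r q q' l) (?xs ! p l)) * (\<Prod>l = k - s..<Suc k. u (r q q' l) (?xs ! p l))"
      using s prod.atLeastLessThan_concat[of 0 "k - s" "Suc k" "\<lambda>l. u (r q q' l) (?xs ! p l)"] by simp
    then show ?thesis by (simp add: r_def del: prod.op_ivl_Suc)
  qed
  define c where "c q q' = signof q * signof q' * ((\<Prod>j = 0..<s. u (q j) (a ! j)) * (\<Prod>j = Suc s..<k. u (q' j) (b ! j)))" for q q'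
  have "minor k u (shuffle_left k s a b p) * minor k u (shuffle_right k s a b p) =
    (\<Sum>q\<in>?P. \<Sum>q'\<in>?P. c q q' * (\<Prod>l = 0..<Suc k. u (r q q' l) (?xs ! p l)))" for p
    unfolding minor_columns sum_product left right prod_r c_def
    by (intro sum.cong refl) (simp add: mult_ac del: prod.op_ivl_Suc)
  then have "(\<Sum>p | p permutes {0..<Suc k}. signof p *
     (minor k u (shuffle_left k s a b p) * minor k u (shuffle_right k s a b p))) =
    (\<Sum>p | p permutes {0..<Suc k}. \<Sum>q\<in>?P. \<Sum>q'\<in>?P. c q q' * (signof p * (\<Prod>l = 0..<Suc k. u (r q q' l) (?xs ! p l))))"
    by (simp add: sum_distrib_left mult_ac del: prod.op_ivl_Suc)
  also have "\<dots> = (\<Sum>q\<in>?P. \<Sum>q'\<in>?P. \<Sum>p | p permutes {0..<Suc k}. c q q' * (signof p * (\<Prod>l = 0..<Suc k. u (r q q' l) (?xs ! p l))))"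
    by (subst sum.swap, rule sum.cong[OF refl], rule sum.swap)
  also have "\<dots> = (\<Sum>q\<in>?P. \<Sum>q'\<in>?P. c q q' * (\<Sum>p | p permutes {0..<Suc k}. signof p * (\<Prod>l = 0..<Suc k. u (r q q' l) (?xs ! p l))))"
    by (simp add: sum_distrib_left del: prod.op_ivl_Suc)
  also have "\<dots> = 0"
  proof (intro sum.neutral ballI)
    fix q q' assume "q \<in> ?P" "q' \<in> ?P"
    then have r: "r q q' l < k" if "l < Suc k" for l
      using that s permutes_in_image[of q "{0..<k}" "s + l"] permutes_in_image[of q' "{0..<k}" "l - (k - s)"]
      by (auto simp: r_def)
    show "c q q' * (\<Sum>p | p permutes {0..<Suc k}. signof p * (\<Prod>l = 0..<Suc k. u (r q q' l) (?xs ! p l))) = 0"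
      using alternating_rows[of k "r q q'" u "\<lambda>l. ?xs ! l", OF r] by (simp only: mult_zero_right)
  qed
  finally show ?thesis .
qed

end

definition shuffle_tail :: "nat \<Rightarrow> nat \<Rightarrow> nat list \<Rightarrow> nat list \<Rightarrow> (nat list, complex) mpoly" where
  "shuffle_tail k s a b = (\<Sum>p | p permutes {0..<Suc k} \<and> p ` {0..<k - s} \<noteq> {0..<k - s}.
     Const (signof p) * (hat_var k (shuffle_left k s a b p) * hat_var k (shuffle_right k s a b p)))"

text \<open>The permutations preserving the block \<open>{0..<k - s}\<close> contribute equal terms to
  \<open>shuffle_relation\<close>; the other ones move a column of \<open>b\<close> into \<open>a\<close>.\<close>

context
  fixes k s :: nat and a b :: "nat list"
  assumes s: "s < k" and len: "length a = k" "length b = k"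
begin

lemma shuffle_left_nth:
  "m < k \<Longrightarrow> shuffle_left k s a b p ! m = (if m < s then a ! m else (drop s a @ take (Suc s) b) ! p (m - s))"
  using s len by (simp add: shuffle_left_def nth_append del: append_take_drop_id)

lemma shuffle_right_nth:
  "m < k \<Longrightarrow> shuffle_right k s a b p ! m = (if m \<le> s then (drop s a @ take (Suc s) b) ! p (k - s + m) else b ! m)"
  using s len by (auto simp: shuffle_right_def nth_append simp del: upt_Suc)

text \<open>Swapping two positions of the same block swaps two columns of one minor; its sign
  cancels the sign of the transposition.\<close>

lemma shuffle_term_swap:
  assumes p: "p permutes {0..<Suc k}" and ij: "i \<noteq> j" "i < k - s \<and> j < k - s \<or> i \<in> {k - s..<Suc k} \<and> j \<in> {k - s..<Suc k}"
  shows "signof (p \<circ> Transposition.transpose i j) *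
      (minor k u (shuffle_left k s a b (p \<circ> Transposition.transpose i j)) * minor k u (shuffle_right k s a b (p \<circ> Transposition.transpose i j))) =
    signof p * (minor k u (shuffle_left k s a b p) * minor k u (shuffle_right k s a b p))"
proof -
  let ?t = "Transposition.transpose i j"
  note l = length_shuffle[OF s len]
  have "permutation p" "permutation ?t" using p permutation_permutes by (auto intro: permutation_swap_id)
  then have sgn: "signof (p \<circ> ?t) = - (signof p :: complex)" using ij(1) by (simp add: sign_compose sign_swap_id)
  from ij(2) show ?thesis
  proof
    assume ij': "i < k - s \<and> j < k - s"
    have "shuffle_left k s a b (p \<circ> ?t) ! m = shuffle_left k s a b p ! Transposition.transpose (s + i) (s + j) m" if "m < k" for m
      using that ij' s by (cases "m < s"; cases "m = s + i"; cases "m = s + j") (auto simp: shuffle_left_nth transpose_def)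
    then have 1: "minor k u (shuffle_left k s a b (p \<circ> ?t)) = - minor k u (shuffle_left k s a b p)"
      using ij ij' s l by (intro minor_swap[of _ k _ "s + i" "s + j"]) auto
    have 2: "shuffle_right k s a b (p \<circ> ?t) = shuffle_right k s a b p"
      unfolding shuffle_right_def using ij' by (auto simp: transpose_def simp del: upt_Suc)
    show ?thesis by (simp add: sgn 1 2)
  next
    assume ij': "i \<in> {k - s..<Suc k} \<and> j \<in> {k - s..<Suc k}"
    have "shuffle_right k s a b (p \<circ> ?t) ! m = shuffle_right k s a b p ! Transposition.transpose (i - (k - s)) (j - (k - s)) m" if "m < k" for m
      using that ij' s by (cases "m \<le> s"; cases "m + (k - s) = i"; cases "m + (k - s) = j")
        (auto simp: shuffle_right_nth transpose_def add.commute)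
    then have 1: "minor k u (shuffle_right k s a b (p \<circ> ?t)) = - minor k u (shuffle_right k s a b p)"
      if "i - (k - s) < k" "j - (k - s) < k"
      using ij ij' s l that by (intro minor_swap[of _ k _ "i - (k - s)" "j - (k - s)"]) auto
    have 2: "shuffle_left k s a b (p \<circ> ?t) = shuffle_left k s a b p"
      unfolding shuffle_left_def using ij' by (auto simp: transpose_def)
    have "i - (k - s) < k" "j - (k - s) < k" using ij' s by auto
    then show ?thesis by (simp add: sgn 1 2)
  qed
qed

text \<open>Such a \<open>p\<close> is a permutation of the first block composed with one of the
  second. Both are products of transpositions inside a block, so \<open>shuffle_term_swap\<close>
  leads back to the identity.\<close>

lemma shuffle_term_block:
  assumes p: "p permutes {0..<Suc k}" and block: "p ` {0..<k - s} = {0..<k - s}"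
  shows "signof p * (minor k u (shuffle_left k s a b p) * minor k u (shuffle_right k s a b p)) = minor k u a * minor k u b"
proof -
  define F where "F p = signof p * (minor k u (shuffle_left k s a b p) * minor k u (shuffle_right k s a b p))" for p
  let ?B1 = "{0..<k - s}" and ?B2 = "{k - s..<Suc k}"
  define p1 where "p1 l = (if l < k - s then p l else l)" for l
  define p2 where "p2 l = (if l < k - s then l else p l)" for l
  have inj: "inj p" using permutes_inj[OF p] .
  have block2: "p ` ?B2 = ?B2"
  proof -
    have "?B2 = {0..<Suc k} - ?B1" using s by auto
    then show ?thesis using image_set_diff[OF inj, of "{0..<Suc k}" ?B1] permutes_image[OF p] block by simp
  qed
  have p1: "p1 permutes ?B1"
  proof (rule bij_imp_permutes)
    have "bij_betw p ?B1 ?B1" using block inj by (auto simp: bij_betw_def intro: inj_on_subset)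
    then show "bij_betw p1 ?B1 ?B1" by (rule bij_betw_cong[THEN iffD1, rotated]) (auto simp: p1_def)
  qed (auto simp: p1_def)
  have p2: "p2 permutes ?B2"
  proof (rule bij_imp_permutes)
    have "bij_betw p ?B2 ?B2" using block2 inj by (auto simp: bij_betw_def intro: inj_on_subset)
    then show "bij_betw p2 ?B2 ?B2" by (rule bij_betw_cong[THEN iffD1, rotated]) (auto simp: p2_def)
    show "p2 x = x" if "x \<notin> ?B2" for x
      using that permutes_not_in[OF p, of x] by (auto simp: p2_def)
  qed
  have p_eq: "p = p1 \<circ> p2"
  proof
    fix l show "p l = (p1 \<circ> p2) l"
    proof (cases "l < k - s")
      case False
      then have "\<not> p l < k - s"
        using imageI[of l ?B2 p] unfolding block2 using permutes_not_in[OF p, of l] by (cases "l < Suc k") auto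
      then show ?thesis using False by (simp add: p1_def p2_def)
    qed (simp add: p1_def p2_def)
  qed
  have sub: "q permutes {0..<Suc k}" if "q permutes ?B1 \<or> q permutes ?B2" for q
    using that s by (auto intro: permutes_subset)
  have "F p1 = F id"
    using finite_atLeastLessThan p1
  proof (induction rule: permutes_rev_induct)
    case (swap i j q)
    have "F (q \<circ> Transposition.transpose i j) = F q"
      unfolding F_def by (rule shuffle_term_swap) (use swap sub in auto)
    then show ?case using swap.IH by (rule trans)
  qed simp
  moreover have "F (p1 \<circ> p2) = F p1"
    using finite_atLeastLessThan p2
  proof (induction rule: permutes_rev_induct)
    case (swap i j q)
    have "(p1 \<circ> q) permutes {0..<Suc k}" using sub p1 swap by (intro permutes_compose) auto
    then have "F (p1 \<circ> q \<circ> Transposition.transpose i j) = F (p1 \<circ> q)"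
      unfolding F_def by (rule shuffle_term_swap) (use swap in auto)
    then show ?case using swap.IH unfolding o_assoc by (rule trans)
  qed simp
  ultimately show ?thesis
    using shuffle_id[OF s len] by (simp add: F_def p_eq[symmetric])
qed

text \<open>\<open>N\<close> counts the permutations that preserve the block; it is positive because
  of the identity and can later be inverted in the complex numbers.\<close>

lemma shuffle_relation_vanishing:
  assumes set: "set a \<subseteq> {1..n}" "set b \<subseteq> {1..n}"
  shows "\<exists>N > 0. Const (of_nat N) * (hat_var k a * hat_var k b) + shuffle_tail k s a b \<in>
    vanishing (plucker_index k n) (grass_cone k n) \<inter> forms (plucker_index k n) 2"
proof -
  define K where "K = {p. p permutes {0..<Suc k} \<and> p ` {0..<k - s} = {0..<k - s}}"
  define K' where "K' = {p. p permutes {0..<Suc k} \<and> p ` {0..<k - s} \<noteq> {0..<k - s}}"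
  have fin: "finite {p. p permutes {0..<Suc k}}" by (rule finite_permutations) simp
  then have fins: "finite K" "finite K'" by (auto simp: K_def K'_def intro: rev_finite_subset)
  have split: "{p. p permutes {0..<Suc k}} = K \<union> K'" "K \<inter> K' = {}" by (auto simp: K_def K'_def)
  have "id \<in> K" by (simp add: K_def permutes_id)
  then have N: "card K > 0" using fins by (auto simp: card_gt_0_iff)
  let ?f = "Const (of_nat (card K)) * (hat_var k a * hat_var k b) + shuffle_tail k s a b"
  have hat2: "hat_var k c * hat_var k c' \<in> forms (plucker_index k n) 2"
    if "length c = k" "length c' = k" "set c \<subseteq> {1..n}" "set c' \<subseteq> {1..n}" for c c'
    using forms_mult[OF hat_var_forms hat_var_forms, of c k n c'] that by (simp add: numeral_2_eq_2)
  have Const_forms: "Const c * f \<in> forms V d" if "f \<in> forms V d" for c f and V :: "nat list set" and d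
  proof -
    have "Const c \<in> forms V 0"
      unfolding Const_def by (rule single_in_forms) (simp_all add: monom_degree_eq)
    then show ?thesis using forms_mult[of "Const c" V 0 f d] that by simp
  qed
  have form: "?f \<in> forms (plucker_index k n) 2"
  proof -
    have "hat_var k (shuffle_left k s a b p) * hat_var k (shuffle_right k s a b p) \<in> forms (plucker_index k n) 2"
      if "p permutes {0..<Suc k}" for p
      using that set_shuffle[OF s len set] length_shuffle[OF s len] by (intro hat2) auto
    then have "shuffle_tail k s a b \<in> forms (plucker_index k n) 2"
      unfolding shuffle_tail_def by (intro sum_in_forms Const_forms) auto
    moreover have "Const (of_nat (card K)) * (hat_var k a * hat_var k b) \<in> forms (plucker_index k n) 2"
      using len set by (intro Const_forms hat2)
    \<comment> \<open>A sum of two forms, presented as a sum over a two-element set so that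
      \<open>sum_in_forms\<close> applies.\<close>
    ultimately have "(\<Sum>i\<in>{True, False}. if i then Const (of_nat (card K)) * (hat_var k a * hat_var k b) else shuffle_tail k s a b) \<in> forms (plucker_index k n) 2"
      by (intro sum_in_forms) auto
    then show ?thesis by simp
  qed
  have "poly_eval (plucker_vector k n u) ?f = 0" for u
  proof -
    define F where "F p = signof p * (minor k u (shuffle_left k s a b p) * minor k u (shuffle_right k s a b p))" for p
    have "poly_eval (plucker_vector k n u) (shuffle_tail k s a b) = (\<Sum>p\<in>K'. F p)"
      unfolding shuffle_tail_def K'_def[symmetric] F_def poly_eval_sum
      using set_shuffle[OF s len set] length_shuffle[OF s len]
      by (intro sum.cong refl) (auto simp: poly_eval_mult poly_subst_Const[OF comm_ring_hom_id] poly_eval_hat_var hat_plucker_vector K'_def)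
    moreover have "(\<Sum>p\<in>K. F p) = (\<Sum>p\<in>K. minor k u a * minor k u b)"
      using shuffle_term_block by (intro sum.cong refl) (auto simp: F_def K_def)
    moreover have "(\<Sum>p\<in>K. F p) + (\<Sum>p\<in>K'. F p) = 0"
      using shuffle_relation[OF s len, of u] sum.union_disjoint[OF fins split(2), of F]
      by (simp add: F_def split)
    ultimately show ?thesis
      using len set by (simp add: poly_eval_add poly_eval_mult poly_subst_Const[OF comm_ring_hom_id]
          poly_eval_hat_var hat_plucker_vector)
  qed
  then show ?thesis using form form_vanishing_grass_cone[OF form] N by blast
qed

text \<open>As many columns leave the left factor as enter it. Those that leave are at least
  \<open>a ! s\<close>, those that enter are at most \<open>b ! s\<close>.\<close>

lemma sum_list_shuffle_left_less:
  assumes sorted: "sorted a" "sorted b" and less: "b ! s < a ! s"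
    and p: "p permutes {0..<Suc k}" "p ` {0..<k - s} \<noteq> {0..<k - s}"
  shows "sum_list (shuffle_left k s a b p) < sum_list a"
proof -
  let ?xs = "drop s a @ take (Suc s) b" and ?B = "{0..<k - s}"
  have split: "sum_list (shuffle_left k s a b q) = sum_list (take s a) + (\<Sum>l\<in>?B. ?xs ! q l)" for q
    unfolding shuffle_left_def by (simp add: interv_sum_list_conv_sum_set_nat)
  have inj: "inj_on p A" for A using permutes_inj[OF p(1)] by (rule inj_on_subset) simp
  let ?C = "p ` ?B"
  have card: "card ?C = card ?B" using inj by (rule card_image)
  have fin: "finite ?C" "finite ?B" by auto
  have C: "?C \<subseteq> {0..<Suc k}"
    using permutes_image[OF p(1)] image_mono[of ?B "{0..<Suc k}" p] by force
  have cd: "card (?C - ?B) = card (?B - ?C)"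
    using card card_Diff_subset_Int[of ?C ?B] card_Diff_subset_Int[of ?B ?C] by (simp add: Int_commute)
  have ne: "?B - ?C \<noteq> {}"
  proof
    assume "?B - ?C = {}"
    then show False using card p(2) card_subset_eq[of ?C ?B] by auto
  qed
  have low: "?xs ! m \<le> b ! s" if "m \<in> ?C - ?B" for m
  proof -
    have m: "k - s \<le> m" "m < Suc k" using that C by auto
    then have "?xs ! m = b ! (m - (k - s))" using s len by (simp add: nth_append)
    also have "\<dots> \<le> b ! s" using m s len by (intro sorted_nth_mono[OF sorted(2)]) auto
    finally show ?thesis .
  qed
  have high: "a ! s \<le> ?xs ! m" if "m \<in> ?B - ?C" for m
  proof -
    have "?xs ! m = a ! (s + m)" using that s len by (simp add: nth_append)
    then show ?thesis using that s len sorted_nth_mono[OF sorted(1), of s "s + m"] by auto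
  qed
  have "(\<Sum>m\<in>?C - ?B. ?xs ! m) \<le> card (?C - ?B) * (b ! s)"
    using sum_bounded_above[of "?C - ?B" "\<lambda>m. ?xs ! m" "b ! s"] low by simp
  also have "\<dots> < card (?B - ?C) * (a ! s)" using cd ne less by (simp add: card_gt_0_iff)
  also have "\<dots> \<le> (\<Sum>m\<in>?B - ?C. ?xs ! m)"
    using sum_bounded_below[of "?B - ?C" "a ! s" "\<lambda>m. ?xs ! m"] high by simp
  finally have "(\<Sum>m\<in>?C - ?B. ?xs ! m) < (\<Sum>m\<in>?B - ?C. ?xs ! m)" .
  moreover have "(\<Sum>m\<in>?C. ?xs ! m) = (\<Sum>m\<in>?C \<inter> ?B. ?xs ! m) + (\<Sum>m\<in>?C - ?B. ?xs ! m)"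
    using sum.Int_Diff[OF fin(1)] .
  moreover have "(\<Sum>m\<in>?B. ?xs ! m) = (\<Sum>m\<in>?C \<inter> ?B. ?xs ! m) + (\<Sum>m\<in>?B - ?C. ?xs ! m)"
    using sum.Int_Diff[OF fin(2), of _ ?C] by (simp add: Int_commute)
  moreover have "(\<Sum>l\<in>?B. ?xs ! p l) = (\<Sum>m\<in>?C. ?xs ! m)"
    using sum.reindex[OF inj, of "\<lambda>m. ?xs ! m" ?B] by simp
  ultimately have "(\<Sum>l\<in>?B. ?xs ! p l) < (\<Sum>m\<in>?B. ?xs ! m)" by linarith
  then show ?thesis using split[of p] split[of id] shuffle_id(1)[OF s len] by simp
qed

end

section \<open>Quadratic straightening of products of minors\<close>

context set_lattice
begin

lemma std_polys_Const: "r \<in> std_polys D \<Longrightarrow> Const c * r \<in> std_polys D"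
  using keys_mult[of "Const c" r] unfolding std_polys_def Const_def by (fastforce split: if_splits)

lemma straighten_Const:
  assumes Q: "ideal Q (poly_ring V)" and "\<exists>r\<in>std_polys D. f - r \<in> Q"
  shows "\<exists>r\<in>std_polys D. Const c * f - r \<in> Q"
proof -
  obtain r where r: "r \<in> std_polys D" "f - r \<in> Q" using assms(2) by blast
  have "Const c \<in> carrier (poly_ring V)" unfolding Const_def by (rule single_in_carrier) simp
  then have "Const c * f - Const c * r \<in> Q"
    using poly_idealD(5)[OF Q r(2)] by (simp add: right_diff_distrib)
  then show ?thesis using std_polys_Const[OF r(1)] by blast
qed

end

context
  fixes k n :: nat
begin

interpretation L: set_lattice "plucker_index k n" "tuple_ideal k n" "map2 min" "map2 max"
  by (rule set_lattice_plucker)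

lemma quadratic_straighten_hat:
  assumes "length a = k" "length b = k" "set a \<subseteq> {1..n}" "set b \<subseteq> {1..n}"
  shows "\<exists>r\<in>L.std_polys {2}. hat_var k a * hat_var k b - r \<in> vanishing (plucker_index k n) (grass_cone k n)"
  using assms
proof (induction "sum_list a" arbitrary: a b rule: less_induct)
  case less
  let ?V = "plucker_index k n"
  let ?J = "vanishing ?V (grass_cone k n)"
  note J = ideal_vanishing[of ?V "grass_cone k n"]
  show ?case
  proof (cases "distinct a \<and> distinct b")
    case False
    then have "hat_var k a * hat_var k b = 0" by (auto simp: hat_var_def)
    moreover have "0 \<in> L.std_polys {2}" by (simp add: L.std_polys_def)
    ultimately show ?thesis using poly_idealD(2)[OF J] by (metis diff_self)
  next
    case True
    define a' b' where "a' = sort a" and "b' = sort b"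
    have V: "a' \<in> ?V" "b' \<in> ?V" using less.prems True sort_in_plucker_index by (auto simp: a'_def b'_def)
    note la = plucker_index_nth[OF V(1)] and lb = plucker_index_nth[OF V(2)]
    have sum_a': "sum_list a' = sum_list a"
      unfolding a'_def by (metis mset_sort sum_mset_sum_list)
    have sorted_sort: "sort a' = a'" "sort b' = b'" by (simp_all add: a'_def b'_def sorted_sort_id)
    have hat': "hat_var k a' = Const (sort_sign k a') * Var a'" "hat_var k b' = Const (sort_sign k b') * Var b'"
      using la(5) lb(5) sorted_sort by (simp_all add: hat_var_def)
    have "\<exists>r\<in>L.std_polys {2}. Var a' * Var b' - r \<in> ?J"
    proof (cases "L.comparable a' b'")
      case True
      then have "Var a' * Var b' \<in> L.std_polys {2}"
        using V by (auto simp: L.std_polys_def Var_mult_Var L.std_def keys_plus_monom monom_degree_eq L.comparable_def numeral_2_eq_2)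
      then show ?thesis using poly_idealD(2)[OF J] by (metis diff_self)
    next
      case False
      \<comment> \<open>Incomparability gives a descent in either direction; the one with the larger
        entry in \<open>a'\<close> is the one that lowers the left factor.\<close>
      then obtain s where s: "s < k" "b' ! s < a' ! s"
        using tuple_ideal_subset_iff[OF V] unfolding L.comparable_def by (meson not_le)
      define W where "W = shuffle_tail k s a' b'"
      obtain N where N: "N > 0" "Const (of_nat N) * (hat_var k a' * hat_var k b') + W \<in> ?J"
        using shuffle_relation_vanishing[OF s(1) la(1) lb(1) la(4) lb(4)] by (auto simp: W_def)
      have "\<exists>r\<in>L.std_polys {2}. W - r \<in> ?J"
        unfolding W_def shuffle_tail_def
      proof (intro L.straighten_sum[OF J] L.straighten_Const[OF J])
        fix p assume "p \<in> {p. p permutes {0..<Suc k} \<and> p ` {0..<k - s} \<noteq> {0..<k - s}}"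
        then have p: "p permutes {0..<Suc k}" "p ` {0..<k - s} \<noteq> {0..<k - s}" by auto
        show "\<exists>r\<in>L.std_polys {2}. hat_var k (shuffle_left k s a' b' p) * hat_var k (shuffle_right k s a' b' p) - r \<in> ?J"
          using sum_list_shuffle_left_less[OF s(1) la(1) lb(1) la(6) lb(6) s(2) p]
            length_shuffle[OF s(1) la(1) lb(1)] set_shuffle[OF s(1) la(1) lb(1) la(4) lb(4) p(1)]
          by (intro less.hyps) (auto simp: sum_a')
      qed
      then obtain r where r: "r \<in> L.std_polys {2}" "W - r \<in> ?J" by blast
      define c where "c = of_nat N * sort_sign k a' * sort_sign k b'"
      have c: "c \<noteq> 0" using N(1) sort_sign_nonzero[OF la(1,5)] sort_sign_nonzero[OF lb(1,5)] by (simp add: c_def)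
      have Const_mult: "Const x * Const y = (Const (x * y) :: (nat list, complex) mpoly)" for x y
        by (simp add: Const_def mult_single)
      have inv: "Const (1 / c) * (Const c * f) = f" for f :: "(nat list, complex) mpoly"
        using c by (simp add: Const_mult flip: mult.assoc) (simp add: Const_def)
      have eq: "Const (of_nat N) * (hat_var k a' * hat_var k b') = Const c * (Var a' * Var b')"
        by (simp add: hat' c_def mult_ac flip: Const_mult)
      have "Const c * (Var a' * Var b') + r \<in> ?J"
        using poly_idealD(4)[OF J N(2) r(2)] by (simp add: eq)
      moreover have "Const (1 / c) \<in> carrier (poly_ring ?V)" unfolding Const_def by (rule single_in_carrier) simp
      ultimately have "Const (1 / c) * (Const c * (Var a' * Var b') + r) \<in> ?J" by (intro poly_idealD(5)[OF J])
      also have "Const (1 / c) * (Const c * (Var a' * Var b') + r) = Var a' * Var b' - Const (- 1 / c) * r"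
        by (simp add: distrib_left inv) (simp add: Const_def single_uminus)
      finally show ?thesis using L.std_polys_Const[OF r(1)] by blast
    qed
    from L.straighten_Const[OF J L.straighten_Const[OF J this, of "sort_sign k b"], of "sort_sign k a"]
    have "\<exists>r\<in>L.std_polys {2}. Const (sort_sign k a) * (Const (sort_sign k b) * (Var a' * Var b')) - r \<in> ?J" .
    moreover have "hat_var k a * hat_var k b = Const (sort_sign k a) * (Const (sort_sign k b) * (Var a' * Var b'))"
      using True by (simp only: hat_var_def a'_def b'_def if_True mult_ac)
    ultimately show ?thesis by simp
  qed
qed

lemma quadratic_straighten:
  assumes "a \<in> plucker_index k n" "b \<in> plucker_index k n"
  shows "\<exists>r\<in>L.std_polys {2}. Var a * Var b - r \<in> vanishing (plucker_index k n) (grass_cone k n)"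
proof -
  note la = plucker_index_nth[OF assms(1)] and lb = plucker_index_nth[OF assms(2)]
  note J = ideal_vanishing[of "plucker_index k n" "grass_cone k n"]
  have sort: "sort a = a" "sort b = b" using la(6) lb(6) by (simp_all add: sorted_sort_id)
  define c where "c = 1 / (sort_sign k a * sort_sign k b)"
  have c: "c * (sort_sign k a * sort_sign k b) = 1"
    using sort_sign_nonzero[OF la(1,5)] sort_sign_nonzero[OF lb(1,5)] by (simp add: c_def)
  have "Const c * (hat_var k a * hat_var k b) =
      (Const c * (Const (sort_sign k a) * Const (sort_sign k b))) * (Var a * Var b)"
    using la(5) lb(5) by (simp only: hat_var_def sort if_True mult_ac)
  also have "Const c * (Const (sort_sign k a) * Const (sort_sign k b)) = (1 :: (nat list, complex) mpoly)"
    using c by (simp add: Const_def mult_single)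
  finally have "Const c * (hat_var k a * hat_var k b) = Var a * Var b" by simp
  then show ?thesis
    using L.straighten_Const[OF J quadratic_straighten_hat[OF la(1) lb(1) la(4) lb(4)], of c] by simp
qed

end

section \<open>The Grassmannian as a zero set\<close>

text \<open>Induction on the number of columns of \<open>b\<close> outside \<open>a\<close>.
  Exchanging one such column \<open>b0\<close> against all columns of \<open>a\<close> expresses the
  product of the coordinates \<open>a\<close> and \<open>b\<close> through products of a coordinate
  within one exchange of \<open>a\<close> and one with fewer columns outside \<open>a\<close>.
  Coordinate \<open>a\<close> being 1, this determines coordinate \<open>b\<close>.\<close>

lemma exchange_unique:
  assumes kill: "\<And>f. f \<in> vanishing (plucker_index k n) (grass_cone k n) \<inter> forms (plucker_index k n) 2 \<Longrightarrow>
      poly_eval x f = 0 \<and> poly_eval y f = 0"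
    and a: "a \<in> plucker_index k n" "x a = 1" "y a = 1"
    and near: "\<And>c. c \<in> plucker_index k n \<Longrightarrow> card (set c - set a) \<le> 1 \<Longrightarrow> x c = y c"
    and b: "b \<in> plucker_index k n"
  shows "x b = y b"
  using b
proof (induction "card (set b - set a)" arbitrary: b rule: less_induct)
  case less
  show ?case
  proof (cases "card (set b - set a) \<le> 1")
    case False
    then obtain b0 where b0: "b0 \<in> set b" "b0 \<notin> set a" by (metis DiffE card.empty equals0I zero_le)
    note la = plucker_index_nth[OF a(1)] and lb = plucker_index_nth[OF less.prems]
    define c where "c = remove1 b0 b"
    \<comment> \<open>With \<open>b0\<close> in front, the shuffle at \<open>s = 0\<close> moves
      exactly the columns of \<open>a\<close> and \<open>b0\<close>.\<close>
    define bs where "bs = b0 # c"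
    have k: "0 < k" using b0 lb(1) by (cases b) auto
    have c: "set c = set b - {b0}" "distinct c" "length c = k - 1"
      using b0 lb by (simp_all add: c_def length_remove1)
    have bs: "length bs = k" "set bs = set b" "distinct bs"
      using c b0 k by (auto simp: bs_def)
    have sort_bs: "sort bs = b"
      using bs lb(5,6) by (intro sorted_distinct_set_unique) auto
    have sort_a: "sort a = a" using la(6) by (simp add: sorted_sort_id)
    have bs_sub: "set bs \<subseteq> {1..n}" using bs lb(4) by simp
    define K' where "K' = {p. p permutes {0..<Suc k} \<and> p ` {0..<k - 0} \<noteq> {0..<k - 0}}"
    define summand where "summand z p = signof p * (hat k z (shuffle_left k 0 a bs p) * hat k z (shuffle_right k 0 a bs p))"
      for z :: "nat list \<Rightarrow> complex" and p
    obtain N where N: "N > 0" "Const (of_nat N) * (hat_var k a * hat_var k bs) + shuffle_tail k 0 a bs \<in>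
        vanishing (plucker_index k n) (grass_cone k n) \<inter> forms (plucker_index k n) 2"
      using shuffle_relation_vanishing[OF k la(1) bs(1) la(4) bs_sub] by blast
    have "poly_eval z (Const (of_nat N) * (hat_var k a * hat_var k bs) + shuffle_tail k 0 a bs) =
      of_nat N * (hat k z a * hat k z bs) + (\<Sum>p\<in>K'. summand z p)" for z
      unfolding shuffle_tail_def K'_def[symmetric] term_def
      by (simp add: poly_eval_add poly_eval_mult poly_eval_sum poly_subst_Const[OF comm_ring_hom_id] poly_eval_hat_var)
        (rule sum.cong, simp_all add: summand_def)
    then have rel: "of_nat N * (hat k x a * hat k x bs) + (\<Sum>p\<in>K'. summand x p) = 0"
      "of_nat N * (hat k y a * hat k y bs) + (\<Sum>p\<in>K'. summand y p) = 0"
      using kill[OF N(2)] by metis+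
    have hat_eq: "hat k x d = hat k y d" if "distinct d \<Longrightarrow> x (sort d) = y (sort d)" for d
      using that by (auto simp: hat_def)
    have "summand x p = summand y p" if "p \<in> K'" for p
    proof -
      have p: "p permutes {0..<Suc k}" "p ` {0..<k} \<noteq> {0..<k}" using that by (auto simp: K'_def)
      note len = length_shuffle[OF k la(1) bs(1), of p] and sub = set_shuffle[OF k la(1) bs(1) la(4) bs_sub p(1)]
      \<comment> \<open>Position \<open>k\<close> supplies the first column of the right factor.
        Since \<open>p\<close> does not preserve the block, a column of \<open>a\<close> replaces
        \<open>b0\<close> there.\<close>
      have "p k \<noteq> k"
      proof
        assume pk: "p k = k"
        have "p ` {0..<k} = p ` ({0..<Suc k} - {k})" by (rule arg_cong[of _ _ "(`) p"]) auto
        also have "\<dots> = {0..<Suc k} - {k}"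
          using image_set_diff[OF permutes_inj[OF p(1)], of "{0..<Suc k}" "{k}"] permutes_image[OF p(1)] pk by simp
        also have "\<dots> = {0..<k}" by auto
        finally show False using p(2) by simp
      qed
      then have pk: "p k < k" using permutes_in_image[OF p(1), of k] by simp
      have right: "shuffle_right k 0 a bs p = a ! p k # c"
        using pk la(1) by (simp add: shuffle_right_def bs_def nth_append)
      have "hat k x (shuffle_right k 0 a bs p) = hat k y (shuffle_right k 0 a bs p)"
      proof (rule hat_eq)
        assume d: "distinct (shuffle_right k 0 a bs p)"
        have "set (sort (shuffle_right k 0 a bs p)) - set a = (set b - set a) - {b0}"
          using c(1) nth_mem[of "p k" a] pk la(1) unfolding right set_sort list.set by blast
        moreover have "card ((set b - set a) - {b0}) < card (set b - set a)"
          using b0 by (intro card_Diff1_less) auto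
        ultimately show "x (sort (shuffle_right k 0 a bs p)) = y (sort (shuffle_right k 0 a bs p))"
          using sort_in_plucker_index[OF len(2) d sub(2)] by (intro less.hyps) simp_all
      qed
      moreover have "hat k x (shuffle_left k 0 a bs p) = hat k y (shuffle_left k 0 a bs p)"
      proof (rule hat_eq)
        assume d: "distinct (shuffle_left k 0 a bs p)"
        have "set (shuffle_left k 0 a bs p) \<subseteq> insert b0 (set a)"
        proof -
          have "(a @ [b0]) ! p l \<in> insert b0 (set a)" if "l < k" for l
            using permutes_in_image[OF p(1), of l] that nth_mem[of "p l" "a @ [b0]"] la(1) by auto
          then have "(\<lambda>l. (a @ [b0]) ! p l) ` {0..<k} \<subseteq> insert b0 (set a)"
            by (intro image_subsetI) simp
          then show ?thesis by (simp add: shuffle_left_def bs_def del: nth_append)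
        qed
        then have "set (sort (shuffle_left k 0 a bs p)) - set a \<subseteq> {b0}" by auto
        from card_mono[OF _ this] have "card (set (sort (shuffle_left k 0 a bs p)) - set a) \<le> 1" by simp
        then show "x (sort (shuffle_left k 0 a bs p)) = y (sort (shuffle_left k 0 a bs p))"
          using sort_in_plucker_index[OF len(1) d sub(1)] by (intro near)
      qed
      ultimately show ?thesis by (simp add: summand_def)
    qed
    then have "(\<Sum>p\<in>K'. summand x p) = (\<Sum>p\<in>K'. summand y p)" by (rule sum.cong[OF refl])
    then have "of_nat N * (hat k x a * hat k x bs) = (of_nat N * (hat k y a * hat k y bs) :: complex)"
      using rel by (metis add_right_cancel)
    then show ?thesis
      using N(1) a(2,3) la(5) bs(3) sort_bs sort_a sort_sign_nonzero[OF la(1,5)] sort_sign_nonzero[OF bs(1,3)]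
      by (simp add: hat_def)
  qed (use near less.prems in blast)
qed

text \<open>Cramer's rule for the identity matrix.\<close>

lemma minor_unit_column:
  assumes "length a = k" "i < k" and unit: "\<And>r l. r < k \<Longrightarrow> l < k \<Longrightarrow> u r (a ! l) = (if r = l then 1 else 0)"
  shows "minor k u (a[i := j]) = u i j"
proof -
  let ?x = "Matrix.vec k (\<lambda>r. u r j)"
  have "mat k k (\<lambda>(r, l). u r (a[i := j] ! l)) = replace_col (1\<^sub>m k) (1\<^sub>m k *\<^sub>v ?x) i"
    using assms by (intro eq_matI) (auto simp: replace_col_def nth_list_update)
  moreover have "det (replace_col (1\<^sub>m k) (1\<^sub>m k *\<^sub>v ?x) i) = vec_index ?x i * det (1\<^sub>m k)"
    using assms(2) by (intro cramer_lemma_mat) auto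
  ultimately have "minor k u (a[i := j]) = vec_index ?x i * det (1\<^sub>m k)"
    unfolding minor_def by simp
  then show ?thesis using assms by simp
qed

lemma sort_sign_sorted:
  assumes "length c = k" "distinct c" "sorted c"
  shows "sort_sign k c = 1"
proof -
  have "mat k k (\<lambda>(i, j). if sort c ! i = c ! j then 1 else (0 :: complex)) = 1\<^sub>m k"
    using assms by (intro eq_matI) (auto simp: nth_eq_iff_index_eq sorted_sort_id)
  then show ?thesis by (simp add: sort_sign_def)
qed

text \<open>After scaling a nonzero coordinate \<open>a\<close> to 1, the coordinates one exchange
  away from \<open>a\<close> are the entries of a matrix whose columns \<open>a\<close> form the
  identity. The Pluecker vector of that matrix agrees with the given one there, hence everywhere by
  \<open>exchange_unique\<close>.\<close>

lemma grass_cone_iff: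
  assumes x: "x \<in> coord_space (plucker_index k n)"
    and kill: "\<And>f. f \<in> vanishing (plucker_index k n) (grass_cone k n) \<inter> forms (plucker_index k n) 2 \<Longrightarrow> poly_eval x f = 0"
  shows "x \<in> grass_cone k n"
proof (cases "x = 0")
  case True
  then have "x = cscale 0 (plucker_vector k n (\<lambda>_ _. 0))" by simp
  then show ?thesis unfolding grass_cone_def by blast
next
  case False
  then obtain a where xa: "x a \<noteq> 0" by (auto simp: fun_eq_iff)
  then have a: "a \<in> plucker_index k n" using x by (auto simp: coord_space_def)
  note la = plucker_index_nth[OF a]
  define z where "z = cscale (1 / x a) x"
  have z: "z a = 1" "x = cscale (x a) z" using xa by (simp_all add: z_def) (simp add: cscale_def)
  have sort_a: "sort a = a" using la(6) by (simp add: sorted_sort_id)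
  have hat_a: "hat k z a = 1" using z(1) la(5) sort_a sort_sign_sorted[OF la(1,5,6)] by (simp add: hat_def)
  \<comment> \<open>The entries forced by \<open>minor_unit_column\<close>; \<open>hat\<close>
    accounts for the sign of reordering and gives 0 for a repeated column.\<close>
  define u where "u i j = hat k z (a[i := j])" for i j
  have unit: "u r (a ! l) = (if r = l then 1 else 0)" if "r < k" "l < k" for r l
  proof (cases "r = l")
    case True
    then show ?thesis using hat_a by (simp add: u_def)
  next
    case False
    have "(a[r := a ! l]) ! r = (a[r := a ! l]) ! l" using False that la(1) by simp
    then have "\<not> distinct (a[r := a ! l])"
      using False that la(1) by (metis length_list_update nth_eq_iff_index_eq)
    then show ?thesis using False by (simp add: u_def hat_def)
  qed
  define y where "y = plucker_vector k n u"
  have minor_a: "minor k u a = 1"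
  proof -
    have "mat k k (\<lambda>(i, j). u i (a ! j)) = 1\<^sub>m k" using unit by (intro eq_matI) auto
    then show ?thesis by (simp add: minor_def)
  qed
  have "x b = cscale (x a) y b" for b
  proof (cases "b \<in> plucker_index k n")
    case True
    have "z b = y b"
    proof (rule exchange_unique[where x = z and y = y and a = a, OF _ a z(1) _ _ True])
      show "y a = 1" using minor_a a by (simp add: y_def plucker_vector_eq)
    next
      fix f assume f: "f \<in> vanishing (plucker_index k n) (grass_cone k n) \<inter> forms (plucker_index k n) 2"
      then have "poly_eval z f = 0" using kill[OF f] poly_eval_form[of f _ 2] by (auto simp: z_def)
      moreover have "y \<in> grass_cone k n" unfolding grass_cone_def y_def
        by (intro CollectI exI[of _ 1] exI[of _ u]) simp
      ultimately show "poly_eval z f = 0 \<and> poly_eval y f = 0" using f by (auto simp: vanishing_def)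
    next
      fix c assume c: "c \<in> plucker_index k n" "card (set c - set a) \<le> 1"
      note lc = plucker_index_nth[OF c(1)]
      have card_eq: "card (set c) = card (set a)" using la lc by (simp add: distinct_card)
      show "z c = y c"
      proof (cases "set c \<subseteq> set a")
        case True
        then have "set c = set a" using card_eq by (simp add: card_subset_eq)
        then have "c = a" using la lc by (intro sorted_distinct_set_unique) auto
        then show ?thesis using z(1) minor_a a by (simp add: y_def plucker_vector_eq)
      next
        case False
        then obtain j where j: "set c - set a = {j}" using c(2)
          by (metis Diff_eq_empty_iff One_nat_def card_1_singletonE card_eq_0_iff finite_Diff finite_set le_Suc_eq le_zero_eq)
        have "card (set a - set c) = card (set c - set a)"
          using card_eq card_Diff_subset_Int[of "set a" "set c"] card_Diff_subset_Int[of "set c" "set a"] by (simp add: Int_commute)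
        then have "card (set a - set c) = 1" using j by simp
        then obtain m where m: "set a - set c = {m}" by (rule card_1_singletonE)
        then obtain i where i: "i < k" "a ! i = m" using la(1) by (metis Diff_iff in_set_conv_nth insertI1)
        have set_upd: "set (a[i := j]) = set c"
        proof -
          have "set (a[i := j]) = insert j (set a - {m})"
            using set_update_distinct[OF la(5)] i la(1) by simp
          then show ?thesis using j m by auto
        qed
        have len: "length (a[i := j]) = k" using la(1) by simp
        have dist: "distinct (a[i := j])"
          using set_upd card_eq la(1,5) by (metis card_distinct distinct_card length_list_update)
        have sub: "set (a[i := j]) \<subseteq> {1..n}" using set_upd lc(4) by simp
        have sort_upd: "sort (a[i := j]) = c"
          using set_upd dist lc by (intro sorted_distinct_set_unique) auto
        have "hat k y (a[i := j]) = hat k z (a[i := j])"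
          using hat_plucker_vector[OF len sub, of u] minor_unit_column[OF la(1) i(1) unit, of j]
          by (simp add: y_def u_def)
        then show ?thesis
          using dist sort_upd sort_sign_nonzero[OF len dist] by (simp add: hat_def)
      qed
    qed
    moreover have "x b = cscale (x a) z b" by (rule fun_cong[OF z(2)])
    ultimately show ?thesis by (simp only: cscale_def)
  next
    case False
    then show ?thesis using x by (simp add: coord_space_def cscale_def y_def plucker_vector_eq)
  qed
  then have "x = cscale (x a) (plucker_vector k n u)" unfolding y_def by (rule ext)
  then show ?thesis unfolding grass_cone_def by blast
qed

lemma grass_cone_scale: "x \<in> grass_cone k n \<Longrightarrow> cscale c x \<in> grass_cone k n"
proof -
  assume "x \<in> grass_cone k n"
  then obtain d u where "x = cscale d (plucker_vector k n u)" by (auto simp: grass_cone_def)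
  then have "cscale c x = cscale (c * d) (plucker_vector k n u)" by simp
  then show ?thesis unfolding grass_cone_def by blast
qed

subsection \<open>Subspaces and Pluecker points\<close>

definition independent_rows :: "nat \<Rightarrow> (nat \<Rightarrow> nat \<Rightarrow> complex) \<Rightarrow> bool" where
  "independent_rows k u \<longleftrightarrow> (\<forall>\<alpha>. (\<forall>j. (\<Sum>i<k. \<alpha> i * u i j) = 0) \<longrightarrow> (\<forall>i<k. \<alpha> i = 0))"

lemma minor_dependent_rows:
  assumes "\<And>j. j \<in> set c \<Longrightarrow> (\<Sum>i<k. \<alpha> i * u i j) = 0" "i < k" "\<alpha> i \<noteq> 0" "length c = k"
  shows "minor k u c = 0"
proof -
  let ?A = "mat k k (\<lambda>(i, j). u i (c ! j))" and ?v = "Matrix.vec k \<alpha>"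
  have "?A\<^sup>T *\<^sub>v ?v = 0\<^sub>v k"
  proof (rule eq_vecI)
    fix j assume "j < dim_vec (0\<^sub>v k :: complex Matrix.vec)"
    then have j: "j < k" by simp
    then have "vec_index (?A\<^sup>T *\<^sub>v ?v) j = (\<Sum>i = 0..<k. u i (c ! j) * \<alpha> i)"
      by (simp add: scalar_prod_def)
    also have "\<dots> = (\<Sum>i<k. \<alpha> i * u i (c ! j))" by (simp add: lessThan_atLeast0 mult.commute)
    also have "\<dots> = 0" using assms(1,4) j by simp
    finally show "vec_index (?A\<^sup>T *\<^sub>v ?v) j = vec_index (0\<^sub>v k) j" using j by simp
  qed simp
  moreover have "?v \<noteq> 0\<^sub>v k"
  proof
    assume "?v = 0\<^sub>v k"
    then have "vec_index ?v i = vec_index (0\<^sub>v k) i" by simp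
    then show False using assms(2,3) by simp
  qed
  ultimately have "det (?A\<^sup>T) = 0"
    using det_0_iff_vec_prod_zero_field[of "?A\<^sup>T" k] by (metis mat_carrier transpose_carrier_mat vec_carrier)
  then show ?thesis unfolding minor_def by (simp add: det_transpose[of _ k])
qed

lemma minor_change_rows:
  assumes "\<And>i j. i < k \<Longrightarrow> u' i j = (\<Sum>l<k. A i l * u l j)"
  shows "minor k u' c = det (mat k k (\<lambda>(i, l). A i l)) * minor k u c"
proof -
  have "mat k k (\<lambda>(i, j). u' i (c ! j)) = mat k k (\<lambda>(i, l). A i l) * mat k k (\<lambda>(i, j). u i (c ! j))"
    using assms by (intro eq_matI) (auto simp: scalar_prod_def lessThan_atLeast0)
  then show ?thesis unfolding minor_def by (simp add: det_mult[of _ k])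
qed

text \<open>Induction on the rows: expanding along a new last column \<open>j\<close> gives a linear
  combination of the \<open>u i j\<close> in which row \<open>k\<close> has a nonzero minor as
  coefficient. By independence it cannot vanish for every \<open>j\<close>.\<close>

lemma independent_rows_minor:
  assumes "independent_rows k u" "\<And>i j. i < k \<Longrightarrow> j \<notin> {1..n} \<Longrightarrow> u i j = 0"
  shows "\<exists>c. length c = k \<and> set c \<subseteq> {1..n} \<and> minor k u c \<noteq> 0"
  using assms
proof (induction k)
  case 0
  have "minor 0 u [] = 1" by (simp add: minor_def det_dim_zero)
  then show ?case by (intro exI[of _ "[]"]) simp
next
  case (Suc k)
  have "independent_rows k u"
    unfolding independent_rows_def
  proof (intro allI impI)
    fix \<alpha> i assume *: "\<forall>j. (\<Sum>i<k. \<alpha> i * u i j) = 0" "i < k"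
    have "(if i = k then 0 else \<alpha> i) = 0"
      using Suc.prems(1)[unfolded independent_rows_def, rule_format, of "\<lambda>i. if i = k then 0 else \<alpha> i" i] * by simp
    then show "\<alpha> i = 0" using *(2) by simp
  qed
  then obtain c where c: "length c = k" "set c \<subseteq> {1..n}" "minor k u c \<noteq> 0"
    using Suc.IH Suc.prems(2) by auto
  let ?A = "\<lambda>j. mat (Suc k) (Suc k) (\<lambda>(i, l). u i ((c @ [j]) ! l))"
  \<comment> \<open>Cofactors along the last column do not see that column, so the placeholder
    \<open>0\<close> can stand for \<open>j\<close>.\<close>
  define \<alpha> where "\<alpha> i = cofactor (?A 0) i k" for i
  have expand: "minor (Suc k) u (c @ [j]) = (\<Sum>i<Suc k. \<alpha> i * u i j)" for j
  proof -
    have "mat_delete (?A j) i k = mat_delete (?A 0) i k" for i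
      using c(1) by (intro eq_matI) (auto simp: mat_delete_def nth_append)
    then have "cofactor (?A j) i k = \<alpha> i" for i by (simp add: \<alpha>_def cofactor_def)
    then show ?thesis
      unfolding minor_def using laplace_expansion_column[of "?A j" "Suc k" k] c(1)
      by (simp add: nth_append mult.commute del: sum.lessThan_Suc)
  qed
  have "mat_delete (?A 0) k k = mat k k (\<lambda>(i, l). u i (c ! l))"
    using c(1) by (intro eq_matI) (auto simp: mat_delete_def nth_append)
  then have "\<alpha> k \<noteq> 0" using c(3) by (simp add: \<alpha>_def cofactor_def minor_def)
  then obtain j where j: "(\<Sum>i<Suc k. \<alpha> i * u i j) \<noteq> 0"
    using Suc.prems(1) unfolding independent_rows_def by (metis lessI)
  then have "j \<in> {1..n}" using Suc.prems(2) by (metis (no_types, lifting) lessThan_iff mult_zero_right sum.neutral)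
  then show ?case using j expand[of j] c by (intro exI[of _ "c @ [j]"]) auto
qed

lemma minor_nonzero_plucker_vector:
  assumes "length c = k" "set c \<subseteq> {1..n}" "minor k u c \<noteq> 0"
  shows "plucker_vector k n u \<noteq> 0"
proof
  assume "plucker_vector k n u = 0"
  then have "hat k (plucker_vector k n u) c = 0" by (simp add: hat_def)
  then show False using hat_plucker_vector[OF assms(1,2)] assms(3) by simp
qed

text \<open>Rows that are combinations of the \<open>u l\<close> multiply every minor by the
  determinant of the change of rows.\<close>

lemma plucker_embedding_eq_line:
  assumes U: "module.subspace cscale U" "\<And>i. i < k \<Longrightarrow> u i \<in> U" "plucker_vector k n u \<noteq> 0"
    and gen: "\<And>x. x \<in> U \<Longrightarrow> 0 < k \<Longrightarrow> \<exists>\<alpha>. \<forall>j. x j = (\<Sum>l<k. \<alpha> l * u l j)"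
  shows "plucker_embedding k n U = line (plucker_vector k n u)"
proof -
  interpret vector_space cscale by (rule vector_space_cscale)
  have "{plucker_vector k n u' | u'. \<forall>i<k. u' i \<in> U} \<subseteq> line (plucker_vector k n u)"
  proof clarify
    fix u' assume u': "\<forall>i<k. u' i \<in> U"
    have "\<exists>\<alpha>. \<forall>j. u' i j = (\<Sum>l<k. \<alpha> l * u l j)" if "i < k" for i
      using gen[of "u' i"] u' that by auto
    then obtain A where "\<And>i j. i < k \<Longrightarrow> u' i j = (\<Sum>l<k. A i l * u l j)" by metis
    from minor_change_rows[OF this]
    have "plucker_vector k n u' = cscale (det (mat k k (\<lambda>(i, l). A i l))) (plucker_vector k n u)"
      by (auto simp: plucker_vector_eq cscale_def fun_eq_iff)
    then show "plucker_vector k n u' \<in> line (plucker_vector k n u)" by (auto simp: line_def)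
  qed
  then have "plucker_embedding k n U \<subseteq> line (plucker_vector k n u)"
    unfolding plucker_embedding_def line_eq_span by (intro span_minimal) auto
  moreover have "line (plucker_vector k n u) \<subseteq> plucker_embedding k n U"
    unfolding plucker_embedding_def line_eq_span using U(2) by (intro span_mono) blast
  ultimately show ?thesis by blast
qed

lemma sum_fun_apply: "(\<Sum>i\<in>A. f i) x = (\<Sum>i\<in>A. f i x)"
  by (induction A rule: infinite_finite_induct) auto

text \<open>A basis of a subspace has a nonzero minor, which gives one inclusion. For the other, a
  matrix with nonzero Pluecker vector has independent rows, and their span is the required
  subspace.\<close>

lemma grassmannian_eq: "grassmannian k n = {L \<in> proj_space (plucker_index k n). L \<subseteq> grass_cone k n}"
proof (intro equalityI subsetI)
  interpret vector_space cscale by (rule vector_space_cscale)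
  fix L assume "L \<in> grassmannian k n"
  then obtain U where U: "L = plucker_embedding k n U" "subspace U" "U \<subseteq> coord_space {1..n}" "dim U = k"
    by (auto simp: grassmannian_def subspaces_of_dim_def)
  obtain B where B: "B \<subseteq> U" "independent B" "U \<subseteq> span B" "card B = k"
    using basis_exists[of U] U(4) by metis
  have "\<exists>u. (\<forall>i<k. u i \<in> U) \<and> independent_rows k u \<and>
    (\<forall>x\<in>U. 0 < k \<longrightarrow> (\<exists>\<alpha>. \<forall>j. x j = (\<Sum>l<k. \<alpha> l * u l j)))"
  \<comment> \<open>Finiteness of \<open>B\<close> is read off from \<open>card B = k\<close> being
    positive; for \<open>k = 0\<close> the claims about rows are empty.\<close>
  proof (cases "k = 0")
    case False
    then have finB: "finite B" using B(4) card_gt_0_iff by fastforce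
    obtain u where u: "bij_betw u {..<k} B" using ex_bij_betw_nat_finite[OF finB] B(4) by (auto simp: lessThan_atLeast0)
    define idx where "idx = the_inv_into {..<k} u"
    have idx: "idx (u i) = i" if "i < k" for i
      using that u by (simp add: idx_def bij_betw_def the_inv_into_f_f)
    have comb: "(\<Sum>v\<in>B. cscale (f v) v) j = (\<Sum>l<k. f (u l) * u l j)" for f j
      using sum.reindex_bij_betw[OF u, of "\<lambda>v. cscale (f v) v"]
      by (simp add: sum_fun_apply cscale_def sum.reindex_bij_betw[OF u, of "\<lambda>v. f v * v j"])
    have "independent_rows k u"
      unfolding independent_rows_def
    proof (intro allI impI)
      fix \<alpha> i assume *: "\<forall>j. (\<Sum>i<k. \<alpha> i * u i j) = 0" "i < k"
      have "(\<Sum>v\<in>B. cscale (\<alpha> (idx v)) v) = 0"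
        using * idx by (simp add: fun_eq_iff comb)
      then have "\<alpha> (idx (u i)) = 0"
        using independentD[OF B(2) finB order_refl, of "\<lambda>v. \<alpha> (idx v)" "u i"] bij_betwE[OF u] *(2) by auto
      then show "\<alpha> i = 0" using idx *(2) by simp
    qed
    moreover have "\<exists>\<alpha>. \<forall>j. x j = (\<Sum>l<k. \<alpha> l * u l j)" if xU: "x \<in> U" for x
    proof -
      obtain f where "x = (\<Sum>v\<in>B. cscale (f v) v)" using B(3) xU span_finite[OF finB] by auto
      then show ?thesis using comb by (intro exI[of _ "\<lambda>l. f (u l)"]) simp
    qed
    moreover have "u i \<in> U" if "i < k" for i using bij_betwE[OF u] B(1) that by auto
    ultimately show ?thesis by blast
  qed (auto simp: independent_rows_def)
  then obtain u where u: "\<And>i. i < k \<Longrightarrow> u i \<in> U" "independent_rows k u"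
    "\<And>x. x \<in> U \<Longrightarrow> 0 < k \<Longrightarrow> \<exists>\<alpha>. \<forall>j. x j = (\<Sum>l<k. \<alpha> l * u l j)" by blast
  have "u i j = 0" if "i < k" "j \<notin> {1..n}" for i j using u(1) U(3) that by (force simp: coord_space_def)
  then obtain c where "length c = k" "set c \<subseteq> {1..n}" "minor k u c \<noteq> 0"
    using independent_rows_minor[OF u(2)] by blast
  then have nz: "plucker_vector k n u \<noteq> 0" by (rule minor_nonzero_plucker_vector)
  have L: "L = line (plucker_vector k n u)"
    unfolding U(1) using U(2) u nz by (intro plucker_embedding_eq_line) auto
  have "plucker_vector k n u \<in> coord_space (plucker_index k n)" by (auto simp: coord_space_def plucker_vector_eq)
  then show "L \<in> {L \<in> proj_space (plucker_index k n). L \<subseteq> grass_cone k n}"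
    using line_in_proj_space[OF _ nz] by (auto simp: L line_def grass_cone_def)
next
  interpret vector_space cscale by (rule vector_space_cscale)
  fix L assume "L \<in> {L \<in> proj_space (plucker_index k n). L \<subseteq> grass_cone k n}"
  then have L: "L \<in> proj_space (plucker_index k n)" "L \<subseteq> grass_cone k n" by auto
  obtain z where z: "z \<noteq> 0" "L = line z" using proj_space_cases[OF L(1)] by blast
  then obtain c u0 where cu: "z = cscale c (plucker_vector k n u0)"
    using L(2) self_in_line[of z] by (auto simp: grass_cone_def)
  \<comment> \<open>Clearing the columns outside \<open>{1..n}\<close> puts the rows into the
    coordinate space and leaves the Pluecker coordinates unchanged.\<close>
  define u where "u i j = (if j \<in> {1..n} then u0 i j else 0)" for i j
  have pv: "plucker_vector k n u = plucker_vector k n u0"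
  proof
    fix b
    show "plucker_vector k n u b = plucker_vector k n u0 b"
    proof (cases "b \<in> plucker_index k n")
      case True
      then have "mat k k (\<lambda>(i, j). u i (b ! j)) = mat k k (\<lambda>(i, j). u0 i (b ! j))"
        using plucker_index_nth(3)[OF True] by (intro eq_matI) (auto simp: u_def)
      then show ?thesis by (simp add: plucker_vector_def)
    qed (simp add: plucker_vector_def)
  qed
  have c: "c \<noteq> 0" "plucker_vector k n u \<noteq> 0" using z(1) cu pv by auto
  have Lu: "L = line (plucker_vector k n u)" using z(2) cu c line_cscale pv by simp
  obtain b where b: "b \<in> plucker_index k n" "minor k u b \<noteq> 0"
    using c(2) by (auto simp: fun_eq_iff plucker_vector_eq split: if_splits)
  have indep: "\<alpha> i = 0" if "\<And>j. (\<Sum>i<k. \<alpha> i * u i j) = 0" "i < k" for \<alpha> i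
    using minor_dependent_rows[where c = b and k = k and \<alpha> = \<alpha> and u = u and i = i] that b plucker_index_nth(1)[OF b(1)] by blast
  let ?B = "u ` {..<k}"
  have inj: "inj_on u {..<k}"
  proof (rule inj_onI, rule ccontr)
    fix i j assume ij: "i \<in> {..<k}" "j \<in> {..<k}" "u i = u j" "i \<noteq> j"
    have "(\<Sum>l<k. (if l = i then 1 else if l = j then - 1 else 0) * u l m) =
      (\<Sum>l<k. (if l = i then u i m else 0) + (if l = j then - u j m else 0))" for m
      using ij(4) by (intro sum.cong) auto
    then have "(\<Sum>l<k. (if l = i then 1 else if l = j then - 1 else 0) * u l m) = 0" for m
      using ij by (simp add: sum.distrib)
    from indep[OF this, of i] ij show False by simp
  qed
  have comb: "(\<Sum>v\<in>?B. cscale (f v) v) j = (\<Sum>l<k. f (u l) * u l j)" for f j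
    by (simp add: sum.reindex[OF inj] sum_fun_apply cscale_def)
  have ind: "independent ?B"
  proof (rule independent_if_scalars_zero)
    fix f v assume f: "(\<Sum>v\<in>?B. cscale (f v) v) = 0" "v \<in> ?B"
    then obtain i where i: "i < k" "v = u i" by auto
    have "(\<Sum>l<k. f (u l) * u l j) = 0" for j
      unfolding comb[symmetric] f(1) by simp
    from indep[OF this i(1)] show "f v = 0" by (simp add: i(2))
  qed simp
  have "dim (span ?B) = k" using dim_span_eq_card_independent[OF ind] card_image[OF inj] by simp
  moreover have "?B \<subseteq> coord_space {1..n}" by (auto simp: coord_space_def u_def)
  moreover have "subspace (coord_space {1..n})" by (auto simp: subspace_def coord_space_def cscale_def)
  ultimately have U: "span ?B \<in> subspaces_of_dim k {1..n}"
    unfolding subspaces_of_dim_def using span_minimal[of ?B "coord_space {1..n}"] by auto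
  have "plucker_embedding k n (span ?B) = line (plucker_vector k n u)"
  proof (rule plucker_embedding_eq_line)
    fix x assume "x \<in> span ?B"
    then obtain f where "x = (\<Sum>v\<in>?B. cscale (f v) v)" using span_finite[of ?B] by auto
    then show "\<exists>\<alpha>. \<forall>j. x j = (\<Sum>l<k. \<alpha> l * u l j)"
      using comb by (intro exI[of _ "\<lambda>l. f (u l)"]) simp
  qed (use c in \<open>auto intro: span_base\<close>)
  then show "L \<in> grassmannian k n" unfolding grassmannian_def using U Lu by blast
qed

lemma grassmannian_zero_set:
  "grassmannian k n = zero_set (plucker_index k n)
    (vanishing (plucker_index k n) (grass_cone k n) \<inter> forms (plucker_index k n) 2)"
proof -
  have "L \<subseteq> grass_cone k n \<longleftrightarrow> (\<forall>f\<in>vanishing (plucker_index k n) (grass_cone k n) \<inter> forms (plucker_index k n) 2.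
    \<forall>x\<in>L. poly_eval x f = 0)" if "L \<in> proj_space (plucker_index k n)" for L
  proof -
    have "L \<subseteq> coord_space (plucker_index k n)" using that by (auto simp: proj_space_def subspaces_of_dim_def)
    then have "x \<in> grass_cone k n"
      if "x \<in> L" "\<forall>f\<in>vanishing (plucker_index k n) (grass_cone k n) \<inter> forms (plucker_index k n) 2. poly_eval x f = 0" for x
      using that by (intro grass_cone_iff) auto
    then show ?thesis unfolding vanishing_def by blast
  qed
  then show ?thesis unfolding grassmannian_eq zero_set_def by blast
qed

section \<open>Leading exponents of minors\<close>

text \<open>On the curve \<open>z\<^bsub>i,j\<^esub> = t\<^bsup>e i j\<^esup>\<close> with the lexicographic exponents \<open>e i j\<close> below, the minor of the
  columns \<open>a\<close> is dominated by its diagonal term.\<close>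

context
  fixes k n B :: nat
  assumes B: "2 \<le> B"
begin

interpretation L: set_lattice "plucker_index k n" "tuple_ideal k n" "map2 min" "map2 max"
  by (rule set_lattice_plucker)

definition lex_rank :: "nat \<times> nat \<Rightarrow> nat" where
  "lex_rank = (\<lambda>(i, j). (k - i) * (n + 1) + (n - j))"

text \<open>The summand \<open>1\<close> comes from the scalar \<open>t\<close> in
  \<open>curve\<close>. It occupies position \<open>lex_rank (k, n) = 0\<close>, so in the weight of
  a monomial that digit records the degree.\<close>

definition diag_exponent :: "nat list \<Rightarrow> nat" where
  "diag_exponent a = 1 + (\<Sum>i<k. B ^ lex_rank (i, a ! i))"

text \<open>The digits of \<open>weight diag_exponent m\<close>. Row \<open>k\<close> is fictitious
  and holds the degree in column \<open>n\<close>.\<close>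

definition entry_count :: "(nat list \<Rightarrow>\<^sub>0 nat) \<Rightarrow> nat \<times> nat \<Rightarrow> nat" where
  "entry_count m = (\<lambda>(i, j). if i < k then weight (\<lambda>a. of_bool (a ! i = j)) m
     else if j = n then monom_degree m else 0)"

lemma inj_lex_rank: "inj_on lex_rank ({..k} \<times> {..n})"
proof (rule inj_onI)
  fix x y assume xy: "x \<in> {..k} \<times> {..n}" "y \<in> {..k} \<times> {..n}" "lex_rank x = lex_rank y"
  obtain i j i' j' where eq: "x = (i, j)" "y = (i', j')" by (cases x, cases y)
  have "lex_rank (i, j) div (n + 1) = k - i \<and> lex_rank (i, j) mod (n + 1) = n - j" for i j
    unfolding lex_rank_def prod.case by (simp only: div_mult_self3 mod_mult_self3) simp
  from this[of i j] this[of i' j'] have "k - i = k - i'" "n - j = n - j'" using xy(3) eq by simp_all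
  then show "x = y" using xy(1,2) eq by auto
qed

lemma lex_rank_less:
  assumes "j' \<le> n" "lex_rank (i, j) < lex_rank (i', j')" "i' \<le> k" "i \<le> k"
  shows "i' < i \<or> i' = i \<and> j' < j"
proof (rule ccontr)
  assume "\<not> ?thesis"
  then consider "i < i'" | "i = i'" "j \<le> j'" by linarith
  then show False
  proof cases
    case 1
    then have "Suc (k - i') \<le> k - i" using assms by linarith
    then have "Suc (k - i') * (n + 1) \<le> (k - i) * (n + 1)" by (rule mult_le_mono1)
    moreover have "lex_rank (i', j') < Suc (k - i') * (n + 1)" by (simp add: lex_rank_def)
    moreover have "(k - i) * (n + 1) \<le> lex_rank (i, j)" by (simp add: lex_rank_def)
    ultimately show False using assms(2) by linarith
  next
    case 2
    then show False using assms(2) by (simp add: lex_rank_def)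
  qed
qed

lemma sum_entries: "(\<And>i. i < k \<Longrightarrow> c i \<le> n) \<Longrightarrow>
  (\<Sum>x\<in>{..<k} \<times> {..n}. (case x of (i, j) \<Rightarrow> of_bool (c i = j)) * f x) = (\<Sum>i<k. f (i, c i :: nat) :: nat)"
proof -
  assume c: "\<And>i. i < k \<Longrightarrow> c i \<le> n"
  have "(\<Sum>x\<in>{..<k} \<times> {..n}. (case x of (i, j) \<Rightarrow> of_bool (c i = j)) * f x) =
    (\<Sum>i<k. \<Sum>j\<le>n. of_bool (c i = j) * f (i, j))"
    by (subst sum.cartesian_product) (simp add: case_prod_unfold)
  also have "\<dots> = (\<Sum>i<k. \<Sum>j\<le>n. if j = c i then f (i, j) else 0)"
    by (intro sum.cong refl) auto
  also have "\<dots> = (\<Sum>i<k. f (i, c i))" using c by (intro sum.cong refl) simp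
  finally show ?thesis .
qed

text \<open>At the first row moved by \<open>p\<close>, the permutation picks a later and hence
  larger column, which has a lower digit position; all more significant rows agree.\<close>

lemma diagonal_dominant:
  assumes a: "a \<in> plucker_index k n" and p: "p permutes {0..<k}" "p \<noteq> id"
  shows "(\<Sum>i<k. B ^ lex_rank (i, a ! p i)) < (\<Sum>i<k. B ^ lex_rank (i, a ! i))"
proof -
  note la = plucker_index_nth[OF a]
  obtain i1 where i1: "p i1 \<noteq> i1" using p(2) by (auto simp: fun_eq_iff)
  define i0 where "i0 = (LEAST i. p i \<noteq> i)"
  have i0: "p i0 \<noteq> i0" unfolding i0_def by (rule LeastI[of "\<lambda>i. p i \<noteq> i", OF i1])
  have fixed: "p i = i" if "i < i0" for i
    using not_less_Least[of i "\<lambda>i. p i \<noteq> i"] that unfolding i0_def by blast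
  have i0k: "i0 < k" using i0 permutes_not_in[OF p(1), of i0] by force
  have pi0: "p i0 < k" using permutes_in_image[OF p(1), of i0] i0k by simp
  have "i0 < p i0"
  proof (rule ccontr)
    assume "\<not> i0 < p i0"
    then have "p (p i0) = p i0" using i0 fixed by auto
    then show False using permutes_inj[OF p(1)] i0 by (auto dest: injD)
  qed
  then have less: "a ! i0 < a ! p i0" using la(2) pi0 by blast
  have pk: "p i < k" if "i < k" for i using permutes_in_image[OF p(1), of i] that by simp
  have "(\<Sum>x\<in>{..<k} \<times> {..n}. (case x of (i, j) \<Rightarrow> of_bool (a ! p i = j)) * B ^ lex_rank x) <
    (\<Sum>x\<in>{..<k} \<times> {..n}. (case x of (i, j) \<Rightarrow> of_bool (a ! i = j)) * B ^ lex_rank x)"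
  proof (rule digits_less[where x = "(i0, a ! i0)"])
    show "inj_on lex_rank ({..<k} \<times> {..n})" by (rule inj_on_subset[OF inj_lex_rank]) auto
    show "(i0, a ! i0) \<in> {..<k} \<times> {..n}" using i0k la(3) by auto
    show "(case y of (i, j) \<Rightarrow> of_bool (a ! p i = j)) < B" for y using B by (auto split: prod.split)
    show "(case (i0, a ! i0) of (i, j) \<Rightarrow> of_bool (a ! p i = j)) < (case (i0, a ! i0) of (i, j) \<Rightarrow> (of_bool (a ! i = j) :: nat))"
      using less by simp
    fix y assume y: "y \<in> {..<k} \<times> {..n}" "lex_rank (i0, a ! i0) < lex_rank y"
    obtain i j where ij: "y = (i, j)" "i < k" "j \<le> n" using y(1) by auto
    have "i < i0 \<or> i = i0 \<and> j < a ! i0"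
      using lex_rank_less[of j i0 "a ! i0" i] y(2) ij i0k by simp
    then show "(case y of (i, j) \<Rightarrow> of_bool (a ! p i = j)) = (case y of (i, j) \<Rightarrow> (of_bool (a ! i = j) :: nat))"
      using ij less fixed by auto
  qed simp
  then show ?thesis using sum_entries[of "\<lambda>i. a ! p i"] sum_entries[of "\<lambda>i. a ! i"] la(3) pk by simp
qed

lemma weight_diag_exponent:
  "keys m \<subseteq> plucker_index k n \<Longrightarrow>
    weight diag_exponent m = (\<Sum>x\<in>{..k} \<times> {..n}. entry_count m x * B ^ lex_rank x)"
proof (induction m rule: monom_induct)
  case zero
  show ?case by (auto simp: entry_count_def monom_degree_eq intro!: sum.neutral)
next
  case (plus m a)
  then have a: "a \<in> plucker_index k n" and m: "keys m \<subseteq> plucker_index k n" by (auto simp: keys_plus_monom)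
  have set: "{..k} \<times> {..n} = ({..<k} \<times> {..n}) \<union> ({k} \<times> {..n})" by auto
  have "(\<Sum>x\<in>{..k} \<times> {..n}. entry_count (single a 1) x * B ^ lex_rank x) =
    (\<Sum>x\<in>{..<k} \<times> {..n}. entry_count (single a 1) x * B ^ lex_rank x) + (\<Sum>x\<in>{k} \<times> {..n}. entry_count (single a 1) x * B ^ lex_rank x)"
    unfolding set by (rule sum.union_disjoint) auto
  also have "(\<Sum>x\<in>{..<k} \<times> {..n}. entry_count (single a 1) x * B ^ lex_rank x) =
    (\<Sum>x\<in>{..<k} \<times> {..n}. (case x of (i, j) \<Rightarrow> of_bool (a ! i = j)) * B ^ lex_rank x)"
    by (intro sum.cong refl) (auto simp: entry_count_def)
  also have "\<dots> = (\<Sum>i<k. B ^ lex_rank (i, a ! i))"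
    using plucker_index_nth(3)[OF a] by (intro sum_entries) auto
  also have "(\<Sum>x\<in>{k} \<times> {..n}. entry_count (single a 1) x * B ^ lex_rank x) = (\<Sum>j\<le>n. if j = n then 1 else 0)"
  proof -
    have "{k} \<times> {..n} = Pair k ` {..n}" by auto
    then have "(\<Sum>x\<in>{k} \<times> {..n}. entry_count (single a 1) x * B ^ lex_rank x) =
        (\<Sum>j\<le>n. entry_count (single a 1) (k, j) * B ^ lex_rank (k, j))"
      by (simp add: sum.reindex inj_on_def)
    also have "\<dots> = (\<Sum>j\<le>n. if j = n then 1 else 0)"
      by (intro sum.cong refl) (simp add: entry_count_def lex_rank_def monom_degree_eq)
    finally show ?thesis .
  qed
  finally have "(\<Sum>x\<in>{..k} \<times> {..n}. entry_count (single a 1) x * B ^ lex_rank x) = diag_exponent a"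
    by (simp add: diag_exponent_def)
  moreover have "entry_count (m + single a 1) x = entry_count m x + entry_count (single a 1) x" for x
    by (cases x) (simp add: entry_count_def monom_degree_eq)
  ultimately show ?case using plus.IH[OF m] by (simp add: distrib_right sum.distrib)
qed

lemma entry_count_le: "entry_count m x \<le> monom_degree m"
proof (cases x)
  case (Pair i j)
  have "weight (\<lambda>a. of_bool (a ! i = j)) m \<le> monom_degree m"
    unfolding weight_def monom_degree_def by (rule sum_mono) simp
  then show ?thesis by (simp add: Pair entry_count_def)
qed

text \<open>Membership of \<open>(i, j)\<close> in the order ideal of \<open>a\<close> only asks
  entry \<open>k - i\<close> to be large enough, so multiplicities are partial sums of
  digits.\<close>

lemma multiplicity_entry_count:
  "keys m \<subseteq> plucker_index k n \<Longrightarrow> (i, j) \<in> grass_poset k n \<Longrightarrow>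
    L.multiplicity m (i, j) = (\<Sum>c | c \<le> n \<and> j \<le> c + i - 1. entry_count m (k - i, c))"
proof (induction m rule: monom_induct)
  case zero
  then show ?case by (simp add: L.multiplicity_def entry_count_def grass_poset_def)
next
  case (plus m a)
  then have a: "a \<in> plucker_index k n" and m: "keys m \<subseteq> plucker_index k n" by (auto simp: keys_plus_monom)
  have ki: "k - i < k" using plus.prems(2) by (auto simp: grass_poset_def)
  let ?C = "{c. c \<le> n \<and> j \<le> c + i - 1}"
  have "(\<Sum>c\<in>?C. entry_count (single a 1) (k - i, c)) = (\<Sum>c\<in>?C. if c = a ! (k - i) then 1 else 0)"
    using ki by (intro sum.cong) (auto simp: entry_count_def)
  also have "\<dots> = (if a ! (k - i) \<in> ?C then 1 else 0)"
  proof -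
    have "finite ?C" by (rule finite_subset[of _ "{..n}"]) auto
    then show ?thesis by simp
  qed
  also have "\<dots> = L.multiplicity (single a 1) (i, j)"
    using plucker_index_nth(3)[OF a ki] plus.prems(2) by (simp add: tuple_ideal_def)
  finally have "L.multiplicity (single a 1) (i, j) = (\<Sum>c\<in>?C. entry_count (single a 1) (k - i, c))" ..
  moreover have "entry_count (m + single a 1) x = entry_count m x + entry_count (single a 1) x" for x
    by (cases x) (simp add: entry_count_def monom_degree_eq)
  ultimately show ?case using plus.IH[OF m plus.prems(2)] by (simp add: sum.distrib)
qed

text \<open>In degree below \<open>B\<close> every digit is below \<open>B\<close>, so the weight
  determines the digits, these determine degree and multiplicities, and \<open>std_unique\<close>
  applies.\<close>

lemma inj_diag_exponent: "inj_on (weight diag_exponent) {m. L.std m \<and> monom_degree m < B}"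
proof (rule inj_onI)
  fix m m' assume m: "m \<in> {m. L.std m \<and> monom_degree m < B}" "m' \<in> {m. L.std m \<and> monom_degree m < B}"
    and eq: "weight diag_exponent m = weight diag_exponent m'"
  have sub: "keys m \<subseteq> plucker_index k n" "keys m' \<subseteq> plucker_index k n" using m by (auto simp: L.std_def)
  have count: "entry_count m x = entry_count m' x" if "x \<in> {..k} \<times> {..n}" for x
  proof (rule digits_inj[OF _ inj_lex_rank _ _ _ that])
    show "(\<Sum>x\<in>{..k} \<times> {..n}. entry_count m x * B ^ lex_rank x) = (\<Sum>x\<in>{..k} \<times> {..n}. entry_count m' x * B ^ lex_rank x)"
      using eq weight_diag_exponent sub by simp
  qed (use m entry_count_le in \<open>auto intro: le_less_trans\<close>)
  show "m = m'"
  proof (rule L.std_unique)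
    show "monom_degree m = monom_degree m'" using count[of "(k, n)"] by (simp add: entry_count_def)
    fix p
    show "L.multiplicity m p = L.multiplicity m' p"
    proof (cases "p \<in> grass_poset k n")
      case True
      obtain i j where p: "p = (i, j)" by (cases p)
      show ?thesis using True count unfolding p
        by (subst (1 2) multiplicity_entry_count) (use sub in \<open>auto intro!: sum.cong\<close>)
    next
      case False
      then have "\<not> 0 < L.multiplicity m'' p" for m''
        using tuple_ideal_subset unfolding L.multiplicity_pos_iff by blast
      then show ?thesis by simp
    qed
  qed (use m in auto)
qed

definition minor_poly :: "nat list \<Rightarrow> complex poly" where
  "minor_poly a = monom 1 1 * (\<Sum>p | p permutes {0..<k}. monom (signof p) (\<Sum>i<k. B ^ lex_rank (i, a ! p i)))"

definition curve :: "complex \<Rightarrow> nat list \<Rightarrow> complex" where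
  "curve t = cscale t (plucker_vector k n (\<lambda>i j. t ^ (B ^ lex_rank (i, j))))"

lemma curve_in_grass_cone: "curve t \<in> grass_cone k n"
  unfolding curve_def grass_cone_def by blast

lemma poly_minor_poly: "a \<in> plucker_index k n \<Longrightarrow> poly (minor_poly a) t = curve t a"
  by (simp add: minor_poly_def curve_def cscale_def plucker_vector_eq minor_rows poly_monom poly_sum
      power_sum lessThan_atLeast0)

text \<open>By \<open>diagonal_dominant\<close> only the identity permutation attains the top
  degree, and its sign is 1.\<close>

lemma minor_poly_monic:
  assumes a: "a \<in> plucker_index k n"
  shows "Polynomial.degree (minor_poly a) = diag_exponent a" "lead_coeff (minor_poly a) = 1"
proof -
  define e where "e p = (\<Sum>i<k. B ^ lex_rank (i, a ! p i))" for p
  let ?q = "\<Sum>p | p permutes {0..<k}. monom (signof p :: complex) (e p)"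
  have fin: "finite {p. p permutes {0..<k}}" by (rule finite_permutations) simp
  have coeff: "Polynomial.coeff ?q d = (\<Sum>p | p permutes {0..<k}. if e p = d then signof p else 0)" for d
    by (simp add: coeff_sum)
  have less: "e p < e id" if "p permutes {0..<k}" "p \<noteq> id" for p
    using diagonal_dominant[OF a that] by (simp add: e_def)
  have "Polynomial.coeff ?q (e id) = (\<Sum>p | p permutes {0..<k}. if p = id then 1 else 0)"
    unfolding coeff using less by (intro sum.cong) (auto simp: less_le)
  then have top: "Polynomial.coeff ?q (e id) = 1" using fin by (simp add: permutes_id)
  have "Polynomial.coeff ?q d = 0" if "e id < d" for d
    unfolding coeff using less that by (intro sum.neutral) (auto, metis less_asym)
  then have "Polynomial.degree ?q \<le> e id" by (intro degree_le) auto
  then have deg: "Polynomial.degree ?q = e id" using top by (intro antisym le_degree) auto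
  then have lead: "lead_coeff ?q = 1" "?q \<noteq> 0" using top by auto
  have eq: "minor_poly a = monom 1 1 * ?q" by (simp add: minor_poly_def e_def)
  show "Polynomial.degree (minor_poly a) = diag_exponent a"
    unfolding eq using lead(2) deg by (subst degree_mult_eq) (auto simp: degree_monom_eq diag_exponent_def e_def)
  show "lead_coeff (minor_poly a) = 1"
    unfolding eq lead_coeff_mult lead(1) by (simp add: degree_monom_eq)
qed

lemma meval_minor_poly_monic:
  "keys m \<subseteq> plucker_index k n \<Longrightarrow>
    Polynomial.degree (meval minor_poly m) = weight diag_exponent m \<and> lead_coeff (meval minor_poly m) = 1"
proof (induction m rule: monom_induct)
  case (plus m a)
  then have a: "a \<in> plucker_index k n" and m: "keys m \<subseteq> plucker_index k n" by (auto simp: keys_plus_monom)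
  have "meval minor_poly m \<noteq> 0" "minor_poly a \<noteq> 0"
    using plus.IH[OF m] minor_poly_monic[OF a] by auto
  then have "Polynomial.degree (meval minor_poly m * minor_poly a) = weight diag_exponent m + diag_exponent a"
    using plus.IH[OF m] minor_poly_monic(1)[OF a] by (simp add: degree_mult_eq)
  moreover have "lead_coeff (meval minor_poly m * minor_poly a) = 1"
    unfolding lead_coeff_mult using plus.IH[OF m] minor_poly_monic(2)[OF a] by (metis mult_1)
  ultimately show ?case by simp
qed simp

definition curve_poly :: "(nat list, complex) mpoly \<Rightarrow> complex poly" where
  "curve_poly f = (\<Sum>m\<in>keys f. smult (lookup f m) (meval minor_poly m))"

lemma poly_curve_poly:
  assumes "f \<in> carrier (poly_ring (plucker_index k n))"
  shows "poly (curve_poly f) t = poly_eval (curve t) f"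
proof -
  have "poly (meval minor_poly m) t = meval (curve t) m" if "m \<in> keys f" for m
  proof -
    have "keys m \<subseteq> plucker_index k n" using that assms by (auto simp: carrier_poly_ring)
    then have "poly (minor_poly v) t ^ lookup m v = curve t v ^ lookup m v" if "v \<in> keys m" for v
      using poly_minor_poly[of v t] that by auto
    then show ?thesis by (simp add: meval_def poly_prod)
  qed
  then show ?thesis by (simp add: curve_poly_def poly_sum poly_eval_meval)
qed

text \<open>Each monomial restricts to a monic polynomial whose degree is its weight, so only
  monomials of top weight reach the coefficient at \<open>D\<close>.\<close>

lemma coeff_curve_poly:
  assumes f: "f \<in> carrier (poly_ring (plucker_index k n))" and D: "\<And>m. m \<in> keys f \<Longrightarrow> weight diag_exponent m \<le> D"
  shows "Polynomial.coeff (curve_poly f) D = (\<Sum>m\<in>{m \<in> keys f. weight diag_exponent m = D}. lookup f m)"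
proof -
  have "Polynomial.coeff (curve_poly f) D = (\<Sum>m\<in>keys f. if weight diag_exponent m = D then lookup f m else 0)"
    unfolding curve_poly_def coeff_sum
  proof (intro sum.cong refl)
    fix m assume m: "m \<in> keys f"
    note mon = meval_minor_poly_monic[of m]
    have sub: "keys m \<subseteq> plucker_index k n" using f m by (auto simp: carrier_poly_ring)
    show "Polynomial.coeff (smult (lookup f m) (meval minor_poly m)) D = (if weight diag_exponent m = D then lookup f m else 0)"
      using mon[OF sub] D[OF m] by (auto intro: coeff_eq_0)
  qed
  also have "\<dots> = (\<Sum>m\<in>{m \<in> keys f. weight diag_exponent m = D}. lookup f m)"
    by (simp add: sum.inter_filter)
  finally show ?thesis .
qed

lemma modular_diag_exponent: "L.modular diag_exponent"
  unfolding L.modular_def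
proof (intro ballI)
  fix a b assume ab: "a \<in> plucker_index k n" "b \<in> plucker_index k n"
  have "(\<Sum>i<k. B ^ lex_rank (i, map2 min a b ! i)) + (\<Sum>i<k. B ^ lex_rank (i, map2 max a b ! i)) =
    (\<Sum>i<k. B ^ lex_rank (i, a ! i)) + (\<Sum>i<k. B ^ lex_rank (i, b ! i))"
    unfolding sum.distrib[symmetric] using plucker_index_nth(1)[OF ab(1)] plucker_index_nth(1)[OF ab(2)]
    by (intro sum.cong refl) (auto simp: min_def max_def)
  then show "diag_exponent (map2 min a b) + diag_exponent (map2 max a b) = diag_exponent a + diag_exponent b"
    by (simp add: diag_exponent_def)
qed

end

section \<open>Independence of standard monomials and leading terms of the straightening
  relations\<close>

context
  fixes k n :: nat
begin

interpretation L: set_lattice "plucker_index k n" "tuple_ideal k n" "map2 min" "map2 max"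
  by (rule set_lattice_plucker)

text \<open>Along the curve the standard monomials of \<open>g\<close> have distinct degrees, so the
  top one cannot cancel. The product with \<open>minor_poly v\<close> yields a parameter at which
  coordinate \<open>v\<close> is nonzero too, as the charts require.\<close>

lemma std_independent:
  assumes g: "g \<in> L.std_polys UNIV" "g \<noteq> 0" and v: "v \<in> plucker_index k n"
  shows "\<exists>x\<in>grass_cone k n. x v \<noteq> 0 \<and> poly_eval x g \<noteq> 0"
proof -
  define B where "B = 2 + (\<Sum>m\<in>keys g. monom_degree m)"
  have B: "2 \<le> B" by (simp add: B_def)
  have deg: "monom_degree m < B" if "m \<in> keys g" for m
  proof -
    have "monom_degree m \<le> (\<Sum>m\<in>keys g. monom_degree m)" using that by (intro member_le_sum) auto
    then show ?thesis by (simp add: B_def)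
  qed
  let ?\<theta> = "weight (diag_exponent k n B)"
  have inj: "inj_on ?\<theta> (keys g)"
    using deg g(1) by (intro inj_on_subset[OF inj_diag_exponent[OF B]]) (auto simp: L.std_polys_def)
  have "keys g \<noteq> {}" using g(2) by simp
  then have ne: "?\<theta> ` keys g \<noteq> {}" "finite (?\<theta> ` keys g)" by auto
  obtain m where m: "m \<in> keys g" "?\<theta> m = Max (?\<theta> ` keys g)" using Max_in[OF ne(2,1)] by auto
  have "{m' \<in> keys g. ?\<theta> m' = ?\<theta> m} = {m}" using inj m(1) by (auto dest: inj_onD)
  then have "Polynomial.coeff (curve_poly k n B g) (?\<theta> m) = lookup g m"
    using coeff_curve_poly[OF B L.std_polys_carrier[OF g(1)], of "?\<theta> m"] m ne by simp
  then have "curve_poly k n B g \<noteq> 0" using m(1) by auto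
  moreover have "minor_poly k n B v \<noteq> 0" using minor_poly_monic(2)[OF B v] by auto
  ultimately have "curve_poly k n B g * minor_poly k n B v \<noteq> 0" by simp
  then obtain t where "poly (curve_poly k n B g * minor_poly k n B v) t \<noteq> 0"
    using poly_all_0_iff_0 by blast
  then show ?thesis
    using poly_curve_poly[OF B L.std_polys_carrier[OF g(1)], of t] poly_minor_poly[OF B v, of t] curve_in_grass_cone[OF B, of k n t]
    by (intro bexI[of _ "curve k n B t"]) auto
qed

text \<open>The relation vanishes on the curve, so its terms of top weight cancel. The standard ones
  have distinct weights, hence the product of \<open>a\<close> and \<open>b\<close> takes part in
  the cancellation. By modularity its only possible partner is the product of meet and join, with
  coefficient 1; all other terms lie strictly lower.\<close>

lemma quadratic_straighten_leading:
  "\<exists>\<theta>. L.modular \<theta> \<and> (\<forall>a\<in>plucker_index k n. \<forall>b\<in>plucker_index k n. \<not> L.comparable a b \<longrightarrow>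
    (\<exists>r\<in>L.std_polys {2}. Var a * Var b - r \<in> vanishing (plucker_index k n) (grass_cone k n) \<and>
      lookup r (single (map2 min a b) 1 + single (map2 max a b) 1) = 1 \<and>
      (\<forall>s\<in>keys r. s \<noteq> single (map2 min a b) 1 + single (map2 max a b) 1 \<longrightarrow> weight \<theta> s < \<theta> a + \<theta> b)))"
proof (intro exI[of _ "diag_exponent k n 3"] conjI ballI impI)
  \<comment> \<open>The base has to exceed the degree 2 of the monomials compared.\<close>
  have B: "(2::nat) \<le> 3" by simp
  let ?V = "plucker_index k n" and ?\<theta> = "diag_exponent k n 3"
  show modular: "L.modular ?\<theta>" by (rule modular_diag_exponent[OF B])
  fix a b assume ab: "a \<in> ?V" "b \<in> ?V" "\<not> L.comparable a b"
  obtain r where r: "r \<in> L.std_polys {2}" "Var a * Var b - r \<in> vanishing ?V (grass_cone k n)"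
    using quadratic_straighten[OF ab(1,2)] by blast
  define f where "f = Var a * Var b - r"
  define m where "m = single a 1 + single b (1::nat)"
  define m' where "m' = single (map2 min a b) 1 + single (map2 max a b) (1::nat)"
  have lookup_f: "lookup f s = (if s = m then 1 else 0) - lookup r s" for s
    by (simp add: f_def Var_mult_Var m_def lookup_minus lookup_single when_def)
  have "\<not> L.std m" using ab(3) by (auto simp: L.std_def m_def keys_plus_monom)
  then have m_r: "m \<notin> keys r" using r(1) by (auto simp: L.std_polys_def)
  have f_m: "lookup f m = 1" using m_r by (simp add: lookup_f in_keys_iff)
  have keys_f: "keys f = insert m (keys r)" using m_r by (auto simp: in_keys_iff lookup_f split: if_splits)
  have f: "f \<in> carrier (poly_ring ?V)" using r(2) by (simp add: f_def vanishing_def)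
  have "poly (curve_poly k n 3 f) t = 0" for t
    using poly_curve_poly[OF B f, of t] r(2) curve_in_grass_cone[OF B, of k n t] by (simp add: f_def vanishing_def)
  then have zero: "curve_poly k n 3 f = 0" using poly_all_0_iff_0 by blast
  have std_m': "L.std m'"
    using L.meet[OF ab(1,2)] L.join[OF ab(1,2)] by (auto simp: L.std_def m'_def keys_plus_monom L.comparable_def)
  have \<theta>_m': "weight ?\<theta> m' = weight ?\<theta> m" using modular ab(1,2) by (simp add: m_def m'_def L.modular_def)
  have inj: "s = s'" if "L.std s" "L.std s'" "monom_degree s = 2" "monom_degree s' = 2" "weight ?\<theta> s = weight ?\<theta> s'" for s s'
    using inj_onD[OF inj_diag_exponent[OF B], of k n s s'] that by simp
  have r_std: "L.std s" "monom_degree s = 2" if "s \<in> keys r" for s using r(1) that by (auto simp: L.std_polys_def)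
  have deg_m': "monom_degree m' = 2" by (simp add: m'_def monom_degree_eq)
  define D where "D = Max (weight ?\<theta> ` keys f)"
  have fin: "finite (weight ?\<theta> ` keys f)" "weight ?\<theta> ` keys f \<noteq> {}" using keys_f by auto
  have D: "weight ?\<theta> s \<le> D" if "s \<in> keys f" for s using that fin(1) by (auto simp: D_def)
  obtain s0 where s0: "s0 \<in> keys f" "weight ?\<theta> s0 = D" using Max_in[OF fin] by (auto simp: D_def)
  have sum: "(\<Sum>s\<in>{s \<in> keys f. weight ?\<theta> s = D}. lookup f s) = 0"
    using coeff_curve_poly[OF B f D] zero by simp
  have D_m: "D = weight ?\<theta> m"
  proof (rule ccontr)
    assume neq: "D \<noteq> weight ?\<theta> m"
    then have "s0 \<in> keys r" using s0 keys_f by auto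
    have "{s \<in> keys f. weight ?\<theta> s = D} = {s0}"
      using s0 neq keys_f inj r_std \<open>s0 \<in> keys r\<close> by auto
    then show False using sum s0(1) by (simp add: in_keys_iff)
  qed
  have "lookup r m' = 1"
  proof (cases "m' \<in> keys r")
    case True
    have "{s \<in> keys f. weight ?\<theta> s = D} = {m, m'}"
      using True keys_f D_m \<theta>_m' inj r_std std_m' deg_m' by auto
    moreover have "m \<noteq> m'" using True m_r by blast
    ultimately have "lookup f m + lookup f m' = 0" using sum by simp
    then show ?thesis using f_m \<open>m \<noteq> m'\<close> by (simp add: lookup_f)
  next
    case False
    have "{s \<in> keys f. weight ?\<theta> s = D} = {m}"
    proof -
      have "s = m" if "s \<in> keys f" "weight ?\<theta> s = D" for s
        using that False keys_f D_m \<theta>_m' inj[of s m'] r_std std_m' deg_m' by auto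
      then show ?thesis using keys_f D_m by auto
    qed
    then show ?thesis using sum f_m by simp
  qed
  moreover have "weight ?\<theta> s < ?\<theta> a + ?\<theta> b" if "s \<in> keys r" "s \<noteq> m'" for s
  proof -
    have "weight ?\<theta> s \<noteq> weight ?\<theta> m'" using inj that r_std std_m' deg_m' by blast
    then have "weight ?\<theta> s < weight ?\<theta> m" using D[of s] that keys_f D_m \<theta>_m' by simp
    then show ?thesis by (simp add: m_def)
  qed
  ultimately show "\<exists>r\<in>L.std_polys {2}. Var a * Var b - r \<in> vanishing ?V (grass_cone k n) \<and>
      lookup r (single (map2 min a b) 1 + single (map2 max a b) 1) = 1 \<and>
      (\<forall>s\<in>keys r. s \<noteq> single (map2 min a b) 1 + single (map2 max a b) 1 \<longrightarrow> weight ?\<theta> s < ?\<theta> a + ?\<theta> b)"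
    using r by (intro bexI[of _ r]) (auto simp: m'_def)
qed

end

section \<open>Supermodular weights and Hibi varieties\<close>

lemma zero_set_Idl:
  assumes "F \<subseteq> carrier (poly_ring V)"
  shows "zero_set V (Idl\<^bsub>poly_ring V\<^esub> F) = zero_set V F"
proof
  show "zero_set V (Idl\<^bsub>poly_ring V\<^esub> F) \<subseteq> zero_set V F"
    using poly_Idl(2)[OF assms] by (auto simp: zero_set_def)
  show "zero_set V F \<subseteq> zero_set V (Idl\<^bsub>poly_ring V\<^esub> F)"
  proof
    fix L assume L: "L \<in> zero_set V F"
    then have "Idl\<^bsub>poly_ring V\<^esub> F \<subseteq> vanishing V L"
      using assms by (intro Idl_subset_vanishing) (auto simp: zero_set_def)
    then show "L \<in> zero_set V (Idl\<^bsub>poly_ring V\<^esub> F)" using L by (auto simp: zero_set_def vanishing_def)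
  qed
qed

lemma irreducible_in_finite_Union:
  assumes C: "irreducible_in X C" and fin: "finite \<D>" and closed: "\<And>Z. Z \<in> \<D> \<Longrightarrow> closedin X Z"
    and sub: "C \<subseteq> \<Union>\<D>"
  shows "\<exists>Z\<in>\<D>. C \<subseteq> Z"
  using fin closed sub
proof (induction \<D> rule: finite_induct)
  case empty
  then show ?case using C by (auto simp: irreducible_in_def)
next
  case (insert Z \<D>)
  have "closedin X (\<Union>\<D>)" using insert by (intro closedin_Union) auto
  then have "C \<subseteq> Z \<or> C \<subseteq> \<Union>\<D>"
    using C insert.prems by (auto simp: irreducible_in_def)
  then show ?case using insert by auto
qed

text \<open>The projectivization of the cone \<open>X\<close>.\<close>

definition plines :: "'v set \<Rightarrow> ('v \<Rightarrow> complex) set \<Rightarrow> ('v \<Rightarrow> complex) set set" where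
  "plines V X = {L \<in> proj_space V. L \<subseteq> X}"

section \<open>Irreducibility of Hibi varieties\<close>

context set_lattice
begin

definition hibi_cone :: "('v \<Rightarrow> complex) set" where
  "hibi_cone = {x \<in> coord_space V. \<forall>a\<in>V. \<forall>b\<in>V. x a * x b = x (meet a b) * x (join a b)}"

lemma hibi_cone_scale:
  assumes x: "x \<in> hibi_cone"
  shows "cscale c x \<in> hibi_cone"
proof -
  have "c * x a * (c * x b) = c * x (meet a b) * (c * x (join a b))" if "a \<in> V" "b \<in> V" for a b
  proof -
    have "x a * x b = x (meet a b) * x (join a b)" using x that by (simp add: hibi_cone_def)
    then have "c * c * (x a * x b) = c * c * (x (meet a b) * x (join a b))" by (rule arg_cong)
    then show ?thesis by (simp only: mult_ac)
  qed
  then show ?thesis using x by (simp add: hibi_cone_def coord_space_def cscale_def)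
qed

lemma hibi_cone_normal_form:
  "keys m \<subseteq> V \<Longrightarrow> \<exists>s. std s \<and> (\<forall>x\<in>hibi_cone. meval x m = meval x s)"
proof (induction m rule: chain_induct)
  case (std s)
  then show ?case by blast
next
  case (swap a b m)
  have "meval x (single a 1 + single b 1 + m) = meval x (single (meet a b) 1 + single (join a b) 1 + m)"
    if "x \<in> hibi_cone" for x using that swap(1,2) by (simp add: hibi_cone_def)
  then show ?case using swap(5) by metis
qed

lemma torus_point:
  assumes "modular g"
  shows "(\<lambda>a. if a \<in> V then t ^ g a else 0) \<in> hibi_cone"
  using assms meet join by (auto simp: hibi_cone_def coord_space_def modular_def simp flip: power_add)

text \<open>Monomials with a variable outside \<open>V\<close> vanish on the cone, the others are
  replaced by their normal form. \<open>W\<close> stands for the variables of an ambient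
  space.\<close>

lemma hibi_cone_std:
  assumes "f \<in> carrier (poly_ring W)"
  shows "\<exists>f'\<in>std_polys UNIV. \<forall>x\<in>hibi_cone. poly_eval x f = poly_eval x f'"
proof -
  obtain nf where nf: "\<And>m. keys m \<subseteq> V \<Longrightarrow> std (nf m) \<and> (\<forall>x\<in>hibi_cone. meval x m = meval x (nf m))"
    using hibi_cone_normal_form by metis
  define f' where "f' = (\<Sum>m\<in>{m\<in>keys f. keys m \<subseteq> V}. single (nf m) (lookup f m))"
  have "f' \<in> std_polys UNIV"
    unfolding f'_def using nf by (intro std_polys_sum) (auto simp: std_polys_def split: if_splits)
  moreover have "poly_eval x f = poly_eval x f'" if x: "x \<in> hibi_cone" for x
  proof -
    have "poly_eval x f = (\<Sum>m\<in>{m\<in>keys f. keys m \<subseteq> V}. lookup f m * meval x m)"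
      unfolding poly_eval_meval
    proof (rule sum.mono_neutral_right)
      show "\<forall>m\<in>keys f - {m \<in> keys f. keys m \<subseteq> V}. lookup f m * meval x m = 0"
        using x by (auto simp: hibi_cone_def coord_space_def meval_eq_0_iff)
    qed auto
    also have "\<dots> = (\<Sum>m\<in>{m\<in>keys f. keys m \<subseteq> V}. lookup f m * meval x (nf m))"
      using nf x by (intro sum.cong) auto
    also have "\<dots> = poly_eval x f'"
      by (simp add: f'_def poly_eval_sum poly_eval_monom)
    finally show ?thesis .
  qed
  ultimately show ?thesis by blast
qed

lemma poly_eval_torus:
  assumes "f \<in> carrier (poly_ring V)"
  shows "poly_eval (\<lambda>a. if a \<in> V then t ^ g a else 0) f = (\<Sum>m\<in>keys f. lookup f m * t ^ weight g m)"
proof -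
  have "meval (\<lambda>a. if a \<in> V then t ^ g a else 0) m = t ^ weight g m" if "m \<in> keys f" for m
  proof -
    have "keys m \<subseteq> V" using that assms by (auto simp: carrier_poly_ring)
    then have "meval (\<lambda>a. if a \<in> V then t ^ g a else 0) m = meval (\<lambda>a. t ^ g a) m"
      by (intro meval_cong) auto
    then show ?thesis by (simp add: meval_power)
  qed
  then show ?thesis by (simp add: poly_eval_meval)
qed

text \<open>One modular weight separates the monomials of both polynomials at once. Both then
  restrict to nonzero polynomials in \<open>t\<close>, and so does their product with
  \<open>t\<close>.\<close>

lemma common_torus_point:
  assumes "f \<in> std_polys UNIV" "f \<noteq> 0" "h \<in> std_polys UNIV" "h \<noteq> (0 :: ('v, complex) mpoly)"
  shows "\<exists>g t. modular g \<and> t \<noteq> 0 \<and> poly_eval (\<lambda>a. if a \<in> V then t ^ g a else 0) f \<noteq> 0 \<and>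
    poly_eval (\<lambda>a. if a \<in> V then t ^ g a else 0) h \<noteq> 0"
proof -
  have "finite (keys f \<union> keys h)" "\<And>s. s \<in> keys f \<union> keys h \<Longrightarrow> std s"
    using assms by (auto simp: std_polys_def)
  then obtain g where g: "modular g" "inj_on (weight g) (keys f \<union> keys h)"
    using separating_modular_weight by blast
  define pol where "pol q = (\<Sum>m\<in>keys q. monom (lookup q m) (weight g m))" for q :: "('v, complex) mpoly"
  have poly_pol: "poly (pol q) t = poly_eval (\<lambda>a. if a \<in> V then t ^ g a else 0) q" if "q \<in> std_polys UNIV" for q t
    using poly_eval_torus[OF std_polys_carrier[OF that]] by (simp add: pol_def poly_sum poly_monom)
  have nz: "pol q \<noteq> 0" if q: "q \<noteq> 0" "keys q \<subseteq> keys f \<union> keys h" for q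
  proof
    assume "pol q = 0"
    have "keys q \<noteq> {}" using q(1) by simp
    then obtain m where m: "m \<in> keys q" by blast
    have "(\<Sum>m\<in>keys q. lookup q m * t ^ weight g m) = 0" for t
      using arg_cong[OF \<open>pol q = 0\<close>, of "\<lambda>p. poly p t"] by (simp add: pol_def poly_sum poly_monom)
    then have "lookup q m = 0"
      by (rule exponents_independent[OF finite_keys inj_on_subset[OF g(2) q(2)] _ m])
    then show False using m by (simp add: in_keys_iff)
  qed
  have "pol f * (pol h * monom 1 1) \<noteq> 0" using nz[of f] nz[of h] assms by simp
  then obtain t where "poly (pol f * (pol h * monom 1 1)) t \<noteq> 0" using poly_all_0_iff_0 by blast
  then show ?thesis using g(1) poly_pol assms by (intro exI[of _ g] exI[of _ t]) (auto simp: poly_monom)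
qed

text \<open>A closed set that misses part of the variety is avoided wherever a suitable nonzero
  standard polynomial is nonzero; a common torus point avoids two such sets.\<close>

lemma irreducible_hibi_lines:
  assumes "V \<noteq> {}" "V \<subseteq> W"
  shows "irreducible_in (zariski W) (plines W hibi_cone)"
proof -
  have sub: "hibi_cone \<subseteq> coord_space W" using assms(2) by (auto simp: hibi_cone_def coord_space_def)
  note cone = hibi_cone_scale
  have torus_line: "line (\<lambda>a. if a \<in> V then t ^ g a else 0) \<in> plines W hibi_cone"
    if "modular g" "t \<noteq> 0" for g and t :: complex
  proof -
    let ?x = "\<lambda>a. if a \<in> V then t ^ g a else (0 :: complex)"
    have x: "?x \<in> hibi_cone" by (rule torus_point[OF that(1)])
    obtain a where "a \<in> V" using assms(1) by blast
    have nz: "?x \<noteq> 0"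
    proof
      assume "?x = 0"
      from fun_cong[OF this, of a] show False using \<open>a \<in> V\<close> that(2) by simp
    qed
    have "line ?x \<in> proj_space W" by (rule line_in_proj_space[OF subsetD[OF sub x] nz])
    moreover have "line ?x \<subseteq> hibi_cone" unfolding line_def using cone[OF x] by blast
    ultimately show ?thesis by (simp add: plines_def)
  qed
  show ?thesis
    unfolding irreducible_in_def topspace_zariski
  proof (intro conjI allI impI)
    show "plines W hibi_cone \<subseteq> proj_space W" by (auto simp: plines_def)
    have "modular (\<lambda>_. 0)" by (simp add: modular_def)
    then show "plines W hibi_cone \<noteq> {}" using torus_line[of "\<lambda>_. 0" 1] by auto
    fix A B assume AB: "closedin (zariski W) A \<and> closedin (zariski W) B \<and> plines W hibi_cone \<subseteq> A \<union> B"
    then obtain F G where F: "F \<subseteq> (\<Union>d. forms W d)" "A = zero_set W F" and G: "G \<subseteq> (\<Union>d. forms W d)" "B = zero_set W G"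
      unfolding closedin_zariski by blast
    have escape: "\<exists>f'\<in>std_polys UNIV. f' \<noteq> 0 \<and> (\<forall>x\<in>hibi_cone. poly_eval x f' \<noteq> 0 \<longrightarrow> line x \<notin> zero_set W F)"
      if F: "F \<subseteq> (\<Union>d. forms W d)" "\<not> plines W hibi_cone \<subseteq> zero_set W F" for F
    proof -
      obtain L f x where L: "L \<in> plines W hibi_cone" "f \<in> F" "x \<in> L" "poly_eval x f \<noteq> 0"
        using F(2) by (auto simp: zero_set_def plines_def)
      have "f \<in> carrier (poly_ring W)" using F(1) L(2) by (auto simp: forms_def)
      then obtain f' where f': "f' \<in> std_polys UNIV" "\<And>x. x \<in> hibi_cone \<Longrightarrow> poly_eval x f = poly_eval x f'"
        using hibi_cone_std by metis
      have "x \<in> hibi_cone" using L(1,3) by (auto simp: plines_def)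
      then have "f' \<noteq> 0" using f'(2)[of x] L(4) by (metis poly_eval_zero)
      moreover have "line y \<notin> zero_set W F" if "y \<in> hibi_cone" "poly_eval y f' \<noteq> 0" for y
      proof
        assume "line y \<in> zero_set W F"
        then have "poly_eval y f = 0" using L(2) self_in_line[of y] by (auto simp: in_zero_set_iff)
        then show False using that f'(2)[OF that(1)] by simp
      qed
      ultimately show ?thesis using f'(1) by blast
    qed
    show "plines W hibi_cone \<subseteq> A \<or> plines W hibi_cone \<subseteq> B"
    proof (rule ccontr)
      assume "\<not> ?thesis"
      then obtain f h where f: "f \<in> std_polys UNIV" "f \<noteq> 0" "\<And>x. x \<in> hibi_cone \<Longrightarrow> poly_eval x f \<noteq> 0 \<Longrightarrow> line x \<notin> A"
        and h: "h \<in> std_polys UNIV" "h \<noteq> 0" "\<And>x. x \<in> hibi_cone \<Longrightarrow> poly_eval x h \<noteq> 0 \<Longrightarrow> line x \<notin> B"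
        using escape[OF F(1)] escape[OF G(1)] F(2) G(2) by metis
      obtain g t where gt: "modular g" "t \<noteq> 0" "poly_eval (\<lambda>a. if a \<in> V then t ^ g a else 0) f \<noteq> 0"
        "poly_eval (\<lambda>a. if a \<in> V then t ^ g a else 0) h \<noteq> 0"
        using common_torus_point[OF f(1,2) h(1,2)] by blast
      then have "line (\<lambda>a. if a \<in> V then t ^ g a else 0) \<notin> A \<union> B"
        using f(3) h(3) torus_point by blast
      then show False using torus_line[OF gt(1,2)] AB by blast
    qed
  qed
qed

end

text \<open>The rank \<open>\<rho>\<close> increases strictly along \<open>r\<close>; it breaks ties
  when linear extensions are constructed.\<close>

locale supermodular_lattice = set_lattice V T meet join
  for V :: "'v set" and T :: "'v \<Rightarrow> 'p set" and meet join +
  fixes P :: "'p set" and r :: "('p \<times> 'p) set" and \<rho> :: "'p \<Rightarrow> nat" and w :: "'v \<Rightarrow> real"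
  assumes finP: "finite P" and ideals: "T ` V = order_ideals P r"
    and rank: "\<And>p q. (p, q) \<in> r \<Longrightarrow> p \<noteq> q \<Longrightarrow> \<rho> p < \<rho> q" and r_sub: "r \<subseteq> P \<times> P"
    and supermodular: "\<And>a b. a \<in> V \<Longrightarrow> b \<in> V \<Longrightarrow> w a + w b \<le> w (meet a b) + w (join a b)"
begin

definition zero_cone :: "('v \<Rightarrow> complex) set" where
  "zero_cone = {x \<in> coord_space V. \<forall>a\<in>V. \<forall>b\<in>V. \<not> comparable a b \<longrightarrow>
    x a * x b = (if w a + w b = w (meet a b) + w (join a b) then x (meet a b) * x (join a b) else 0)}"

lemma T_sub: "a \<in> V \<Longrightarrow> T a \<subseteq> P"
  using ideals by (auto simp: order_ideals_def)

lemma T_down: "a \<in> V \<Longrightarrow> q \<in> T a \<Longrightarrow> (p, q) \<in> r \<Longrightarrow> p \<in> T a"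
  using ideals by (auto simp: order_ideals_def)

lemma T_eqD: "a \<in> V \<Longrightarrow> b \<in> V \<Longrightarrow> T a = T b \<Longrightarrow> a = b"
  using inj by (auto dest: inj_onD)

text \<open>Labels may have gaps, where the chain of prefixes stays constant for a step.\<close>

definition linear_extension :: "('p \<Rightarrow> nat) \<Rightarrow> bool" where
  "linear_extension \<kappa> \<longleftrightarrow> inj_on \<kappa> P \<and> (\<forall>(p, q)\<in>r. p \<noteq> q \<longrightarrow> \<kappa> p < \<kappa> q)"

definition prefix :: "('p \<Rightarrow> nat) \<Rightarrow> nat \<Rightarrow> 'v" where
  "prefix \<kappa> t = inv_into V T {p \<in> P. \<kappa> p < t}"

text \<open>The affine function interpolating \<open>w\<close> along the maximal chain of prefixes of \<open>\<kappa>\<close>.\<close>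

definition interpolant :: "('p \<Rightarrow> nat) \<Rightarrow> 'v \<Rightarrow> real" where
  "interpolant \<kappa> a = w (prefix \<kappa> 0) + (\<Sum>p\<in>T a. w (prefix \<kappa> (Suc (\<kappa> p))) - w (prefix \<kappa> (\<kappa> p)))"

text \<open>The interpolant lies above \<open>w\<close> everywhere, so this contact set is the
  domain of linearity that contains the chain of prefixes of \<open>\<kappa>\<close>.\<close>

definition cell :: "('p \<Rightarrow> nat) \<Rightarrow> 'v set" where
  "cell \<kappa> = {a \<in> V. w a = interpolant \<kappa> a}"

text \<open>The order that Birkhoff's theorem attaches to the sublattice
  \<open>cell \<kappa>\<close>.\<close>

definition cell_order :: "('p \<Rightarrow> nat) \<Rightarrow> ('p \<times> 'p) set" where
  "cell_order \<kappa> = {(p, q). p \<in> P \<and> q \<in> P \<and> (\<forall>a\<in>cell \<kappa>. q \<in> T a \<longrightarrow> p \<in> T a)}"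

lemma cell_sub: "cell \<kappa> \<subseteq> V"
  by (auto simp: cell_def)

context
  fixes \<kappa> assumes \<kappa>: "linear_extension \<kappa>"
begin

lemma prefix: "prefix \<kappa> t \<in> V" "T (prefix \<kappa> t) = {p \<in> P. \<kappa> p < t}"
proof -
  have "{p \<in> P. \<kappa> p < t} \<in> T ` V"
    unfolding ideals order_ideals_def using \<kappa> r_sub by (fastforce simp: linear_extension_def)
  then show "prefix \<kappa> t \<in> V" "T (prefix \<kappa> t) = {p \<in> P. \<kappa> p < t}"
    by (auto simp: prefix_def inv_into_into f_inv_into_f)
qed

lemma interpolant_modular:
  "a \<in> V \<Longrightarrow> b \<in> V \<Longrightarrow> interpolant \<kappa> (meet a b) + interpolant \<kappa> (join a b) = interpolant \<kappa> a + interpolant \<kappa> b"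
  using sum.union_inter[of "T a" "T b" "\<lambda>p. w (prefix \<kappa> (Suc (\<kappa> p))) - w (prefix \<kappa> (\<kappa> p))"] meet[of a b] join[of a b] finT
  by (simp add: interpolant_def)

lemma prefix_Suc:
  "prefix \<kappa> (Suc t) = prefix \<kappa> t \<and> (\<forall>p\<in>P. \<kappa> p \<noteq> t) \<or>
    (\<exists>p\<in>P. \<kappa> p = t \<and> T (prefix \<kappa> (Suc t)) = insert p (T (prefix \<kappa> t)) \<and> p \<notin> T (prefix \<kappa> t))"
proof (cases "\<exists>p\<in>P. \<kappa> p = t")
  case True
  then obtain p where p: "p \<in> P" "\<kappa> p = t" by blast
  have "q = p" if "q \<in> P" "\<kappa> q = t" for q
    using inj_onD[of \<kappa> P q p] \<kappa> p that by (simp add: linear_extension_def)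
  then have "{q \<in> P. \<kappa> q < Suc t} = insert p {q \<in> P. \<kappa> q < t}"
    unfolding less_Suc_eq using p by blast
  then have "T (prefix \<kappa> (Suc t)) = insert p (T (prefix \<kappa> t))" "p \<notin> T (prefix \<kappa> t)"
    unfolding prefix using p by simp_all
  then show ?thesis using p by blast
next
  case False
  then have "T (prefix \<kappa> (Suc t)) = T (prefix \<kappa> t)" by (auto simp: prefix less_Suc_eq)
  then have "prefix \<kappa> (Suc t) = prefix \<kappa> t" by (intro T_eqD prefix)
  then show ?thesis using False by blast
qed

text \<open>Follow the meets of \<open>a\<close> with the growing prefixes. When a new element of
  \<open>T a\<close> enters, supermodularity of the new meet and the old prefix, whose meet and join
  are the old meet and the new prefix, bounds the increment of \<open>w\<close> by that of the
  interpolant.\<close>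

lemma weight_le_interpolant:
  assumes a: "a \<in> V"
  shows "w a \<le> interpolant \<kappa> a"
proof -
  have meetV: "meet a (prefix \<kappa> t) \<in> V" "T (meet a (prefix \<kappa> t)) = T a \<inter> T (prefix \<kappa> t)" for t
    using meet[OF a prefix(1)] by auto
  have "w (meet a (prefix \<kappa> t)) \<le> interpolant \<kappa> (meet a (prefix \<kappa> t))" for t
  proof (induction t)
    case 0
    have "T (meet a (prefix \<kappa> 0)) = T (prefix \<kappa> 0)" by (auto simp: meetV prefix)
    then have "meet a (prefix \<kappa> 0) = prefix \<kappa> 0" by (intro T_eqD meetV prefix)
    then show ?case by (simp add: interpolant_def prefix)
  next
    case (Suc t)
    let ?m = "meet a (prefix \<kappa> t)" and ?m' = "meet a (prefix \<kappa> (Suc t))"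
    from prefix_Suc[of t] show ?case
    proof (elim disjE conjE bexE)
      fix p assume p: "p \<in> P" "\<kappa> p = t" "T (prefix \<kappa> (Suc t)) = insert p (T (prefix \<kappa> t))" "p \<notin> T (prefix \<kappa> t)"
      show ?case
      proof (cases "p \<in> T a")
        case True
        have T_m': "T ?m' = insert p (T ?m)" using True p by (auto simp: meetV)
        have "meet ?m' (prefix \<kappa> t) = ?m"
          using meet[OF meetV(1) prefix(1), of "Suc t" t] p True by (intro T_eqD meetV(1)) (auto simp: meetV)
        moreover have "join ?m' (prefix \<kappa> t) = prefix \<kappa> (Suc t)"
          using join[OF meetV(1) prefix(1), of "Suc t" t] p True by (intro T_eqD prefix(1)) (auto simp: meetV)
        ultimately have "w ?m' + w (prefix \<kappa> t) \<le> w ?m + w (prefix \<kappa> (Suc t))"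
          using supermodular[OF meetV(1) prefix(1), of "Suc t" t] by simp
        moreover have "interpolant \<kappa> ?m' = interpolant \<kappa> ?m + (w (prefix \<kappa> (Suc t)) - w (prefix \<kappa> t))"
          unfolding interpolant_def T_m' using p finT[OF meetV(1)] by (simp add: meetV)
        ultimately show ?thesis using Suc by linarith
      next
        case False
        then have "T ?m' = T ?m" using p by (auto simp: meetV)
        then have "?m' = ?m" by (intro T_eqD meetV)
        then show ?thesis using Suc by simp
      qed
    qed (use Suc in simp)
  qed
  moreover have "meet a (prefix \<kappa> (Suc (\<Sum>p\<in>P. \<kappa> p))) = a"
  proof (intro T_eqD meetV a)
    have "\<kappa> p < Suc (\<Sum>p\<in>P. \<kappa> p)" if "p \<in> P" for p
      using member_le_sum[OF that, of \<kappa>] finP by simp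
    then show "T (meet a (prefix \<kappa> (Suc (\<Sum>p\<in>P. \<kappa> p)))) = T a"
      using T_sub[OF a] by (auto simp: meetV prefix)
  qed
  ultimately show ?thesis by metis
qed

lemma prefix_in_cell: "prefix \<kappa> t \<in> cell \<kappa>"
proof (induction t)
  case 0
  then show ?case by (simp add: cell_def interpolant_def prefix)
next
  case (Suc t)
  from prefix_Suc[of t] show ?case
  proof (elim disjE conjE bexE)
    fix p assume p: "p \<in> P" "\<kappa> p = t" "T (prefix \<kappa> (Suc t)) = insert p (T (prefix \<kappa> t))" "p \<notin> T (prefix \<kappa> t)"
    have "interpolant \<kappa> (prefix \<kappa> (Suc t)) = interpolant \<kappa> (prefix \<kappa> t) + (w (prefix \<kappa> (Suc t)) - w (prefix \<kappa> t))"
      unfolding interpolant_def p(3) using p finT[OF prefix(1)] by simp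
    then show ?case using Suc by (simp add: cell_def prefix)
  qed (use Suc in simp)
qed

text \<open>\<open>w\<close> is supermodular, the interpolant is modular and lies above
  \<open>w\<close>; equality at \<open>a\<close> and \<open>b\<close> leaves no room at meet and
  join.\<close>

lemma cell_sublattice:
  assumes "a \<in> cell \<kappa>" "b \<in> cell \<kappa>"
  shows "meet a b \<in> cell \<kappa>" "join a b \<in> cell \<kappa>"
proof -
  have V: "a \<in> V" "b \<in> V" "w a = interpolant \<kappa> a" "w b = interpolant \<kappa> b" using assms by (auto simp: cell_def)
  have "meet a b \<in> V" "join a b \<in> V" using meet join V by auto
  then show "meet a b \<in> cell \<kappa>" "join a b \<in> cell \<kappa>"
    using supermodular[OF V(1,2)] interpolant_modular[OF V(1,2)] weight_le_interpolant[of "meet a b"]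
      weight_le_interpolant[of "join a b"] V unfolding cell_def by auto
qed

lemma set_lattice_cell: "set_lattice (cell \<kappa>) T meet join"
proof
  have V: "a \<in> V" if "a \<in> cell \<kappa>" for a using that cell_sub by blast
  show "finite (cell \<kappa>)" by (rule finite_subset[OF cell_sub fin])
  show "inj_on T (cell \<kappa>)" by (rule inj_on_subset[OF inj cell_sub])
  show "meet a b \<in> cell \<kappa> \<and> T (meet a b) = T a \<inter> T b" "join a b \<in> cell \<kappa> \<and> T (join a b) = T a \<union> T b"
    if "a \<in> cell \<kappa>" "b \<in> cell \<kappa>" for a b
    using cell_sublattice[OF that] meet[OF V V, OF that] join[OF V V, OF that] by simp_all
  show "finite (T a)" if "a \<in> cell \<kappa>" for a by (rule finT[OF V[OF that]])
qed

text \<open>Antisymmetry holds because all prefixes belong to the cell and separate elements with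
  distinct labels.\<close>

lemma cell_order_partial_order: "partial_order_on P (cell_order \<kappa>)"
proof -
  have "p = q" if "(p, q) \<in> cell_order \<kappa>" "(q, p) \<in> cell_order \<kappa>" for p q
  proof (rule ccontr)
    assume "p \<noteq> q"
    have pq: "p \<in> P" "q \<in> P" using that by (auto simp: cell_order_def)
    then have "\<kappa> p \<noteq> \<kappa> q" using \<kappa> \<open>p \<noteq> q\<close> by (auto simp: linear_extension_def dest: inj_onD)
    moreover have "x \<in> T (prefix \<kappa> (Suc (\<kappa> y)))" if "(x, y) \<in> cell_order \<kappa>" "y \<in> P" for x y
      using that prefix_in_cell[of "Suc (\<kappa> y)"] by (auto simp: cell_order_def prefix)
    then have "q \<in> T (prefix \<kappa> (Suc (\<kappa> p)))" "p \<in> T (prefix \<kappa> (Suc (\<kappa> q)))" using that pq by blast+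
    ultimately show False by (simp add: prefix)
  qed
  moreover have "trans (cell_order \<kappa>)" unfolding trans_def cell_order_def by blast
  ultimately show ?thesis
    by (auto simp: partial_order_on_def preorder_on_def refl_on_def antisym_def cell_order_def)
qed

lemma cell_order_stronger: "r \<subseteq> cell_order \<kappa>"
  using r_sub cell_sub T_down by (fastforce simp: cell_order_def)

text \<open>For \<open>q\<close> in an ideal \<open>J\<close>, the intersection of all cell members
  containing \<open>q\<close> is a cell member consisting of elements below \<open>q\<close>, hence
  inside \<open>J\<close>; the union of these is \<open>J\<close>. Prefixes supply a member
  containing \<open>q\<close> and, for empty \<open>J\<close>, the empty one.\<close>

lemma order_ideals_cell_order: "order_ideals P (cell_order \<kappa>) = T ` cell \<kappa>"
proof
  show "T ` cell \<kappa> \<subseteq> order_ideals P (cell_order \<kappa>)"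
    using T_sub cell_sub by (fastforce simp: order_ideals_def cell_order_def)
  show "order_ideals P (cell_order \<kappa>) \<subseteq> T ` cell \<kappa>"
  proof
    fix J assume "J \<in> order_ideals P (cell_order \<kappa>)"
    then have J: "J \<subseteq> P" "\<And>p q. q \<in> J \<Longrightarrow> (p, q) \<in> cell_order \<kappa> \<Longrightarrow> p \<in> J" by (auto simp: order_ideals_def)
    have finC: "finite (cell \<kappa>)" using finite_subset[OF cell_sub fin] .
    have Inter: "\<exists>a\<in>cell \<kappa>. T a = \<Inter>(T ` A)" if "finite A" "A \<noteq> {}" "A \<subseteq> cell \<kappa>" for A
      using that
    proof (induction A rule: finite_ne_induct)
      case (insert b A)
      then obtain a where "a \<in> cell \<kappa>" "T a = \<Inter>(T ` A)" by auto
      then show ?case using insert.prems cell_sublattice(1)[of b a] meet[of b a] cell_sub by (intro bexI[of _ "meet b a"]) auto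
    qed auto
    have Un: "\<exists>a\<in>cell \<kappa>. T a = \<Union>(T ` A)" if "finite A" "A \<subseteq> cell \<kappa>" for A
      using that
    proof (induction A rule: finite_induct)
      case empty
      then show ?case using prefix_in_cell[of 0] by (intro bexI[of _ "prefix \<kappa> 0"]) (auto simp: prefix)
    next
      case (insert b A)
      then obtain a where "a \<in> cell \<kappa>" "T a = \<Union>(T ` A)" by auto
      then show ?case using insert.prems cell_sublattice(2)[of b a] join[of b a] cell_sub by (intro bexI[of _ "join b a"]) auto
    qed
    have "\<exists>a\<in>cell \<kappa>. q \<in> T a \<and> T a \<subseteq> J" if q: "q \<in> J" for q
    proof -
      let ?A = "{a \<in> cell \<kappa>. q \<in> T a}"
      have "prefix \<kappa> (Suc (\<kappa> q)) \<in> ?A" using prefix_in_cell q J(1) by (auto simp: prefix)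
      then obtain a where a: "a \<in> cell \<kappa>" "T a = \<Inter>(T ` ?A)" using Inter[of ?A] finC by auto
      moreover have "T a \<subseteq> J"
      proof
        fix p assume "p \<in> T a"
        then have "p \<in> P" using T_sub[of a] a(1) cell_sub by blast
        moreover have "p \<in> T b" if "b \<in> cell \<kappa>" "q \<in> T b" for b using \<open>p \<in> T a\<close> a(2) that by blast
        ultimately have "(p, q) \<in> cell_order \<kappa>" using q J(1) by (auto simp: cell_order_def)
        then show "p \<in> J" using J(2) q by blast
      qed
      moreover have "q \<in> T a" using a(2) by blast
      ultimately show ?thesis by blast
    qed
    then obtain c where c: "\<And>q. q \<in> J \<Longrightarrow> c q \<in> cell \<kappa> \<and> q \<in> T (c q) \<and> T (c q) \<subseteq> J" by metis
    have "finite J" using J(1) finP finite_subset by blast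
    then obtain a where "a \<in> cell \<kappa>" "T a = \<Union>(T ` (c ` J))" using Un[of "c ` J"] c by auto
    moreover have "\<Union>(T ` (c ` J)) = J" using c by auto
    ultimately show "J \<in> T ` cell \<kappa>" by auto
  qed
qed

definition cell_cone :: "('v \<Rightarrow> complex) set" where
  "cell_cone = set_lattice.hibi_cone (cell \<kappa>) meet join"

lemma cell_cone_def': "cell_cone = {x \<in> coord_space (cell \<kappa>). \<forall>a\<in>cell \<kappa>. \<forall>b\<in>cell \<kappa>. x a * x b = x (meet a b) * x (join a b)}"
  unfolding cell_cone_def set_lattice.hibi_cone_def[OF set_lattice_cell] ..

lemma cell_cone_scale: "x \<in> cell_cone \<Longrightarrow> cscale c x \<in> cell_cone"
  unfolding cell_cone_def by (rule set_lattice.hibi_cone_scale[OF set_lattice_cell])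

text \<open>Coordinates outside the cell vanish, so an equation could fail only if its meet and join
  lie in the cell while \<open>a\<close> or \<open>b\<close> does not. If \<open>w\<close> is
  additive on such a pair, then \<open>w \<le> interpolant\<close> has to be an equality at both
  \<open>a\<close> and \<open>b\<close>.\<close>

lemma cell_cone_sub: "cell_cone \<subseteq> zero_cone"
proof
  fix x assume x: "x \<in> cell_cone"
  have supp: "x a = 0" if "a \<notin> cell \<kappa>" for a using x that by (auto simp: cell_cone_def' coord_space_def)
  have "x a * x b = (if w a + w b = w (meet a b) + w (join a b) then x (meet a b) * x (join a b) else 0)"
    if V: "a \<in> V" "b \<in> V" for a b
  proof (cases "a \<in> cell \<kappa> \<and> b \<in> cell \<kappa>")
    case True
    then have "w a + w b = w (meet a b) + w (join a b)"
      using cell_sublattice[of a b] interpolant_modular[OF V] by (auto simp: cell_def)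
    then show ?thesis using x True by (auto simp: cell_cone_def')
  next
    case False
    have "\<not> (meet a b \<in> cell \<kappa> \<and> join a b \<in> cell \<kappa>)" if "w a + w b = w (meet a b) + w (join a b)"
    proof
      assume "meet a b \<in> cell \<kappa> \<and> join a b \<in> cell \<kappa>"
      then have "w a + w b = interpolant \<kappa> a + interpolant \<kappa> b"
        using that interpolant_modular[OF V] by (simp add: cell_def)
      then have "w a = interpolant \<kappa> a" "w b = interpolant \<kappa> b"
        using weight_le_interpolant[OF V(1)] weight_le_interpolant[OF V(2)] by linarith+
      then show False using False V by (simp add: cell_def)
    qed
    then show ?thesis using False supp by auto
  qed
  moreover have "x \<in> coord_space V" using x cell_sub by (auto simp: cell_cone_def' coord_space_def)
  ultimately show "x \<in> zero_cone" by (auto simp: zero_cone_def)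
qed

end

text \<open>Elements are sorted by the number of members of \<open>K\<close> that miss them. As
  \<open>K\<close> is a chain, each of its members is then an initial segment, and prefixes lie in
  the cell.\<close>

lemma exists_linear_extension:
  assumes K: "K \<subseteq> V" "\<And>a b. a \<in> K \<Longrightarrow> b \<in> K \<Longrightarrow> comparable a b"
  shows "\<exists>\<kappa>. linear_extension \<kappa> \<and> K \<subseteq> cell \<kappa>"
proof -
  have finK: "finite K" using K(1) fin finite_subset by blast
  obtain code :: "'p \<Rightarrow> nat" and N where code: "inj_on code P" "\<And>p. p \<in> P \<Longrightarrow> code p < N"
    using finite_imp_inj_to_nat_seg[OF finP] by (metis imageI mem_Collect_eq)
  define M where "M = Suc (\<Sum>p\<in>P. \<rho> p)"
  have M: "\<rho> p < M" if "p \<in> P" for p using member_le_sum[OF that, of \<rho>] finP by (simp add: M_def)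
  define level where "level p = card {a \<in> K. p \<notin> T a}" for p
  \<comment> \<open>Mixed radix for the lexicographic order by level, then rank, then an injective
    code.\<close>
  define \<kappa> where "\<kappa> p = (level p * M + \<rho> p) * N + code p" for p
  have lex: "\<kappa> p < \<kappa> q" if "level p * M + \<rho> p < level q * M + \<rho> q" "p \<in> P" for p q
  proof -
    have "Suc (level p * M + \<rho> p) * N \<le> (level q * M + \<rho> q) * N" using that by (intro mult_le_mono1) auto
    then show ?thesis using code(2)[OF that(2)] by (simp add: \<kappa>_def)
  qed
  have level_less: "\<kappa> p < \<kappa> q" if "level p < level q" "p \<in> P" for p q
  proof (rule lex)
    have "Suc (level p) * M \<le> level q * M" using that by (intro mult_le_mono1) auto
    then show "level p * M + \<rho> p < level q * M + \<rho> q" using M[OF that(2)] by simp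
  qed fact
  have "linear_extension \<kappa>"
    unfolding linear_extension_def
  proof (intro conjI inj_onI ballI, safe)
    fix p q assume pq: "p \<in> P" "q \<in> P" "\<kappa> p = \<kappa> q"
    have "code p = code q" using arg_cong[OF pq(3), of "\<lambda>x. x mod N"] code(2) pq by (simp add: \<kappa>_def)
    then show "p = q" using code(1) pq by (auto dest: inj_onD)
  next
    fix p q assume pq: "(p, q) \<in> r" "p \<noteq> q"
    have "{a \<in> K. p \<notin> T a} \<subseteq> {a \<in> K. q \<notin> T a}" using K(1) T_down pq by blast
    then have "level p \<le> level q" unfolding level_def by (intro card_mono) (use finK in auto)
    then have "level p * M \<le> level q * M" by (rule mult_le_mono1)
    then have "level p * M + \<rho> p < level q * M + \<rho> q" using rank[OF pq] by linarith
    then show "\<kappa> p < \<kappa> q" using pq r_sub by (intro lex) auto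
  qed
  moreover have "a \<in> cell \<kappa>" if a: "a \<in> K" for a
  proof -
    have less: "\<kappa> p < \<kappa> q" if "p \<in> T a" "q \<in> P" "q \<notin> T a" for p q
    proof (rule level_less)
      have "T b \<subseteq> T a" if "b \<in> K" "p \<notin> T b" for b
        using K(2)[OF a that(1)] that(2) \<open>p \<in> T a\<close> by (auto simp: comparable_def)
      then have "{b \<in> K. p \<notin> T b} \<subset> {b \<in> K. q \<notin> T b}" using that a by blast
      then show "level p < level q" unfolding level_def by (intro psubset_card_mono) (use finK in auto)
      show "p \<in> P" using T_sub[of a] K(1) a that by blast
    qed
    \<comment> \<open>The least label outside \<open>T a\<close>, or a number above all labels if
      \<open>T a\<close> is everything and the minimum would be over the empty set.\<close>
    define t where "t = (if P \<subseteq> T a then Suc (\<Sum>p\<in>P. \<kappa> p) else Min (\<kappa> ` (P - T a)))"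
    have aV: "a \<in> V" using K(1) a by blast
    have "T a = {p \<in> P. \<kappa> p < t}"
    proof (cases "P \<subseteq> T a")
      case True
      have "\<kappa> p < t" if "p \<in> P" for p using member_le_sum[OF that, of \<kappa>] finP True by (simp add: t_def)
      then show ?thesis using True T_sub[OF aV] by auto
    next
      case False
      then have *: "finite (\<kappa> ` (P - T a))" "\<kappa> ` (P - T a) \<noteq> {}" using finP by auto
      have "\<kappa> p < t" if "p \<in> T a" for p using less that Min_in[OF *] False by (auto simp: t_def)
      moreover have "t \<le> \<kappa> q" if "q \<in> P - T a" for q using Min_le[OF *(1)] that False by (auto simp: t_def)
      ultimately show ?thesis using T_sub[OF aV] by (intro equalityI subsetI) (auto, meson DiffI not_less)
    qed
    then have "a = prefix \<kappa> t" using \<open>linear_extension \<kappa>\<close> by (intro T_eqD aV) (auto simp: prefix)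
    then show ?thesis using prefix_in_cell[OF \<open>linear_extension \<kappa>\<close>] by simp
  qed
  ultimately show ?thesis by blast
qed

text \<open>Swapping to meet and join preserves all modular weights. At a point where the monomial
  is nonzero, the pair swapped must satisfy the binomial and not the monomial equation, so
  \<open>w\<close> is additive on it and preserved too.\<close>

lemma zero_cone_normal_form:
  "keys m \<subseteq> V \<Longrightarrow> \<exists>s. std s \<and>
    (\<forall>g :: 'v \<Rightarrow> real. (\<forall>a\<in>V. \<forall>b\<in>V. g (meet a b) + g (join a b) = g a + g b) \<longrightarrow> weight g m = weight g s) \<and>
    (\<forall>x\<in>zero_cone. meval x m \<noteq> 0 \<longrightarrow> weight w m = weight w s \<and> meval x m = meval x s)"
proof (induction m rule: chain_induct)
  case (std s)
  then show ?case by blast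
next
  case (swap a b m)
  let ?m = "single (meet a b) 1 + single (join a b) 1 + m"
  obtain s where s: "std s"
    "\<And>g :: 'v \<Rightarrow> real. (\<forall>a\<in>V. \<forall>b\<in>V. g (meet a b) + g (join a b) = g a + g b) \<Longrightarrow> weight g ?m = weight g s"
    "\<And>x. x \<in> zero_cone \<Longrightarrow> meval x ?m \<noteq> 0 \<Longrightarrow> weight w ?m = weight w s \<and> meval x ?m = meval x s"
    using swap(5) by blast
  have "weight w (single a 1 + single b 1 + m) = weight w s \<and> meval x (single a 1 + single b 1 + m) = meval x s"
    if x: "x \<in> zero_cone" "meval x (single a 1 + single b 1 + m) \<noteq> 0" for x
  proof -
    have rel: "x a * x b = (if w a + w b = w (meet a b) + w (join a b) then x (meet a b) * x (join a b) else 0)"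
      using x(1) swap(1-3) by (auto simp: zero_cone_def)
    then have mod: "w a + w b = w (meet a b) + w (join a b)" using x(2) by (auto split: if_splits)
    have "x a * x b = x (meet a b) * x (join a b)" using rel mod by simp
    then have "meval x (single a 1 + single b 1 + m) = meval x ?m"
      unfolding meval_add meval_single power_one_right by (rule arg_cong)
    moreover have "weight w (single a 1 + single b 1 + m) = weight w ?m" using mod by simp
    ultimately show ?thesis using s(3)[OF x(1)] x(2) by metis
  qed
  then show ?case using s(1,2) swap(1,2) by (intro exI[of _ s]) auto
qed

text \<open>Let \<open>m\<close> be the product of all nonzero coordinates of \<open>x\<close> and
  \<open>s\<close> its normal form, a chain inside some cell. The modular interpolant has equal
  weight on \<open>m\<close> and \<open>s\<close>, it equals \<open>w\<close> on \<open>s\<close>,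
  and \<open>w\<close> has equal weight on \<open>s\<close> and \<open>m\<close>. As
  \<open>w \<le> interpolant\<close> termwise, the whole support of \<open>x\<close> lies in the
  cell.\<close>

lemma zero_cone_cover:
  assumes x: "x \<in> zero_cone"
  shows "\<exists>\<kappa>. linear_extension \<kappa> \<and> x \<in> cell_cone \<kappa>"
proof -
  define S where "S = {a \<in> V. x a \<noteq> 0}"
  have S: "finite S" "S \<subseteq> V" using fin by (auto simp: S_def)
  define m where "m = (\<Sum>a\<in>S. single a (1::nat))"
  have lookup_m: "lookup m a = (if a \<in> S then 1 else 0)" for a
  proof -
    have "lookup m a = (\<Sum>b\<in>S. if b = a then 1 else 0)"
      unfolding m_def lookup_sum by (intro sum.cong) (auto simp: lookup_single when_def)
    then show ?thesis using S(1) by simp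
  qed
  have keys_m: "keys m = S" by (auto simp: in_keys_iff lookup_m split: if_splits)
  have "meval x m \<noteq> 0" by (auto simp: meval_eq_0_iff keys_m S_def)
  then obtain s where s: "std s" "weight w m = weight w s"
    "\<And>g :: 'v \<Rightarrow> real. (\<forall>a\<in>V. \<forall>b\<in>V. g (meet a b) + g (join a b) = g a + g b) \<Longrightarrow> weight g m = weight g s"
    using zero_cone_normal_form[of m] x S(2) keys_m by blast
  obtain \<kappa> where \<kappa>: "linear_extension \<kappa>" "keys s \<subseteq> cell \<kappa>"
    using exists_linear_extension[of "keys s"] s(1) by (auto simp: std_def)
  have "weight (interpolant \<kappa>) m = weight (interpolant \<kappa>) s"
    using interpolant_modular[OF \<kappa>(1)] by (intro s(3)) auto
  also have "\<dots> = weight w s" using \<kappa>(2) by (intro weight_cong) (auto simp: cell_def)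
  finally have "(\<Sum>a\<in>S. interpolant \<kappa> a - w a) = 0"
    using s(2) by (simp add: weight_def keys_m lookup_m sum_subtractf)
  then have "\<forall>a\<in>S. interpolant \<kappa> a - w a = 0"
    using S weight_le_interpolant[OF \<kappa>(1)] by (subst (asm) sum_nonneg_eq_0_iff) auto
  then have "S \<subseteq> cell \<kappa>" using S(2) by (auto simp: cell_def)
  then have "x \<in> coord_space (cell \<kappa>)" using x by (auto simp: S_def zero_cone_def coord_space_def)
  moreover have "x a * x b = x (meet a b) * x (join a b)" if ab: "a \<in> cell \<kappa>" "b \<in> cell \<kappa>" for a b
  proof (cases "comparable a b")
    case True
    have V: "a \<in> V" "b \<in> V" using ab cell_sub by auto
    from True have "meet a b = a \<and> join a b = b \<or> meet a b = b \<and> join a b = a"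
      unfolding comparable_def
    proof
      assume "T a \<subseteq> T b"
      then show ?thesis using meet[OF V] join[OF V] V by (auto intro!: T_eqD)
    next
      assume "T b \<subseteq> T a"
      then show ?thesis using meet[OF V] join[OF V] V by (auto intro!: T_eqD)
    qed
    then show ?thesis by auto
  next
    case False
    have V: "a \<in> V" "b \<in> V" using ab cell_sub by auto
    have "w a + w b = w (meet a b) + w (join a b)"
      using cell_sublattice[OF \<kappa>(1) ab] interpolant_modular[OF \<kappa>(1) V] ab by (auto simp: cell_def)
    then show ?thesis using x False V by (auto simp: zero_cone_def)
  qed
  ultimately show ?thesis using \<kappa>(1) by (auto simp: cell_cone_def'[OF \<kappa>(1)])
qed

text \<open>For a monomial \<open>s\<close> of \<open>f\<close> choose a cell containing its
  support. On the torus points of that cell only monomials supported there survive, and a separating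
  weight isolates the coefficient of \<open>s\<close>.\<close>

lemma zero_cone_std_zero:
  assumes f: "f \<in> std_polys UNIV" and van: "\<And>x. x \<in> zero_cone \<Longrightarrow> poly_eval x f = 0"
  shows "f = 0"
proof (rule ccontr)
  assume "f \<noteq> 0"
  then have "keys f \<noteq> {}" by simp
  then obtain s where s: "s \<in> keys f" by blast
  have std_s: "std s" using f s by (auto simp: std_polys_def)
  obtain \<kappa> where \<kappa>: "linear_extension \<kappa>" "keys s \<subseteq> cell \<kappa>"
    using exists_linear_extension[of "keys s"] std_s by (auto simp: std_def)
  obtain g where g: "modular g" "inj_on (weight g) (keys f)"
    using separating_modular_weight[of "keys f"] f by (auto simp: std_polys_def)
  interpret C: set_lattice "cell \<kappa>" T meet join by (rule set_lattice_cell[OF \<kappa>(1)])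
  have "C.modular g" using g(1) cell_sub by (auto simp: modular_def C.modular_def)
  let ?S = "{m \<in> keys f. keys m \<subseteq> cell \<kappa>}"
  have "(\<Sum>m\<in>?S. lookup f m * t ^ weight g m) = 0" for t
  proof -
    let ?x = "\<lambda>a. if a \<in> cell \<kappa> then t ^ g a else 0"
    have "?x \<in> zero_cone"
      using C.torus_point[OF \<open>C.modular g\<close>] cell_cone_sub[OF \<kappa>(1)] by (auto simp: cell_cone_def[OF \<kappa>(1)])
    then have "0 = (\<Sum>m\<in>keys f. lookup f m * meval ?x m)" using van by (simp add: poly_eval_meval)
    also have "\<dots> = (\<Sum>m\<in>?S. lookup f m * meval ?x m)"
      by (rule sum.mono_neutral_right) (auto simp: meval_eq_0_iff)
    also have "\<dots> = (\<Sum>m\<in>?S. lookup f m * t ^ weight g m)"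
    proof (intro sum.cong refl)
      fix m assume "m \<in> ?S"
      then have "meval ?x m = meval (\<lambda>a. t ^ g a) m" by (intro meval_cong) auto
      then show "lookup f m * meval ?x m = lookup f m * t ^ weight g m" by (simp add: meval_power)
    qed
    finally show ?thesis by simp
  qed
  then have "lookup f s = 0"
    using s \<kappa>(2) inj_on_subset[OF g(2), of ?S] by (intro exponents_independent[of ?S "weight g" "lookup f" s]) simp_all
  then show False using s by (simp add: in_keys_iff)
qed

section \<open>Hibi varieties as the irreducible components of the zero cone\<close>

definition dual_point :: "('p set \<Rightarrow> complex) set \<Rightarrow> ('v \<Rightarrow> complex) set" where
  "dual_point L = (\<lambda>x a. if a \<in> V then x (T a) else 0) ` L"

text \<open>By \<open>order_ideals_cell_order\<close>, \<open>T\<close> relabels the cell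
  coordinates as the order ideals of the stronger order. \<open>\<phi>\<close> and
  \<open>\<psi>\<close> transport vectors along it, with 0 at the remaining coordinates.\<close>

lemma dual_point_hibi_variety:
  assumes \<kappa>: "linear_extension \<kappa>"
  shows "dual_point ` hibi_variety P (cell_order \<kappa>) = plines V (cell_cone \<kappa>)"
proof -
  let ?O = "order_ideals P (cell_order \<kappa>)"
  let ?F = "{Var J1 * Var J2 - Var (J1 \<union> J2) * Var (J1 \<inter> J2) | J1 J2. J1 \<in> ?O \<and> J2 \<in> ?O} :: ('p set, complex) mpoly set"
  have O: "?O = T ` cell \<kappa>" by (rule order_ideals_cell_order[OF \<kappa>])
  have O_closed: "J1 \<union> J2 \<in> ?O" "J1 \<inter> J2 \<in> ?O" if "J1 \<in> ?O" "J2 \<in> ?O" for J1 J2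
    using that by (auto simp: order_ideals_def)
  have forms2: "Var J1 * Var J2 \<in> forms ?O 2" if "J1 \<in> ?O" "J2 \<in> ?O" for J1 J2
    unfolding Var_mult_Var using that by (intro single_in_forms) (auto simp: keys_plus_monom monom_degree_eq)
  have F: "?F \<subseteq> (\<Union>d. forms ?O d)"
  proof
    fix f assume "f \<in> ?F"
    then obtain J1 J2 where f: "f = Var J1 * Var J2 - Var (J1 \<union> J2) * Var (J1 \<inter> J2)" "J1 \<in> ?O" "J2 \<in> ?O" by blast
    have "f \<in> forms ?O 2" unfolding f(1) by (intro diff_in_forms forms2 O_closed f)
    then show "f \<in> (\<Union>d. forms ?O d)" by blast
  qed
  have hv: "hibi_variety P (cell_order \<kappa>) = zero_set ?O ?F"
    unfolding hibi_variety_def hibi_ideal_def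
    using F by (intro zero_set_Idl) (auto dest: forms_carrier)
  define \<phi> where "\<phi> x = (\<lambda>a. if a \<in> V then x (T a) else (0::complex))" for x :: "'p set \<Rightarrow> complex"
  define \<psi> where "\<psi> x = (\<lambda>J. if J \<in> ?O then x (inv_into V T J) else (0::complex))" for x :: "'v \<Rightarrow> complex"
  have invT: "inv_into V T (T a) = a" if "a \<in> V" for a using that inj by simp
  have cone: "\<phi> z \<in> cell_cone \<kappa> \<longleftrightarrow> (\<forall>f\<in>?F. poly_eval z f = 0)" if z: "z \<in> coord_space ?O" for z
  proof -
    have "T a \<in> ?O \<longleftrightarrow> a \<in> cell \<kappa>" if "a \<in> V" for a
      unfolding O using that cell_sub T_eqD by blast
    then have "\<phi> z \<in> coord_space (cell \<kappa>)" using z by (auto simp: \<phi>_def coord_space_def)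
    moreover have "\<phi> z a * \<phi> z b = \<phi> z (meet a b) * \<phi> z (join a b) \<longleftrightarrow> z (T a) * z (T b) = z (T a \<union> T b) * z (T a \<inter> T b)"
      if "a \<in> cell \<kappa>" "b \<in> cell \<kappa>" for a b
      using that cell_sub meet[of a b] join[of a b] by (auto simp: \<phi>_def mult.commute)
    moreover have "(\<forall>f\<in>?F. poly_eval z f = 0) \<longleftrightarrow>
      (\<forall>a\<in>cell \<kappa>. \<forall>b\<in>cell \<kappa>. z (T a) * z (T b) = z (T a \<union> T b) * z (T a \<inter> T b))"
    proof -
      have "(\<forall>f\<in>?F. poly_eval z f = 0) \<longleftrightarrow> (\<forall>J1\<in>?O. \<forall>J2\<in>?O. z J1 * z J2 = z (J1 \<union> J2) * z (J1 \<inter> J2))"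
        by (fastforce simp: poly_eval_diff poly_eval_mult poly_eval_Var)
      then show ?thesis unfolding O by simp
    qed
    ultimately show ?thesis by (simp add: cell_cone_def'[OF \<kappa>])
  qed
  have \<phi>\<psi>: "\<phi> (\<psi> x) = x" if "x \<in> coord_space (cell \<kappa>)" for x
  proof
    fix a show "\<phi> (\<psi> x) a = x a"
      using that invT[of a] cell_sub T_eqD by (cases "a \<in> cell \<kappa>") (auto simp: \<phi>_def \<psi>_def coord_space_def O)
  qed
  have \<psi>_coord: "\<psi> x \<in> coord_space ?O" for x by (simp add: \<psi>_def coord_space_def)
  have \<phi>_inj: "z = 0" if "\<phi> z = 0" "z \<in> coord_space ?O" for z
  proof
    fix J show "z J = 0 J"
    proof (cases "J \<in> ?O")
      case True
      then obtain a where "a \<in> cell \<kappa>" "J = T a" unfolding O by blast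
      then have a: "a \<in> V" "J = T a" using cell_sub by auto
      then have "\<phi> z a = z J" by (simp add: \<phi>_def)
      then show ?thesis using that(1) by simp
    qed (use that in \<open>simp add: coord_space_def\<close>)
  qed
  have image_line: "dual_point (line z) = line (\<phi> z)" for z
    by (auto simp: dual_point_def line_def \<phi>_def cscale_def image_iff fun_eq_iff)
  note scale = cell_cone_scale[OF \<kappa>]
  show ?thesis
  proof (intro equalityI subsetI)
    fix L assume "L \<in> dual_point ` hibi_variety P (cell_order \<kappa>)"
    then obtain L0 where L0: "L0 \<in> zero_set ?O ?F" "L = dual_point L0" by (auto simp: hv)
    then obtain z where z: "z \<in> coord_space ?O" "z \<noteq> 0" "L0 = line z" using proj_space_cases[of L0 ?O] by (auto simp: zero_set_def)
    have "\<phi> z \<in> cell_cone \<kappa>" using cone[OF z(1)] L0(1) line_in_zero_set_iff[OF F z(1,2)] z(3) by blast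
    moreover have "\<phi> z \<noteq> 0" using \<phi>_inj z by blast
    moreover have "\<phi> z \<in> coord_space V" by (simp add: \<phi>_def coord_space_def)
    moreover have "L = line (\<phi> z)" by (simp add: L0(2) z(3) image_line)
    moreover have "line (\<phi> z) \<subseteq> cell_cone \<kappa>"
      unfolding line_def using scale[OF \<open>\<phi> z \<in> cell_cone \<kappa>\<close>] by blast
    ultimately show "L \<in> plines V (cell_cone \<kappa>)"
      using line_in_proj_space[of "\<phi> z" V] by (simp add: plines_def)
  next
    fix L assume "L \<in> plines V (cell_cone \<kappa>)"
    then have L: "L \<in> proj_space V" "L \<subseteq> cell_cone \<kappa>" by (auto simp: plines_def)
    obtain x where "x \<noteq> 0" "L = line x" using proj_space_cases[OF L(1)] by blast
    then have x: "x \<noteq> 0" "L = line x" "x \<in> cell_cone \<kappa>" using L(2) self_in_line[of x] by auto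
    have xc: "x \<in> coord_space (cell \<kappa>)" using x(3) by (simp add: cell_cone_def'[OF \<kappa>])
    have "\<psi> x \<noteq> 0"
    proof
      assume "\<psi> x = 0"
      then have "x = \<phi> 0" using \<phi>\<psi>[OF xc] by simp
      then show False using x(1) by (simp add: \<phi>_def zero_fun_def)
    qed
    moreover have "\<phi> (\<psi> x) \<in> cell_cone \<kappa>" unfolding \<phi>\<psi>[OF xc] by (rule x(3))
    ultimately have "line (\<psi> x) \<in> zero_set ?O ?F"
      using iffD1[OF cone[OF \<psi>_coord]] iffD2[OF line_in_zero_set_iff[OF F \<psi>_coord]] by blast
    moreover have "L = dual_point (line (\<psi> x))" by (simp add: image_line \<phi>\<psi>[OF xc] x(2))
    ultimately show "L \<in> dual_point ` hibi_variety P (cell_order \<kappa>)" by (auto simp: hv)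
  qed
qed

lemma closedin_cell_lines:
  assumes \<kappa>: "linear_extension \<kappa>"
  shows "closedin (zariski V) (plines V (cell_cone \<kappa>))"
proof -
  define F :: "('v, complex) mpoly set" where "F = Var ` (V - cell \<kappa>) \<union>
    {Var a * Var b - Var (meet a b) * Var (join a b) | a b. a \<in> cell \<kappa> \<and> b \<in> cell \<kappa>}"
  have forms2: "Var a * Var b \<in> forms V 2" if "a \<in> V" "b \<in> V" for a b
    unfolding Var_mult_Var using that by (intro single_in_forms) (auto simp: keys_plus_monom monom_degree_eq)
  have forms1: "Var a \<in> forms V 1" if "a \<in> V" for a
    unfolding Var_def using that by (intro single_in_forms) (auto simp: monom_degree_eq)
  have "F \<subseteq> (\<Union>d. forms V d)"
  proof
    fix f assume "f \<in> F"
    then consider a where "a \<in> V" "f = Var a" |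
      a b where "a \<in> cell \<kappa>" "b \<in> cell \<kappa>" "f = Var a * Var b - Var (meet a b) * Var (join a b)"
      by (auto simp: F_def)
    then show "f \<in> (\<Union>d. forms V d)"
    proof cases
      case 1
      then show ?thesis using forms1 by blast
    next
      case 2
      then have "f \<in> forms V 2"
        using cell_sub meet[of a b] join[of a b] by (auto intro!: diff_in_forms forms2)
      then show ?thesis by blast
    qed
  qed
  moreover have "plines V (cell_cone \<kappa>) = zero_set V F"
  proof -
    have "x \<in> cell_cone \<kappa> \<longleftrightarrow> (\<forall>f\<in>F. poly_eval x f = 0)" if x: "x \<in> coord_space V" for x
    proof -
      have "x \<in> coord_space (cell \<kappa>) \<longleftrightarrow> (\<forall>a\<in>V - cell \<kappa>. x a = 0)" using x cell_sub by (auto simp: coord_space_def)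
      moreover have "(\<forall>f\<in>F. poly_eval x f = 0) \<longleftrightarrow> (\<forall>a\<in>V - cell \<kappa>. poly_eval x (Var a) = 0) \<and>
          (\<forall>a\<in>cell \<kappa>. \<forall>b\<in>cell \<kappa>. poly_eval x (Var a * Var b - Var (meet a b) * Var (join a b)) = 0)"
        unfolding F_def by blast
      ultimately show ?thesis unfolding cell_cone_def'[OF \<kappa>]
        by (simp add: poly_eval_Var poly_eval_diff poly_eval_mult)
    qed
    moreover have "L \<subseteq> coord_space V" if "L \<in> proj_space V" for L
      using that by (auto simp: proj_space_def subspaces_of_dim_def)
    ultimately show ?thesis unfolding plines_def zero_set_def by blast
  qed
  ultimately show ?thesis unfolding closedin_zariski by blast
qed

text \<open>The cell varieties are closed, irreducible, finite in number and cover; a component lies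
  in one of them and equals it by maximality.\<close>

theorem irreducible_components_zero_cone:
  assumes C: "irreducible_component (zariski V) (plines V zero_cone) C"
  shows "\<exists>\<kappa>. linear_extension \<kappa> \<and> C = plines V (cell_cone \<kappa>)"
proof -
  define \<D> where "\<D> = {plines V (cell_cone \<kappa>) | \<kappa>. linear_extension \<kappa>}"
  \<comment> \<open>There are infinitely many labellings \<open>\<kappa>\<close>, but the variety
    depends only on the cell, a subset of \<open>V\<close>.\<close>
  have "\<D> \<subseteq> (\<lambda>D. plines V (set_lattice.hibi_cone D meet join)) ` Pow V"
    using cell_sub by (auto simp: \<D>_def cell_cone_def)
  then have fin\<D>: "finite \<D>" by (rule finite_subset) (use fin in simp)
  have "plines V zero_cone \<subseteq> \<Union>\<D>"
  proof
    fix L assume "L \<in> plines V zero_cone"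
    then have L: "L \<in> proj_space V" "L \<subseteq> zero_cone" by (auto simp: plines_def)
    obtain z where z: "L = line z" using proj_space_cases[OF L(1)] by blast
    then obtain \<kappa> where \<kappa>: "linear_extension \<kappa>" "z \<in> cell_cone \<kappa>" using zero_cone_cover L(2) self_in_line by blast
    then have "cscale c z \<in> cell_cone \<kappa>" for c by (rule cell_cone_scale)
    then have "L \<in> plines V (cell_cone \<kappa>)" using L(1) by (auto simp: plines_def z line_def)
    then show "L \<in> \<Union>\<D>" using \<kappa>(1) by (auto simp: \<D>_def)
  qed
  moreover have "irreducible_in (zariski V) C" "C \<subseteq> plines V zero_cone"
    and max: "\<And>D. irreducible_in (zariski V) D \<Longrightarrow> D \<subseteq> plines V zero_cone \<Longrightarrow> C \<subseteq> D \<Longrightarrow> D = C"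
    using C by (auto simp: irreducible_component_def)
  ultimately have C': "irreducible_in (zariski V) C" "C \<subseteq> \<Union>\<D>" by auto
  have "closedin (zariski V) Z" if "Z \<in> \<D>" for Z using that closedin_cell_lines by (auto simp: \<D>_def)
  from irreducible_in_finite_Union[OF C'(1) fin\<D> this C'(2)]
  obtain Z where "Z \<in> \<D>" "C \<subseteq> Z" by blast
  then obtain \<kappa> where \<kappa>: "linear_extension \<kappa>" "C \<subseteq> plines V (cell_cone \<kappa>)" by (auto simp: \<D>_def)
  have "irreducible_in (zariski V) (plines V (cell_cone \<kappa>))"
    unfolding cell_cone_def[OF \<kappa>(1)]
    using prefix_in_cell[OF \<kappa>(1)] cell_sub by (intro set_lattice.irreducible_hibi_lines[OF set_lattice_cell[OF \<kappa>(1)]]) auto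
  moreover have "plines V (cell_cone \<kappa>) \<subseteq> plines V zero_cone"
    using cell_cone_sub[OF \<kappa>(1)] by (auto simp: plines_def)
  ultimately show ?thesis using max \<kappa> by blast
qed

end

section \<open>Initial ideals of the Hibi ideal\<close>

lemma vector_space_Const: "vector_space (\<lambda>(c :: complex) (p :: ('v, complex) mpoly). Const c * p)"
  by unfold_locales (auto simp: Const_def algebra_simps mult_single single_add)

lemma lookup_initial_form:
  "lookup (initial_form w p) m =
    (if m \<in> keys p \<and> (\<forall>m'\<in>keys p. monom_weight w m \<le> monom_weight w m') then lookup p m else 0)"
proof -
  let ?M = "{m \<in> keys p. \<forall>m'\<in>keys p. monom_weight w m \<le> monom_weight w m'}"
  have "lookup (initial_form w p) m = (\<Sum>m'\<in>?M. if m' = m then lookup p m else 0)"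
    unfolding initial_form_def lookup_sum by (intro sum.cong) (auto simp: lookup_single when_def)
  then show ?thesis by simp
qed

lemma initial_form_keys: "keys (initial_form w p) \<subseteq> keys p"
  by (auto simp: in_keys_iff lookup_initial_form split: if_splits)

lemma initial_form_nonzero:
  assumes "p \<noteq> 0"
  shows "\<exists>m\<in>keys p. m \<in> keys (initial_form w p)"
proof -
  have "keys p \<noteq> {}" using assms by simp
  then have *: "finite (monom_weight w ` keys p)" "monom_weight w ` keys p \<noteq> {}" by auto
  obtain m where m: "m \<in> keys p" "monom_weight w m = Min (monom_weight w ` keys p)" using Min_in[OF *] by auto
  then have "m \<in> keys (initial_form w p)" using Min_le[OF *(1)] by (auto simp: in_keys_iff lookup_initial_form)
  then show ?thesis using m(1) by blast
qed

lemma initial_form_binomial: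
  assumes "m \<noteq> m'"
  shows "initial_form w (single m 1 - single m' (1::complex)) =
    (if monom_weight w m < monom_weight w m' then single m 1
     else if monom_weight w m' < monom_weight w m then - single m' 1 else single m 1 - single m' 1)"
proof (rule poly_mapping_eqI)
  fix s
  have keys: "keys (single m 1 - single m' (1::complex)) = {m, m'}"
    using assms by (auto simp: in_keys_iff lookup_minus lookup_single when_def split: if_splits)
  show "lookup (initial_form w (single m 1 - single m' (1::complex))) s = lookup
    (if monom_weight w m < monom_weight w m' then single m 1
     else if monom_weight w m' < monom_weight w m then - single m' 1 else single m 1 - single m' 1) s"
    unfolding lookup_initial_form keys using assms by (auto simp: lookup_minus lookup_single when_def)
qed

lemma initial_ideal_closed:
  fixes I :: "('v, complex) mpoly set"
  shows "p \<in> I \<Longrightarrow> initial_form w p \<in> initial_ideal w I"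
    and "0 \<in> initial_ideal w I"
    and "p \<in> initial_ideal w I \<Longrightarrow> q \<in> initial_ideal w I \<Longrightarrow> p + q \<in> initial_ideal w I"
    and "p \<in> initial_ideal w I \<Longrightarrow> Const c * p \<in> initial_ideal w I"
    and "(\<And>i. i \<in> A \<Longrightarrow> f i \<in> initial_ideal w I) \<Longrightarrow> (\<Sum>i\<in>A. f i) \<in> initial_ideal w I"
    and "I \<subseteq> carrier (poly_ring V) \<Longrightarrow> initial_ideal w I \<subseteq> carrier (poly_ring V)"
proof -
  interpret C: vector_space "\<lambda>(c :: complex) (p :: ('v, complex) mpoly). Const c * p" by (rule vector_space_Const)
  show "p \<in> I \<Longrightarrow> initial_form w p \<in> initial_ideal w I"
    unfolding initial_ideal_def by (auto intro: C.span_base)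
  show "0 \<in> initial_ideal w I" unfolding initial_ideal_def by (rule C.span_zero)
  show "p \<in> initial_ideal w I \<Longrightarrow> q \<in> initial_ideal w I \<Longrightarrow> p + q \<in> initial_ideal w I"
    unfolding initial_ideal_def by (rule C.span_add)
  show "p \<in> initial_ideal w I \<Longrightarrow> Const c * p \<in> initial_ideal w I"
    unfolding initial_ideal_def by (rule C.span_scale)
  show "(\<And>i. i \<in> A \<Longrightarrow> f i \<in> initial_ideal w I) \<Longrightarrow> (\<Sum>i\<in>A. f i) \<in> initial_ideal w I"
    unfolding initial_ideal_def by (rule C.span_sum)
  assume I: "I \<subseteq> carrier (poly_ring V)"
  show "initial_ideal w I \<subseteq> carrier (poly_ring V)"
    unfolding initial_ideal_def
  proof (rule C.span_minimal)
    show "initial_form w ` I \<subseteq> carrier (poly_ring V)"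
    proof
      fix q assume "q \<in> initial_form w ` I"
      then obtain p where p: "p \<in> I" "q = initial_form w p" by blast
      then have "p \<in> carrier (poly_ring V)" using I by blast
      then show "q \<in> carrier (poly_ring V)"
        using initial_form_keys[of w p] unfolding p(2) carrier_poly_ring by blast
    qed
    have "Const c \<in> carrier (poly_ring V)" for c :: complex unfolding Const_def by (rule single_in_carrier) simp
    then show "C.subspace (carrier (poly_ring V))"
      by (auto simp: C.subspace_def plus_in_carrier poly_ring_mult_closed carrier_poly_ring[of 0])
  qed
qed

subsection \<open>The incomparability ideal\<close>

lemma Var_power: "Var v ^ e = single (single v e) 1"
  by (induction e) (simp_all add: Var_def mult_single flip: single_add)

lemma prod_single: "(\<Prod>i\<in>A. single (f i) 1) = (single (\<Sum>i\<in>A. f i) 1 :: ('v, 'b::comm_ring_1) mpoly)"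
  by (induction A rule: infinite_finite_induct) (simp_all add: mult_single)

context
  fixes k n :: nat
begin

interpretation L: set_lattice "plucker_index k n" "tuple_ideal k n" "map2 min" "map2 max"
  by (rule set_lattice_plucker)

text \<open>Polynomials all of whose monomials contain an incomparable pair form an ideal, which
  contains the incomparability ideal. \<open>psi_O\<close> relabels monomials injectively, so
  nothing cancels and the property can be pulled back.\<close>

lemma I_m_not_std:
  assumes g: "g \<in> I_m k n" and m: "m \<in> keys g"
  shows "\<not> L.std m"
proof -
  let ?V = "plucker_index k n" and ?T = "tuple_ideal k n"
  let ?O = "order_ideals (grass_poset k n) (grass_order k n)"
  define push where "push m = (\<Sum>v\<in>keys m. single (?T v) (lookup m v))" for m :: "nat list \<Rightarrow>\<^sub>0 nat"
  define N :: "((nat \<times> nat) set, complex) mpoly set" where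
    "N = {q \<in> carrier (poly_ring ?O). \<forall>m\<in>keys q. \<exists>J1\<in>keys m. \<exists>J2\<in>keys m. \<not> J1 \<subseteq> J2 \<and> \<not> J2 \<subseteq> J1}"
  have "incomparable_ideal (grass_poset k n) (grass_order k n) \<subseteq> N"
    unfolding incomparable_ideal_def
  proof (rule poly_Idl(3))
    let ?G = "{Var J1 * Var J2 | J1 J2. J1 \<in> ?O \<and> J2 \<in> ?O \<and> \<not> J1 \<subseteq> J2 \<and> \<not> J2 \<subseteq> J1} :: ((nat \<times> nat) set, complex) mpoly set"
    show "?G \<subseteq> carrier (poly_ring ?O)" by (auto intro: poly_ring_mult_closed Var_in_carrier)
    show "?G \<subseteq> N"
    proof
      fix q assume "q \<in> ?G"
      then obtain J1 J2 where q: "q = Var J1 * Var J2" "J1 \<in> ?O" "J2 \<in> ?O" "\<not> J1 \<subseteq> J2" "\<not> J2 \<subseteq> J1" by blast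
      then have "q \<in> carrier (poly_ring ?O)" by (simp add: poly_ring_mult_closed Var_in_carrier)
      moreover have "keys q = {single J1 1 + single J2 1}" by (simp add: q(1) Var_mult_Var)
      ultimately show "q \<in> N" using q(4,5) by (auto simp: N_def keys_plus_monom)
    qed
    show "ideal N (poly_ring ?O)"
    proof (rule poly_idealI)
      show "0 \<in> N" by (simp add: N_def carrier_poly_ring)
      show "p + q \<in> N" if "p \<in> N" "q \<in> N" for p q
      proof -
        have "\<exists>J1\<in>keys m. \<exists>J2\<in>keys m. \<not> J1 \<subseteq> J2 \<and> \<not> J2 \<subseteq> J1" if m: "m \<in> keys (p + q)" for m
        proof -
          have "m \<in> keys p \<or> m \<in> keys q" using subsetD[OF Poly_Mapping.keys_add m] by simp
          then show ?thesis using \<open>p \<in> N\<close> \<open>q \<in> N\<close> unfolding N_def by blast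
        qed
        moreover have "p + q \<in> carrier (poly_ring ?O)" using that by (intro plus_in_carrier) (auto simp: N_def)
        ultimately show ?thesis unfolding N_def by blast
      qed
      show "q * p \<in> N" if "p \<in> N" "q \<in> carrier (poly_ring ?O)" for p q
      proof -
        have "\<exists>J1\<in>keys m. \<exists>J2\<in>keys m. \<not> J1 \<subseteq> J2 \<and> \<not> J2 \<subseteq> J1" if m: "m \<in> keys (q * p)" for m
        proof -
          obtain a b where ab: "b \<in> keys p" "m = a + b" using keys_mult[of q p] m by blast
          have "\<exists>J1\<in>keys b. \<exists>J2\<in>keys b. \<not> J1 \<subseteq> J2 \<and> \<not> J2 \<subseteq> J1"
            using \<open>p \<in> N\<close> ab(1) by (simp add: N_def)
          then show ?thesis unfolding ab(2) keys_plus_monom by (meson UnI2)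
        qed
        moreover have "q * p \<in> carrier (poly_ring ?O)" using that by (intro poly_ring_mult_closed) (auto simp: N_def)
        ultimately show ?thesis unfolding N_def by blast
      qed
    qed (auto simp: N_def)
  qed
  then have N: "psi_O k n g \<in> N" and gV: "g \<in> carrier (poly_ring ?V)" using g by (auto simp: I_m_def)
  have psi: "psi_O k n g = (\<Sum>m\<in>keys g. single (push m) (lookup g m))"
    unfolding psi_O_def poly_subst_def push_def
    by (simp add: Var_power prod_single Const_def mult_single)
  have lookup_push: "lookup (push m) (?T v) = lookup m v" if "keys m \<subseteq> ?V" "v \<in> ?V" for m v
  proof -
    have "lookup (push m) (?T v) = (\<Sum>u\<in>keys m. if u = v then lookup m u else 0)"
      unfolding push_def lookup_sum using that inj_onD[OF L.inj]
      by (intro sum.cong) (auto simp: lookup_single when_def)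
    then show ?thesis by (auto simp: in_keys_iff)
  qed
  have push_inj: "m' = m''" if "keys m' \<subseteq> ?V" "keys m'' \<subseteq> ?V" "push m' = push m''" for m' m''
  proof (rule poly_mapping_eqI)
    fix v show "lookup m' v = lookup m'' v"
    proof (cases "v \<in> ?V")
      case True
      then show ?thesis using lookup_push[OF that(1), of v] lookup_push[OF that(2), of v] that(3) by simp
    next
      case False
      then have "v \<notin> keys m'" "v \<notin> keys m''" using that by auto
      then show ?thesis by (simp add: in_keys_iff)
    qed
  qed
  have sub: "keys m' \<subseteq> ?V" if "m' \<in> keys g" for m' using gV that by (auto simp: carrier_poly_ring)
  have "lookup (psi_O k n g) (push m) = (\<Sum>m'\<in>keys g. if m' = m then lookup g m else 0)"
    unfolding psi lookup_sum using push_inj sub m by (intro sum.cong) (auto simp: lookup_single when_def)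
  then have "push m \<in> keys (psi_O k n g)" using m by (simp add: in_keys_iff)
  then obtain J1 J2 where J: "J1 \<in> keys (push m)" "J2 \<in> keys (push m)" "\<not> J1 \<subseteq> J2" "\<not> J2 \<subseteq> J1"
    using N unfolding N_def by blast
  have "keys (push m) \<subseteq> ?T ` keys m"
    using keys_sum_subset[of "\<lambda>v. single (?T v) (lookup m v)" "keys m"] unfolding push_def by (auto split: if_splits)
  then show ?thesis using J unfolding L.std_def L.comparable_def by blast
qed

lemma tuple_ideal_order_ideals:
  assumes "k \<le> n"
  shows "tuple_ideal k n ` plucker_index k n = order_ideals (grass_poset k n) (grass_order k n)"
proof
  show "order_ideals (grass_poset k n) (grass_order k n) \<subseteq> tuple_ideal k n ` plucker_index k n"
    using tuple_ideal_surj[OF assms] by blast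
  show "tuple_ideal k n ` plucker_index k n \<subseteq> order_ideals (grass_poset k n) (grass_order k n)"
  proof clarify
    fix a assume a: "a \<in> plucker_index k n"
    have step: "a ! i + d \<le> a ! (i + d)" if "i + d < k" for i d
      using that
    proof (induction d)
      case (Suc d)
      then show ?case using plucker_index_nth(2)[OF a, of "i + d" "i + Suc d"] by simp
    qed simp
    show "tuple_ideal k n a \<in> order_ideals (grass_poset k n) (grass_order k n)"
      unfolding order_ideals_def
    proof (intro CollectI conjI ballI allI impI)
      show "tuple_ideal k n a \<subseteq> grass_poset k n" by (rule tuple_ideal_subset)
      fix q p assume q: "q \<in> tuple_ideal k n a" and pq: "(p, q) \<in> grass_order k n"
      obtain i j i' j' where eq: "p = (i, j)" "q = (i', j')" by (cases p, cases q)
      have le: "i \<le> i'" "j \<le> j'" "1 \<le> i" "i' \<le> k" "(i, j) \<in> grass_poset k n"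
        using pq unfolding eq by (auto simp: grass_order_def grass_poset_def)
      have "a ! (k - i') + (i' - i) \<le> a ! (k - i' + (i' - i))" using le by (intro step) auto
      then have "a ! (k - i') + i' \<le> a ! (k - i) + i" using le by simp
      moreover have "j' \<le> a ! (k - i') + i' - 1" using q unfolding eq by (simp add: tuple_ideal_def)
      ultimately show "p \<in> tuple_ideal k n a" using le unfolding eq by (simp add: tuple_ideal_def)
    qed
  qed
qed

abbreviation plucker_zero_cone :: "(nat list \<Rightarrow> real) \<Rightarrow> (nat list \<Rightarrow> complex) set" where
  "plucker_zero_cone w \<equiv> supermodular_lattice.zero_cone (plucker_index k n) (tuple_ideal k n) (map2 min) (map2 max) w"

text \<open>The ideal \<open>Q\<close> of the expected quadrics satisfies
  \<open>Q \<subseteq> I\<close> and \<open>Q \<subseteq> vanishing\<close>, and every polynomial is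
  standard modulo \<open>Q\<close>. Neither \<open>I\<close> nor the vanishing ideal contains a
  nonzero standard polynomial, so both equal \<open>Q\<close>.\<close>

theorem initial_ideal_structure:
  assumes kn: "k \<le> n" and I: "is_initial_ideal_of I (I_h k n)" and Im: "is_initial_ideal_of (I_m k n) I"
  shows "\<exists>w. supermodular_lattice (plucker_index k n) (tuple_ideal k n) (map2 min) (map2 max)
      (grass_poset k n) (grass_order k n) (\<lambda>(i, j). i + j) w \<and>
    I = vanishing (plucker_index k n) (plucker_zero_cone w)"
proof -
  let ?V = "plucker_index k n"
  obtain w where w: "I = initial_ideal w (I_h k n)" using I by (auto simp: is_initial_ideal_of_def)
  obtain w' where w': "I_m k n = initial_ideal w' I" using Im by (auto simp: is_initial_ideal_of_def)
  let ?G = "{Var a * Var b - Var (map2 min a b) * Var (map2 max a b) | a b. a \<in> ?V \<and> b \<in> ?V} :: (nat list, complex) mpoly set"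
  have G: "?G \<subseteq> carrier (poly_ring ?V)"
    using L.meet L.join by (auto intro!: diff_in_carrier poly_ring_mult_closed Var_in_carrier)
  have I_h: "ideal (I_h k n) (poly_ring ?V)" "?G \<subseteq> I_h k n"
    unfolding I_h_def using poly_Idl(1,2)[OF G] by auto
  have I_sub: "I \<subseteq> carrier (poly_ring ?V)"
    unfolding w by (rule initial_ideal_closed(6)[OF poly_idealD(1)[OF I_h(1)]])
  note I_closed = initial_ideal_closed[where w = w and I = "I_h k n", folded w]
  have mm: "map2 min a b \<in> ?V" "map2 max a b \<in> ?V" if "a \<in> ?V" "b \<in> ?V" for a b
    using L.meet[OF that] L.join[OF that] by auto
  have binomial: "single (single a 1 + single b 1 + m) 1 - single (single (map2 min a b) 1 + single (map2 max a b) 1 + m) 1 \<in> I_h k n"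
    if "a \<in> ?V" "b \<in> ?V" "keys m \<subseteq> ?V" for a b m
  proof -
    have "single m 1 * (Var a * Var b - Var (map2 min a b) * Var (map2 max a b)) \<in> I_h k n"
      using that I_h(2) by (intro poly_idealD(5)[OF I_h(1)] single_in_carrier) auto
    then show ?thesis by (simp add: Var_mult_Var right_diff_distrib mult_single add.commute)
  qed
  \<comment> \<open>Otherwise its initial form for \<open>w'\<close> would be a nonzero element of
    \<open>I_m\<close> supported on standard monomials.\<close>
  have std_zero: "g = 0" if g: "g \<in> I" "g \<in> L.std_polys UNIV" for g
  proof (rule ccontr)
    assume "g \<noteq> 0"
    then obtain m where m: "m \<in> keys g" "m \<in> keys (initial_form w' g)" using initial_form_nonzero by blast
    have "initial_form w' g \<in> I_m k n" unfolding w' by (rule initial_ideal_closed(1)[OF g(1)])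
    then show False using I_m_not_std m g(2) by (auto simp: L.std_polys_def)
  qed
  have std_pair: "L.std (single (map2 min a b) 1 + single (map2 max a b) 1)" if "a \<in> ?V" "b \<in> ?V" for a b
    using L.meet[OF that] L.join[OF that] by (auto simp: L.std_def keys_plus_monom L.comparable_def)
  \<comment> \<open>If it failed, the initial form of the binomial would be, up to sign, the
    standard monomial of meet and join.\<close>
  have supermodular: "w a + w b \<le> w (map2 min a b) + w (map2 max a b)" if ab: "a \<in> ?V" "b \<in> ?V" for a b
  proof (rule ccontr)
    let ?m = "single a 1 + single b (1::nat)" and ?m' = "single (map2 min a b) 1 + single (map2 max a b) (1::nat)"
    assume "\<not> ?thesis"
    then have less: "monom_weight w ?m' < monom_weight w ?m" by (simp add: monom_weight_eq)
    then have "?m \<noteq> ?m'" by auto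
    then have "initial_form w (single ?m 1 - single ?m' 1) = - single ?m' 1"
      using less by (simp add: initial_form_binomial)
    moreover have "single ?m 1 - single ?m' 1 \<in> I_h k n" using binomial[OF ab, of 0] by simp
    ultimately have "- single ?m' 1 \<in> I" using I_closed(1) by metis
    moreover have "- single ?m' (1::complex) \<in> L.std_polys UNIV" using std_pair[OF ab] by (simp add: L.std_polys_def)
    ultimately have "- single ?m' (1::complex) = 0" using std_zero by blast
    then show False by (metis lookup_single_eq lookup_uminus lookup_zero neg_equal_0_iff_equal zero_neq_one)
  qed
  have SL: "supermodular_lattice ?V (tuple_ideal k n) (map2 min) (map2 max)
      (grass_poset k n) (grass_order k n) (\<lambda>(i, j). i + j) w"
  proof unfold_locales
    show "finite (grass_poset k n)" by (rule finite_grass_poset)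
    show "tuple_ideal k n ` ?V = order_ideals (grass_poset k n) (grass_order k n)"
      by (rule tuple_ideal_order_ideals[OF kn])
  qed (use supermodular in \<open>auto simp: grass_order_def\<close>)
  then interpret S: supermodular_lattice ?V "tuple_ideal k n" "map2 min" "map2 max"
    "grass_poset k n" "grass_order k n" "\<lambda>(i, j). i + j" w .
  define q where "q a b = Var a * Var b - (if w a + w b = w (map2 min a b) + w (map2 max a b)
    then Var (map2 min a b) * Var (map2 max a b) else (0 :: (nat list, complex) mpoly))" for a b
  define F where "F = {q a b | a b. a \<in> ?V \<and> b \<in> ?V \<and> \<not> L.comparable a b}"
  define Q where "Q = Idl\<^bsub>poly_ring ?V\<^esub> F"
  have F_sub: "F \<subseteq> carrier (poly_ring ?V)"
  proof
    fix f assume "f \<in> F"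
    then obtain a b where f: "f = q a b" "a \<in> ?V" "b \<in> ?V" by (auto simp: F_def)
    have "(0 :: (nat list, complex) mpoly) \<in> carrier (poly_ring ?V)" by (simp add: carrier_poly_ring)
    then show "f \<in> carrier (poly_ring ?V)"
      using f(2,3) mm[OF f(2,3)] unfolding f(1) q_def
      by (auto intro!: diff_in_carrier poly_ring_mult_closed Var_in_carrier)
  qed
  note Q = poly_Idl[OF F_sub, folded Q_def]
  \<comment> \<open>\<open>I\<close> is by definition only a linear span of initial forms. The
    polynomials all of whose monomial multiples lie in \<open>I\<close> do form an ideal, and the
    multiples of the generators are initial forms of multiples of binomials.\<close>
  have "Q \<subseteq> {p \<in> carrier (poly_ring ?V). \<forall>m. keys m \<subseteq> ?V \<longrightarrow> single m 1 * p \<in> I}"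
  proof (rule Q(3)[OF poly_idealI])
    show "F \<subseteq> {p \<in> carrier (poly_ring ?V). \<forall>m. keys m \<subseteq> ?V \<longrightarrow> single m 1 * p \<in> I}"
    proof
      fix f assume fF: "f \<in> F"
      then obtain a b where f: "f = q a b" and ab: "a \<in> ?V" "b \<in> ?V" "\<not> L.comparable a b" by (auto simp: F_def)
      have "single m 1 * f \<in> I" if "keys m \<subseteq> ?V" for m
      proof -
        let ?m = "single a 1 + single b 1 + m" and ?m' = "single (map2 min a b) 1 + single (map2 max a b) 1 + m"
        have "?m \<noteq> ?m'"
        proof
          assume "?m = ?m'"
          then have "single a 1 + single b 1 = single (map2 min a b) 1 + single (map2 max a b) (1::nat)" by simp
          then have "L.std (single a 1 + single b 1)" using std_pair[OF ab(1,2)] by simp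
          then show False using ab(3) by (auto simp: L.std_def keys_plus_monom)
        qed
        then have "initial_form w (single ?m 1 - single ?m' 1) =
            (if w a + w b = w (map2 min a b) + w (map2 max a b) then single ?m 1 - single ?m' 1 else single ?m 1)"
          using supermodular[OF ab(1,2)] by (simp add: initial_form_binomial monom_weight_eq)
        also have "\<dots> = single m 1 * f"
          by (simp add: f q_def Var_mult_Var right_diff_distrib mult_single add.commute)
        finally show ?thesis using I_closed(1)[OF binomial[OF ab(1,2) that]] by simp
      qed
      then show "f \<in> {p \<in> carrier (poly_ring ?V). \<forall>m. keys m \<subseteq> ?V \<longrightarrow> single m 1 * p \<in> I}"
        using fF F_sub by blast
    qed
    show "0 \<in> {p \<in> carrier (poly_ring ?V). \<forall>m. keys m \<subseteq> ?V \<longrightarrow> single m 1 * p \<in> I}"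
      using I_closed(2) by (simp add: carrier_poly_ring)
    show "p + p' \<in> {p \<in> carrier (poly_ring ?V). \<forall>m. keys m \<subseteq> ?V \<longrightarrow> single m 1 * p \<in> I}"
      if "p \<in> {p \<in> carrier (poly_ring ?V). \<forall>m. keys m \<subseteq> ?V \<longrightarrow> single m 1 * p \<in> I}"
        "p' \<in> {p \<in> carrier (poly_ring ?V). \<forall>m. keys m \<subseteq> ?V \<longrightarrow> single m 1 * p \<in> I}" for p p'
      using that I_closed(3) by (simp add: distrib_left plus_in_carrier)
    show "h * p \<in> {p \<in> carrier (poly_ring ?V). \<forall>m. keys m \<subseteq> ?V \<longrightarrow> single m 1 * p \<in> I}"
      if p: "p \<in> {p \<in> carrier (poly_ring ?V). \<forall>m. keys m \<subseteq> ?V \<longrightarrow> single m 1 * p \<in> I}"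
        and h: "h \<in> carrier (poly_ring ?V)" for p h
    proof -
      have "single m 1 * (h * p) \<in> I" if m: "keys m \<subseteq> ?V" for m
      proof -
        have "single m 1 * (h * p) = (\<Sum>m'\<in>keys h. Const (lookup h m') * (single (m + m') 1 * p))"
          by (subst sum_of_singles[of h]) (simp add: sum_distrib_left sum_distrib_right Const_def mult_single flip: mult.assoc)
        moreover have "single (m + m') 1 * p \<in> I" if "m' \<in> keys h" for m'
        proof -
          have "keys (m + m') \<subseteq> ?V" using m h that unfolding keys_plus_monom carrier_poly_ring by blast
          then show ?thesis using p by blast
        qed
        ultimately show ?thesis using I_closed(4,5) by (metis (no_types, lifting))
      qed
      then show ?thesis using p h by (simp add: poly_ring_mult_closed)
    qed
  qed auto
  then have Q_I: "Q \<subseteq> I"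
  proof -
    assume *: "Q \<subseteq> {p \<in> carrier (poly_ring ?V). \<forall>m. keys m \<subseteq> ?V \<longrightarrow> single m 1 * p \<in> I}"
    show "Q \<subseteq> I"
    proof
      fix p assume "p \<in> Q"
      then have "\<forall>m. keys m \<subseteq> ?V \<longrightarrow> single m 1 * p \<in> I" using * by blast
      then have "single 0 1 * p \<in> I" by (metis empty_subsetI keys_zero)
      then show "p \<in> I" by simp
    qed
  qed
  have Q_van: "Q \<subseteq> vanishing ?V S.zero_cone"
    unfolding Q_def
  proof (rule Idl_subset_vanishing)
    show "f \<in> carrier (poly_ring ?V)" if "f \<in> F" for f using that F_sub by blast
    show "poly_eval x f = 0" if f: "f \<in> F" and x: "x \<in> S.zero_cone" for f x
    proof -
      obtain a b where "f = q a b" "a \<in> ?V" "b \<in> ?V" "\<not> L.comparable a b" using f by (auto simp: F_def)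
      then show ?thesis using x
        by (auto simp: q_def S.zero_cone_def poly_eval_diff poly_eval_mult poly_eval_Var poly_eval_zero)
    qed
  qed
  have straighten: "\<exists>r\<in>L.std_polys UNIV. p - r \<in> Q" if "p \<in> carrier (poly_ring ?V)" for p
  proof (rule L.straighten[OF Q(1) _ that])
    fix a b assume ab: "a \<in> ?V" "b \<in> ?V" "\<not> L.comparable a b"
    let ?r = "if w a + w b = w (map2 min a b) + w (map2 max a b)
      then Var (map2 min a b) * Var (map2 max a b) else (0 :: (nat list, complex) mpoly)"
    have "Var a * Var b - ?r \<in> Q" using Q(2) ab unfolding F_def q_def by blast
    moreover have "\<forall>s\<in>keys ?r. keys s \<subseteq> ?V \<and> weight L.corank s < L.corank a + L.corank b \<and> monom_degree s = 2"
      using mm[OF ab(1,2)] L.corank_less[OF ab] by (auto simp: Var_mult_Var keys_plus_monom monom_degree_eq)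
    ultimately show "\<exists>r. Var a * Var b - r \<in> Q \<and>
        (\<forall>s\<in>keys r. keys s \<subseteq> ?V \<and> weight L.corank s < L.corank a + L.corank b \<and> monom_degree s = 2)" by blast
  qed simp
  \<comment> \<open>The sandwich: the standard remainder of \<open>f\<close> modulo \<open>Q\<close>
    lies in \<open>X\<close> along with \<open>f\<close>, hence is zero.\<close>
  have split: "f \<in> Q" if f: "f \<in> carrier (poly_ring ?V)" and X: "Q \<subseteq> X" "f \<in> X"
    "\<And>p q. p \<in> X \<Longrightarrow> q \<in> X \<Longrightarrow> p - q \<in> X" "\<And>r. r \<in> X \<Longrightarrow> r \<in> L.std_polys UNIV \<Longrightarrow> r = 0" for f X
  proof -
    obtain r where r: "r \<in> L.std_polys UNIV" "f - r \<in> Q" using straighten[OF f] by blast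
    have "f - (f - r) \<in> X" using X r(2) by blast
    then have "r = 0" using X(4) r(1) by simp
    then show ?thesis using r(2) by simp
  qed
  have I_diff: "p - p' \<in> I" if "p \<in> I" "p' \<in> I" for p p'
    using I_closed(3)[OF that(1) I_closed(4)[OF that(2), of "- 1"]] by (simp add: Const_def single_uminus)
  have "I = vanishing ?V S.zero_cone"
  proof
    show "I \<subseteq> vanishing ?V S.zero_cone"
      using split[of _ I] I_sub Q_I I_diff std_zero Q_van by blast
    show "vanishing ?V S.zero_cone \<subseteq> I"
    proof
      fix f assume f: "f \<in> vanishing ?V S.zero_cone"
      have "f \<in> Q"
      proof (rule split[of _ "vanishing ?V S.zero_cone"])
        show "f \<in> carrier (poly_ring ?V)" using f by (simp add: vanishing_def)
        show "r = 0" if "r \<in> vanishing ?V S.zero_cone" "r \<in> L.std_polys UNIV" for r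
          using S.zero_cone_std_zero[OF that(2)] that(1) by (simp add: vanishing_def)
      qed (use Q_van f poly_idealD(4)[OF ideal_vanishing] in auto)
      then show "f \<in> I" using Q_I by blast
    qed
  qed
  then show ?thesis using SL by blast
qed

end

section \<open>The degenerating family\<close>

text \<open>The action on polynomials dual to \<open>diag\<close> on points.\<close>

definition twist :: "('v \<Rightarrow> complex) \<Rightarrow> ('v, complex) mpoly \<Rightarrow> ('v, complex) mpoly" where
  "twist \<sigma> f = (\<Sum>m\<in>keys f. single m (lookup f m * meval \<sigma> m))"

lemma lookup_twist: "lookup (twist \<sigma> f) m = lookup f m * meval \<sigma> m"
proof -
  have "lookup (twist \<sigma> f) m = (\<Sum>m'\<in>keys f. if m' = m then lookup f m * meval \<sigma> m else 0)"
    unfolding twist_def lookup_sum by (intro sum.cong) (auto simp: lookup_single when_def)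
  then show ?thesis by (simp add: in_keys_iff)
qed

lemma keys_twist: "keys (twist \<sigma> f) \<subseteq> keys f"
  by (auto simp: in_keys_iff lookup_twist)

lemma poly_eval_twist: "poly_eval x (twist \<sigma> f) = poly_eval (diag \<sigma> x) f"
  unfolding twist_def poly_eval_sum poly_eval_monom
  by (simp add: diag_def poly_eval_scale_weight)

lemma twist_carrier: "f \<in> carrier (poly_ring V) \<Longrightarrow> twist \<sigma> f \<in> carrier (poly_ring V)"
  using keys_twist[of \<sigma> f] by (auto simp: carrier_poly_ring)

abbreviation specialize :: "complex \<Rightarrow> ('v, complex poly) mpoly \<Rightarrow> ('v, complex) mpoly" where
  "specialize t \<equiv> Poly_Mapping.map (\<lambda>c. poly c t)"

lemma lookup_specialize: "lookup (specialize t p) m = poly (lookup p m) t"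
  by (simp add: map.rep_eq when_def)

lemma keys_specialize: "keys (specialize t p) \<subseteq> keys p"
  by (auto simp: in_keys_iff lookup_specialize)

lemma poly_eval_specialize: "poly_eval x (specialize t p) = poly_subst (\<lambda>c. poly c t) x p"
proof -
  have "poly_eval x (specialize t p) = (\<Sum>m\<in>keys p. poly (lookup p m) t * meval x m)"
    using poly_subst_superset[OF finite_keys keys_specialize, where h = "\<lambda>c. c" and \<sigma> = x]
    by (simp add: lookup_specialize meval_def)
  then show ?thesis by (simp add: poly_subst_meval)
qed

lemma specialize_diff: "specialize t (p - q) = specialize t p - specialize t q"
  by (rule poly_mapping_eqI) (simp add: lookup_specialize lookup_minus)

lemma finite_monomials: "finite V \<Longrightarrow> finite {m :: 'v \<Rightarrow>\<^sub>0 nat. keys m \<subseteq> V \<and> monom_degree m = d}"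
proof (induction d)
  case 0
  have "{m :: 'v \<Rightarrow>\<^sub>0 nat. keys m \<subseteq> V \<and> monom_degree m = 0} \<subseteq> {0}"
    by (auto simp: monom_degree_def in_keys_iff simp flip: Poly_Mapping.keys_eq_empty)
  then show ?case by (rule finite_subset) simp
next
  case (Suc d)
  let ?M = "\<lambda>d. {m :: 'v \<Rightarrow>\<^sub>0 nat. keys m \<subseteq> V \<and> monom_degree m = d}"
  have "?M (Suc d) \<subseteq> (\<lambda>(v, m). single v 1 + m) ` (V \<times> ?M d)"
  proof
    fix m assume m: "m \<in> ?M (Suc d)"
    then have "keys m \<noteq> {}" by (auto simp: monom_degree_def)
    then obtain v where v: "v \<in> keys m" by blast
    define m' where "m' = m - single v 1"
    have eq: "m = single v 1 + m'" unfolding m'_def by (rule single_minus_add[OF v])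
    have "v \<in> V" "m' \<in> ?M d" using m unfolding eq by (auto simp: keys_plus_monom monom_degree_eq)
    then show "m \<in> (\<lambda>(v, m). single v 1 + m) ` (V \<times> ?M d)" using eq by auto
  qed
  then show ?case using Suc by (auto intro: finite_subset)
qed

lemma poly_ring_a_minus:
  fixes p q :: "('v, 'b::comm_ring_1) mpoly"
  assumes "p \<in> carrier (poly_ring V)" "q \<in> carrier (poly_ring V)"
  shows "\<ominus>\<^bsub>poly_ring V\<^esub> q = - q" "p \<ominus>\<^bsub>poly_ring V\<^esub> q = p - q"
proof -
  interpret cring "poly_ring V :: ('v, 'b) mpoly ring" by (rule cring_poly_ring)
  show "\<ominus>\<^bsub>poly_ring V\<^esub> q = - q"
    using assms(2) by (intro minus_equality) (auto simp: carrier_poly_ring)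
  then show "p \<ominus>\<^bsub>poly_ring V\<^esub> q = p - q" by (simp add: a_minus_def)
qed

text \<open>The coordinates are weighted by \<open>E\<close>; \<open>R a b\<close> is the straightened form of the product of the
  Pluecker coordinates \<open>a\<close> and \<open>b\<close>, and \<open>\<mu>\<close> makes the straightening terminate.\<close>

locale plucker_family =
  supermodular_lattice "plucker_index k n" "tuple_ideal k n" "map2 min" "map2 max"
    "grass_poset k n" "grass_order k n" "\<lambda>(i, j). i + j" w for k n w +
  fixes E \<mu> :: "nat list \<Rightarrow> nat" and R :: "nat list \<Rightarrow> nat list \<Rightarrow> (nat list, complex) mpoly"
  assumes kn: "k \<le> n"
    and R_std: "\<And>a b. a \<in> plucker_index k n \<Longrightarrow> b \<in> plucker_index k n \<Longrightarrow> \<not> comparable a b \<Longrightarrow>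
      R a b \<in> std_polys {2}"
    and R_vanishing: "\<And>a b. a \<in> plucker_index k n \<Longrightarrow> b \<in> plucker_index k n \<Longrightarrow> \<not> comparable a b \<Longrightarrow>
      Var a * Var b - R a b \<in> vanishing (plucker_index k n) (grass_cone k n)"
    and R_leading: "\<And>a b. a \<in> plucker_index k n \<Longrightarrow> b \<in> plucker_index k n \<Longrightarrow> \<not> comparable a b \<Longrightarrow>
      lookup (R a b) (single (map2 min a b) 1 + single (map2 max a b) 1) = 1"
    and R_weight: "\<And>a b s. a \<in> plucker_index k n \<Longrightarrow> b \<in> plucker_index k n \<Longrightarrow> \<not> comparable a b \<Longrightarrow>
      s \<in> keys (R a b) \<Longrightarrow> weight E s \<le> E a + E b \<and> weight \<mu> s < \<mu> a + \<mu> b \<and>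
      (weight E s = E a + E b \<longleftrightarrow>
        s = single (map2 min a b) 1 + single (map2 max a b) 1 \<and> w a + w b = w (map2 min a b) + w (map2 max a b))"
begin

section \<open>Equations and fibres of the family\<close>

abbreviation "V \<equiv> plucker_index k n"

text \<open>Homogenization of the straightening relation with respect to \<open>E\<close>.
  \<open>R_weight\<close> makes the exponents of \<open>t\<close> genuine differences, zero exactly
  for the meet-join term of a pair on which \<open>w\<close> is additive.\<close>

definition rel_tail :: "nat list \<Rightarrow> nat list \<Rightarrow> (nat list, complex poly) mpoly" where
  "rel_tail a b = (\<Sum>s\<in>keys (R a b). single s (monom (lookup (R a b) s) (E a + E b - weight E s)))"

definition rels :: "(nat list, complex poly) mpoly set" where
  "rels = {Var a * Var b - rel_tail a b | a b. a \<in> V \<and> b \<in> V \<and> \<not> comparable a b}"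

definition family :: "(nat list, complex poly) mpoly set" where
  "family = Idl\<^bsub>poly_ring V\<^esub> rels"

definition fibre_cone :: "complex \<Rightarrow> (nat list \<Rightarrow> complex) set" where
  "fibre_cone t = (if t = 0 then zero_cone else diag (\<lambda>a. t ^ E a) ` grass_cone k n)"

lemma rels_forms: "rels \<subseteq> forms V 2"
proof
  fix f assume "f \<in> rels"
  then obtain a b where f: "f = Var a * Var b - rel_tail a b" and ab: "a \<in> V" "b \<in> V" "\<not> comparable a b"
    by (auto simp: rels_def)
  have "Var a * Var b \<in> forms V 2"
    unfolding Var_mult_Var using ab by (intro single_in_forms) (auto simp: keys_plus_monom monom_degree_eq)
  moreover have "rel_tail a b \<in> forms V 2"
    unfolding rel_tail_def using R_std[OF ab] by (intro sum_in_forms single_in_forms) (auto simp: std_polys_def std_def)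
  ultimately show "f \<in> forms V 2" unfolding f by (rule diff_in_forms)
qed

lemma rels_carrier: "rels \<subseteq> carrier (poly_ring V)"
  using rels_forms by (auto dest: forms_carrier)

lemmas family = poly_Idl[OF rels_carrier, folded family_def]

lemma family_carrier: "family \<subseteq> carrier (poly_ring V)"
  by (rule poly_idealD(1)[OF family(1)])

text \<open>For \<open>t \<noteq> 0\<close> the diagonal change of coordinates extracts
  \<open>t ^ (E a + E b)\<close> and leaves the Pluecker relation. For \<open>t = 0\<close> the only
  term of the tail that can survive is meet times join, as in the equations of
  \<open>zero_cone\<close>.\<close>

lemma rel_vanishing:
  assumes ab: "a \<in> V" "b \<in> V" "\<not> comparable a b" and x: "x \<in> fibre_cone t"
  shows "poly_subst (\<lambda>c. poly c t) x (Var a * Var b - rel_tail a b) = 0"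
proof -
  note hom = comm_ring_hom_poly[of t]
  have eval: "poly_subst (\<lambda>c. poly c t) x (Var a * Var b - rel_tail a b) =
    x a * x b - (\<Sum>s\<in>keys (R a b). lookup (R a b) s * t ^ (E a + E b - weight E s) * meval x s)"
    by (simp add: rel_tail_def poly_subst_diff[OF hom] poly_subst_mult[OF hom] poly_subst_Var[OF hom]
        poly_subst_sum[OF hom] poly_subst_single[OF hom] poly_monom)
  note W = R_weight[OF ab]
  show ?thesis
  proof (cases "t = 0")
    case False
    then obtain y where y: "y \<in> grass_cone k n" "x = diag (\<lambda>a. t ^ E a) y" using x by (auto simp: fibre_cone_def)
    have x_eq: "x = (\<lambda>a. t ^ E a * y a)" by (simp add: y(2) diag_def)
    have "lookup (R a b) s * t ^ (E a + E b - weight E s) * meval x s = t ^ (E a + E b) * (lookup (R a b) s * meval y s)"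
      if "s \<in> keys (R a b)" for s
    proof -
      have "t ^ (E a + E b - weight E s) * t ^ weight E s = t ^ (E a + E b)"
        using W[OF that] by (simp flip: power_add)
      then show ?thesis by (simp add: x_eq meval_mult meval_power mult_ac)
    qed
    then have "(\<Sum>s\<in>keys (R a b). lookup (R a b) s * t ^ (E a + E b - weight E s) * meval x s) =
        (\<Sum>s\<in>keys (R a b). t ^ (E a + E b) * (lookup (R a b) s * meval y s))"
      by (rule sum.cong[OF refl])
    also have "\<dots> = t ^ (E a + E b) * poly_eval y (R a b)"
      by (simp only: poly_eval_meval sum_distrib_left)
    finally have "(\<Sum>s\<in>keys (R a b). lookup (R a b) s * t ^ (E a + E b - weight E s) * meval x s) =
        t ^ (E a + E b) * poly_eval y (R a b)" .
    moreover have "poly_eval y (R a b) = y a * y b"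
      using R_vanishing[OF ab] y(1) by (simp add: vanishing_def poly_eval_diff poly_eval_mult poly_eval_Var)
    moreover have "x a * x b = t ^ (E a + E b) * (y a * y b)" by (simp add: x_eq power_add mult_ac)
    ultimately show ?thesis using eval by simp
  next
    case True
    let ?m = "single (map2 min a b) 1 + single (map2 max a b) (1::nat)"
    let ?mod = "w a + w b = w (map2 min a b) + w (map2 max a b)"
    have "lookup (R a b) s * t ^ (E a + E b - weight E s) * meval x s = (if s = ?m then if ?mod then meval x ?m else 0 else 0)"
      if s: "s \<in> keys (R a b)" for s
    proof (cases "weight E s = E a + E b")
      case True
      then show ?thesis using W[OF s] R_leading[OF ab] by simp
    next
      case False
      then have "0 < E a + E b - weight E s" "\<not> (s = ?m \<and> ?mod)" using W[OF s] by auto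
      then show ?thesis using \<open>t = 0\<close> by auto
    qed
    then have "(\<Sum>s\<in>keys (R a b). lookup (R a b) s * t ^ (E a + E b - weight E s) * meval x s) =
      (\<Sum>s\<in>keys (R a b). if s = ?m then if ?mod then meval x ?m else 0 else 0)" by (rule sum.cong[OF refl])
    also have "\<dots> = (if ?mod then meval x ?m else 0)"
      using R_leading[OF ab] by (simp add: in_keys_iff)
    finally show ?thesis using eval x ab True by (auto simp: fibre_cone_def zero_cone_def)
  qed
qed

lemma family_vanishing:
  assumes "p \<in> family" "x \<in> fibre_cone t"
  shows "poly_eval x (specialize t p) = 0"
proof -
  have "family \<subseteq> {p \<in> carrier (poly_ring V). \<forall>x\<in>fibre_cone t. poly_subst (\<lambda>c. poly c t) x p = 0}"
    by (rule family(3)[OF ideal_poly_subst_zeros[OF comm_ring_hom_poly]])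
      (use rels_carrier rel_vanishing in \<open>auto simp: rels_def\<close>)
  then show ?thesis using assms by (auto simp: poly_eval_specialize)
qed

lemma family_straighten:
  assumes "p \<in> carrier (poly_ring V)" "\<And>m. m \<in> keys p \<Longrightarrow> monom_degree m \<in> D"
  shows "\<exists>r\<in>std_polys D. p - r \<in> family"
proof (rule straighten[OF family(1) _ assms])
  fix a b assume ab: "a \<in> V" "b \<in> V" "\<not> comparable a b"
  have "keys (rel_tail a b) \<subseteq> keys (R a b)"
    using keys_sum_subset[of "\<lambda>s. single s (monom (lookup (R a b) s) (E a + E b - weight E s))" "keys (R a b)"]
    unfolding rel_tail_def by (fastforce split: if_splits)
  then have "\<forall>s\<in>keys (rel_tail a b). keys s \<subseteq> V \<and> weight \<mu> s < \<mu> a + \<mu> b \<and> monom_degree s = 2"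
    using R_weight[OF ab] R_std[OF ab] unfolding std_polys_def std_def by blast
  moreover have "Var a * Var b - rel_tail a b \<in> family" using family(2) ab unfolding rels_def by blast
  ultimately show "\<exists>r. Var a * Var b - r \<in> family \<and>
      (\<forall>s\<in>keys r. keys s \<subseteq> V \<and> weight \<mu> s < \<mu> a + \<mu> b \<and> monom_degree s = 2)" by blast
qed

lemma fibre_cone_scale:
  assumes x: "x \<in> fibre_cone t"
  shows "cscale c x \<in> fibre_cone t"
proof (cases "t = 0")
  case True
  have "(c * x a) * (c * x b) = (if w a + w b = w (map2 min a b) + w (map2 max a b)
      then (c * x (map2 min a b)) * (c * x (map2 max a b)) else 0)"
    if "a \<in> V" "b \<in> V" "\<not> comparable a b" for a b
  proof -
    have "x a * x b = (if w a + w b = w (map2 min a b) + w (map2 max a b)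
      then x (map2 min a b) * x (map2 max a b) else 0)"
      using x True that by (simp add: fibre_cone_def zero_cone_def)
    then have "c * c * (x a * x b) = c * c * (if w a + w b = w (map2 min a b) + w (map2 max a b)
      then x (map2 min a b) * x (map2 max a b) else 0)" by (rule arg_cong)
    then show ?thesis by (simp add: mult_ac split: if_splits)
  qed
  then show ?thesis using x True by (simp add: fibre_cone_def zero_cone_def coord_space_def cscale_def)
next
  case False
  then obtain y where y: "y \<in> grass_cone k n" "x = diag (\<lambda>a. t ^ E a) y" using x by (auto simp: fibre_cone_def)
  have "cscale c x = diag (\<lambda>a. t ^ E a) (cscale c y)" by (simp add: y(2) diag_def cscale_def fun_eq_iff)
  then show ?thesis using grass_cone_scale[OF y(1)] False by (auto simp: fibre_cone_def)
qed

lemma V_nonempty: "V \<noteq> {}"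
proof -
  have "[1..<Suc k] \<in> V" by (rule plucker_indexI) (use kn in \<open>auto simp del: upt_Suc\<close>)
  then show ?thesis by blast
qed

text \<open>Twisting multiplies coefficients by nonzero numbers, keeps the support and moves the
  question to the Grassmannian.\<close>

lemma twisted_std_independent:
  assumes g: "g \<in> std_polys UNIV" "g \<noteq> 0" and v: "v \<in> V" and t: "t \<noteq> 0"
  shows "\<exists>x\<in>fibre_cone t. x v \<noteq> 0 \<and> poly_eval x g \<noteq> 0"
proof -
  let ?\<sigma> = "\<lambda>a. t ^ E a"
  have "keys (twist ?\<sigma> g) = keys g" using t by (auto simp: in_keys_iff lookup_twist meval_eq_0_iff)
  then have "twist ?\<sigma> g \<in> std_polys UNIV" "twist ?\<sigma> g \<noteq> 0"
    using g by (auto simp: std_polys_def simp flip: Poly_Mapping.keys_eq_empty)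
  from std_independent[OF this v] obtain y where y: "y \<in> grass_cone k n" "y v \<noteq> 0" "poly_eval y (twist ?\<sigma> g) \<noteq> 0"
    by blast
  then have "diag ?\<sigma> y \<in> fibre_cone t" "diag ?\<sigma> y v \<noteq> 0" "poly_eval (diag ?\<sigma> y) g \<noteq> 0"
    using t by (auto simp: fibre_cone_def diag_def poly_eval_twist)
  then show ?thesis by blast
qed

lemma fibre_std_zero:
  assumes "g \<in> std_polys UNIV" "\<And>x. x \<in> fibre_cone t \<Longrightarrow> poly_eval x g = 0"
  shows "g = 0"
proof (cases "t = 0")
  case True
  then show ?thesis using zero_cone_std_zero[OF assms(1)] assms(2) by (simp add: fibre_cone_def)
next
  case False
  obtain v where "v \<in> V" using V_nonempty by blast
  then show ?thesis using twisted_std_independent[OF assms(1) _ _ False] assms(2) by blast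
qed

lemma std_polys_specialize: "r \<in> std_polys D \<Longrightarrow> specialize t r \<in> std_polys D"
  using keys_specialize[of t r] by (auto simp: std_polys_def)

lemma specialize_carrier: "p \<in> carrier (poly_ring V) \<Longrightarrow> specialize t p \<in> carrier (poly_ring V)"
  using keys_specialize[of t p] by (auto simp: carrier_poly_ring)

text \<open>Lift \<open>f\<close> with constant coefficients and straighten it modulo the family.
  The remainder specializes to a standard polynomial that vanishes on the fibre, hence to 0, so
  \<open>f\<close> is the specialization of an element of the family.\<close>

lemma fibre_ideal_family: "fibre_ideal t family = vanishing V (fibre_cone t)"
proof
  show "fibre_ideal t family \<subseteq> vanishing V (fibre_cone t)"
    using family_vanishing family_carrier specialize_carrier by (auto simp: fibre_ideal_def vanishing_def)
  show "vanishing V (fibre_cone t) \<subseteq> fibre_ideal t family"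
  proof
    fix f assume f: "f \<in> vanishing V (fibre_cone t)"
    define p where "p = Poly_Mapping.map (\<lambda>c. [:c:]) f"
    have lookup_p: "lookup p m = [:lookup f m:]" for m by (simp add: p_def map.rep_eq when_def)
    have "keys p = keys f" by (auto simp: in_keys_iff lookup_p)
    then have "p \<in> carrier (poly_ring V)" using f by (auto simp: vanishing_def carrier_poly_ring)
    then obtain r where r: "r \<in> std_polys UNIV" "p - r \<in> family" using family_straighten[of p UNIV] by auto
    have p_t: "specialize t p = f" by (rule poly_mapping_eqI) (simp add: lookup_specialize lookup_p)
    have "specialize t r = 0"
    proof (rule fibre_std_zero[of _ t])
      show "specialize t r \<in> std_polys UNIV" by (rule std_polys_specialize[OF r(1)])
      fix x assume x: "x \<in> fibre_cone t"
      have "poly_eval x (specialize t p - specialize t r) = 0"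
        using family_vanishing[OF r(2) x] by (simp add: specialize_diff)
      then show "poly_eval x (specialize t r) = 0" using f x by (simp add: p_t vanishing_def poly_eval_diff)
    qed
    then have "specialize t (p - r) = f" by (simp add: specialize_diff p_t)
    then show "f \<in> fibre_ideal t family" using r(2) by (auto simp: fibre_ideal_def)
  qed
qed

lemma coord_space_proj: "L \<in> proj_space V \<Longrightarrow> L \<subseteq> coord_space V"
  by (auto simp: proj_space_def subspaces_of_dim_def)

lemma zero_cone_iff:
  assumes x: "x \<in> coord_space V" and kill: "\<And>f. f \<in> vanishing V zero_cone \<Longrightarrow> f \<in> forms V 2 \<Longrightarrow> poly_eval x f = 0"
  shows "x \<in> zero_cone"
proof -
  have "x a * x b = (if w a + w b = w (map2 min a b) + w (map2 max a b) then x (map2 min a b) * x (map2 max a b) else 0)"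
    if ab: "a \<in> V" "b \<in> V" "\<not> comparable a b" for a b
  proof -
    let ?q = "if w a + w b = w (map2 min a b) + w (map2 max a b) then Var (map2 min a b) * Var (map2 max a b) else 0"
    have forms2: "Var c * Var d \<in> forms V 2" if "c \<in> V" "d \<in> V" for c d
      unfolding Var_mult_Var using that by (intro single_in_forms) (auto simp: keys_plus_monom monom_degree_eq)
    have "0 \<in> forms V 2" by (simp add: forms_def carrier_poly_ring)
    then have f: "Var a * Var b - ?q \<in> forms V 2"
      using meet[OF ab(1,2)] join[OF ab(1,2)] ab by (auto intro!: diff_in_forms forms2)
    have ev: "poly_eval y (Var a * Var b - ?q) = y a * y b -
      (if w a + w b = w (map2 min a b) + w (map2 max a b) then y (map2 min a b) * y (map2 max a b) else 0)" for y
      by (simp add: poly_eval_diff poly_eval_mult poly_eval_Var poly_eval_zero)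
    have "Var a * Var b - ?q \<in> vanishing V zero_cone"
      using forms_carrier[OF f] ab unfolding vanishing_def by (auto simp: ev zero_cone_def)
    from kill[OF this f] show ?thesis unfolding ev by simp
  qed
  then show ?thesis using x by (simp add: zero_cone_def)
qed

text \<open>Quadrics suffice over \<open>t = 0\<close> by the defining equations, and elsewhere
  because \<open>twist\<close> carries the quadrics of the Grassmannian to those of the
  fibre.\<close>

lemma fibre_cone_iff:
  assumes x: "x \<in> coord_space V" and kill: "\<And>f. f \<in> vanishing V (fibre_cone t) \<Longrightarrow> f \<in> forms V 2 \<Longrightarrow> poly_eval x f = 0"
  shows "x \<in> fibre_cone t"
proof (cases "t = 0")
  case True
  then show ?thesis using zero_cone_iff[OF x] kill by (simp add: fibre_cone_def)
next
  case False
  let ?\<sigma> = "\<lambda>a. t ^ E a" and ?\<tau> = "\<lambda>a. 1 / t ^ E a"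
  have inv: "diag ?\<tau> (diag ?\<sigma> y) = y" "diag ?\<sigma> (diag ?\<tau> y) = y" for y using False by (auto simp: diag_def)
  have "diag ?\<tau> x \<in> grass_cone k n"
  proof (rule grass_cone_iff)
    show "diag ?\<tau> x \<in> coord_space V" using x by (simp add: coord_space_def diag_def)
    fix f assume f: "f \<in> vanishing V (grass_cone k n) \<inter> forms V 2"
    have "twist ?\<tau> f \<in> vanishing V (fibre_cone t)"
      using f False by (auto simp: vanishing_def twist_carrier fibre_cone_def poly_eval_twist inv)
    moreover have "twist ?\<tau> f \<in> forms V 2" using f keys_twist[of ?\<tau> f] by (auto simp: forms_def twist_carrier)
    ultimately have "poly_eval x (twist ?\<tau> f) = 0" by (rule kill)
    then show "poly_eval (diag ?\<tau> x) f = 0" by (simp add: poly_eval_twist)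
  qed
  then have "diag ?\<sigma> (diag ?\<tau> x) \<in> fibre_cone t" using False by (auto simp: fibre_cone_def)
  then show ?thesis by (simp add: inv)
qed

lemma zero_set_fibre:
  "zero_set V (vanishing V (fibre_cone t)) = plines V (fibre_cone t)"
  "zero_set V (vanishing V (fibre_cone t) \<inter> forms V 2) = plines V (fibre_cone t)"
proof -
  have "L \<subseteq> fibre_cone t" if "L \<in> proj_space V" "\<forall>f\<in>vanishing V (fibre_cone t) \<inter> forms V 2. \<forall>x\<in>L. poly_eval x f = 0" for L
    using that coord_space_proj[OF that(1)] by (intro subsetI fibre_cone_iff) auto
  then show "zero_set V (vanishing V (fibre_cone t)) = plines V (fibre_cone t)"
    "zero_set V (vanishing V (fibre_cone t) \<inter> forms V 2) = plines V (fibre_cone t)"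
    unfolding zero_set_def plines_def vanishing_def by blast+
qed

lemma reduced_fibre: "reduced_subscheme V (fibre_ideal t family)"
  unfolding fibre_ideal_family by (rule reduced_vanishing[OF fibre_cone_scale])

lemma general_fibre:
  assumes t: "t \<noteq> 0"
  shows "subscheme_isomorphic V (fibre_ideal t family) (grassmannian k n)"
  unfolding subscheme_isomorphic_def
proof (intro conjI reduced_fibre)
  let ?\<sigma> = "\<lambda>a. 1 / t ^ E a"
  have fc: "fibre_cone t = diag (\<lambda>a. t ^ E a) ` grass_cone k n" using t by (simp add: fibre_cone_def)
  have image_proj: "diag \<tau> ` L \<in> proj_space V" if L: "L \<in> proj_space V" and \<tau>: "\<And>a. \<tau> a \<noteq> 0" for L \<tau>
  proof -
    obtain z where z: "z \<in> coord_space V" "z \<noteq> 0" "L = line z" using proj_space_cases[OF L] .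
    have "diag \<tau> z \<in> coord_space V" using z(1) by (simp add: coord_space_def diag_def)
    moreover have "diag \<tau> z \<noteq> 0"
    proof
      assume *: "diag \<tau> z = 0"
      have "z a = 0" for a using fun_cong[OF *, of a] \<tau>[of a] by (simp add: diag_def)
      then show False using z(2) by (simp add: fun_eq_iff)
    qed
    ultimately show ?thesis unfolding z(3) diag_line by (rule line_in_proj_space)
  qed
  have "isomorphic_varieties V (plines V (fibre_cone t)) V (grassmannian k n)"
  proof (rule isomorphic_diag[of ?\<sigma>])
    show "1 / t ^ E a \<noteq> 0" for a using t by simp
    show "plines V (fibre_cone t) \<subseteq> proj_space V" by (auto simp: plines_def)
    show "grassmannian k n \<subseteq> proj_space V" by (auto simp: grassmannian_eq)
    show "diag ?\<sigma> ` L \<in> grassmannian k n" if "L \<in> plines V (fibre_cone t)" for L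
    proof -
      have L: "L \<in> proj_space V" "L \<subseteq> fibre_cone t" using that by (auto simp: plines_def)
      have "diag ?\<sigma> ` L \<subseteq> grass_cone k n"
      proof
        fix y assume "y \<in> diag ?\<sigma> ` L"
        then obtain x where x: "x \<in> L" "y = diag ?\<sigma> x" by blast
        then obtain z where z: "z \<in> grass_cone k n" "x = diag (\<lambda>a. t ^ E a) z" using L(2) fc by blast
        have "y = z" unfolding x(2) z(2) using t by (simp add: diag_def)
        then show "y \<in> grass_cone k n" using z(1) by simp
      qed
      moreover have "diag ?\<sigma> ` L \<in> proj_space V" using t by (intro image_proj L) simp
      ultimately show ?thesis by (simp add: grassmannian_eq)
    qed
    show "diag (\<lambda>a. 1 / ?\<sigma> a) ` L \<in> plines V (fibre_cone t)" if "L \<in> grassmannian k n" for L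
    proof -
      have L: "L \<in> proj_space V" "L \<subseteq> grass_cone k n" using that by (auto simp: grassmannian_eq)
      have "diag (\<lambda>a. 1 / ?\<sigma> a) ` L \<in> proj_space V" using t by (intro image_proj L) simp
      then show ?thesis using L(2) by (auto simp: plines_def fc)
    qed
  qed
  then show "isomorphic_varieties V (zero_set V (fibre_ideal t family)) V (grassmannian k n)"
    by (simp add: fibre_ideal_family zero_set_fibre)
qed

lemma special_fibre: "subscheme_isomorphic V (fibre_ideal 0 family) (plines V zero_cone)"
  unfolding subscheme_isomorphic_def
proof (intro conjI reduced_fibre)
  have "diag (\<lambda>_. 1) ` L = L" "diag (\<lambda>_. 1 / 1) ` L = L" for L :: "(nat list \<Rightarrow> complex) set" by (auto simp: diag_def)
  moreover have "zero_set V (fibre_ideal 0 family) = plines V zero_cone"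
    unfolding fibre_ideal_family zero_set_fibre by (simp add: fibre_cone_def)
  ultimately show "isomorphic_varieties V (zero_set V (fibre_ideal 0 family)) V (plines V zero_cone)"
    by (intro isomorphic_diag[of "\<lambda>_. 1"]) (auto simp: plines_def)
qed

subsection \<open>Flatness\<close>

text \<open>Over \<open>t \<noteq> 0\<close> the points with nonzero coordinate \<open>v\<close>,
  scaled into the chart, detect standard polynomials. Over \<open>t = 0\<close> whole components may
  lie in the hyperplane where that coordinate vanishes, but the coefficients are polynomials in
  \<open>t\<close> and are determined by nonzero \<open>t\<close>.\<close>

lemma chart_std_zero:
  assumes v: "v \<in> V" and g: "g \<in> std_polys {d}" "g \<in> chart_ideal V family v"
  shows "g = 0"
proof -
  have special: "specialize t g = 0" if t: "t \<noteq> 0" for t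
  proof (rule ccontr)
    assume "specialize t g \<noteq> 0"
    moreover have std_t: "specialize t g \<in> std_polys {d}" by (rule std_polys_specialize[OF g(1)])
    ultimately obtain x where x: "x \<in> fibre_cone t" "x v \<noteq> 0" "poly_eval x (specialize t g) \<noteq> 0"
      using twisted_std_independent[of "specialize t g" v t] v t by (auto simp: std_polys_def)
    define y where "y = cscale (1 / x v) x"
    have y: "y \<in> fibre_cone t" "y v = 1" unfolding y_def using fibre_cone_scale[OF x(1)] x(2)
      by (simp, simp add: cscale_def)
    have "chart_ideal V family v \<subseteq> {p \<in> carrier (poly_ring V). \<forall>x\<in>{y}. poly_subst (\<lambda>c. poly c t) x p = 0}"
    proof (rule chart_idealD(3)[OF v family_carrier ideal_poly_subst_zeros[OF comm_ring_hom_poly]])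
      show "family \<subseteq> {p \<in> carrier (poly_ring V). \<forall>x\<in>{y}. poly_subst (\<lambda>c. poly c t) x p = 0}"
        using family_vanishing y(1) family_carrier by (auto simp: poly_eval_specialize)
      have "Var v - 1 \<in> carrier (poly_ring V :: (nat list, complex poly) mpoly ring)"
        using poly_idealD(1)[OF ideal_chart[OF v family_carrier]] chart_idealD(2)[OF v family_carrier] by blast
      then show "Var v - 1 \<in> {p \<in> carrier (poly_ring V). \<forall>x\<in>{y}. poly_subst (\<lambda>c. poly c t) x p = 0}"
        using y(2) by (simp add: poly_subst_diff[OF comm_ring_hom_poly] poly_subst_Var[OF comm_ring_hom_poly]
            poly_subst_one[OF comm_ring_hom_poly])
    qed
    then have "poly_eval y (specialize t g) = 0" using g(2) by (auto simp: poly_eval_specialize)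
    moreover have "specialize t g \<in> forms V d"
      using std_t std_polys_carrier[OF std_t] by (auto simp: forms_def std_polys_def)
    ultimately show False using poly_eval_form[of "specialize t g" V d] x by (simp add: y_def)
  qed
  show ?thesis
  proof (rule poly_mapping_eqI)
    fix m
    \<comment> \<open>The factor \<open>t\<close> turns vanishing at all nonzero \<open>t\<close>
      into vanishing everywhere.\<close>
    have "poly (lookup g m * monom 1 1) t = 0" for t
      using arg_cong[OF special[of t], of "\<lambda>p. lookup p m"] by (cases "t = 0") (simp_all add: lookup_specialize poly_monom)
    then have "lookup g m * monom 1 1 = 0" using poly_all_0_iff_0 by blast
    then show "lookup g m = lookup 0 m" by simp
  qed
qed

text \<open>The chart is the union of the images of the standard polynomials of degree
  \<open>d\<close>. Each image is free on the standard monomials by \<open>chart_std_zero\<close>,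
  and homogenizing to a common degree puts any finite set into one of them.\<close>

lemma flat_chart:
  assumes v: "v \<in> V"
  shows "flat_module (univ_ring :: complex poly ring) (chart_module V family v)"
proof -
  let ?P = "poly_ring V :: (nat list, complex poly) mpoly ring"
  let ?Q = "chart_ideal V family v" and ?M = "chart_module V family v"
  let ?R = "univ_ring :: complex poly ring"
  interpret P: cring ?P by (rule cring_poly_ring)
  interpret id: ideal ?Q ?P by (rule ideal_chart[OF v family_carrier])
  interpret M: module ?R ?M by (rule module_chart[OF v family_carrier])
  note Q = poly_idealD[OF ideal_chart[OF v family_carrier]]
  define \<kappa> where "\<kappa> f = ?Q +>\<^bsub>?P\<^esub> f" for f
  have C: "Const c \<in> carrier ?P" for c unfolding Const_def by (rule single_in_carrier) simp
  have carrier_M: "carrier ?M = \<kappa> ` carrier ?P"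
    by (auto simp: chart_module_def chart_ring_def FactRing_def A_RCOSETS_def' \<kappa>_def)
  have add: "\<kappa> f \<oplus>\<^bsub>?M\<^esub> \<kappa> g = \<kappa> (f + g)" if "f \<in> carrier ?P" "g \<in> carrier ?P" for f g
    using ring_hom_add[OF id.rcos_ring_hom that] by (simp add: chart_module_def chart_ring_def \<kappa>_def)
  have smult: "c \<odot>\<^bsub>?M\<^esub> \<kappa> f = \<kappa> (Const c * f)" if "f \<in> carrier ?P" for c f
    using ring_hom_mult[OF id.rcos_ring_hom C that] by (simp add: chart_module_def chart_ring_def \<kappa>_def)
  have zero: "\<zero>\<^bsub>?M\<^esub> = \<kappa> 0"
    using P.a_coset_add_zero[OF Q(1)] by (simp add: chart_module_def chart_ring_def FactRing_def \<kappa>_def)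
  have eq_iff: "\<kappa> f = \<kappa> g \<longleftrightarrow> f - g \<in> ?Q" if "f \<in> carrier ?P" "g \<in> carrier ?P" for f g
    using P.quotient_eq_iff_same_a_r_cos[OF id.ideal_axioms that] that by (simp add: \<kappa>_def poly_ring_a_minus)
  have std_minus: "r - r' \<in> std_polys D" if "r \<in> std_polys D" "r' \<in> std_polys D" for r r' D
    using that Poly_Mapping.keys_diff[of r r'] by (fastforce simp: std_polys_def)
  have std_plus: "r + r' \<in> std_polys D" if "r \<in> std_polys D" "r' \<in> std_polys D" for r r' D
    using that Poly_Mapping.keys_add[of r r'] by (fastforce simp: std_polys_def)
  have std_carrier: "r \<in> carrier ?P" if "r \<in> std_polys D" for r D by (rule std_polys_carrier[OF that])
  show ?thesis
  proof (rule flat_moduleI[where ?'s = "nat list \<Rightarrow>\<^sub>0 nat"])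
    show "module ?R ?M" by (rule M.module_axioms)
    fix A assume A: "finite A" "A \<subseteq> carrier ?M"
    then obtain F where F: "finite F" "F \<subseteq> carrier ?P" "A = \<kappa> ` F"
      unfolding carrier_M by (metis finite_subset_image)
    define d where "d = (\<Sum>f\<in>F. \<Sum>m\<in>keys f. monom_degree m)"
    have d: "monom_degree m \<le> d" if "f \<in> F" "m \<in> keys f" for f m
    proof -
      have "monom_degree m \<le> (\<Sum>m\<in>keys f. monom_degree m)" using that by (intro member_le_sum) auto
      also have "\<dots> \<le> d" unfolding d_def using that F(1) by (intro member_le_sum) auto
      finally show ?thesis .
    qed
    define B where "B = \<kappa> ` std_polys {d}"
    define S where "S = {m. std m \<and> monom_degree m = d}"
    have finS: "finite S"
      by (rule finite_subset[OF _ finite_monomials[OF fin, of d]]) (auto simp: S_def std_def)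
    have unique: "r = r'" if "r \<in> std_polys {d}" "r' \<in> std_polys {d}" "\<kappa> r = \<kappa> r'" for r r'
      using chart_std_zero[OF v std_minus[OF that(1,2)]] that eq_iff std_carrier by auto
    \<comment> \<open>The unique standard representative of degree \<open>d\<close>; its
      coefficients are the coordinates.\<close>
    define repr where "repr m = (THE r. r \<in> std_polys {d} \<and> m = \<kappa> r)" for m
    have repr: "repr (\<kappa> r) = r" if "r \<in> std_polys {d}" for r
      unfolding repr_def using that unique by (intro the_equality) auto
    have "A \<subseteq> B"
    proof
      fix a assume "a \<in> A"
      then obtain f where f: "f \<in> F" "a = \<kappa> f" using F(3) by blast
      have fc: "f \<in> carrier ?P" using f F(2) by blast
      obtain g where g: "g \<in> forms V d" "f - g \<in> ?Q"
        using chart_homogenize[OF v family_carrier fc] d[OF f(1)] by blast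
      obtain r where r: "r \<in> std_polys {d}" "g - r \<in> family"
        using family_straighten[of g "{d}"] g(1) by (auto simp: forms_def)
      have "(f - g) + (g - r) \<in> ?Q"
        using r(2) chart_idealD(1)[OF v family_carrier] by (intro Q(3) g(2)) blast
      then have "\<kappa> f = \<kappa> r" using eq_iff[OF fc std_carrier[OF r(1)]] by simp
      then show "a \<in> B" using r(1) f(2) by (auto simp: B_def)
    qed
    moreover have "free_coordinates ?R ?M B S (\<lambda>s. \<kappa> (single s 1)) (\<lambda>s m. lookup (repr m) s)"
      unfolding free_coordinates_def
    proof (intro conjI ballI)
      have single_std: "single s c \<in> std_polys {d}" if "s \<in> S" for s and c :: "complex poly"
        using that by (auto simp: S_def std_polys_def)
      show "submodule B ?R ?M"
      proof (rule M.submoduleI)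
        show "B \<subseteq> carrier ?M" unfolding B_def carrier_M using std_carrier by blast
        have zero_std: "0 \<in> std_polys {d}" by (simp add: std_polys_def)
        then show "\<zero>\<^bsub>?M\<^esub> \<in> B" unfolding zero B_def by (rule imageI)
        show "a \<oplus>\<^bsub>?M\<^esub> b \<in> B" if ab: "a \<in> B" "b \<in> B" for a b
        proof -
          obtain r r' where r: "a = \<kappa> r" "b = \<kappa> r'" "r \<in> std_polys {d}" "r' \<in> std_polys {d}"
            using ab unfolding B_def by blast
          show ?thesis unfolding r(1,2) add[OF std_carrier[OF r(3)] std_carrier[OF r(4)]] B_def
            by (rule imageI[OF std_plus[OF r(3,4)]])
        qed
        show "c \<odot>\<^bsub>?M\<^esub> a \<in> B" if a: "a \<in> B" for c a
        proof -
          obtain r where r: "a = \<kappa> r" "r \<in> std_polys {d}" using a unfolding B_def by blast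
          show ?thesis unfolding r(1) smult[OF std_carrier[OF r(2)]] B_def
            by (rule imageI[OF std_polys_Const[OF r(2)]])
        qed
        show "\<ominus>\<^bsub>?M\<^esub> a \<in> B" if a: "a \<in> B" for a
        proof -
          obtain r where r: "a = \<kappa> r" "r \<in> std_polys {d}" using a unfolding B_def by blast
          have r': "0 - r \<in> std_polys {d}" by (rule std_minus[OF zero_std r(2)])
          have "\<kappa> (0 - r) \<oplus>\<^bsub>?M\<^esub> \<kappa> r = \<zero>\<^bsub>?M\<^esub>"
            using add[OF std_carrier[OF r'] std_carrier[OF r(2)]] zero by simp
          then have "\<ominus>\<^bsub>?M\<^esub> \<kappa> r = \<kappa> (0 - r)"
            using std_carrier[OF r'] std_carrier[OF r(2)] by (intro M.minus_equality) (auto simp: carrier_M)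
          then show ?thesis unfolding r(1) B_def using r' by auto
        qed
      qed
      show "finite S" by (rule finS)
      show "\<kappa> (single s 1) \<in> B" if "s \<in> S" for s unfolding B_def by (rule imageI[OF single_std[OF that]])
      show "lookup (repr m) s \<in> carrier ?R" for s m by (simp add: univ_ring_def)
      show "lookup (repr (a \<oplus>\<^bsub>?M\<^esub> b)) s = lookup (repr a) s \<oplus>\<^bsub>?R\<^esub> lookup (repr b) s" if ab: "a \<in> B" "b \<in> B" for s a b
      proof -
        obtain r r' where r: "a = \<kappa> r" "b = \<kappa> r'" "r \<in> std_polys {d}" "r' \<in> std_polys {d}"
          using ab unfolding B_def by blast
        show ?thesis unfolding r(1,2) add[OF std_carrier[OF r(3)] std_carrier[OF r(4)]]
            repr[OF r(3)] repr[OF r(4)] repr[OF std_plus[OF r(3,4)]]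
          by (simp add: lookup_add univ_ring_def)
      qed
      show "lookup (repr (c \<odot>\<^bsub>?M\<^esub> a)) s = c \<otimes>\<^bsub>?R\<^esub> lookup (repr a) s" if a: "a \<in> B" for s c a
      proof -
        obtain r where r: "a = \<kappa> r" "r \<in> std_polys {d}" using a unfolding B_def by blast
        have "lookup (Const c * r) s = c * lookup r s"
          using mult_map_scale_conv_mult[of c r] by (simp add: Const_def map.rep_eq when_def flip: mult_map_scale_conv_mult)
        then show ?thesis unfolding r(1) smult[OF std_carrier[OF r(2)]] repr[OF r(2)] repr[OF std_polys_Const[OF r(2)]]
          by (simp add: univ_ring_def)
      qed
      show "a = (\<Oplus>\<^bsub>?M\<^esub>s\<in>S. lookup (repr a) s \<odot>\<^bsub>?M\<^esub> \<kappa> (single s 1))" if a: "a \<in> B" for a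
      proof -
        obtain r where r: "a = \<kappa> r" "r \<in> std_polys {d}" using a unfolding B_def by blast
        have trm: "c \<odot>\<^bsub>?M\<^esub> \<kappa> (single s 1) = \<kappa> (single s c)" if "s \<in> S" for c s
          using smult[OF std_carrier[OF single_std[OF that]], of c 1] by (simp add: Const_def mult_single)
        have "(\<Oplus>\<^bsub>?M\<^esub>s\<in>K. lookup r s \<odot>\<^bsub>?M\<^esub> \<kappa> (single s 1)) = \<kappa> (\<Sum>s\<in>K. single s (lookup r s))" if "K \<subseteq> S" for K
          using finite_subset[OF that finS] that
        proof (induction K rule: finite_induct)
          case empty
          then show ?case by (simp add: zero)
        next
          case (insert s K)
          have mem: "lookup r s \<odot>\<^bsub>?M\<^esub> \<kappa> (single s 1) \<in> carrier ?M" if "s \<in> S" for s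
            unfolding trm[OF that] carrier_M using std_carrier[OF single_std[OF that]] by blast
          have sum_carrier: "(\<Sum>s\<in>K. single s (lookup r s)) \<in> carrier ?P"
            using insert.prems std_carrier[OF single_std] by (intro sum_in_carrier) auto
          have "(\<Oplus>\<^bsub>?M\<^esub>s\<in>insert s K. lookup r s \<odot>\<^bsub>?M\<^esub> \<kappa> (single s 1)) =
            lookup r s \<odot>\<^bsub>?M\<^esub> \<kappa> (single s 1) \<oplus>\<^bsub>?M\<^esub> (\<Oplus>\<^bsub>?M\<^esub>s\<in>K. lookup r s \<odot>\<^bsub>?M\<^esub> \<kappa> (single s 1))"
            using insert mem by (intro M.finsum_insert) auto
          also have "\<dots> = \<kappa> (single s (lookup r s)) \<oplus>\<^bsub>?M\<^esub> \<kappa> (\<Sum>s\<in>K. single s (lookup r s))"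
            using insert trm by simp
          also have "\<dots> = \<kappa> (\<Sum>s\<in>insert s K. single s (lookup r s))"
            using insert add[OF std_carrier[OF single_std] sum_carrier] by simp
          finally show ?case .
        qed
        moreover have "(\<Sum>s\<in>S. single s (lookup r s)) = r"
        proof -
          have "keys r \<subseteq> S" using r(2) by (auto simp: std_polys_def S_def)
          then have "(\<Sum>s\<in>S. single s (lookup r s)) = (\<Sum>s\<in>keys r. single s (lookup r s))"
            using finS by (intro sum.mono_neutral_right) (auto simp: in_keys_iff)
          then show ?thesis by (simp flip: sum_of_singles)
        qed
        ultimately show ?thesis unfolding r(1) repr[OF r(2)] by simp
      qed
    qed
    ultimately show "\<exists>B (S :: (nat list \<Rightarrow>\<^sub>0 nat) set) e coord. A \<subseteq> B \<and> free_coordinates ?R ?M B S e coord" by blast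
  qed
qed

lemma flat_degeneration_zero_cone:
  "flat_degeneration V (plines V zero_cone) (grassmannian k n)"
  unfolding flat_degeneration_def
proof (intro conjI exI allI impI)
  have "plines V zero_cone = zero_set V (vanishing V (fibre_cone 0) \<inter> forms V 2)"
    unfolding zero_set_fibre(2) by (simp add: fibre_cone_def)
  then show "closedin (zariski V) (plines V zero_cone)" unfolding closedin_zariski by blast
  show "closedin (zariski V) (grassmannian k n)"
    unfolding closedin_zariski using grassmannian_zero_set[of k n] by blast
  show "flat_family V family"
    unfolding flat_family_def homogeneous_ideal_def
  proof (intro conjI ballI)
    show "\<exists>F. F \<subseteq> (\<Union>d. forms V d) \<and> family = Idl\<^bsub>poly_ring V\<^esub> F"
      using rels_forms unfolding family_def by (intro exI[of _ rels]) blast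
  qed (rule flat_chart)
  show "subscheme_isomorphic V (fibre_ideal 0 family) (plines V zero_cone)" by (rule special_fibre)
qed (rule general_fibre)

end

section \<open>Choice of the weights of the family\<close>

lemma exists_plucker_family:
  assumes kn: "k \<le> n"
    and SL: "supermodular_lattice (plucker_index k n) (tuple_ideal k n) (map2 min) (map2 max)
      (grass_poset k n) (grass_order k n) (\<lambda>(i, j). i + j) w"
  shows "\<exists>E \<mu> R. plucker_family k n w E \<mu> R"
proof -
  let ?V = "plucker_index k n"
  interpret S: supermodular_lattice ?V "tuple_ideal k n" "map2 min" "map2 max"
    "grass_poset k n" "grass_order k n" "\<lambda>(i, j). i + j" w by (rule SL)
  define pair where "pair a b = single (map2 min a b) 1 + single (map2 max a b) (1::nat)" for a b :: "nat list"
  obtain \<theta> where \<theta>: "S.modular \<theta>"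
    "\<And>a b. a \<in> ?V \<Longrightarrow> b \<in> ?V \<Longrightarrow> \<not> S.comparable a b \<Longrightarrow>
      \<exists>r\<in>S.std_polys {2}. Var a * Var b - r \<in> vanishing ?V (grass_cone k n) \<and> lookup r (pair a b) = 1 \<and>
      (\<forall>s\<in>keys r. s \<noteq> pair a b \<longrightarrow> weight \<theta> s < \<theta> a + \<theta> b)"
    using quadratic_straighten_leading[of k n] unfolding pair_def by blast
  define R where "R a b = (SOME r. r \<in> S.std_polys {2} \<and> Var a * Var b - r \<in> vanishing ?V (grass_cone k n) \<and>
    lookup r (pair a b) = 1 \<and> (\<forall>s\<in>keys r. s \<noteq> pair a b \<longrightarrow> weight \<theta> s < \<theta> a + \<theta> b))" for a b
  have R: "R a b \<in> S.std_polys {2}" "Var a * Var b - R a b \<in> vanishing ?V (grass_cone k n)"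
      "lookup (R a b) (pair a b) = 1" "\<And>s. s \<in> keys (R a b) \<Longrightarrow> s \<noteq> pair a b \<Longrightarrow> weight \<theta> s < \<theta> a + \<theta> b"
    if "a \<in> ?V" "b \<in> ?V" "\<not> S.comparable a b" for a b
  proof -
    have "\<exists>r. r \<in> S.std_polys {2} \<and> Var a * Var b - r \<in> vanishing ?V (grass_cone k n) \<and>
      lookup r (pair a b) = 1 \<and> (\<forall>s\<in>keys r. s \<noteq> pair a b \<longrightarrow> weight \<theta> s < \<theta> a + \<theta> b)"
      using \<theta>(2)[OF that] by blast
    from someI_ex[OF this, folded R_def] show "R a b \<in> S.std_polys {2}" "Var a * Var b - R a b \<in> vanishing ?V (grass_cone k n)"
      "lookup (R a b) (pair a b) = 1" "\<And>s. s \<in> keys (R a b) \<Longrightarrow> s \<noteq> pair a b \<Longrightarrow> weight \<theta> s < \<theta> a + \<theta> b" by blast+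
  qed
  obtain u :: "nat list \<Rightarrow> int" where u: "\<And>a b c d. a \<in> ?V \<Longrightarrow> b \<in> ?V \<Longrightarrow> c \<in> ?V \<Longrightarrow> d \<in> ?V \<Longrightarrow>
    (w a + w b < w c + w d \<longrightarrow> u a + u b < u c + u d) \<and> (w a + w b = w c + w d \<longrightarrow> u a + u b = u c + u d)"
    using integral_weights[OF finite_plucker_index[of k n], of w] by blast
  define U where "U = (\<Sum>a\<in>?V. \<bar>u a\<bar>)"
  have U: "\<bar>u a\<bar> \<le> U" if "a \<in> ?V" for a unfolding U_def by (rule member_le_sum) (use that finite_plucker_index in auto)
  have "0 \<le> U" unfolding U_def by (rule sum_nonneg) simp
  \<comment> \<open>For sums over two pairs, the values of \<open>u\<close> differ by at most
    \<open>4 * U\<close>, so a drop of \<open>\<theta>\<close> by 1 outweighs them. The summand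
    \<open>U\<close> keeps \<open>E\<close> nonnegative. \<open>u\<close> is subtracted because
    supermodularity makes it larger on meet and join, where the weight must not increase.\<close>
  define E where "E a = nat ((4 * U + 1) * int (\<theta> a) + U - u a)" for a
  define Cmax where "Cmax = (\<Sum>a\<in>?V. S.corank a)"
  have Cmax: "S.corank a \<le> Cmax" if "a \<in> ?V" for a unfolding Cmax_def by (rule member_le_sum) (use that finite_plucker_index in auto)
  \<comment> \<open>\<open>\<theta>\<close> decreases for all terms but meet times join, where it is
    constant and \<open>corank\<close> decreases. The factor \<open>2 * Cmax + 1\<close> lets a drop
    of \<open>\<theta>\<close> beat two coranks.\<close>
  define \<mu> where "\<mu> a = (2 * Cmax + 1) * \<theta> a + S.corank a" for a
  have E: "int (E a) = (4 * U + 1) * int (\<theta> a) + U - u a" if "a \<in> ?V" for a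
  proof -
    have "0 \<le> (4 * U + 1) * int (\<theta> a)" using \<open>0 \<le> U\<close> by (intro mult_nonneg_nonneg) simp_all
    then show ?thesis using U[OF that] unfolding E_def by linarith
  qed
  have degree2: "\<exists>c d. s = single c 1 + single d 1 \<and> c \<in> ?V \<and> d \<in> ?V" if "s \<in> keys r" "r \<in> S.std_polys {2}" for s and r :: "(nat list, complex) mpoly"
  proof -
    have s: "keys s \<subseteq> ?V" "monom_degree s = 2" using that by (auto simp: S.std_polys_def S.std_def)
    then have "keys s \<noteq> {}" by (auto simp: monom_degree_def)
    then obtain c where "c \<in> keys s" by blast
    from single_minus_add[OF this] obtain s' where s': "s = single c 1 + s'" by blast
    then have "monom_degree s' = 1" using s(2) by (simp add: monom_degree_eq)
    then have "keys s' \<noteq> {}" by (auto simp: monom_degree_def)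
    then obtain d where "d \<in> keys s'" by blast
    from single_minus_add[OF this] obtain s'' where s'': "s' = single d 1 + s''" by blast
    then have "monom_degree s'' = 0" using \<open>monom_degree s' = 1\<close> by (simp add: monom_degree_eq)
    then have "s'' = 0" by (auto simp: monom_degree_def in_keys_iff simp flip: Poly_Mapping.keys_eq_empty)
    then show ?thesis using s(1) s' s'' by (intro exI[of _ c] exI[of _ d]) (auto simp: keys_plus_monom)
  qed
  have W: "weight E s \<le> E a + E b \<and> weight \<mu> s < \<mu> a + \<mu> b \<and>
      (weight E s = E a + E b \<longleftrightarrow> s = pair a b \<and> w a + w b = w (map2 min a b) + w (map2 max a b))"
    if ab: "a \<in> ?V" "b \<in> ?V" "\<not> S.comparable a b" and s: "s \<in> keys (R a b)" for a b s
  proof (cases "s = pair a b")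
    case True
    have V: "map2 min a b \<in> ?V" "map2 max a b \<in> ?V" using S.meet[OF ab(1,2)] S.join[OF ab(1,2)] by auto
    have mod: "\<theta> (map2 min a b) + \<theta> (map2 max a b) = \<theta> a + \<theta> b" using \<theta>(1) ab by (simp add: S.modular_def)
    have "int (E (map2 min a b)) + int (E (map2 max a b)) =
        (4 * U + 1) * (int (\<theta> (map2 min a b)) + int (\<theta> (map2 max a b))) + 2 * U - (u (map2 min a b) + u (map2 max a b))"
      using E[OF V(1)] E[OF V(2)] by (simp add: distrib_left)
    also have "int (\<theta> (map2 min a b)) + int (\<theta> (map2 max a b)) = int (\<theta> a) + int (\<theta> b)" using mod by linarith
    finally have "int (E (map2 min a b)) + int (E (map2 max a b)) =
        int (E a) + int (E b) + (u a + u b) - (u (map2 min a b) + u (map2 max a b))"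
      using E[OF ab(1)] E[OF ab(2)] by (simp add: distrib_left)
    moreover have "u a + u b \<le> u (map2 min a b) + u (map2 max a b) \<and>
        (u a + u b = u (map2 min a b) + u (map2 max a b) \<longleftrightarrow> w a + w b = w (map2 min a b) + w (map2 max a b))"
      using u[OF ab(1,2) V] S.supermodular[OF ab(1,2)] by linarith
    moreover have "weight \<mu> s < \<mu> a + \<mu> b"
    proof -
      have "\<mu> (map2 min a b) + \<mu> (map2 max a b) = (2 * Cmax + 1) * (\<theta> (map2 min a b) + \<theta> (map2 max a b)) +
          (S.corank (map2 min a b) + S.corank (map2 max a b))" by (simp add: \<mu>_def distrib_left)
      also have "\<dots> < (2 * Cmax + 1) * (\<theta> a + \<theta> b) + (S.corank a + S.corank b)"
        unfolding mod using S.corank_less[OF ab] by simp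
      also have "\<dots> = \<mu> a + \<mu> b" by (simp add: \<mu>_def distrib_left)
      finally show ?thesis by (simp add: True pair_def)
    qed
    moreover have "weight E s = E (map2 min a b) + E (map2 max a b)" by (simp add: True pair_def)
    ultimately show ?thesis using True by linarith
  next
    case False
    obtain c d where cd: "s = single c 1 + single d 1" "c \<in> ?V" "d \<in> ?V" using degree2[OF s R(1)[OF ab]] by blast
    have less: "\<theta> c + \<theta> d + 1 \<le> \<theta> a + \<theta> b" using R(4)[OF ab s False] cd(1) by simp
    have "(4 * U + 1) * (int (\<theta> c) + int (\<theta> d) + 1) \<le> (4 * U + 1) * (int (\<theta> a) + int (\<theta> b))"
      using less \<open>0 \<le> U\<close> by (intro mult_left_mono) linarith+
    then have "int (E c) + int (E d) < int (E a) + int (E b)"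
      using E[OF cd(2)] E[OF cd(3)] E[OF ab(1)] E[OF ab(2)] U[OF cd(2)] U[OF cd(3)] U[OF ab(1)] U[OF ab(2)]
      by (simp add: distrib_left)
    then have "weight E s < E a + E b" by (simp add: cd(1))
    moreover have "weight \<mu> s < \<mu> a + \<mu> b"
    proof -
      have "(2 * Cmax + 1) * (\<theta> c + \<theta> d + 1) \<le> (2 * Cmax + 1) * (\<theta> a + \<theta> b)" using less by (rule mult_le_mono2)
      then have "\<mu> c + \<mu> d < \<mu> a + \<mu> b"
        using Cmax[OF cd(2)] Cmax[OF cd(3)] by (simp add: \<mu>_def distrib_left)
      then show ?thesis by (simp add: cd(1))
    qed
    ultimately show ?thesis using False by linarith
  qed
  have "plucker_family k n w E \<mu> R"
  proof (intro plucker_family.intro SL plucker_family_axioms.intro kn)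
  qed (use R W in \<open>simp_all add: pair_def\<close>)
  then show ?thesis by blast
qed

theorem theorem2p4p4:
  fixes k n :: nat and I :: "(nat list, complex) mpoly set"
  assumes "k \<le> n"
    and "is_initial_ideal_of I (I_h k n)"
    and "is_initial_ideal_of (I_m k n) I"
  shows "flat_degeneration (plucker_index k n) (zero_set (plucker_index k n) I) (grassmannian k n) \<and>
    (\<forall>C. irreducible_component (zariski (plucker_index k n)) (zero_set (plucker_index k n) I) C \<longrightarrow>
      (\<exists>r. partial_order_on (grass_poset k n) r \<and> grass_order k n \<subseteq> r \<and>
        C = psi_O_point k n ` hibi_variety (grass_poset k n) r))"
proof -
  obtain w where SL: "supermodular_lattice (plucker_index k n) (tuple_ideal k n) (map2 min) (map2 max)
      (grass_poset k n) (grass_order k n) (\<lambda>(i, j). i + j) w"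
    and I: "I = vanishing (plucker_index k n) (plucker_zero_cone k n w)"
    using initial_ideal_structure[OF assms] by blast
  obtain E \<mu> R where "plucker_family k n w E \<mu> R" using exists_plucker_family[OF assms(1) SL] by blast
  then interpret F: plucker_family k n w E \<mu> R .
  \<comment> \<open>The zero set of \<open>I\<close> is the special fibre:
    \<open>fibre_cone 0\<close> is \<open>zero_cone\<close>.\<close>
  have zero_set_I: "zero_set (plucker_index k n) I = plines (plucker_index k n) F.zero_cone"
    using F.zero_set_fibre(1)[of 0] by (simp add: I F.fibre_cone_def)
  have dual: "psi_O_point k n = F.dual_point"
    by (simp add: fun_eq_iff psi_O_point_def F.dual_point_def)
  show ?thesis
  proof (intro conjI allI impI)
    show "flat_degeneration (plucker_index k n) (zero_set (plucker_index k n) I) (grassmannian k n)"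
      unfolding zero_set_I by (rule F.flat_degeneration_zero_cone)
    fix C assume "irreducible_component (zariski (plucker_index k n)) (zero_set (plucker_index k n) I) C"
    then obtain \<kappa> where \<kappa>: "F.linear_extension \<kappa>" "C = plines (plucker_index k n) (F.cell_cone \<kappa>)"
      using F.irreducible_components_zero_cone unfolding zero_set_I by blast
    show "\<exists>r. partial_order_on (grass_poset k n) r \<and> grass_order k n \<subseteq> r \<and>
        C = psi_O_point k n ` hibi_variety (grass_poset k n) r"
      unfolding dual \<kappa>(2)
      using F.cell_order_partial_order[OF \<kappa>(1)] F.cell_order_stronger[OF \<kappa>(1)] F.dual_point_hibi_variety[OF \<kappa>(1)]
      by blast
  qed
qed

end
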